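(* Let $d\ge1$ be an integer and let $\{X, X_{k,i}^{(m)}: k,i\ge1,\ 1\le m\le d\}$ be an array of i.i.d. real random variables with $\mathbb EX=0$, $\mathbb EX^2=1$. Let $X'$ be an independent copy of $X$, let $\alpha,c_1,c_2>0$, and assume $$\sup_x x^{1+2\alpha}\,\mathbb P\big(|XX'|\ge\sqrt{x\log x}\big)<\infty.$$ For each $n$ let $p=p_n$ be an integer with $c_1n^\alpha\le p\le c_2n^\alpha$. Put $Y^{(m)}_{k,i,j}=X^{(m)}_{k,i}X^{(m)}_{k,j}$, $X_{k,i,j}=(Y^{(1)}_{k,i,j},\dots,Y^{(d)}_{k,i,j})\in\mathbb R^d$, and $$W_{p,n}=\max_{1\le i<j\le p}\Big\|\sum_{k=1}^nX_{k,i,j}\Big\|,$$ where $\|\cdot\|$ is the Euclidean norm on $\mathbb R^d$. Let $\alpha_p=4\log p-(2-d)\log_2 p$. Then for any $0<\varepsilon\le 10^{-4}$ there exists a finite constant $C$ (independent of $n$ and $p$) such that for all $n$ $$\sup_{y\in\mathbb R}\Big|\mathbb P\Big(\frac{W_{p,n}^2}{n}-\alpha_p\le y\Big)-\exp\Big(-\frac{p^2-p}{2}\mathbb P(\chi^2(d)\ge\alpha_p+y)\Big)\Big|$$ $$\le Cp^{-1+20\sqrt\varepsilon}+C\frac{(\log n)^{5/2}}{n^{1/2}}\mathbb E\big[|XX'|^3I\{|XX'|\le\sqrt n/(\log n)^4\}\big]+Cn^{1+2\alpha}\,\mathbb P\big(|XX'|\ge d^{-1/2}\varepsilon\sqrt{n\log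 p}\big),$$ where $\chi^2(d)$ denotes a chi-square random variable with $d$ degrees of freedom.
   Context: Throughout, $\log x$ denotes $\ln\max(x,e)$ and $\log_2 x=\log(\log x)$. $I\{\cdot\}$ denotes an indicator. *)

theory Defs
  imports "HOL-Probability.Probability"
begin

text \<open>Paper's logarithm conventions: log x = ln (max x e), log_2 x = log (log x).\<close>
definition logc :: "real \<Rightarrow> real" where
  "logc x = ln (max x (exp 1))"

definition logc2 :: "real \<Rightarrow> real" where
  "logc2 x = logc (logc x)"

definition chi2_density :: "nat \<Rightarrow> real \<Rightarrow> real" where
  "chi2_density k x =
     (if x > 0 then x powr (real k / 2 - 1) * exp (- x / 2) / (2 powr (real k / 2) * Gamma (real k / 2))
      else 0)"

definition chi2_tail :: "nat \<Rightarrow> real \<Rightarrow> real" where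
  "chi2_tail k t = measure (density lborel (\<lambda>x. ennreal (chi2_density k x))) {t..}"

definition W :: "nat \<Rightarrow> (nat \<Rightarrow> nat \<Rightarrow> nat \<Rightarrow> 'a \<Rightarrow> real) \<Rightarrow> nat \<Rightarrow> nat \<Rightarrow> 'a \<Rightarrow> real" where
  "W d Xa p n \<omega> = Max {L2_set (\<lambda>m. \<Sum>k=1..n. Xa m k i \<omega> * Xa m k j \<omega>) {1..d} | i j. 1 \<le> i \<and> i < j \<and> j \<le> p}"

definition alpha_p :: "nat \<Rightarrow> nat \<Rightarrow> real" where
  "alpha_p d p = 4 * logc (real p) - (2 - real d) * logc2 (real p)"

end

theory Submission
  imports Defs "HOL-Real_Asymp.Real_Asymp"
begin

text \<open>
  The products are truncated at \<open>b = \<epsilon> \<surd>(n log p) / \<surd>d\<close>, at the cost of the last error term. Chen and Stein's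
  method for a dependency graph (the pairs \<open>(i, j)\<close> sharing an index are neighbours) compares the probability
  that no pair exceeds level \<open>t\<close> with \<open>exp (- \<lambda>)\<close>, where \<open>\<lambda>\<close> is the expected number of exceedances. The joint
  exceedance probability of two neighbours is bounded by the exponential Markov inequality over a finite grid
  of directions: the two products sharing an index are uncorrelated, so the exponents add up.
  The exceedance probability of a single pair needs a relative error. Truncating further at
  \<open>b0 = \<surd>n / (log n)^4\<close>, each coordinate is treated by exponential tilting and a smoothing inequality
  for characteristic functions, which gives moderate deviations with relative error, and the \<open>d\<close> independent
  coordinates are then replaced by normal ones one at a time, which produces the \<open>\<chi>\<^sup>2(d)\<close> tail.
  Levels outside \<open>[4 (1 - \<surd>\<epsilon>) log p, 8 log p]\<close> are covered by monotonicity. The tail hypothesis enters only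
  through the moment of order \<open>2 + 3 \<alpha>\<close> of \<open>X X'\<close>.
\<close>

section \<open>Poisson approximation\<close>

lemma integral_abs_diff_le:
  fixes f g h :: "'a \<Rightarrow> real"
  assumes "integrable M f" "integrable M g" "integrable M h" "\<And>x. x \<in> space M \<Longrightarrow> \<bar>f x - g x\<bar> \<le> h x"
  shows "\<bar>integral\<^sup>L M f - integral\<^sup>L M g\<bar> \<le> integral\<^sup>L M h"
proof -
  have "\<bar>integral\<^sup>L M f - integral\<^sup>L M g\<bar> = \<bar>LINT x|M. f x - g x\<bar>" using assms by simp
  also have "\<dots> \<le> (LINT x|M. \<bar>f x - g x\<bar>)" by (rule integral_abs_bound)
  also have "\<dots> \<le> integral\<^sup>L M h" using assms by (intro integral_mono) auto
  finally show ?thesis .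
qed

text \<open>At \<open>w = 0\<close> the truncated subtraction gives the value at \<open>1\<close>, which the Stein equation multiplies by \<open>0\<close>.\<close>

definition stein_fun :: "real \<Rightarrow> nat \<Rightarrow> real" where
  "stein_fun l w = integral {0..1} (\<lambda>u. u ^ (w - 1) * exp (- l * u))"

lemma stein_fun_integrable: "(\<lambda>u. u ^ w * exp (- l * u)) integrable_on {0..1::real}"
  by (intro integrable_continuous_real continuous_intros)

lemma stein_fun_bounds:
  assumes "0 \<le> l"
  shows "0 \<le> stein_fun l w" "stein_fun l w \<le> 1"
proof -
  show "0 \<le> stein_fun l w" unfolding stein_fun_def
    by (intro integral_nonneg stein_fun_integrable) auto
  have "stein_fun l w \<le> integral {0..1} (\<lambda>u::real. 1)" unfolding stein_fun_def
  proof (intro integral_le stein_fun_integrable)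
    fix u :: real assume "u \<in> {0..1}"
    then show "u ^ (w - 1) * exp (- l * u) \<le> 1"
      using assms by (intro mult_le_one power_le_one) auto
  qed auto
  then show "stein_fun l w \<le> 1" by simp
qed

lemma stein_fun_rec:
  assumes "w \<ge> 1"
  shows "l * stein_fun l (Suc w) - real w * stein_fun l w = - exp (- l)"
proof -
  have "((\<lambda>u. real w * (u ^ (w - 1) * exp (- l * u)) - l * (u ^ w * exp (- l * u))) has_integral
      (1 ^ w * exp (- l * 1) - 0 ^ w * exp (- l * 0))) {0..1::real}"
    by (rule fundamental_theorem_of_calculus)
       (auto intro!: derivative_eq_intros simp flip: has_real_derivative_iff_has_vector_derivative simp: algebra_simps)
  then have "integral {0..1} (\<lambda>u. real w * (u ^ (w - 1) * exp (- l * u)) - l * (u ^ w * exp (- l * u))) = exp (- l)"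
    using assms by (simp add: integral_unique)
  moreover have "integral {0..1} (\<lambda>u. real w * (u ^ (w - 1) * exp (- l * u)) - l * (u ^ w * exp (- l * u)))
     = real w * stein_fun l w - l * stein_fun l (Suc w)"
    unfolding stein_fun_def
    by (subst integral_diff) (auto intro!: integrable_continuous_real continuous_intros)
  ultimately show ?thesis by linarith
qed

lemma stein_fun_1: "l * stein_fun l 1 = 1 - exp (- l)"
proof -
  have "((\<lambda>u. l * exp (- l * u)) has_integral (- exp (- l * 1) - (- exp (- l * 0)))) {0..1::real}"
    by (rule fundamental_theorem_of_calculus)
       (auto intro!: derivative_eq_intros simp flip: has_real_derivative_iff_has_vector_derivative)
  then have "integral {0..1} (\<lambda>u. l * exp (- l * u)) = 1 - exp (- l)"
    by (intro integral_unique) simp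
  then show ?thesis unfolding stein_fun_def by simp
qed

lemma stein_equation:
  "l * stein_fun l (Suc w) - real w * stein_fun l w = (if w = 0 then 1 else 0) - exp (- l)"
  using stein_fun_rec[of w l] stein_fun_1[of l] by (cases "w = 0") auto

lemma stein_fun_lipschitz:
  assumes "0 \<le> l"
  shows "\<bar>stein_fun l a - stein_fun l b\<bar> \<le> \<bar>real a - real b\<bar>"
proof (cases "a = b")
  case False
  then have "1 \<le> \<bar>real a - real b\<bar>" by linarith
  then show ?thesis using stein_fun_bounds[OF assms, of a] stein_fun_bounds[OF assms, of b] by linarith
qed simp

lemma (in prob_space) chen_stein_void:
  fixes A :: "'i \<Rightarrow> 'a set" and B :: "'i \<Rightarrow> 'i set"
  assumes I: "finite I" and A[measurable]: "\<And>i. i \<in> I \<Longrightarrow> A i \<in> events"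
    and B: "\<And>i. i \<in> I \<Longrightarrow> i \<in> B i \<and> B i \<subseteq> I"
    and ind: "\<And>i. i \<in> I \<Longrightarrow> indep_var borel (indicator (A i) :: 'a \<Rightarrow> real) borel
                 (\<lambda>\<omega>. \<Sum>j\<in>I - B i. indicator (A j) \<omega> :: real)"
  shows "\<bar>prob (space M - (\<Union>i\<in>I. A i)) - exp (- (\<Sum>i\<in>I. prob (A i)))\<bar>
     \<le> (\<Sum>i\<in>I. \<Sum>j\<in>B i. prob (A i) * prob (A j)) + (\<Sum>i\<in>I. \<Sum>j\<in>B i - {i}. prob (A i \<inter> A j))"
proof -
  define l where "l = (\<Sum>i\<in>I. prob (A i))"
  have l0: "0 \<le> l" unfolding l_def by (simp add: sum_nonneg)
  define g where "g = (\<lambda>x::real. stein_fun l (nat \<lfloor>x\<rfloor>))"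
  have g_meas[measurable]: "g \<in> borel_measurable borel" unfolding g_def by measurable
  have g01: "0 \<le> g x" "g x \<le> 1" for x using stein_fun_bounds[OF l0] by (auto simp: g_def)
  have fB: "finite (B i)" if "i \<in> I" for i using B[OF that] I by (auto intro: finite_subset)
  define V where "V = (\<lambda>J \<omega>. \<Sum>j\<in>J. indicator (A j) \<omega> :: real)"
  have V_meas[measurable]: "V J \<in> borel_measurable M" if "J \<subseteq> I" for J
    unfolding V_def using that by (intro borel_measurable_sum borel_measurable_indicator A) auto
  have V_nat: "V J \<omega> = real (card {j\<in>J. \<omega> \<in> A j})" if "J \<subseteq> I" for J \<omega>
  proof -
    have fJ: "finite J" using that I finite_subset by blast
    show ?thesis unfolding V_def using fJ by (simp add: indicator_def sum.If_cases Int_def)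
  qed
  have g_V1: "g (V J \<omega> + 1) = stein_fun l (Suc (card {j\<in>J. \<omega> \<in> A j}))" if "J \<subseteq> I" for J \<omega>
    unfolding V_nat[OF that] g_def
    by (metis (no_types, lifting) floor_of_nat nat_int of_nat_Suc add.commute)
  have g_V: "g (V J \<omega>) = stein_fun l (card {j\<in>J. \<omega> \<in> A j})" if "J \<subseteq> I" for J \<omega>
    unfolding V_nat[OF that] g_def by simp
  have int: "integrable M f" if "f \<in> borel_measurable M" "\<And>x. \<bar>f x\<bar> \<le> 1" for f :: "'a \<Rightarrow> real"
    using that by (intro integrable_const_bound[where B=1]) auto
  have gint: "integrable M (\<lambda>\<omega>. g (V J \<omega> + 1))" "integrable M (\<lambda>\<omega>. g (V J \<omega>))"
     "i \<in> I \<Longrightarrow> integrable M (\<lambda>\<omega>. indicator (A i) \<omega> * g (V J \<omega>))" 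
     "i \<in> I \<Longrightarrow> integrable M (\<lambda>\<omega>. indicator (A i) \<omega> * g (V J \<omega> + 1))" if "J \<subseteq> I" for J i
    using that g01 by (auto intro!: int simp: abs_mult indicator_def)
  have Vint: "integrable M (V J)" if "J \<subseteq> I" for J
    unfolding V_def using that
    by (intro Bochner_Integration.integrable_sum integrable_real_indicator A emeasure_finite) (auto simp: less_top[symmetric])
  have expV: "expectation (V J) = (\<Sum>j\<in>J. prob (A j))" if "J \<subseteq> I" for J
  proof -
    have "expectation (V J) = (\<Sum>j\<in>J. expectation (indicator (A j)))" unfolding V_def
      using that by (intro Bochner_Integration.integral_sum integrable_real_indicator A) (auto simp: less_top[symmetric])
    also have "\<dots> = (\<Sum>j\<in>J. prob (A j))" using that A by (intro sum.cong) auto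
    finally show ?thesis .
  qed
  have U: "(\<Union>i\<in>I. A i) \<in> events" using I A by auto
  have pt: "indicator (space M - (\<Union>i\<in>I. A i)) \<omega> - exp (- l)
      = (\<Sum>i\<in>I. prob (A i) * g (V I \<omega> + 1) - indicator (A i) \<omega> * g (V I \<omega>))" if "\<omega> \<in> space M" for \<omega>
  proof -
    let ?w = "card {j\<in>I. \<omega> \<in> A j}"
    have "(?w = 0) = (\<omega> \<notin> (\<Union>i\<in>I. A i))" using I by auto
    then have "indicator (space M - (\<Union>i\<in>I. A i)) \<omega> - exp (- l) = (if ?w = 0 then 1 else 0) - exp (- l)"
      using that by (auto simp: indicator_def)
    also have "\<dots> = l * stein_fun l (Suc ?w) - real ?w * stein_fun l ?w" using stein_equation by metis
    also have "\<dots> = l * g (V I \<omega> + 1) - V I \<omega> * g (V I \<omega>)"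
      unfolding g_V1[OF subset_refl] g_V[OF subset_refl] by (simp add: V_nat)
    also have "\<dots> = (\<Sum>i\<in>I. prob (A i) * g (V I \<omega> + 1) - indicator (A i) \<omega> * g (V I \<omega>))"
      by (simp add: l_def sum_subtractf sum_distrib_right) (simp add: V_def sum_distrib_right)
    finally show ?thesis .
  qed
  have "prob (space M - (\<Union>i\<in>I. A i)) - exp (- l) = expectation (\<lambda>\<omega>. indicator (space M - (\<Union>i\<in>I. A i)) \<omega> - exp (- l))"
    using U by (subst Bochner_Integration.integral_diff) (auto simp: prob_space intro!: integrable_real_indicator simp: less_top[symmetric])
  also have "\<dots> = expectation (\<lambda>\<omega>. \<Sum>i\<in>I. prob (A i) * g (V I \<omega> + 1) - indicator (A i) \<omega> * g (V I \<omega>))"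
    using pt by (intro Bochner_Integration.integral_cong) auto
  also have "\<dots> = (\<Sum>i\<in>I. prob (A i) * expectation (\<lambda>\<omega>. g (V I \<omega> + 1)) - expectation (\<lambda>\<omega>. indicator (A i) \<omega> * g (V I \<omega>)))"
  proof (subst Bochner_Integration.integral_sum)
    fix i assume i: "i \<in> I"
    show "integrable M (\<lambda>\<omega>. prob (A i) * g (V I \<omega> + 1) - indicator (A i) \<omega> * g (V I \<omega>))"
      using gint(1)[OF subset_refl] gint(3)[OF subset_refl i] by (intro Bochner_Integration.integrable_diff integrable_mult_right) auto
  next
    show "(\<Sum>i\<in>I. expectation (\<lambda>\<omega>. prob (A i) * g (V I \<omega> + 1) - indicator (A i) \<omega> * g (V I \<omega>)))
      = (\<Sum>i\<in>I. prob (A i) * expectation (\<lambda>\<omega>. g (V I \<omega> + 1)) - expectation (\<lambda>\<omega>. indicator (A i) \<omega> * g (V I \<omega>)))"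
    proof (intro sum.cong refl)
      fix i assume i: "i \<in> I"
      show "expectation (\<lambda>\<omega>. prob (A i) * g (V I \<omega> + 1) - indicator (A i) \<omega> * g (V I \<omega>))
        = prob (A i) * expectation (\<lambda>\<omega>. g (V I \<omega> + 1)) - expectation (\<lambda>\<omega>. indicator (A i) \<omega> * g (V I \<omega>))"
        using gint(1)[OF subset_refl] gint(3)[OF subset_refl i] by (subst Bochner_Integration.integral_diff) auto
    qed
  qed
  finally have main: "prob (space M - (\<Union>i\<in>I. A i)) - exp (- l) =
     (\<Sum>i\<in>I. prob (A i) * expectation (\<lambda>\<omega>. g (V I \<omega> + 1)) - expectation (\<lambda>\<omega>. indicator (A i) \<omega> * g (V I \<omega>)))" .
  have term_le: "\<bar>prob (A i) * expectation (\<lambda>\<omega>. g (V I \<omega> + 1)) - expectation (\<lambda>\<omega>. indicator (A i) \<omega> * g (V I \<omega>))\<bar>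
     \<le> (\<Sum>j\<in>B i. prob (A i) * prob (A j)) + (\<Sum>j\<in>B i - {i}. prob (A i \<inter> A j))" if i: "i \<in> I" for i
  proof -
    let ?J = "I - B i"
    have J: "?J \<subseteq> I" by auto
    have "indep_var borel (indicator (A i) :: 'a \<Rightarrow> real) borel ((\<lambda>x. g (x + 1)) \<circ> V ?J)"
      using indep_var_compose[OF ind[OF i], of "\<lambda>x. x" borel "\<lambda>x. g (x + 1)" borel]
      by (simp add: comp_def V_def)
    then have fac: "expectation (\<lambda>\<omega>. indicator (A i) \<omega> * g (V ?J \<omega> + 1)) = prob (A i) * expectation (\<lambda>\<omega>. g (V ?J \<omega> + 1))"
      using indep_var_lebesgue_integral[of "indicator (A i) :: 'a \<Rightarrow> real" "(\<lambda>x. g (x + 1)) \<circ> V ?J"] gint(1)[OF J] A[OF i]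
      by (simp add: comp_def less_top[symmetric])
    have split1: "V I \<omega> = V ?J \<omega> + V (B i) \<omega>" for \<omega>
      unfolding V_def using B[OF i] I by (metis sum.subset_diff)
    have split2: "V (B i) \<omega> = indicator (A i) \<omega> + V (B i - {i}) \<omega>" for \<omega>
      unfolding V_def using B[OF i] fB[OF i] by (meson sum.remove)
    have Vnn: "0 \<le> V J \<omega>" for J \<omega> unfolding V_def by (simp add: sum_nonneg)
    have lip1: "\<bar>g (V I \<omega> + 1) - g (V ?J \<omega> + 1)\<bar> \<le> V (B i) \<omega>" for \<omega>
    proof -
      have "\<bar>g (V I \<omega> + 1) - g (V ?J \<omega> + 1)\<bar> \<le> \<bar>real (Suc (card {j\<in>I. \<omega> \<in> A j})) - real (Suc (card {j\<in>?J. \<omega> \<in> A j}))\<bar>"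
        unfolding g_V1[OF J] g_V1[OF subset_refl] by (rule stein_fun_lipschitz[OF l0])
      also have "\<dots> = \<bar>V I \<omega> - V ?J \<omega>\<bar>" unfolding V_nat[OF J] V_nat[OF subset_refl] by simp
      also have "\<dots> = V (B i) \<omega>" using split1[of \<omega>] Vnn[of "B i" \<omega>] by simp
      finally show ?thesis .
    qed
    have lip2: "\<bar>indicator (A i) \<omega> * g (V ?J \<omega> + 1) - indicator (A i) \<omega> * g (V I \<omega>)\<bar> \<le> indicator (A i) \<omega> * V (B i - {i}) \<omega>" for \<omega>
    proof (cases "\<omega> \<in> A i")
      case True
      have "\<bar>g (V ?J \<omega> + 1) - g (V I \<omega>)\<bar> \<le> \<bar>real (Suc (card {j\<in>?J. \<omega> \<in> A j})) - real (card {j\<in>I. \<omega> \<in> A j})\<bar>"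
        unfolding g_V1[OF J] g_V[OF subset_refl] by (rule stein_fun_lipschitz[OF l0])
      also have "\<dots> = \<bar>V ?J \<omega> + 1 - V I \<omega>\<bar>" unfolding V_nat[OF J] V_nat[OF subset_refl] by simp
      also have "\<dots> = V (B i - {i}) \<omega>" using split1[of \<omega>] split2[of \<omega>] Vnn[of "B i - {i}" \<omega>] True by simp
      finally show ?thesis using True by simp
    qed auto
    have BI: "B i \<subseteq> I" "B i - {i} \<subseteq> I" using B[OF i] by auto
    have AV: "(\<lambda>\<omega>. indicator (A i) \<omega> * V (B i - {i}) \<omega>) = V' " if "V' = (\<lambda>\<omega>. \<Sum>j\<in>B i - {i}. indicator (A i \<inter> A j) \<omega>)" for V' :: "'a \<Rightarrow> real"
      unfolding that V_def by (auto simp: sum_distrib_left indicator_inter_arith)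
    have AVint: "integrable M (\<lambda>\<omega>. indicator (A i) \<omega> * V (B i - {i}) \<omega>)"
      unfolding AV[OF refl] using BI i
      by (intro Bochner_Integration.integrable_sum integrable_real_indicator sets.Int A) (auto simp: less_top[symmetric])
    have AVexp: "expectation (\<lambda>\<omega>. indicator (A i) \<omega> * V (B i - {i}) \<omega>) = (\<Sum>j\<in>B i - {i}. prob (A i \<inter> A j))"
    proof -
      have "expectation (\<lambda>\<omega>. indicator (A i) \<omega> * V (B i - {i}) \<omega>) = (\<Sum>j\<in>B i - {i}. expectation (indicator (A i \<inter> A j)))" unfolding AV[OF refl]
        using BI i by (intro Bochner_Integration.integral_sum integrable_real_indicator sets.Int A) (auto simp: less_top[symmetric])
      also have "\<dots> = (\<Sum>j\<in>B i - {i}. prob (A i \<inter> A j))"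
      proof (intro sum.cong refl)
        fix j assume "j \<in> B i - {i}"
        then have "A i \<inter> A j \<in> events" using BI i by (intro sets.Int A) auto
        then show "expectation (indicator (A i \<inter> A j)) = prob (A i \<inter> A j)" by simp
      qed
      finally show ?thesis .
    qed
    have "\<bar>expectation (\<lambda>\<omega>. g (V I \<omega> + 1)) - expectation (\<lambda>\<omega>. g (V ?J \<omega> + 1))\<bar> \<le> expectation (V (B i))"
      using gint(1)[OF J] gint(1)[OF subset_refl] Vint[OF BI(1)]
      by (intro integral_abs_diff_le lip1)
    then have 1: "\<bar>prob (A i) * expectation (\<lambda>\<omega>. g (V I \<omega> + 1)) - prob (A i) * expectation (\<lambda>\<omega>. g (V ?J \<omega> + 1))\<bar> \<le> (\<Sum>j\<in>B i. prob (A i) * prob (A j))"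
      unfolding expV[OF BI(1)] right_diff_distrib[symmetric] abs_mult sum_distrib_left[symmetric] by (simp add: mult_left_mono)
    have 2: "\<bar>expectation (\<lambda>\<omega>. indicator (A i) \<omega> * g (V ?J \<omega> + 1)) - expectation (\<lambda>\<omega>. indicator (A i) \<omega> * g (V I \<omega>))\<bar> \<le> (\<Sum>j\<in>B i - {i}. prob (A i \<inter> A j))"
      unfolding AVexp[symmetric] using gint(4)[OF J i] gint(3)[OF subset_refl i] AVint
      by (intro integral_abs_diff_le lip2)
    show ?thesis using 1 2 unfolding fac by linarith
  qed
  have "\<bar>prob (space M - (\<Union>i\<in>I. A i)) - exp (- l)\<bar> \<le> (\<Sum>i\<in>I. (\<Sum>j\<in>B i. prob (A i) * prob (A j)) + (\<Sum>j\<in>B i - {i}. prob (A i \<inter> A j)))"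
    unfolding main by (intro order_trans[OF sum_abs] sum_mono term_le)
  then show ?thesis unfolding l_def by (simp add: sum.distrib)
qed

section \<open>Smoothing inequality\<close>

lemma interval_measure_diff_le_char:
  fixes g :: "real \<Rightarrow> real"
  assumes \<mu>: "real_distribution \<mu>" "\<And>x. measure \<mu> {x} = 0"
    and \<nu>: "real_distribution \<nu>" "\<And>x. measure \<nu> {x} = 0"
    and g: "integrable lborel g" "\<And>t. 0 \<le> g t"
    and le: "\<And>t. cmod (char \<mu> t - char \<nu> t) \<le> \<bar>t\<bar> * g t"
    and ab: "a \<le> b"
  shows "\<bar>measure \<mu> {a<..b} - measure \<nu> {a<..b}\<bar> \<le> (1 / pi) * (LINT t|lborel. g t)"
proof -
  interpret mu: real_distribution \<mu> by fact
  interpret nu: real_distribution \<nu> by fact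
  define F where "F = (\<lambda>t::real. (iexp (-(t * a)) - iexp (-(t * b))) / (\<i> * t))"
  have F_meas[measurable]: "F \<in> borel_measurable borel" unfolding F_def by measurable
  have F1: "cmod (F t) \<le> b - a" for t
  proof (cases "t = 0")
    case False
    have "cmod (F t) = cmod ((iexp (t * (-a)) - iexp (t * (-b))) / (\<i> * t))" by (simp add: F_def)
    also have "\<dots> \<le> - a - (- b)" using ab False by (intro Levy_Inversion_aux2) auto
    finally show ?thesis by simp
  qed (use ab in \<open>auto simp: F_def\<close>)
  have F2: "cmod (F t) * \<bar>t\<bar> \<le> 2" for t
  proof (cases "t = 0")
    case False
    have "cmod (iexp (-(t * a)) - iexp (-(t * b))) \<le> 1 + 1"
      by (rule order_trans[OF norm_triangle_ineq4]) (simp del: of_real_mult of_real_minus)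
    then show ?thesis using False by (simp add: F_def norm_divide norm_mult del: of_real_mult of_real_minus)
  qed auto
  have int: "set_integrable lborel {-T<..<T} (\<lambda>t. F t * char \<rho> t)" if "real_distribution \<rho>" for T \<rho>
  proof -
    interpret real_distribution \<rho> by fact
    show ?thesis unfolding set_integrable_def
    proof (rule integrableI_bounded_set[where A="{-T<..<T}" and B="b - a"])
      show "AE x in lborel. x \<in> {- T<..<T} \<longrightarrow> cmod (indicat_real {- T<..<T} x *\<^sub>R (F x * char \<rho> x)) \<le> b - a"
      proof (intro AE_I2 impI)
        fix x :: real
        have "cmod (F x) * cmod (char \<rho> x) \<le> (b - a) * 1"
          using F1[of x] cmod_char_le_1[of x] ab by (intro mult_mono) auto
        then show "cmod (indicat_real {- T<..<T} x *\<^sub>R (F x * char \<rho> x)) \<le> b - a"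
          using ab by (auto simp: indicator_def norm_mult)
      qed
      show "emeasure lborel {- T<..<T} < \<infinity>" by (rule emeasure_bounded_finite) auto
    qed (auto simp: char_measurable)
  qed
  have bnd: "cmod (1 / (2 * pi) * (CLBINT t=-(real T)..real T. F t * char \<mu> t) - 1 / (2 * pi) * (CLBINT t=-(real T)..real T. F t * char \<nu> t))
     \<le> (1 / pi) * (LINT t|lborel. g t)" for T :: nat
  proof -
    have e: "einterval (ereal (- real T)) (ereal (real T)) = {- real T<..<real T}" by (auto simp: einterval_def)
    have "(CLBINT t=-(real T)..real T. F t * char \<mu> t) - (CLBINT t=-(real T)..real T. F t * char \<nu> t)
      = (CLINT t:{- real T<..<real T}|lborel. F t * char \<mu> t) - (CLINT t:{- real T<..<real T}|lborel. F t * char \<nu> t)"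
      unfolding interval_lebesgue_integral_def e by simp
    also have "\<dots> = (CLINT t:{- real T<..<real T}|lborel. F t * char \<mu> t - F t * char \<nu> t)"
      using set_integral_diff(2)[OF int[OF \<mu>(1)] int[OF \<nu>(1)]] by simp
    finally have eq: "(CLBINT t=-(real T)..real T. F t * char \<mu> t) - (CLBINT t=-(real T)..real T. F t * char \<nu> t)
      = (CLINT t:{- real T<..<real T}|lborel. F t * char \<mu> t - F t * char \<nu> t)" .
    have "cmod (CLINT t:{- real T<..<real T}|lborel. F t * char \<mu> t - F t * char \<nu> t) \<le> (LINT t|lborel. 2 * g t)"
      unfolding set_lebesgue_integral_def
    proof (rule Bochner_Integration.integral_norm_bound_integral)
      show "integrable lborel (\<lambda>t. indicat_real {- real T<..<real T} t *\<^sub>R (F t * char \<mu> t - F t * char \<nu> t))"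
        using set_integral_diff(1)[OF int[OF \<mu>(1)] int[OF \<nu>(1)]] unfolding set_integrable_def .
      show "integrable lborel (\<lambda>t. 2 * g t)" using g by auto
      fix t
      have "cmod (F t * char \<mu> t - F t * char \<nu> t) = cmod (F t) * cmod (char \<mu> t - char \<nu> t)"
        by (simp add: norm_mult flip: right_diff_distrib)
      also have "\<dots> \<le> cmod (F t) * (\<bar>t\<bar> * g t)" by (intro mult_left_mono le) auto
      also have "\<dots> \<le> 2 * g t" using F2[of t] g(2)[of t] by (simp flip: mult.assoc add: mult_right_mono)
      finally show "cmod (indicat_real {- real T<..<real T} t *\<^sub>R (F t * char \<mu> t - F t * char \<nu> t)) \<le> 2 * g t"
        using g(2)[of t] by (auto simp: indicator_def)
    qed
    then show ?thesis unfolding right_diff_distrib[symmetric] eq norm_mult by (simp add: norm_divide field_simps)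
  qed
  have "(\<lambda>T. 1 / (2 * pi) * (CLBINT t=-(real T)..real T. F t * char \<mu> t) - 1 / (2 * pi) * (CLBINT t=-(real T)..real T. F t * char \<nu> t))
     \<longlonglongrightarrow> complex_of_real (measure \<mu> {a<..b}) - complex_of_real (measure \<nu> {a<..b})"
    unfolding F_def using mu.Levy_Inversion[OF ab \<mu>(2) \<mu>(2)] nu.Levy_Inversion[OF ab \<nu>(2) \<nu>(2)]
    by (intro tendsto_diff) simp_all
  then have "cmod (complex_of_real (measure \<mu> {a<..b}) - complex_of_real (measure \<nu> {a<..b})) \<le> (1 / pi) * (LINT t|lborel. g t)"
    by (rule Lim_norm_ubound[OF sequentially_bot _ always_eventually]) (intro allI bnd)
  then show ?thesis by (metis norm_of_real of_real_diff)
qed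

lemma cdf_diff_le_char:
  fixes g :: "real \<Rightarrow> real"
  assumes \<mu>: "real_distribution \<mu>" "\<And>x. measure \<mu> {x} = 0"
    and \<nu>: "real_distribution \<nu>" "\<And>x. measure \<nu> {x} = 0"
    and g: "integrable lborel g" "\<And>t. 0 \<le> g t"
    and le: "\<And>t. cmod (char \<mu> t - char \<nu> t) \<le> \<bar>t\<bar> * g t"
  shows "\<bar>cdf \<mu> x - cdf \<nu> x\<bar> \<le> (1 / pi) * (LINT t|lborel. g t)"
proof -
  interpret mu: real_distribution \<mu> by fact
  interpret nu: real_distribution \<nu> by fact
  have "((\<lambda>a. \<bar>(cdf \<mu> x - cdf \<mu> a) - (cdf \<nu> x - cdf \<nu> a)\<bar>) \<longlongrightarrow> \<bar>(cdf \<mu> x - 0) - (cdf \<nu> x - 0)\<bar>) at_bot"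
    by (intro tendsto_intros mu.cdf_lim_at_bot nu.cdf_lim_at_bot)
  moreover have "eventually (\<lambda>a. \<bar>(cdf \<mu> x - cdf \<mu> a) - (cdf \<nu> x - cdf \<nu> a)\<bar> \<le> (1 / pi) * (LINT t|lborel. g t)) at_bot"
    using eventually_gt_at_bot[of x]
  proof eventually_elim
    case (elim a)
    then show ?case using interval_measure_diff_le_char[OF assms, of a x]
      by (simp add: mu.cdf_diff_eq nu.cdf_diff_eq)
  qed
  ultimately show ?thesis by (intro tendsto_upperbound[of "\<lambda>a. \<bar>(cdf \<mu> x - cdf \<mu> a) - (cdf \<nu> x - cdf \<nu> a)\<bar>" _ at_bot]) auto
qed

lemma std_normal_tail_le:
  assumes "0 \<le> w"
  shows "measure std_normal_distribution {w..} \<le> exp (- w\<^sup>2 / 2)"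
    and "measure std_normal_distribution {..- w} \<le> exp (- w\<^sup>2 / 2)"
proof -
  interpret real_distribution std_normal_distribution by (rule real_dist_normal_dist)
  have key: "measure std_normal_distribution A \<le> exp (- w\<^sup>2 / 2)" if A: "A \<in> sets borel" and c: "\<And>z. z \<in> A \<Longrightarrow> c * (z - c) \<ge> 0" "c\<^sup>2 = w\<^sup>2" for A c
  proof -
    have "emeasure std_normal_distribution A = (\<integral>\<^sup>+z. ennreal (std_normal_density z) * indicator A z \<partial>lborel)"
      using A by (subst emeasure_density) auto
    also have "\<dots> \<le> (\<integral>\<^sup>+z. ennreal (exp (- w\<^sup>2 / 2)) * ennreal (normal_density c 1 z) \<partial>lborel)"
    proof (intro nn_integral_mono)
      fix z
      show "ennreal (std_normal_density z) * indicator A z \<le> ennreal (exp (- w\<^sup>2 / 2)) * ennreal (normal_density c 1 z)"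
      proof (cases "z \<in> A")
        case True
        have "- z\<^sup>2 / 2 \<le> - w\<^sup>2 / 2 + - (z - c)\<^sup>2 / 2"
          using c(1)[OF True] unfolding c(2)[symmetric] by (simp add: power2_eq_square algebra_simps)
        then have "exp (- z\<^sup>2 / 2) \<le> exp (- w\<^sup>2 / 2) * exp (- (z - c)\<^sup>2 / 2)" unfolding exp_add[symmetric] by simp
        then have "std_normal_density z \<le> exp (- w\<^sup>2 / 2) * normal_density c 1 z"
          by (simp add: normal_density_def divide_right_mono)
        then show ?thesis using True by (simp flip: ennreal_mult)
      qed auto
    qed
    also have "\<dots> = ennreal (exp (- w\<^sup>2 / 2))"
      using emeasure_space_1[unfolded emeasure_density] prob_space.emeasure_space_1[OF prob_space_normal_density[of 1 c]]
      by (subst nn_integral_cmult) (auto simp: emeasure_density)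
    finally show ?thesis by (simp add: emeasure_eq_measure)
  qed
  show "measure std_normal_distribution {w..} \<le> exp (- w\<^sup>2 / 2)" using assms by (intro key[of _ w]) auto
  show "measure std_normal_distribution {..- w} \<le> exp (- w\<^sup>2 / 2)" using assms by (intro key[of _ "-w"]) (auto intro: mult_nonneg_nonpos simp: mult_nonneg_nonpos)
qed

lemma std_normal_interval_le:
  assumes "a \<le> b"
  shows "measure std_normal_distribution {a<..b} \<le> b - a"
proof -
  interpret real_distribution std_normal_distribution by (rule real_dist_normal_dist)
  have d1: "std_normal_density z \<le> 1" for z
  proof -
    have "1 \<le> sqrt (2 * pi)" using pi_gt3 by (simp add: real_le_rsqrt)
    then show ?thesis unfolding std_normal_density_def by (intro mult_le_one) auto
  qed
  have "emeasure std_normal_distribution {a<..b} = (\<integral>\<^sup>+z. ennreal (std_normal_density z) * indicator {a<..b} z \<partial>lborel)"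
    by (subst emeasure_density) auto
  also have "\<dots> \<le> (\<integral>\<^sup>+z. indicator {a<..b} z \<partial>lborel)"
    using d1 by (intro nn_integral_mono) (auto simp: indicator_def)
  also have "\<dots> = ennreal (b - a)" using assms by simp
  finally show ?thesis using assms by (simp add: emeasure_eq_measure)
qed

definition gauss_smooth :: "real \<Rightarrow> real measure \<Rightarrow> real measure" where
  "gauss_smooth \<eta> \<mu> = distr (\<mu> \<Otimes>\<^sub>M std_normal_distribution) borel (\<lambda>(x, z). x + \<eta> * z)"

context
  fixes \<mu> :: "real measure" and \<eta> :: real
  assumes \<mu>: "real_distribution \<mu>"
begin

interpretation mu: real_distribution \<mu> by (rule \<mu>)
interpretation N: real_distribution std_normal_distribution by (rule real_dist_normal_dist)
interpretation P: pair_prob_space \<mu> std_normal_distribution ..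

lemma real_distribution_gauss_smooth: "real_distribution (gauss_smooth \<eta> \<mu>)"
  unfolding gauss_smooth_def by (rule P.real_distribution_distr) measurable

lemma char_gauss_smooth: "char (gauss_smooth \<eta> \<mu>) t = char \<mu> t * exp (- (\<eta> * t)\<^sup>2 / 2)"
proof -
  have int: "integrable (\<mu> \<Otimes>\<^sub>M std_normal_distribution) (\<lambda>(x, z). iexp (t * (x + \<eta> * z)))"
    unfolding split_def
    by (rule P.integrable_const_bound[where B=1]) (auto simp del: of_real_add of_real_mult)
  have "char (gauss_smooth \<eta> \<mu>) t = (CLINT p|(\<mu> \<Otimes>\<^sub>M std_normal_distribution). (case p of (x, z) \<Rightarrow> iexp (t * (x + \<eta> * z))))"
    unfolding char_def gauss_smooth_def
    by (subst integral_distr) (auto intro!: Bochner_Integration.integral_cong)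
  also have "\<dots> = (CLINT x|\<mu>. CLINT z|std_normal_distribution. iexp (t * (x + \<eta> * z)))"
    using P.integral_fst'[OF int] by simp
  also have "\<dots> = (CLINT x|\<mu>. iexp (t * x) * char std_normal_distribution (\<eta> * t))"
    by (intro Bochner_Integration.integral_cong refl)
       (simp add: char_def algebra_simps exp_add flip: integral_mult_right_zero)
  also have "\<dots> = char \<mu> t * exp (- (\<eta> * t)\<^sup>2 / 2)"
    unfolding char_std_normal_distribution by (simp add: char_def)
  finally show ?thesis .
qed

lemma gauss_smooth_no_atoms:
  assumes "\<eta> > 0"
  shows "measure (gauss_smooth \<eta> \<mu>) {x} = 0"
proof -
  have "emeasure (gauss_smooth \<eta> \<mu>) {x} = emeasure (\<mu> \<Otimes>\<^sub>M std_normal_distribution) {p. fst p + \<eta> * snd p = x}"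
    unfolding gauss_smooth_def by (subst emeasure_distr) (auto simp: space_pair_measure intro!: arg_cong2[where f=emeasure])
  also have "\<dots> = (\<integral>\<^sup>+a. emeasure std_normal_distribution (Pair a -` {p. fst p + \<eta> * snd p = x}) \<partial>\<mu>)"
  proof (rule N.emeasure_pair_measure_alt)
    have "{p\<in>space (\<mu> \<Otimes>\<^sub>M std_normal_distribution). fst p + \<eta> * snd p = x} \<in> sets (\<mu> \<Otimes>\<^sub>M std_normal_distribution)"
      by measurable
    then show "{p. fst p + \<eta> * snd p = x} \<in> sets (\<mu> \<Otimes>\<^sub>M std_normal_distribution)" by (simp add: space_pair_measure)
  qed
  also have "\<dots> = (\<integral>\<^sup>+a. 0 \<partial>\<mu>)"
  proof (intro nn_integral_cong)
    fix a
    have "Pair a -` {p. fst p + \<eta> * snd p = x} = {(x - a) / \<eta>}" using assms by (auto simp: field_simps)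
    then show "emeasure std_normal_distribution (Pair a -` {p. fst p + \<eta> * snd p = x}) = 0"
      by (simp add: emeasure_density nn_integral_null_set)
  qed
  finally show ?thesis by (simp add: measure_def)
qed

lemma cdf_le_gauss_smooth:
  assumes "\<eta> > 0" "w \<ge> 0"
  shows "cdf \<mu> z \<le> cdf (gauss_smooth \<eta> \<mu>) (z + \<eta> * w) + exp (- w\<^sup>2 / 2)"
    and "cdf (gauss_smooth \<eta> \<mu>) (z - \<eta> * w) \<le> cdf \<mu> z + exp (- w\<^sup>2 / 2)"
proof -
  let ?P = "\<mu> \<Otimes>\<^sub>M std_normal_distribution"
  have G: "cdf (gauss_smooth \<eta> \<mu>) y = measure ?P {p\<in>space ?P. fst p + \<eta> * snd p \<le> y}" for y
    unfolding cdf_def gauss_smooth_def by (subst measure_distr) (auto intro!: arg_cong2[where f=measure])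
  have times: "measure ?P (A \<times> B) = measure \<mu> A * measure std_normal_distribution B" if "A \<in> sets borel" "B \<in> sets borel" for A B
    using that by (simp add: measure_def N.emeasure_pair_measure_Times enn2real_mult)
  have C: "cdf \<mu> z = measure ?P ({..z} \<times> UNIV)"
    unfolding cdf_def using times[of "{..z}" UNIV] N.prob_space by simp
  have R: "measure ?P (UNIV \<times> B) = measure std_normal_distribution B" if "B \<in> sets borel" for B
    using times[of UNIV B] that mu.prob_space by simp
  have E: "{p\<in>space ?P. fst p + \<eta> * snd p \<le> y} \<in> sets ?P" for y by measurable
  have T: "A \<times> B \<in> sets ?P" if "A \<in> sets borel" "B \<in> sets borel" for A B using that by auto
  have "cdf \<mu> z \<le> measure ?P ({p\<in>space ?P. fst p + \<eta> * snd p \<le> z + \<eta> * w} \<union> (UNIV \<times> {w..}))"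
    unfolding C using assms by (intro P.finite_measure_mono sets.Un E T) (auto simp: space_pair_measure intro!: add_mono mult_left_mono)
  also have "\<dots> \<le> cdf (gauss_smooth \<eta> \<mu>) (z + \<eta> * w) + measure ?P (UNIV \<times> {w..})"
    unfolding G by (intro measure_Un_le E T) auto
  also have "\<dots> \<le> cdf (gauss_smooth \<eta> \<mu>) (z + \<eta> * w) + exp (- w\<^sup>2 / 2)"
    using std_normal_tail_le(1)[OF assms(2)] by (simp add: R)
  finally show "cdf \<mu> z \<le> cdf (gauss_smooth \<eta> \<mu>) (z + \<eta> * w) + exp (- w\<^sup>2 / 2)" .
  have "cdf (gauss_smooth \<eta> \<mu>) (z - \<eta> * w) \<le> measure ?P (({..z} \<times> UNIV) \<union> (UNIV \<times> {..-w}))"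
  proof -
    have dis: "a \<le> z \<or> b \<le> - w" if "a + \<eta> * b \<le> z - \<eta> * w" for a b
    proof (cases "a \<le> z")
      case False
      then have "\<eta> * b \<le> \<eta> * (- w)" using that by (simp add: algebra_simps)
      then have "b \<le> - w" using assms by (simp only: mult_le_cancel_left_pos)
      then show ?thesis by simp
    qed simp
    have "{p\<in>space ?P. fst p + \<eta> * snd p \<le> z - \<eta> * w} \<subseteq> ({..z} \<times> UNIV) \<union> (UNIV \<times> {..-w})"
    proof
      fix p assume "p \<in> {p\<in>space ?P. fst p + \<eta> * snd p \<le> z - \<eta> * w}"
      then show "p \<in> ({..z} \<times> UNIV) \<union> (UNIV \<times> {..-w})"
        using dis[of "fst p" "snd p"] by (cases p) auto
    qed
    then show ?thesis unfolding G by (intro P.finite_measure_mono sets.Un E T) auto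
  qed
  also have "\<dots> \<le> cdf \<mu> z + measure ?P (UNIV \<times> {..-w})"
    unfolding C by (intro measure_Un_le E T) auto
  also have "\<dots> \<le> cdf \<mu> z + exp (- w\<^sup>2 / 2)"
    using std_normal_tail_le(2)[OF assms(2)] by (simp add: R)
  finally show "cdf (gauss_smooth \<eta> \<mu>) (z - \<eta> * w) \<le> cdf \<mu> z + exp (- w\<^sup>2 / 2)" .
qed

end

lemma esseen_smoothing:
  fixes g :: "real \<Rightarrow> real"
  assumes \<mu>: "real_distribution \<mu>" and \<eta>: "0 < \<eta>" and w: "0 \<le> w"
    and g: "integrable lborel g" "\<And>t. 0 \<le> g t"
    and le: "\<And>t. cmod (char \<mu> t - complex_of_real (exp (- t\<^sup>2 / 2))) * exp (- (\<eta> * t)\<^sup>2 / 2) \<le> \<bar>t\<bar> * g t"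
  shows "\<bar>cdf \<mu> z - cdf std_normal_distribution z\<bar> \<le> (1 / pi) * (LINT t|lborel. g t) + 2 * \<eta> * w + 2 * exp (- w\<^sup>2 / 2)"
proof -
  interpret mu: real_distribution \<mu> by (rule \<mu>)
  interpret N: real_distribution std_normal_distribution by (rule real_dist_normal_dist)
  note n = real_dist_normal_dist
  let ?N = "std_normal_distribution"
  have char: "cmod (char (gauss_smooth \<eta> \<mu>) t - char (gauss_smooth \<eta> ?N) t) \<le> \<bar>t\<bar> * g t" for t
  proof -
    have "cmod (char (gauss_smooth \<eta> \<mu>) t - char (gauss_smooth \<eta> ?N) t) = cmod ((char \<mu> t - complex_of_real (exp (- t\<^sup>2 / 2))) * complex_of_real (exp (- (\<eta> * t)\<^sup>2 / 2)))"
      unfolding char_gauss_smooth[OF \<mu>] char_gauss_smooth[OF n] char_std_normal_distribution left_diff_distrib ..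
    also have "\<dots> \<le> \<bar>t\<bar> * g t" using le[of t] unfolding norm_mult norm_of_real by simp
    finally show ?thesis .
  qed
  have S: "\<bar>cdf (gauss_smooth \<eta> \<mu>) x - cdf (gauss_smooth \<eta> ?N) x\<bar> \<le> (1 / pi) * (LINT t|lborel. g t)" for x
    by (intro cdf_diff_le_char real_distribution_gauss_smooth gauss_smooth_no_atoms \<mu> n \<eta> g char)
  have L: "cdf ?N b - cdf ?N a \<le> b - a" if "a \<le> b" for a b
    using std_normal_interval_le[OF that] that by (cases "a = b") (auto simp: N.cdf_diff_eq)
  have hw: "0 \<le> \<eta> * w" using \<eta> w by simp
  note up = cdf_le_gauss_smooth[OF \<mu> \<eta> w] cdf_le_gauss_smooth[OF n \<eta> w]
  have "cdf (gauss_smooth \<eta> ?N) (z + \<eta> * w) \<le> cdf ?N (z + 2 * (\<eta> * w)) + exp (- w\<^sup>2 / 2)"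
    using up(4)[of "z + 2 * (\<eta> * w)"] by (simp add: algebra_simps)
  moreover have "cdf ?N (z - 2 * (\<eta> * w)) \<le> cdf (gauss_smooth \<eta> ?N) (z - \<eta> * w) + exp (- w\<^sup>2 / 2)"
    using up(3)[of "z - 2 * (\<eta> * w)"] by (simp add: algebra_simps)
  ultimately show ?thesis
    using up(1)[of z] up(2)[of z] S[of "z + \<eta> * w"] S[of "z - \<eta> * w"] L[of z "z + 2 * (\<eta> * w)"] L[of "z - 2 * (\<eta> * w)" z] hw
    unfolding abs_le_iff by (simp only: mult.assoc) linarith
qed

lemma norm_power_diff_le:
  fixes a b :: complex
  assumes "norm a \<le> r" "norm b \<le> r"
  shows "norm (a ^ n - b ^ n) \<le> real n * r ^ (n - 1) * norm (a - b)"
proof (induction n)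
  case (Suc n)
  have r0: "0 \<le> r" using assms(1) norm_ge_zero order_trans by blast
  have "a ^ Suc n - b ^ Suc n = a * (a ^ n - b ^ n) + (a - b) * b ^ n" by (simp add: algebra_simps)
  then have "norm (a ^ Suc n - b ^ Suc n) \<le> norm a * norm (a ^ n - b ^ n) + norm (a - b) * norm b ^ n"
    by (metis norm_triangle_ineq norm_mult norm_power)
  also have "\<dots> \<le> r * (real n * r ^ (n - 1) * norm (a - b)) + norm (a - b) * r ^ n"
    using assms Suc r0 by (intro add_mono mult_mono power_mono) auto
  also have "\<dots> = real (Suc n) * r ^ (Suc n - 1) * norm (a - b)"
    by (cases n) (auto simp: algebra_simps)
  finally show ?case .
qed simp

lemma gaussian_lebesgue_integral:
  assumes "c > 0"
  shows "integrable lborel (\<lambda>x::real. exp (- (c * x\<^sup>2)))" "(LINT x|lborel. exp (- (c * x\<^sup>2))) = sqrt (pi / c)"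
proof -
  define s where "s = sqrt (1 / (2 * c))"
  have s: "s > 0" "s\<^sup>2 = 1 / (2 * c)" using assms by (auto simp: s_def)
  have eq: "exp (- (c * x\<^sup>2)) = sqrt (pi / c) * normal_density 0 s x" for x
    using assms unfolding normal_density_def s(2) by (simp add: field_simps real_sqrt_divide)
  show "integrable lborel (\<lambda>x::real. exp (- (c * x\<^sup>2)))" unfolding eq using s by simp
  show "(LINT x|lborel. exp (- (c * x\<^sup>2))) = sqrt (pi / c)" unfolding eq using s by simp
qed

lemma exp_minus_le_quadratic:
  assumes "0 \<le> (v::real)"
  shows "\<bar>exp (- v) - (1 - v)\<bar> \<le> v\<^sup>2 / 2"
proof -
  have 1: "1 - v \<le> exp (- v)" using exp_ge_add_one_self[of "-v"] by simp
  have "exp (- v) - (1 - v + v\<^sup>2 / 2) \<le> exp (- 0) - (1 - 0 + 0\<^sup>2 / 2 :: real)"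
  proof (rule DERIV_nonpos_imp_nonincreasing[OF assms])
    fix x :: real assume "0 \<le> x" "x \<le> v"
    have "((\<lambda>v. exp (- v) - (1 - v + v\<^sup>2 / 2)) has_real_derivative (- exp (- x) - (- 1 + x))) (at x)"
      by (auto intro!: derivative_eq_intros)
    moreover have "- exp (- x) - (- 1 + x) \<le> 0" using exp_ge_add_one_self[of "-x"] by simp
    ultimately show "\<exists>y. ((\<lambda>v. exp (- v) - (1 - v + v\<^sup>2 / 2)) has_real_derivative y) (at x) \<and> y \<le> 0" by blast
  qed
  then show ?thesis using 1 by simp
qed

lemma (in real_distribution) char_diff_std_normal_le:
  assumes i: "integrable M (\<lambda>x. x)" "integrable M (\<lambda>x. x\<^sup>2)" "integrable M (\<lambda>x. \<bar>x\<bar> ^ 3)"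
    and t1: "\<bar>expectation (\<lambda>x. x)\<bar> \<le> t1" and t2: "\<bar>expectation (\<lambda>x. x\<^sup>2) - 1\<bar> \<le> t2"
    and b3: "expectation (\<lambda>x. \<bar>x\<bar> ^ 3) \<le> b3"
  shows "cmod (char M u - complex_of_real (exp (- u\<^sup>2 / 2))) \<le> \<bar>u\<bar> * t1 + u\<^sup>2 * t2 / 2 + \<bar>u\<bar> ^ 3 * b3 / 6 + u ^ 4 / 8"
proof -
  let ?m1 = "expectation (\<lambda>x. x)" and ?m2 = "expectation (\<lambda>x. x\<^sup>2)"
  have 0: "cmod (char M u - (\<Sum>k\<le>2. ((\<i> * u)^k / fact k) * expectation (\<lambda>x. x^k))) \<le>
    (\<bar>u\<bar>^2 / fact (Suc 2)) * expectation (\<lambda>x. min (2 * \<bar>x\<bar>^2 * Suc 2) (\<bar>u\<bar> * \<bar>x\<bar>^Suc 2))"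
  proof (rule char_approx2)
    fix k :: nat assume "k \<le> 2"
    then have "k = 0 \<or> k = 1 \<or> k = 2" by auto
    then show "integrable M (\<lambda>x. x ^ k)" using i by auto
  qed
  have s: "(\<Sum>k\<le>2. ((\<i> * u)^k / fact k) * expectation (\<lambda>x. x^k)) = 1 + \<i> * u * ?m1 - u\<^sup>2 / 2 * ?m2"
    using prob_space by (simp add: numeral_2_eq_2 power2_eq_square field_simps)
  have "expectation (\<lambda>x. min (2 * \<bar>x\<bar>^2 * Suc 2) (\<bar>u\<bar> * \<bar>x\<bar>^Suc 2)) \<le> expectation (\<lambda>x. \<bar>u\<bar> * \<bar>x\<bar> ^ 3)"
    using i by (intro integral_mono integrable_min) (auto simp: numeral_3_eq_3 numeral_2_eq_2)
  also have "\<dots> \<le> \<bar>u\<bar> * b3" using b3 by (simp add: mult_left_mono)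
  finally have "(\<bar>u\<bar>^2 / fact (Suc 2)) * expectation (\<lambda>x. min (2 * \<bar>x\<bar>^2 * Suc 2) (\<bar>u\<bar> * \<bar>x\<bar>^Suc 2)) \<le> (\<bar>u\<bar>^2 / fact (Suc 2)) * (\<bar>u\<bar> * b3)"
    by (intro mult_left_mono) auto
  also have "\<dots> = \<bar>u\<bar> ^ 3 * b3 / 6" by (simp add: fact_numeral numeral_3_eq_3 numeral_2_eq_2)
  finally have 1: "cmod (char M u - (1 + \<i> * u * ?m1 - u\<^sup>2 / 2 * ?m2)) \<le> \<bar>u\<bar> ^ 3 * b3 / 6"
    using 0 unfolding s by linarith
  have 2: "\<bar>exp (- (u\<^sup>2 / 2)) - (1 - u\<^sup>2 / 2)\<bar> \<le> u ^ 4 / 8"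
    using exp_minus_le_quadratic[of "u\<^sup>2 / 2"] by (simp add: power_divide flip: power_mult)
  have 3: "cmod (complex_of_real (1 - u\<^sup>2 / 2) - complex_of_real (exp (- u\<^sup>2 / 2))) \<le> u ^ 4 / 8"
    unfolding of_real_diff[symmetric] norm_of_real using 2 by (simp add: abs_minus_commute)
  have 4: "cmod ((1 + \<i> * u * ?m1 - u\<^sup>2 / 2 * ?m2) - complex_of_real (1 - u\<^sup>2 / 2)) \<le> \<bar>u\<bar> * t1 + u\<^sup>2 * t2 / 2"
  proof -
    have "(1 + \<i> * u * ?m1 - u\<^sup>2 / 2 * ?m2) - complex_of_real (1 - u\<^sup>2 / 2) = \<i> * complex_of_real (u * ?m1) - complex_of_real (u\<^sup>2 / 2 * (?m2 - 1))"
      by (simp add: algebra_simps)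
    also have "cmod \<dots> \<le> \<bar>u * ?m1\<bar> + \<bar>u\<^sup>2 / 2 * (?m2 - 1)\<bar>"
      by (rule order_trans[OF norm_triangle_ineq4]) (simp add: norm_mult abs_mult del: of_real_mult)
    also have "\<dots> \<le> \<bar>u\<bar> * t1 + u\<^sup>2 * t2 / 2"
    proof -
      have "u\<^sup>2 * \<bar>?m2 - 1\<bar> \<le> u\<^sup>2 * t2" using t2 by (intro mult_left_mono) auto
      moreover have "\<bar>u\<bar> * \<bar>?m1\<bar> \<le> \<bar>u\<bar> * t1" using t1 by (intro mult_left_mono) auto
      ultimately show ?thesis by (simp add: abs_mult)
    qed
    finally show ?thesis .
  qed
  have "char M u - complex_of_real (exp (- u\<^sup>2 / 2)) = (char M u - (1 + \<i> * u * ?m1 - u\<^sup>2 / 2 * ?m2)) + (((1 + \<i> * u * ?m1 - u\<^sup>2 / 2 * ?m2) - complex_of_real (1 - u\<^sup>2 / 2))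
     + (complex_of_real (1 - u\<^sup>2 / 2) - complex_of_real (exp (- u\<^sup>2 / 2))))" by simp
  then have "cmod (char M u - complex_of_real (exp (- u\<^sup>2 / 2))) \<le> cmod (char M u - (1 + \<i> * u * ?m1 - u\<^sup>2 / 2 * ?m2)) + (cmod ((1 + \<i> * u * ?m1 - u\<^sup>2 / 2 * ?m2) - complex_of_real (1 - u\<^sup>2 / 2))
     + cmod (complex_of_real (1 - u\<^sup>2 / 2) - complex_of_real (exp (- u\<^sup>2 / 2))))"
    by (smt (verit) norm_triangle_ineq)
  then show ?thesis using 1 3 4 by linarith
qed

lemma char_power_diff_le:
  fixes \<phi> :: "real \<Rightarrow> complex" and n :: nat and \<beta> t1 t2 s :: real
  assumes n: "n \<ge> 2" and \<beta>: "\<beta> \<ge> 1/2" and t: "0 \<le> t1" "sqrt n * t1 \<le> 1" "0 \<le> t2" "t2 \<le> 1/10"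
    and le: "\<And>u. cmod (\<phi> u - complex_of_real (exp (- u\<^sup>2 / 2))) \<le> \<bar>u\<bar> * t1 + u\<^sup>2 * t2 / 2 + \<bar>u\<bar> ^ 3 * (32 * \<beta>) / 6 + u ^ 4 / 8"
    and s: "\<bar>s\<bar> \<le> sqrt n / (100 * \<beta>)"
  shows "cmod (\<phi> (s / sqrt n) ^ n - complex_of_real (exp (- s\<^sup>2 / 2))) \<le> \<bar>s\<bar> * ((16 * exp 4) * (sqrt n * t1 + t2 + 6 * \<beta> / sqrt n) * exp (- (s\<^sup>2 / 16)))"
proof -
  define u where "u = s / sqrt n"
  have n0: "sqrt n > 0" using n by simp
  have su: "s = sqrt n * u" using n0 by (simp add: u_def)
  have u1: "\<bar>u\<bar> * (100 * \<beta>) \<le> 1" using s n0 \<beta> by (simp add: u_def field_simps)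
  have "\<bar>u\<bar> * 50 \<le> \<bar>u\<bar> * (100 * \<beta>)" using \<beta> by (intro mult_left_mono) auto
  then have u50: "\<bar>u\<bar> \<le> 1/50" using u1 by linarith
  define e where "e = \<bar>u\<bar> * t1 + u\<^sup>2 * t2 / 2 + 6 * \<bar>u\<bar> ^ 3 * \<beta>"
  have u4: "u ^ 4 \<le> \<bar>u\<bar> ^ 3 * (1/50)" 
  proof -
    have "u ^ 4 = \<bar>u\<bar> ^ 3 * \<bar>u\<bar>" by (simp add: power_even_abs flip: power_Suc2)
    also have "\<dots> \<le> \<bar>u\<bar> ^ 3 * (1/50)" using u50 by (intro mult_left_mono) auto
    finally show ?thesis .
  qed
  have P0: "0 \<le> \<bar>u\<bar> ^ 3 * \<beta>" using \<beta> by simp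
  have "\<bar>u\<bar> ^ 3 * (1/2) \<le> \<bar>u\<bar> ^ 3 * \<beta>" using \<beta> by (intro mult_left_mono) auto
  then have e: "cmod (\<phi> u - complex_of_real (exp (- u\<^sup>2 / 2))) \<le> e"
    using le[of u] u4 P0 unfolding e_def by linarith
  have u3: "\<bar>u\<bar> ^ 3 * \<beta> \<le> u\<^sup>2 / 100"
  proof -
    have "\<bar>u\<bar> ^ 3 * \<beta> = u\<^sup>2 * (\<bar>u\<bar> * \<beta>)" by (simp add: numeral_3_eq_3 power2_eq_square)
    also have "\<dots> \<le> u\<^sup>2 * (1/100)" using u1 by (intro mult_left_mono) auto
    finally show ?thesis by simp
  qed
  have u4': "u ^ 4 \<le> u\<^sup>2 / 2500"
  proof -
    have "u ^ 4 = u\<^sup>2 * \<bar>u\<bar>\<^sup>2" by (simp flip: power_add)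
    also have "\<dots> \<le> u\<^sup>2 * (1/50)\<^sup>2" using u50 by (intro mult_left_mono power_mono) auto
    finally show ?thesis by (simp add: power_divide)
  qed
  have ut2: "u\<^sup>2 * t2 \<le> u\<^sup>2 / 10" using t(4) mult_left_mono[of t2 "1/10" "u\<^sup>2"] by simp
  have eb: "exp (- u\<^sup>2 / 2) \<le> 1 - u\<^sup>2 / 2 + u ^ 4 / 8"
    using abs_le_D1[OF exp_minus_le_quadratic[of "u\<^sup>2 / 2"]] by (simp add: power_divide flip: power_mult)
  define r where "r = exp (- ((19/50) * u\<^sup>2) + \<bar>u\<bar> * t1)"
  have rge: "1 - (19/50) * u\<^sup>2 + \<bar>u\<bar> * t1 \<le> r" unfolding r_def using exp_ge_add_one_self[of "- ((19/50) * u\<^sup>2) + \<bar>u\<bar> * t1"] by linarith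
  have ut1: "0 \<le> \<bar>u\<bar> * t1" using t by simp
  have a: "cmod (\<phi> u) \<le> r"
  proof -
    have "cmod (\<phi> u) \<le> cmod (\<phi> u - complex_of_real (exp (- u\<^sup>2 / 2))) + cmod (complex_of_real (exp (- u\<^sup>2 / 2)))"
      by (smt (verit) norm_triangle_sub)
    also have "\<dots> \<le> e + exp (- u\<^sup>2 / 2)" using e by (simp only: norm_of_real) simp
    also have "\<dots> \<le> 1 - (19/50) * u\<^sup>2 + \<bar>u\<bar> * t1" unfolding e_def using eb u4' u3 ut2 zero_le_power2[of u] by linarith
    finally show ?thesis using rge by linarith
  qed
  have b: "cmod (complex_of_real (exp (- u\<^sup>2 / 2))) \<le> r"
    unfolding norm_of_real abs_exp_cancel using eb u4' rge ut1 zero_le_power2[of u] by linarith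
  have "cmod (\<phi> u ^ n - complex_of_real (exp (- u\<^sup>2 / 2)) ^ n) \<le> real n * r ^ (n - 1) * cmod (\<phi> u - complex_of_real (exp (- u\<^sup>2 / 2)))"
    by (rule norm_power_diff_le[OF a b])
  also have "\<dots> \<le> real n * exp (4 - s\<^sup>2 / 8) * e"
  proof (intro mult_mono mult_left_mono e)
    have "r ^ (n - 1) = exp (real (n - 1) * (- ((19/50) * u\<^sup>2) + \<bar>u\<bar> * t1))" unfolding r_def by (simp add: exp_of_nat_mult)
    also have "\<dots> \<le> exp (4 - s\<^sup>2 / 8)"
    proof -
      have "real (n - 1) * (- ((19/50) * u\<^sup>2)) \<le> (real n / 2) * (- ((19/50) * u\<^sup>2))"
        using n by (intro mult_right_mono_neg) auto
      moreover have "real (n - 1) * (\<bar>u\<bar> * t1) \<le> real n * (\<bar>u\<bar> * t1)" using ut1 by (intro mult_right_mono) auto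
      moreover have "real n * u\<^sup>2 = s\<^sup>2" unfolding su by (simp add: power_mult_distrib)
      moreover have "real n * (\<bar>u\<bar> * t1) \<le> \<bar>s\<bar>"
      proof -
        have "real n = sqrt n * sqrt n" by simp
        then have "real n * (\<bar>u\<bar> * t1) = \<bar>s\<bar> * (sqrt n * t1)" unfolding su abs_mult using n0 by (simp add: ac_simps)
        also have "\<dots> \<le> \<bar>s\<bar> * 1" using t by (intro mult_left_mono) auto
        finally show ?thesis by simp
      qed
      moreover have "\<bar>s\<bar> \<le> 4 + (13/200) * s\<^sup>2"
      proof -
        have "0 \<le> (\<bar>s\<bar> - 100/13)\<^sup>2" by simp
        also have "\<dots> = s\<^sup>2 - 200/13 * \<bar>s\<bar> + (100/13)\<^sup>2" by (simp add: power2_diff)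
        finally show ?thesis by (simp add: power2_eq_square)
      qed
      moreover have "real (n - 1) * (- ((19/50) * u\<^sup>2) + \<bar>u\<bar> * t1) = real (n - 1) * (- ((19/50) * u\<^sup>2)) + real (n - 1) * (\<bar>u\<bar> * t1)"
        by (rule distrib_left)
      moreover have "(real n / 2) * (- ((19/50) * u\<^sup>2)) = - (19/100) * (real n * u\<^sup>2)" by simp
      ultimately show ?thesis unfolding exp_le_cancel_iff by linarith
    qed
    finally show "r ^ (n - 1) \<le> exp (4 - s\<^sup>2 / 8)" .
  qed (auto simp: r_def)
  also have "\<phi> u ^ n - complex_of_real (exp (- u\<^sup>2 / 2)) ^ n = \<phi> u ^ n - complex_of_real (exp (- s\<^sup>2 / 2))"
    unfolding su by (simp add: power_mult_distrib flip: exp_of_nat_mult of_real_power)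
  also have "real n * exp (4 - s\<^sup>2 / 8) * e = exp 4 * (\<bar>s\<bar> * (sqrt n * t1) + s\<^sup>2 * t2 / 2 + 6 * \<bar>s\<bar> ^ 3 * (\<beta> / sqrt n)) * exp (- (s\<^sup>2 / 8))"
  proof -
    have nn: "real n = sqrt n * sqrt n" by simp
    have "real n * e = \<bar>s\<bar> * (sqrt n * t1) + s\<^sup>2 * t2 / 2 + 6 * \<bar>s\<bar> ^ 3 * (\<beta> / sqrt n)"
      unfolding e_def su abs_mult power_mult_distrib using n0 nn
      by (simp add: field_simps numeral_3_eq_3 power2_eq_square)
    moreover have "exp (4 - s\<^sup>2 / 8) = exp 4 * exp (- (s\<^sup>2 / 8))" by (simp flip: exp_add)
    ultimately show ?thesis by (simp add: ac_simps)
  qed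
  also have "\<dots> \<le> exp 4 * (\<bar>s\<bar> * (sqrt n * t1 + t2 + 6 * \<beta> / sqrt n) * (1 + s\<^sup>2)) * exp (- (s\<^sup>2 / 8))"
  proof (intro mult_right_mono mult_left_mono)
    have A: "0 \<le> sqrt n * t1" "0 \<le> 6 * \<beta> / sqrt n" using t \<beta> by auto
    have "\<bar>s\<bar> * (sqrt n * t1) \<le> \<bar>s\<bar> * ((sqrt n * t1) * (1 + s\<^sup>2))" using A by (intro mult_left_mono) (auto simp: distrib_left)
    moreover have "s\<^sup>2 * t2 / 2 \<le> \<bar>s\<bar> * (t2 * (1 + s\<^sup>2))"
    proof -
      have "0 \<le> (\<bar>s\<bar> - 1)\<^sup>2" by simp
      then have "\<bar>s\<bar> \<le> 1 + s\<^sup>2" using sum_squares_bound[of 1 "\<bar>s\<bar>"] by (simp add: power2_eq_square)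
      then have "\<bar>s\<bar> * (t2 * \<bar>s\<bar>) \<le> \<bar>s\<bar> * (t2 * (1 + s\<^sup>2))" using t by (intro mult_left_mono) auto
      moreover have "\<bar>s\<bar> * (t2 * \<bar>s\<bar>) = s\<^sup>2 * t2" by (simp add: power2_eq_square)
      moreover have "0 \<le> s\<^sup>2 * t2" using t by simp
      ultimately show ?thesis by linarith
    qed
    moreover have "6 * \<bar>s\<bar> ^ 3 * (\<beta> / sqrt n) \<le> \<bar>s\<bar> * (6 * \<beta> / sqrt n * (1 + s\<^sup>2))"
    proof -
      have "6 * \<bar>s\<bar> ^ 3 * (\<beta> / sqrt n) = \<bar>s\<bar> * (6 * \<beta> / sqrt n * s\<^sup>2)" by (simp add: numeral_3_eq_3 power2_eq_square)
      also have "\<dots> \<le> \<bar>s\<bar> * (6 * \<beta> / sqrt n * (1 + s\<^sup>2))" using A by (intro mult_left_mono) auto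
      finally show ?thesis .
    qed
    ultimately show "\<bar>s\<bar> * (sqrt n * t1) + s\<^sup>2 * t2 / 2 + 6 * \<bar>s\<bar> ^ 3 * (\<beta> / sqrt n) \<le> \<bar>s\<bar> * (sqrt n * t1 + t2 + 6 * \<beta> / sqrt n) * (1 + s\<^sup>2)"
      by (simp only: distrib_right distrib_left mult.assoc)
  qed auto
  also have "\<dots> = exp 4 * (\<bar>s\<bar> * (sqrt n * t1 + t2 + 6 * \<beta> / sqrt n)) * ((1 + s\<^sup>2) * exp (- (s\<^sup>2 / 8)))" by simp
  also have "\<dots> \<le> exp 4 * (\<bar>s\<bar> * (sqrt n * t1 + t2 + 6 * \<beta> / sqrt n)) * (16 * exp (- (s\<^sup>2 / 16)))"
  proof (intro mult_left_mono)
    have "1 + s\<^sup>2 \<le> 16 * exp (s\<^sup>2 / 16)" using exp_ge_add_one_self[of "s\<^sup>2 / 16"] by linarith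
    then have "(1 + s\<^sup>2) * exp (- (s\<^sup>2 / 8)) \<le> 16 * exp (s\<^sup>2 / 16) * exp (- (s\<^sup>2 / 8))" by (intro mult_right_mono) auto
    also have "\<dots> = 16 * exp (- (s\<^sup>2 / 16))" by (simp flip: exp_add)
    finally show "(1 + s\<^sup>2) * exp (- (s\<^sup>2 / 8)) \<le> 16 * exp (- (s\<^sup>2 / 16))" .
  qed (use t \<beta> in auto)
  finally show ?thesis unfolding u_def by (simp only: ac_simps)
qed

lemma kolmogorov_distance_le:
  fixes \<phi> :: "real \<Rightarrow> complex" and n :: nat and \<beta> t1 t2 :: real
  assumes \<mu>: "real_distribution \<mu>" and char\<mu>: "\<And>s. char \<mu> s = \<phi> (s / sqrt n) ^ n"
    and n: "n \<ge> 3" and \<beta>: "\<beta> \<ge> 1/2" and t: "0 \<le> t1" "sqrt n * t1 \<le> 1" "0 \<le> t2" "t2 \<le> 1/10"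
    and le: "\<And>u. cmod (\<phi> u - complex_of_real (exp (- u\<^sup>2 / 2))) \<le> \<bar>u\<bar> * t1 + u\<^sup>2 * t2 / 2 + \<bar>u\<bar> ^ 3 * (32 * \<beta>) / 6 + u ^ 4 / 8"
  shows "\<bar>cdf \<mu> z - cdf std_normal_distribution z\<bar> \<le> 63000 * (sqrt n * t1 + t2 + ln n * (\<beta> / sqrt n))"
proof -
  interpret mu: real_distribution \<mu> by (rule \<mu>)
  define l where "l = ln (real n)"
  define \<gamma> where "\<gamma> = \<beta> / sqrt n"
  have "exp 1 \<le> (3::real)" using exp_le by simp
  then have l1: "l \<ge> 1" unfolding l_def using n ln_ge_iff[of "real n" 1] by auto
  have n0: "sqrt n > 0" using n by simp
  have g0: "\<gamma> > 0" using \<beta> n0 by (simp add: \<gamma>_def)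
  have el: "exp (- (l / 2)) = 1 / sqrt n" unfolding l_def using n
    by (simp add: exp_minus inverse_eq_divide powr_half_sqrt[symmetric] powr_def)
  have ng: "1 / sqrt n \<le> 2 * \<gamma>" using \<beta> n0 by (simp add: \<gamma>_def field_simps)
  define S where "S = sqrt n / (100 * \<beta>)"
  have S: "S = 1 / (100 * \<gamma>)" "S > 0" using n0 \<beta> by (auto simp: S_def \<gamma>_def)
  define \<eta> where "\<eta> = sqrt (2 * l) / S"
  have \<eta>: "\<eta> > 0" using S l1 by (simp add: \<eta>_def)
  have \<eta>S: "\<eta> * S = sqrt (2 * l)" using S by (simp add: \<eta>_def)
  define D where "D = (16 * exp 4) * (sqrt n * t1 + t2 + 6 * \<gamma>)"
  have D0: "D \<ge> 0" using t g0 by (simp add: D_def)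
  define E where "E = 2 / S * exp (- (l / 2))"
  have E0: "E \<ge> 0" using S by (simp add: E_def)
  define g where "g = (\<lambda>s::real. D * exp (- ((1/16) * s\<^sup>2)) + E * exp (- ((\<eta>\<^sup>2 / 4) * s\<^sup>2)))"
  have g_int: "integrable lborel g" unfolding g_def using \<eta>
    by (intro Bochner_Integration.integrable_add integrable_mult_right gaussian_lebesgue_integral) auto
  have key: "cmod (char \<mu> s - complex_of_real (exp (- s\<^sup>2 / 2))) * exp (- (\<eta> * s)\<^sup>2 / 2) \<le> \<bar>s\<bar> * g s" for s
  proof (cases "\<bar>s\<bar> \<le> S")
    case True
    have "cmod (char \<mu> s - complex_of_real (exp (- s\<^sup>2 / 2))) * exp (- (\<eta> * s)\<^sup>2 / 2) \<le> cmod (char \<mu> s - complex_of_real (exp (- s\<^sup>2 / 2))) * 1"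
      by (intro mult_left_mono) auto
    also have "\<dots> \<le> \<bar>s\<bar> * (D * exp (- (s\<^sup>2 / 16)))"
      using char_power_diff_le[OF _ \<beta> t le, of s] n True unfolding char\<mu> D_def \<gamma>_def S_def by simp
    also have "\<dots> \<le> \<bar>s\<bar> * g s" unfolding g_def using E0 by (intro mult_left_mono) auto
    finally show ?thesis .
  next
    case False
    have "cmod (char \<mu> s - complex_of_real (exp (- s\<^sup>2 / 2))) \<le> cmod (char \<mu> s) + cmod (complex_of_real (exp (- s\<^sup>2 / 2)))" by (rule norm_triangle_ineq4)
    also have "\<dots> \<le> 1 + 1" unfolding norm_of_real using mu.cmod_char_le_1[of s] by (intro add_mono) auto
    finally have 1: "cmod (char \<mu> s - complex_of_real (exp (- s\<^sup>2 / 2))) \<le> 2" by simp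
    have S2: "S\<^sup>2 \<le> s\<^sup>2" using False S by (metis abs_le_square_iff abs_of_pos less_imp_le not_le)
    have "(\<eta>\<^sup>2 / 4) * S\<^sup>2 = l / 2" using \<eta>S l1 by (simp flip: power_mult_distrib)
    then have l2: "l / 2 \<le> (\<eta>\<^sup>2 / 4) * s\<^sup>2" using mult_left_mono[OF S2, of "\<eta>\<^sup>2 / 4"] zero_le_power2[of \<eta>] by linarith
    have "exp (- (\<eta> * s)\<^sup>2 / 2) = exp (- ((\<eta>\<^sup>2 / 4) * s\<^sup>2)) * exp (- ((\<eta>\<^sup>2 / 4) * s\<^sup>2))"
      unfolding exp_add[symmetric] by (simp add: power_mult_distrib)
    also have "\<dots> \<le> exp (- (l / 2)) * exp (- ((\<eta>\<^sup>2 / 4) * s\<^sup>2))" using l2 by (intro mult_right_mono) auto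
    finally have "cmod (char \<mu> s - complex_of_real (exp (- s\<^sup>2 / 2))) * exp (- (\<eta> * s)\<^sup>2 / 2) \<le> 2 * (exp (- (l / 2)) * exp (- ((\<eta>\<^sup>2 / 4) * s\<^sup>2)))"
      using 1 by (intro mult_mono) auto
    also have "\<dots> = S * (E * exp (- ((\<eta>\<^sup>2 / 4) * s\<^sup>2)))" using S by (simp add: E_def)
    also have "\<dots> \<le> \<bar>s\<bar> * g s" using False E0 D0 S unfolding g_def by (intro mult_mono) auto
    finally show ?thesis .
  qed
  have w: "0 \<le> sqrt l" using l1 by simp
  have main: "\<bar>cdf \<mu> z - cdf std_normal_distribution z\<bar> \<le> (1 / pi) * (LINT s|lborel. g s) + 2 * \<eta> * sqrt l + 2 * exp (- (sqrt l)\<^sup>2 / 2)"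
    by (rule esseen_smoothing[OF \<mu> \<eta> w g_int _ key]) (use D0 E0 in \<open>auto simp: g_def\<close>)
  have I: "(LINT s|lborel. g s) = D * sqrt (pi * 16) + E * sqrt (pi / (\<eta>\<^sup>2 / 4))"
    unfolding g_def using gaussian_lebesgue_integral[of "1/16"] gaussian_lebesgue_integral[of "\<eta>\<^sup>2 / 4"] \<eta>
    by (subst Bochner_Integration.integral_add) auto
  have spi: "sqrt pi \<le> 2" using pi_less_4 by (simp add: real_le_lsqrt)
  have I1: "D * sqrt (pi * 16) \<le> 8 * D" using spi D0 mult_left_mono[OF spi D0] by (simp add: real_sqrt_mult)
  have I2: "E * sqrt (pi / (\<eta>\<^sup>2 / 4)) \<le> 16 * \<gamma>"
  proof -
    have sq: "sqrt (pi / (\<eta>\<^sup>2 / 4)) = 2 * sqrt pi / \<eta>" using \<eta> by (simp add: real_sqrt_divide real_sqrt_mult)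
    have "E * sqrt (pi / (\<eta>\<^sup>2 / 4)) = 4 * sqrt pi / sqrt (2 * l) * (1 / sqrt n)"
      unfolding E_def el sq \<eta>S[symmetric] using \<open>S > 0\<close> \<eta> by (simp add: field_simps)
    also have "\<dots> \<le> 8 * (1 / sqrt n)"
    proof (intro mult_right_mono)
      have "1 \<le> sqrt (2 * l)" using l1 by simp
      then have "4 * sqrt pi / sqrt (2 * l) \<le> 4 * sqrt pi / 1" by (intro divide_left_mono) auto
      then show "4 * sqrt pi / sqrt (2 * l) \<le> 8" using spi by simp
    qed auto
    also have "\<dots> \<le> 16 * \<gamma>" using ng by simp
    finally show ?thesis .
  qed
  have E1: "2 * \<eta> * sqrt l \<le> 300 * (l * \<gamma>)"
  proof -
    have s2: "sqrt 2 \<le> 3/2" by (rule real_le_lsqrt) (auto simp: power2_eq_square)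
    have "2 * \<eta> * sqrt l = 200 * sqrt 2 * (l * \<gamma>)" unfolding \<eta>_def S(1) using l1 by (simp add: real_sqrt_mult)
    also have "\<dots> \<le> 300 * (l * \<gamma>)" using s2 l1 g0 by (intro mult_right_mono) auto
    finally show ?thesis .
  qed
  have E2: "2 * exp (- (sqrt l)\<^sup>2 / 2) \<le> 4 * \<gamma>" using l1 el ng by simp
  have e4: "exp 4 \<le> (81::real)"
  proof -
    have "exp (4::real) = exp 1 ^ 4" using exp_of_nat_mult[of 4 "1::real"] by simp
    also have "\<dots> \<le> 3 ^ 4" using exp_le by (intro power_mono) auto
    finally show ?thesis by simp
  qed
  have "0 \<le> (LINT s|lborel. g s)" using D0 E0 by (intro Bochner_Integration.integral_nonneg) (auto simp: g_def)
  then have "(1 / pi) * (LINT s|lborel. g s) \<le> 1 * (LINT s|lborel. g s)" using pi_gt3 by (intro mult_right_mono) (auto simp: field_simps)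
  then have "\<bar>cdf \<mu> z - cdf std_normal_distribution z\<bar> \<le> 8 * D + 16 * \<gamma> + 300 * (l * \<gamma>) + 4 * \<gamma>"
    using main I I1 I2 E1 E2 by linarith
  moreover have "D \<le> 1296 * (sqrt n * t1 + t2 + 6 * \<gamma>)"
    unfolding D_def using e4 t g0 by (intro mult_right_mono) auto
  moreover have "\<gamma> \<le> l * \<gamma>" using l1 g0 by simp
  moreover have "0 \<le> sqrt n * t1" using t by simp
  ultimately have "\<bar>cdf \<mu> z - cdf std_normal_distribution z\<bar> \<le> 63000 * (sqrt n * t1 + t2 + l * \<gamma>)" using t(3) by argo
  then show ?thesis by (simp only: l_def \<gamma>_def)
qed

section \<open>Moderate deviations\<close>

definition tilt :: "real \<Rightarrow> real measure \<Rightarrow> real measure" where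
  "tilt h L = density L (\<lambda>y. ennreal (exp (h * y) / (LINT y|L. exp (h * y))))"

lemma integral_exp_pos:
  assumes "real_distribution L" "integrable L (\<lambda>y. exp (h * y))"
  shows "0 < (LINT y|L. exp (h * y))"
proof -
  interpret real_distribution L by fact
  have "0 \<le> (LINT y|L. exp (h * y))" by (intro Bochner_Integration.integral_nonneg) auto
  moreover have "(LINT y|L. exp (h * y)) \<noteq> 0"
  proof
    assume "(LINT y|L. exp (h * y)) = 0"
    then have "AE y in L. exp (h * y) = 0"
      using integral_nonneg_eq_0_iff_AE[OF assms(2)] by simp
    then show False by simp
  qed
  ultimately show ?thesis by linarith
qed

lemma integral_tilt:
  fixes f :: "real \<Rightarrow> 'b :: {banach, second_countable_topology}"
  assumes L: "real_distribution L" "integrable L (\<lambda>y. exp (h * y))" and f[measurable]: "f \<in> borel_measurable borel"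
  shows "integral\<^sup>L (tilt h L) f = (LINT y|L. exp (h * y) *\<^sub>R f y) /\<^sub>R (LINT y|L. exp (h * y))"
    and "integrable (tilt h L) f \<longleftrightarrow> integrable L (\<lambda>y. exp (h * y) *\<^sub>R f y)"
proof -
  interpret real_distribution L by fact
  note p = integral_exp_pos[OF L]
  let ?Z = "LINT y|L. exp (h * y)"
  have e: "(exp (h * y) / ?Z) *\<^sub>R f y = (1 / ?Z) *\<^sub>R (exp (h * y) *\<^sub>R f y)" for y by simp
  have "integral\<^sup>L (tilt h L) f = (LINT y|L. (exp (h * y) / ?Z) *\<^sub>R f y)"
    unfolding tilt_def using p by (intro integral_density) auto
  also have "\<dots> = (LINT y|L. exp (h * y) *\<^sub>R f y) /\<^sub>R ?Z" unfolding e integral_scaleR_right by (simp add: inverse_eq_divide)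
  finally show "integral\<^sup>L (tilt h L) f = (LINT y|L. exp (h * y) *\<^sub>R f y) /\<^sub>R ?Z" .
  have "integrable (tilt h L) f \<longleftrightarrow> integrable L (\<lambda>y. (exp (h * y) / ?Z) *\<^sub>R f y)"
    unfolding tilt_def using p by (intro integrable_density) auto
  also have "\<dots> \<longleftrightarrow> integrable L (\<lambda>y. exp (h * y) *\<^sub>R f y)" 
  proof
    assume "integrable L (\<lambda>y. (exp (h * y) / ?Z) *\<^sub>R f y)"
    from integrable_scaleR_right[of ?Z, OF this] p show "integrable L (\<lambda>y. exp (h * y) *\<^sub>R f y)" by simp
  next
    assume "integrable L (\<lambda>y. exp (h * y) *\<^sub>R f y)"
    then show "integrable L (\<lambda>y. (exp (h * y) / ?Z) *\<^sub>R f y)" unfolding e by (rule integrable_scaleR_right)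
  qed
  finally show "integrable (tilt h L) f \<longleftrightarrow> integrable L (\<lambda>y. exp (h * y) *\<^sub>R f y)" .
qed

lemma real_distribution_tilt:
  assumes L: "real_distribution L" "integrable L (\<lambda>y. exp (h * y))"
  shows "real_distribution (tilt h L)"
proof -
  interpret real_distribution L by fact
  note p = integral_exp_pos[OF L]
  let ?Z = "LINT y|L. exp (h * y)"
  have "emeasure (tilt h L) (space (tilt h L)) = (\<integral>\<^sup>+y. ennreal (exp (h * y) / ?Z) \<partial>L)"
    unfolding tilt_def by (subst emeasure_density) (auto simp: space_density)
  also have "\<dots> = ennreal (LINT y|L. exp (h * y) / ?Z)"
    using p L(2) by (intro nn_integral_eq_integral) auto
  also have "\<dots> = 1" using p by simp
  finally have "prob_space (tilt h L)" by (rule prob_spaceI)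
  then show ?thesis unfolding real_distribution_def real_distribution_axioms_def by (simp add: tilt_def)
qed

lemma (in prob_space) char_tilt_sum:
  fixes \<zeta> :: "'i \<Rightarrow> 'a \<Rightarrow> real"
  assumes I: "finite I" "card I = n" "n > 0" and ind: "indep_vars (\<lambda>_. borel) \<zeta> I"
    and id: "\<And>i. i \<in> I \<Longrightarrow> distr M borel (\<zeta> i) = L"
    and int: "integrable L (\<lambda>y. exp (h * y))"
  defines "G \<equiv> \<lambda>\<omega>. (\<Sum>i\<in>I. \<zeta> i \<omega>) / sqrt n"
  shows "integrable (distr M borel G) (\<lambda>y. exp (h * sqrt n * y))"
    and "(LINT y|distr M borel G. exp (h * sqrt n * y)) = (LINT y|L. exp (h * y)) ^ n"
    and "char (tilt (h * sqrt n) (distr M borel G)) s = char (tilt h L) (s / sqrt n) ^ n"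
proof -
  have rv: "random_variable borel (\<zeta> i)" if "i \<in> I" for i using ind that unfolding indep_vars_def by auto
  have rvG[measurable]: "random_variable borel G" unfolding G_def using rv by (intro borel_measurable_divide borel_measurable_sum) auto
  interpret G: real_distribution "distr M borel G" by (rule real_distribution_distr) simp
  obtain i0 where i0: "i0 \<in> I" using I by fastforce
  have rL: "real_distribution L" using id[OF i0] real_distribution_distr[OF rv[OF i0]] by simp
  interpret L: real_distribution L by fact
  have n0: "sqrt n > 0" using I by simp
  have int1: "integrable M (\<lambda>\<omega>. exp (h * \<zeta> i \<omega>))" if "i \<in> I" for i
    using int rv[OF that] unfolding id[OF that, symmetric] by (subst (asm) integrable_distr_eq) auto
  have E1: "(LINT \<omega>|M. exp (h * \<zeta> i \<omega>)) = (LINT y|L. exp (h * y))" if "i \<in> I" for i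
    using rv[OF that] unfolding id[OF that, symmetric] by (subst integral_distr) auto
  have ind1: "indep_vars (\<lambda>_. borel) (\<lambda>i \<omega>. exp (h * \<zeta> i \<omega>)) I"
    by (rule indep_vars_compose2[OF ind]) measurable
  have eG: "exp (h * sqrt n * G \<omega>) = (\<Prod>i\<in>I. exp (h * \<zeta> i \<omega>))" for \<omega>
  proof -
    have "h * sqrt n * G \<omega> = (\<Sum>i\<in>I. h * \<zeta> i \<omega>)" unfolding G_def using n0 by (simp flip: sum_distrib_left)
    then show ?thesis using I by (simp add: exp_sum)
  qed
  have intG: "integrable M (\<lambda>\<omega>. exp (h * sqrt n * G \<omega>))"
    unfolding eG by (rule indep_vars_integrable[OF I(1) ind1 int1])
  then show intG': "integrable (distr M borel G) (\<lambda>y. exp (h * sqrt n * y))"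
    by (subst integrable_distr_eq) auto
  have "(LINT y|distr M borel G. exp (h * sqrt n * y)) = (LINT \<omega>|M. exp (h * sqrt n * G \<omega>))"
    by (subst integral_distr) auto
  also have "\<dots> = (\<Prod>i\<in>I. (LINT \<omega>|M. exp (h * \<zeta> i \<omega>)))" unfolding eG by (rule indep_vars_lebesgue_integral[OF I(1) ind1 int1])
  also have "\<dots> = (LINT y|L. exp (h * y)) ^ n" using E1 I by simp
  finally show ZG: "(LINT y|distr M borel G. exp (h * sqrt n * y)) = (LINT y|L. exp (h * y)) ^ n" .
  define f where "f = (\<lambda>y::real. exp (h * y) *\<^sub>R iexp (s / sqrt n * y))"
  have f_meas[measurable]: "f \<in> borel_measurable borel" unfolding f_def by measurable
  have nf: "cmod (f y) = exp (h * y)" for y unfolding f_def by (simp del: of_real_mult of_real_divide)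
  have ind2: "indep_vars (\<lambda>_. borel) (\<lambda>i \<omega>. f (\<zeta> i \<omega>)) I"
    by (rule indep_vars_compose2[OF ind]) measurable
  have int2: "integrable M (\<lambda>\<omega>. f (\<zeta> i \<omega>))" if "i \<in> I" for i
    using int1[OF that] by (rule Bochner_Integration.integrable_bound) (use rv[OF that] nf in auto)
  have E2: "(LINT \<omega>|M. f (\<zeta> i \<omega>)) = (LINT y|L. f y)" if "i \<in> I" for i
    using rv[OF that] unfolding id[OF that, symmetric] by (subst integral_distr) auto
  have eG2: "exp (h * sqrt n * G \<omega>) *\<^sub>R iexp (s * G \<omega>) = (\<Prod>i\<in>I. f (\<zeta> i \<omega>))" for \<omega>
  proof -
    have "iexp (s * G \<omega>) = exp (\<Sum>i\<in>I. \<i> * complex_of_real (s / sqrt n * \<zeta> i \<omega>))"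
      unfolding G_def by (intro arg_cong[where f=exp]) (simp add: sum_distrib_left sum_divide_distrib)
    also have "\<dots> = (\<Prod>i\<in>I. iexp (s / sqrt n * \<zeta> i \<omega>))" using I by (simp add: exp_sum)
    finally show ?thesis unfolding eG f_def by (simp add: scaleR_conv_of_real prod.distrib)
  qed
  have "char (tilt (h * sqrt n) (distr M borel G)) s
     = (LINT y|distr M borel G. exp (h * sqrt n * y) *\<^sub>R iexp (s * y)) /\<^sub>R (LINT y|L. exp (h * y)) ^ n"
    unfolding char_def ZG[symmetric] by (rule integral_tilt(1)[OF G.real_distribution_axioms intG']) measurable
  also have "(LINT y|distr M borel G. exp (h * sqrt n * y) *\<^sub>R iexp (s * y)) = (LINT \<omega>|M. exp (h * sqrt n * G \<omega>) *\<^sub>R iexp (s * G \<omega>))"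
    by (subst integral_distr) auto
  also have "\<dots> = (\<Prod>i\<in>I. (LINT \<omega>|M. f (\<zeta> i \<omega>)))" unfolding eG2 by (rule indep_vars_lebesgue_integral[OF I(1) ind2 int2])
  also have "\<dots> = (LINT y|L. f y) ^ n" using E2 I by simp
  also have "(LINT y|L. f y) ^ n /\<^sub>R (LINT y|L. exp (h * y)) ^ n = ((LINT y|L. f y) /\<^sub>R (LINT y|L. exp (h * y))) ^ n"
    by (simp add: scaleR_conv_of_real power_mult_distrib power_inverse)
  also have "(LINT y|L. f y) /\<^sub>R (LINT y|L. exp (h * y)) = char (tilt h L) (s / sqrt n)"
    unfolding char_def f_def by (rule integral_tilt(1)[OF rL int, symmetric]) measurable
  finally show "char (tilt (h * sqrt n) (distr M borel G)) s = char (tilt h L) (s / sqrt n) ^ n" .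
qed

lemma laplace_half_line_eq:
  assumes L: "real_distribution L" and x: "x > 0"
  shows "(LINT g|L. exp (- (x * g)) * indicator {0<..} g)
     = (LINT v|density lborel (exponential_density x). measure L {0<..v})"
proof -
  interpret L: real_distribution L by fact
  let ?E = "density lborel (exponential_density x)"
  interpret E: prob_space ?E by (rule prob_space_exponential_density[OF x])
  interpret P: pair_prob_space L ?E ..
  let ?Q = "{q. 0 < fst q \<and> fst q \<le> snd q}"
  have Q: "?Q \<in> sets (L \<Otimes>\<^sub>M ?E)"
  proof -
    have "{q\<in>space (L \<Otimes>\<^sub>M ?E). 0 < fst q \<and> fst q \<le> snd q} \<in> sets (L \<Otimes>\<^sub>M ?E)" by measurable
    then show ?thesis by (simp add: space_pair_measure)
  qed
  have E1: "measure ?E {g..} = exp (- (x * g))" if "g > 0" for g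
  proof -
    have "distributed ?E lborel (\<lambda>y. y) (exponential_density x)"
      unfolding distributed_def by (auto simp: exponential_density_def distr_id2)
    then have "measure ?E {y\<in>space ?E. y \<le> g} = 1 - exp (- g * x)"
      using E.exponential_distributedD_le[of "\<lambda>y. y" x g] that x by simp
    moreover have "measure ?E {y\<in>space ?E. g < y} = exp (- g * x)"
      using E.exponential_distributedD_gt[OF \<open>distributed ?E lborel (\<lambda>y. y) (exponential_density x)\<close>, of g] that x by simp
    moreover have "measure ?E {g..} = measure ?E {g<..}"
    proof -
      have "measure ?E {g} = 0" by (simp add: measure_def emeasure_density nn_integral_null_set)
      moreover have "{g..} = {g} \<union> {g<..}" by auto
      ultimately show ?thesis using measure_Un_le[of "{g}" ?E "{g<..}"] E.finite_measure_mono[of "{g<..}" "{g..}"]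
        by (smt (verit) sets_density sets_lborel borel_closed borel_open closed_singleton open_greaterThan closed_atLeast subset_Un_eq sup_ge2)
    qed
    ultimately show ?thesis by (simp add: greaterThan_def mult.commute)
  qed
  have "ennreal (LINT g|L. exp (- (x * g)) * indicator {0<..} g) = (\<integral>\<^sup>+g. ennreal (exp (- (x * g)) * indicator {0<..} g) \<partial>L)"
    by (intro nn_integral_eq_integral[symmetric] L.integrable_const_bound[where B=1]) (use x in \<open>auto simp: indicator_def\<close>)
  also have "\<dots> = (\<integral>\<^sup>+g. emeasure ?E (Pair g -` ?Q) \<partial>L)"
  proof (intro nn_integral_cong)
    fix g :: real
    have "Pair g -` ?Q = (if 0 < g then {g..} else {})" by auto
    then show "ennreal (exp (- (x * g)) * indicator {0<..} g) = emeasure ?E (Pair g -` ?Q)"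
      using E1[of g] by (simp add: E.emeasure_eq_measure)
  qed
  also have "\<dots> = emeasure (L \<Otimes>\<^sub>M ?E) ?Q" by (rule E.emeasure_pair_measure_alt[OF Q, symmetric])
  also have "\<dots> = (\<integral>\<^sup>+v. emeasure L ((\<lambda>g. (g, v)) -` ?Q) \<partial>?E)" by (rule P.emeasure_pair_measure_alt2[OF Q])
  also have "\<dots> = (\<integral>\<^sup>+v. ennreal (measure L {0<..v}) \<partial>?E)"
    by (intro nn_integral_cong) (auto simp: L.emeasure_eq_measure intro!: arg_cong[where f="measure L"])
  also have "\<dots> = ennreal (LINT v|?E. measure L {0<..v})"
  proof (intro nn_integral_eq_integral E.integrable_const_bound[where B=1])
    have "(\<lambda>v. cdf L v - cdf L 0) \<in> borel_measurable borel"
      by (intro borel_measurable_diff borel_measurable_const borel_measurable_mono monoI L.cdf_nondecreasing)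
    moreover have "measure L {0<..v} = max 0 (cdf L v - cdf L 0)" for v
    proof (cases "0 < v")
      case True then show ?thesis using L.cdf_diff_eq[of 0 v] by (simp add: max_def)
    next
      case False then show ?thesis using L.cdf_nondecreasing[of v 0] by auto
    qed
    ultimately show "(\<lambda>v. measure L {0<..v}) \<in> borel_measurable ?E" by simp
  qed auto
  finally show ?thesis
    by (subst (asm) ennreal_inj) (auto intro!: Bochner_Integration.integral_nonneg)
qed

lemma laplace_half_line_diff_le:
  assumes L: "real_distribution L" and L': "real_distribution L'" and x: "x \<ge> 0"
    and D: "\<And>z. \<bar>cdf L z - cdf L' z\<bar> \<le> D"
  shows "\<bar>(LINT g|L. exp (- (x * g)) * indicator {0<..} g) - (LINT g|L'. exp (- (x * g)) * indicator {0<..} g)\<bar> \<le> 2 * D"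
proof -
  interpret L: real_distribution L by fact
  interpret L': real_distribution L' by fact
  have D0: "0 \<le> D" using D[of 0] by linarith
  show ?thesis
  proof (cases "x = 0")
    case True
    have "{0<..} = space L - {..0}" "{0<..} = space L' - {..0}" by auto
    then have "measure L {0<..} = 1 - cdf L 0" "measure L' {0<..} = 1 - cdf L' 0"
      unfolding cdf_def using L.prob_compl[of "{..0}"] L'.prob_compl[of "{..0}"] by simp_all
    then show ?thesis using True D[of 0] D0 by simp
  next
    case False
    then have x: "x > 0" using x by simp
    let ?E = "density lborel (exponential_density x)"
    interpret E: prob_space ?E by (rule prob_space_exponential_density[OF x])
    have int: "integrable ?E (\<lambda>v. measure K {0<..v})" if "real_distribution K" for K
    proof (rule E.integrable_const_bound[where B=1])
      interpret K: real_distribution K by fact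
      have "(\<lambda>v. cdf K v - cdf K 0) \<in> borel_measurable borel"
        by (intro borel_measurable_diff borel_measurable_const borel_measurable_mono monoI K.cdf_nondecreasing)
      moreover have "measure K {0<..v} = max 0 (cdf K v - cdf K 0)" for v
      proof (cases "0 < v")
        case True then show ?thesis using K.cdf_diff_eq[of 0 v] by (simp add: max_def)
      next
        case False then show ?thesis using K.cdf_nondecreasing[of v 0] by auto
      qed
      ultimately show "(\<lambda>v. measure K {0<..v}) \<in> borel_measurable ?E" by simp
      show "AE v in ?E. norm (measure K {0<..v}) \<le> 1" by auto
    qed
    have pt: "\<bar>measure L {0<..v} - measure L' {0<..v}\<bar> \<le> 2 * D" for v
      using D[of v] D[of 0] L.cdf_diff_eq[of 0 v] L'.cdf_diff_eq[of 0 v] D0 by (cases "0 < v") auto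
    have "(LINT v|?E. measure L {0<..v}) - (LINT v|?E. measure L' {0<..v}) = (LINT v|?E. measure L {0<..v} - measure L' {0<..v})"
      using int[OF L] int[OF L'] by simp
    also have "\<bar>\<dots>\<bar> \<le> (LINT v|?E. \<bar>measure L {0<..v} - measure L' {0<..v}\<bar>)" by (rule integral_abs_bound)
    also have "\<dots> \<le> (LINT v|?E. 2 * D)"
      using int[OF L] int[OF L'] pt by (intro integral_mono) auto
    also have "\<dots> = 2 * D" using E.prob_space by simp
    finally show ?thesis unfolding laplace_half_line_eq[OF L x] laplace_half_line_eq[OF L' x] .
  qed
qed

lemma std_normal_tail_tilt:
  "measure std_normal_distribution {x<..} = exp (- x\<^sup>2 / 2) * (LINT z|std_normal_distribution. exp (- (x * z)) * indicator {0<..} z)"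
proof -
  interpret N: real_distribution std_normal_distribution by (rule real_dist_normal_dist)
  have "measure std_normal_distribution {x<..} = (LINT z|std_normal_distribution. indicator {x<..} z)" by simp
  also have "\<dots> = (LINT z|lborel. std_normal_density z * indicator {x<..} z)"
    by (subst integral_density) auto
  also have "\<dots> = (LINT z|lborel. std_normal_density (x + z) * indicator {x<..} (x + z))"
    using lborel_integral_real_affine[of 1 "\<lambda>z. std_normal_density z * indicator {x<..} z" x] by simp
  also have "\<dots> = (LINT z|lborel. exp (- x\<^sup>2 / 2) * (std_normal_density z * (exp (- (x * z)) * indicator {0<..} z)))"
    by (intro Bochner_Integration.integral_cong)
       (auto simp: std_normal_density_def indicator_def power2_sum field_simps simp flip: exp_add)
  also have "\<dots> = exp (- x\<^sup>2 / 2) * (LINT z|std_normal_distribution. exp (- (x * z)) * indicator {0<..} z)"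
    by (subst integral_density) auto
  finally show ?thesis .
qed

lemma std_normal_laplace_ge:
  assumes x: "x \<ge> 0"
  shows "1 / (27 * (1 + x)) \<le> (LINT z|std_normal_distribution. exp (- (x * z)) * indicator {0<..} z)"
proof -
  interpret N: real_distribution std_normal_distribution by (rule real_dist_normal_dist)
  define c where "c = 1 / (1 + x)"
  have c: "0 < c" "c \<le> 1" "x * c \<le> 1" using x by (auto simp: c_def field_simps)
  have i: "integrable lborel (\<lambda>z. std_normal_density z * (exp (- (x * z)) * indicator {0<..} z))"
  proof (rule Bochner_Integration.integrable_bound[of _ std_normal_density])
    show "AE z in lborel. norm (std_normal_density z * (exp (- (x * z)) * indicat_real {0<..} z)) \<le> norm (std_normal_density z)"
      using x by (auto simp: abs_mult indicator_def intro!: mult_left_le)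
  qed auto
  have "1 / (27 * (1 + x)) = (LINT z|lborel. 1/27 * indicator {0<..c} z)"
    using c by (simp add: c_def)
  also have "\<dots> \<le> (LINT z|lborel. std_normal_density z * (exp (- (x * z)) * indicator {0<..} z))"
  proof (intro integral_mono i)
    show "integrable lborel (\<lambda>z. 1/27 * indicat_real {0<..c} z)"
      using c by (intro integrable_mult_right integrable_real_indicator) auto
    fix z :: real
    show "1/27 * indicat_real {0<..c} z \<le> std_normal_density z * (exp (- (x * z)) * indicator {0<..} z)"
    proof (cases "z \<in> {0<..c}")
      case True
      have "x * z \<le> x * c" using True x by (intro mult_left_mono) auto
      then have xz: "x * z \<le> 1" using c by linarith
      have "z\<^sup>2 \<le> 1" using True c by (simp add: abs_square_le_1)
      then have "exp (- 2) \<le> exp (- z\<^sup>2 / 2 + - (x * z))" using xz by simp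
      moreover have "1/9 \<le> exp (- (2::real))"
      proof -
        have "exp (2::real) = exp 1 ^ 2" by (simp flip: exp_of_nat_mult)
        also have "\<dots> \<le> 3 ^ 2" using exp_le by (intro power_mono) auto
        finally show ?thesis by (simp add: exp_minus field_simps)
      qed
      ultimately have 1: "1/9 \<le> exp (- z\<^sup>2 / 2) * exp (- (x * z))" unfolding exp_add[symmetric] by linarith
      have "sqrt (2 * pi) \<le> 3" using pi_less_4 by (intro real_le_lsqrt) auto
      then have "1/3 \<le> 1 / sqrt (2 * pi)" using pi_gt_zero by (intro divide_left_mono) auto
      then have "(1/3) * (1/9) \<le> 1 / sqrt (2 * pi) * (exp (- z\<^sup>2 / 2) * exp (- (x * z)))" using 1 by (intro mult_mono) auto
      then show ?thesis using True by (simp add: std_normal_density_def)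
    next
      case False
      then have "indicat_real {0<..c} z = 0" by simp
      moreover have "0 \<le> std_normal_density z * (exp (- (x * z)) * indicator {0<..} z)" by simp
      ultimately show ?thesis by linarith
    qed
  qed
  also have "\<dots> = (LINT z|std_normal_distribution. exp (- (x * z)) * indicator {0<..} z)"
    by (subst integral_density) auto
  finally show ?thesis .
qed

lemma exp_taylor_remainders:
  assumes "\<bar>w\<bar> \<le> (1::real)"
  shows "\<bar>exp w - 1\<bar> \<le> 3 * \<bar>w\<bar>" "\<bar>exp w - 1 - w\<bar> \<le> 2 * w\<^sup>2" "\<bar>exp w - 1 - w - w\<^sup>2 / 2\<bar> \<le> \<bar>w\<bar> ^ 3 / 2" "exp w \<le> 3"
proof -
  have e3: "exp t \<le> 3" if "\<bar>t\<bar> \<le> 1" for t :: real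
  proof -
    have "exp t \<le> exp 1" using that by simp
    then show ?thesis using exp_le by linarith
  qed
  show "exp w \<le> 3" using e3 assms .
  have R: "\<bar>exp w - (\<Sum>m<n. w ^ m / fact m)\<bar> \<le> 3 / fact n * \<bar>w\<bar> ^ n" for n
  proof -
    obtain t where t: "\<bar>t\<bar> \<le> \<bar>w\<bar>" "exp w = (\<Sum>m<n. (w ^ m) / fact m) + (exp t / fact n) * w ^ n"
      using Maclaurin_exp_le by blast
    have "\<bar>exp w - (\<Sum>m<n. w ^ m / fact m)\<bar> = exp t / fact n * \<bar>w\<bar> ^ n"
      using t(2) by (simp add: abs_mult power_abs)
    also have "\<dots> \<le> 3 / fact n * \<bar>w\<bar> ^ n" using e3[of t] t(1) assms by (intro mult_right_mono divide_right_mono) auto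
    finally show ?thesis .
  qed
  show "\<bar>exp w - 1\<bar> \<le> 3 * \<bar>w\<bar>" using R[of 1] by simp
  have "\<bar>exp w - 1 - w\<bar> \<le> 3 / 2 * w\<^sup>2" using R[of 2] by (simp add: numeral_2_eq_2 diff_diff_add)
  then show "\<bar>exp w - 1 - w\<bar> \<le> 2 * w\<^sup>2" using zero_le_power2[of w] by linarith
  show "\<bar>exp w - 1 - w - w\<^sup>2 / 2\<bar> \<le> \<bar>w\<bar> ^ 3 / 2" using R[of 3]
    by (simp add: numeral_3_eq_3 numeral_2_eq_2 diff_diff_add add.assoc)
qed

context
  fixes L :: "real measure" and h b \<kappa>1 \<kappa>2 \<beta> :: real
  assumes L: "real_distribution L" and bnd: "AE y in L. \<bar>y\<bar> \<le> b" and h: "0 \<le> h" "h \<le> 1" "h * b \<le> 1"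
    and k1: "\<bar>LINT y|L. y\<bar> \<le> \<kappa>1" "h * \<kappa>1 \<le> 1/2" and k2: "\<bar>(LINT y|L. y\<^sup>2) - 1\<bar> \<le> \<kappa>2" "\<kappa>2 \<le> 1"
    and \<beta>: "(LINT y|L. \<bar>y\<bar> ^ 3) \<le> \<beta>" "1/2 \<le> \<beta>"
begin

interpretation L: real_distribution L by (rule L)

lemma prob_UNIV: "measure L UNIV = 1"
  using L.prob_space by simp

lemma AE_hy: "AE y in L. \<bar>h * y\<bar> \<le> 1"
  using bnd
proof eventually_elim
  case (elim y)
  have "\<bar>h * y\<bar> = h * \<bar>y\<bar>" using h by (simp add: abs_mult)
  also have "\<dots> \<le> h * b" using elim h by (intro mult_left_mono) auto
  finally show ?case using h by linarith
qed

lemma int_bounded: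
  fixes f g :: "real \<Rightarrow> real"
  assumes [measurable]: "f \<in> borel_measurable borel" and "\<And>y. \<bar>f y\<bar> \<le> g \<bar>y\<bar>" "\<And>y. 0 \<le> y \<Longrightarrow> y \<le> b \<Longrightarrow> g y \<le> g b"
  shows "integrable L f"
proof (rule L.integrable_const_bound[where B="g b"])
  show "AE x in L. norm (f x) \<le> g b" using bnd
  proof eventually_elim
    case (elim y)
    then show ?case using assms(2)[of y] assms(3)[of "\<bar>y\<bar>"] by simp
  qed
qed simp

lemma int_simple: "integrable L (\<lambda>y. y)" "integrable L (\<lambda>y. y\<^sup>2)" "integrable L (\<lambda>y. \<bar>y\<bar> ^ 3)"
proof -
  show "integrable L (\<lambda>y. y)" by (rule int_bounded[where g="\<lambda>y. y"]) auto
  show "integrable L (\<lambda>y. y\<^sup>2)" by (rule int_bounded[where g="\<lambda>y. y\<^sup>2"]) (auto intro: power_mono)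
  show "integrable L (\<lambda>y. \<bar>y\<bar> ^ 3)" by (rule int_bounded[where g="\<lambda>y. y ^ 3"]) (auto intro: power_mono)
qed

lemma int_exp:
  fixes f :: "real \<Rightarrow> real"
  assumes f[measurable]: "f \<in> borel_measurable borel" and i: "integrable L f"
  shows "integrable L (\<lambda>y. exp (h * y) * f y)"
proof (rule Bochner_Integration.integrable_bound[of _ "\<lambda>y. 3 * f y"])
  show "AE y in L. norm (exp (h * y) * f y) \<le> norm (3 * f y)" using AE_hy
    by eventually_elim (auto simp: abs_mult intro!: mult_right_mono exp_taylor_remainders(4))
qed (use i in auto)

lemma int_exp0: "integrable L (\<lambda>y. exp (h * y))"
  using int_exp[of "\<lambda>_. 1"] by simp

abbreviation "M0 \<equiv> LINT y|L. exp (h * y)"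

lemma le_AE:
  fixes f g :: "real \<Rightarrow> real"
  assumes "f \<in> borel_measurable borel" "integrable L f" "integrable L g" "AE y in L. \<bar>f y\<bar> \<le> g y"
  shows "\<bar>LINT y|L. f y\<bar> \<le> (LINT y|L. g y)"
proof -
  have "\<bar>LINT y|L. f y\<bar> \<le> (LINT y|L. \<bar>f y\<bar>)" by (rule integral_abs_bound)
  also have "\<dots> \<le> (LINT y|L. g y)" using assms by (intro integral_mono_AE) auto
  finally show ?thesis .
qed

lemma M0_approx: "\<bar>M0 - 1 - h\<^sup>2 / 2\<bar> \<le> h * \<kappa>1 + h\<^sup>2 * \<kappa>2 / 2 + h ^ 3 * \<beta> / 2"
proof -
  have "\<bar>LINT y|L. exp (h * y) - (1 + h * y + h\<^sup>2 / 2 * y\<^sup>2)\<bar> \<le> (LINT y|L. (h ^ 3 / 2) * \<bar>y\<bar> ^ 3)"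
  proof (rule le_AE)
    show "AE y in L. \<bar>exp (h * y) - (1 + h * y + h\<^sup>2 / 2 * y\<^sup>2)\<bar> \<le> h ^ 3 / 2 * \<bar>y\<bar> ^ 3" using AE_hy
    proof eventually_elim
      case (elim y)
      have e1: "exp (h * y) - (1 + h * y + h\<^sup>2 / 2 * y\<^sup>2) = exp (h * y) - 1 - h * y - (h * y)\<^sup>2 / 2" by (simp add: power_mult_distrib)
      have e2: "\<bar>h * y\<bar> ^ 3 / 2 = h ^ 3 / 2 * \<bar>y\<bar> ^ 3" using h by (simp add: power_mult_distrib abs_mult)
      show ?case using exp_taylor_remainders(3)[OF elim] unfolding e1 e2 .
    qed
    show "integrable L (\<lambda>y. exp (h * y) - (1 + h * y + h\<^sup>2 / 2 * y\<^sup>2))"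
      by (intro Bochner_Integration.integrable_diff Bochner_Integration.integrable_add integrable_mult_right int_exp0 int_simple L.integrable_const)
    show "integrable L (\<lambda>y. (h ^ 3 / 2) * \<bar>y\<bar> ^ 3)" by (intro integrable_mult_right int_simple)
  qed measurable
  also have "(LINT y|L. (h ^ 3 / 2) * \<bar>y\<bar> ^ 3) = h ^ 3 / 2 * (LINT y|L. \<bar>y\<bar> ^ 3)" by (rule integral_mult_right_zero)
  also have "\<dots> \<le> h ^ 3 / 2 * \<beta>" by (rule mult_left_mono[OF \<beta>(1)]) (use h(1) in simp)
  also have "(LINT y|L. exp (h * y) - (1 + h * y + h\<^sup>2 / 2 * y\<^sup>2)) = M0 - (1 + h * (LINT y|L. y) + h\<^sup>2 / 2 * (LINT y|L. y\<^sup>2))"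
  proof -
    have "(LINT y|L. 1 + h * y + h\<^sup>2 / 2 * y\<^sup>2) = 1 + h * (LINT y|L. y) + h\<^sup>2 / 2 * (LINT y|L. y\<^sup>2)"
      by (subst Bochner_Integration.integral_add) (simp_all add: prob_UNIV int_simple(1,2))
    moreover have "(LINT y|L. exp (h * y) - (1 + h * y + h\<^sup>2 / 2 * y\<^sup>2)) = M0 - (LINT y|L. 1 + h * y + h\<^sup>2 / 2 * y\<^sup>2)"
      by (intro Bochner_Integration.integral_diff Bochner_Integration.integrable_add integrable_mult_right int_exp0 int_simple L.integrable_const)
    ultimately show ?thesis by (simp only:)
  qed
  finally have 1: "\<bar>M0 - (1 + h * (LINT y|L. y) + h\<^sup>2 / 2 * (LINT y|L. y\<^sup>2))\<bar> \<le> h ^ 3 / 2 * \<beta>" .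
  have 2: "\<bar>h * (LINT y|L. y)\<bar> \<le> h * \<kappa>1" unfolding abs_mult using k1(1) h by (intro mult_mono) auto
  have "\<bar>h\<^sup>2 / 2 * ((LINT y|L. y\<^sup>2) - 1)\<bar> \<le> h\<^sup>2 / 2 * \<kappa>2" unfolding abs_mult using k2 by (intro mult_mono) auto
  then have 3: "\<bar>h\<^sup>2 / 2 * (LINT y|L. y\<^sup>2) - h\<^sup>2 / 2\<bar> \<le> h\<^sup>2 / 2 * \<kappa>2" unfolding right_diff_distrib by (simp only: mult_1_right)
  show ?thesis using abs_le_D1[OF 1] abs_le_D1[OF 2] abs_le_D1[OF 3] abs_le_D2[OF 1] abs_le_D2[OF 2] abs_le_D2[OF 3]
    by (intro abs_leI) linarith+
qed

lemma h_powers: "h ^ 3 * \<beta> \<le> h\<^sup>2 * \<beta>" "h\<^sup>2 * \<beta> \<le> h * \<beta>" "h ^ 3 \<le> h\<^sup>2" "h\<^sup>2 \<le> h" "h\<^sup>2 \<le> 2 * (h\<^sup>2 * \<beta>)" "h \<le> 2 * (h * \<beta>)" "0 \<le> h\<^sup>2" "0 \<le> \<kappa>1" "0 \<le> \<kappa>2"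
    "h ^ 4 * \<beta> \<le> h\<^sup>2 * \<beta>" "h ^ 3 \<le> 1" "h\<^sup>2 * \<kappa>1 \<le> \<kappa>1" "h\<^sup>2 * \<kappa>2 \<le> \<kappa>2"
proof -
  show p: "h ^ 3 \<le> h\<^sup>2" "h\<^sup>2 \<le> h" using h power_decreasing[of 2 3 h] power_decreasing[of 1 2 h] by auto
  have p4: "h ^ 4 \<le> h\<^sup>2" using h power_decreasing[of 2 4 h] by auto
  show "h ^ 3 * \<beta> \<le> h\<^sup>2 * \<beta>" "h\<^sup>2 * \<beta> \<le> h * \<beta>" "h ^ 4 * \<beta> \<le> h\<^sup>2 * \<beta>" using p p4 \<beta> by (auto intro: mult_right_mono)
  show "h\<^sup>2 \<le> 2 * (h\<^sup>2 * \<beta>)" using \<beta> mult_left_mono[of "1/2" \<beta> "h\<^sup>2"] by simp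
  show "h \<le> 2 * (h * \<beta>)" using \<beta> h mult_left_mono[of "1/2" \<beta> "h"] by simp
  show k: "0 \<le> \<kappa>1" "0 \<le> \<kappa>2" using k1 k2 by linarith+
  show "0 \<le> h\<^sup>2" by simp
  show "h ^ 3 \<le> 1" using h by (simp add: power_le_one)
  have "h\<^sup>2 \<le> 1" using h by (simp add: power_le_one)
  then show "h\<^sup>2 * \<kappa>1 \<le> \<kappa>1" "h\<^sup>2 * \<kappa>2 \<le> \<kappa>2" using k mult_right_mono[of "h\<^sup>2" 1] by auto
qed

lemma M0_minus1: "\<bar>M0 - 1\<bar> \<le> h * \<kappa>1 + h\<^sup>2 + h ^ 3 * \<beta> / 2"
proof -
  have "h\<^sup>2 * \<kappa>2 \<le> h\<^sup>2 * 1" using k2 by (intro mult_left_mono) auto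
  then show ?thesis using M0_approx h_powers(7) by linarith
qed

lemma M0_ge: "1/2 \<le> M0"
proof -
  have "(LINT y|L. 1 + h * y) \<le> M0"
    by (intro integral_mono Bochner_Integration.integrable_add integrable_mult_right int_exp0 int_simple L.integrable_const exp_ge_add_one_self)
  moreover have "(LINT y|L. 1 + h * y) = 1 + h * (LINT y|L. y)" by (simp add: int_simple(1) prob_UNIV)
  ultimately have "1 + h * (LINT y|L. y) \<le> M0" by simp
  moreover have "\<bar>h * (LINT y|L. y)\<bar> \<le> h * \<kappa>1" unfolding abs_mult using k1(1) h by (intro mult_mono) auto
  ultimately show ?thesis using k1 by linarith
qed

lemma div_M0_le: "\<bar>a\<bar> \<le> c \<Longrightarrow> \<bar>a / M0\<bar> \<le> 2 * c"
proof -
  assume a: "\<bar>a\<bar> \<le> c"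
  have "\<bar>a / M0\<bar> = \<bar>a\<bar> / M0" using M0_ge by (simp add: abs_divide)
  also have "\<dots> \<le> c / (1/2)" using a M0_ge by (intro frac_le) auto
  finally show ?thesis by simp
qed

lemma M1_bound: "\<bar>(LINT y|L. exp (h * y) * y) / M0 - h\<bar> \<le> 4 * \<kappa>1 + 2 * h * \<kappa>2 + 9 * h\<^sup>2 * \<beta>"
proof -
  have i: "integrable L (\<lambda>y. exp (h * y) * y)" by (rule int_exp[OF _ int_simple(1)]) simp
  have "\<bar>LINT y|L. exp (h * y) * y - (y + h * y\<^sup>2)\<bar> \<le> (LINT y|L. (2 * h\<^sup>2) * \<bar>y\<bar> ^ 3)"
  proof (rule le_AE)
    show "AE y in L. \<bar>exp (h * y) * y - (y + h * y\<^sup>2)\<bar> \<le> 2 * h\<^sup>2 * \<bar>y\<bar> ^ 3" using AE_hy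
    proof eventually_elim
      case (elim y)
      have "exp (h * y) * y - (y + h * y\<^sup>2) = (exp (h * y) - 1 - h * y) * y" by (simp add: left_diff_distrib power2_eq_square)
      also have "\<bar>\<dots>\<bar> \<le> 2 * (h * y)\<^sup>2 * \<bar>y\<bar>" unfolding abs_mult by (intro mult_right_mono exp_taylor_remainders(2)[OF elim]) auto
      also have "\<dots> = 2 * h\<^sup>2 * \<bar>y\<bar> ^ 3"
      proof -
        have "\<bar>y\<bar> ^ 3 = y\<^sup>2 * \<bar>y\<bar>" by (simp add: power3_eq_cube power2_eq_square)
        then show ?thesis by (simp only: power_mult_distrib mult.assoc)
      qed
      finally show ?case .
    qed
    show "integrable L (\<lambda>y. exp (h * y) * y - (y + h * y\<^sup>2))"
      by (intro Bochner_Integration.integrable_diff Bochner_Integration.integrable_add integrable_mult_right i int_simple)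
    show "integrable L (\<lambda>y. 2 * h\<^sup>2 * \<bar>y\<bar> ^ 3)" by (intro integrable_mult_right int_simple)
  qed measurable
  also have "\<dots> = 2 * h\<^sup>2 * (LINT y|L. \<bar>y\<bar> ^ 3)" by (rule integral_mult_right_zero)
  also have "\<dots> \<le> 2 * h\<^sup>2 * \<beta>" by (rule mult_left_mono[OF \<beta>(1)]) simp
  also have "(LINT y|L. exp (h * y) * y - (y + h * y\<^sup>2)) = (LINT y|L. exp (h * y) * y) - ((LINT y|L. y) + h * (LINT y|L. y\<^sup>2))"
    by (simp add: i int_simple(1,2))
  finally have 1: "\<bar>(LINT y|L. exp (h * y) * y) - ((LINT y|L. y) + h * (LINT y|L. y\<^sup>2))\<bar> \<le> 2 * h\<^sup>2 * \<beta>" .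
  have "\<bar>h * ((LINT y|L. y\<^sup>2) - 1)\<bar> \<le> h * \<kappa>2" unfolding abs_mult using k2 h by (intro mult_mono) auto
  then have 2: "\<bar>h * (LINT y|L. y\<^sup>2) - h\<bar> \<le> h * \<kappa>2" by (simp add: right_diff_distrib)
  have "\<bar>h * (M0 - 1)\<bar> \<le> h * (h * \<kappa>1 + h\<^sup>2 + h ^ 3 * \<beta> / 2)" unfolding abs_mult using M0_minus1 h by (intro mult_mono) auto
  also have "\<dots> = h\<^sup>2 * \<kappa>1 + h ^ 3 + h ^ 4 * \<beta> / 2" by (simp add: distrib_left power2_eq_square power4_eq_xxxx power3_eq_cube)
  finally have 3: "\<bar>h * M0 - h\<bar> \<le> h\<^sup>2 * \<kappa>1 + h ^ 3 + h ^ 4 * \<beta> / 2" by (simp add: right_diff_distrib)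
  have "\<bar>(LINT y|L. exp (h * y) * y) - h * M0\<bar> \<le> 2 * \<kappa>1 + h * \<kappa>2 + 9/2 * (h\<^sup>2 * \<beta>)"
    using abs_le_D1[OF 1] abs_le_D1[OF 2] abs_le_D1[OF 3] abs_le_D1[OF k1(1)] abs_le_D2[OF 1] abs_le_D2[OF 2] abs_le_D2[OF 3] abs_le_D2[OF k1(1)]
      h_powers(3,5,10,12) by (intro abs_leI) linarith+
  note div = div_M0_le[OF this]
  have eq: "(a - c) / M0 = a / M0 - c'" if "c = c' * M0" for a c c'
    unfolding that using M0_ge by (simp add: diff_divide_distrib)
  have "2 * (2 * \<kappa>1 + h * \<kappa>2 + 9/2 * (h\<^sup>2 * \<beta>)) = 4 * \<kappa>1 + 2 * h * \<kappa>2 + 9 * h\<^sup>2 * \<beta>" by (simp add: algebra_simps)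
  then show ?thesis using div unfolding eq[of "h * M0" h, OF refl] by (simp only:)
qed

lemma M2_bound: "\<bar>(LINT y|L. exp (h * y) * y\<^sup>2) / M0 - 1\<bar> \<le> 2 * \<kappa>2 + 2 * h * \<kappa>1 + 11 * h * \<beta>"
proof -
  have i: "integrable L (\<lambda>y. exp (h * y) * y\<^sup>2)" by (rule int_exp[OF _ int_simple(2)]) simp
  have "\<bar>LINT y|L. exp (h * y) * y\<^sup>2 - y\<^sup>2\<bar> \<le> (LINT y|L. (3 * h) * \<bar>y\<bar> ^ 3)"
  proof (rule le_AE)
    show "AE y in L. \<bar>exp (h * y) * y\<^sup>2 - y\<^sup>2\<bar> \<le> 3 * h * \<bar>y\<bar> ^ 3" using AE_hy
    proof eventually_elim
      case (elim y)
      have "exp (h * y) * y\<^sup>2 - y\<^sup>2 = (exp (h * y) - 1) * y\<^sup>2" by (simp add: left_diff_distrib)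
      also have "\<bar>\<dots>\<bar> \<le> 3 * \<bar>h * y\<bar> * y\<^sup>2" unfolding abs_mult using exp_taylor_remainders(1)[OF elim] by (auto intro!: mult_right_mono simp: abs_mult)
      also have "\<dots> = 3 * h * \<bar>y\<bar> ^ 3"
      proof -
        have "\<bar>y\<bar> ^ 3 = \<bar>y\<bar> * y\<^sup>2" by (simp add: power3_eq_cube power2_eq_square)
        then show ?thesis using h by (simp only: abs_mult abs_of_nonneg mult.assoc)
      qed
      finally show ?case .
    qed
    show "integrable L (\<lambda>y. exp (h * y) * y\<^sup>2 - y\<^sup>2)"
      by (intro Bochner_Integration.integrable_diff i int_simple)
    show "integrable L (\<lambda>y. 3 * h * \<bar>y\<bar> ^ 3)" by (intro integrable_mult_right int_simple)
  qed measurable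
  also have "\<dots> = 3 * h * (LINT y|L. \<bar>y\<bar> ^ 3)" by (rule integral_mult_right_zero)
  also have "\<dots> \<le> 3 * h * \<beta>" by (rule mult_left_mono[OF \<beta>(1)]) (use h(1) in simp)
  also have "(LINT y|L. exp (h * y) * y\<^sup>2 - y\<^sup>2) = (LINT y|L. exp (h * y) * y\<^sup>2) - (LINT y|L. y\<^sup>2)"
    by (simp add: i int_simple(2))
  finally have 1: "\<bar>(LINT y|L. exp (h * y) * y\<^sup>2) - (LINT y|L. y\<^sup>2)\<bar> \<le> 3 * h * \<beta>" .
  have "\<bar>(LINT y|L. exp (h * y) * y\<^sup>2) - M0\<bar> \<le> \<kappa>2 + h * \<kappa>1 + 11/2 * (h * \<beta>)"
    using abs_le_D1[OF 1] abs_le_D1[OF M0_minus1] abs_le_D1[OF k2(1)] abs_le_D2[OF 1] abs_le_D2[OF M0_minus1] abs_le_D2[OF k2(1)]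
      h_powers(1,2,4,6) by (intro abs_leI) linarith+
  note div = div_M0_le[OF this]
  have eq: "(a - c) / M0 = a / M0 - c'" if "c = c' * M0" for a c c'
    unfolding that using M0_ge by (simp add: diff_divide_distrib)
  have "2 * (\<kappa>2 + h * \<kappa>1 + 11/2 * (h * \<beta>)) = 2 * \<kappa>2 + 2 * h * \<kappa>1 + 11 * h * \<beta>" by (simp add: algebra_simps)
  then show ?thesis using div unfolding eq[of M0 1, OF mult_1_left[symmetric]] by (simp only:)
qed

lemma M3_bound: "(LINT y|L. exp (h * y) * \<bar>y\<bar> ^ 3) / M0 \<le> 6 * \<beta>"
proof -
  have i: "integrable L (\<lambda>y. exp (h * y) * \<bar>y\<bar> ^ 3)" by (rule int_exp[OF _ int_simple(3)]) simp
  have "\<bar>LINT y|L. exp (h * y) * \<bar>y\<bar> ^ 3\<bar> \<le> (LINT y|L. 3 * \<bar>y\<bar> ^ 3)"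
  proof (rule le_AE)
    show "AE y in L. \<bar>exp (h * y) * \<bar>y\<bar> ^ 3\<bar> \<le> 3 * \<bar>y\<bar> ^ 3" using AE_hy
      by eventually_elim (auto simp: abs_mult intro!: mult_right_mono exp_taylor_remainders(4))
    show "integrable L (\<lambda>y. 3 * \<bar>y\<bar> ^ 3)" by (intro integrable_mult_right int_simple)
  qed (use i in auto)
  also have "\<dots> = 3 * (LINT y|L. \<bar>y\<bar> ^ 3)" by (rule integral_mult_right_zero)
  also have "\<dots> \<le> 3 * \<beta>" using \<beta>(1) by simp
  finally have "\<bar>LINT y|L. exp (h * y) * \<bar>y\<bar> ^ 3\<bar> \<le> 3 * \<beta>" .
  from div_M0_le[OF this] show ?thesis by simp
qed

lemma shifted_tilt_moments:
  defines "L' \<equiv> distr L borel (\<lambda>y. y - h)"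
  shows "real_distribution L'" "integrable L' (\<lambda>y. exp (h * y))" "(LINT y|L'. exp (h * y)) = M0 * exp (- h\<^sup>2)"
    and "integrable (tilt h L') (\<lambda>y. y)" "integrable (tilt h L') (\<lambda>y. y\<^sup>2)" "integrable (tilt h L') (\<lambda>y. \<bar>y\<bar> ^ 3)"
    and "\<bar>LINT y|tilt h L'. y\<bar> \<le> 4 * \<kappa>1 + 2 * h * \<kappa>2 + 9 * h\<^sup>2 * \<beta>"
    and "\<bar>(LINT y|tilt h L'. y\<^sup>2) - 1\<bar> \<le> 6 * \<kappa>2 + 10 * h * \<kappa>1 + 31 * h * \<beta>"
    and "(LINT y|tilt h L'. \<bar>y\<bar> ^ 3) \<le> 32 * \<beta>"
proof -
  show rL': "real_distribution L'" unfolding L'_def by (rule L.real_distribution_distr) simp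
  have e: "exp (h * (y - h)) = exp (h * y) * exp (- h\<^sup>2)" for y by (simp add: algebra_simps power2_eq_square flip: exp_add)
  show iL': "integrable L' (\<lambda>y. exp (h * y))" unfolding L'_def
    by (subst integrable_distr_eq) (auto simp: e int_exp0)
  show Z: "(LINT y|L'. exp (h * y)) = M0 * exp (- h\<^sup>2)" unfolding L'_def
    by (subst integral_distr) (auto simp: e)
  have I: "integrable (tilt h L') f \<longleftrightarrow> integrable L (\<lambda>y. exp (h * y) * f (y - h))"
    and E: "integral\<^sup>L (tilt h L') f = (LINT y|L. exp (h * y) * f (y - h)) / M0"
    if [measurable]: "f \<in> borel_measurable borel" for f :: "real \<Rightarrow> real"
  proof -
    have r: "exp (h * (y - h)) *\<^sub>R f (y - h) = exp (- h\<^sup>2) * (exp (h * y) * f (y - h))" for y unfolding e by simp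
    have "integrable (tilt h L') f \<longleftrightarrow> integrable L' (\<lambda>y. exp (h * y) *\<^sub>R f y)" by (rule integral_tilt(2)[OF rL' iL' that])
    also have "\<dots> \<longleftrightarrow> integrable L (\<lambda>y. exp (- h\<^sup>2) * (exp (h * y) * f (y - h)))" unfolding L'_def
      by (subst integrable_distr_eq) (auto simp: r simp del: real_scaleR_def)
    finally show "integrable (tilt h L') f \<longleftrightarrow> integrable L (\<lambda>y. exp (h * y) * f (y - h))" by simp
    have "(LINT y|L'. exp (h * y) *\<^sub>R f y) = (LINT y|L. exp (- h\<^sup>2) * (exp (h * y) * f (y - h)))"
      unfolding L'_def by (subst integral_distr) (auto simp: r simp del: real_scaleR_def)
    also have "\<dots> = exp (- h\<^sup>2) * (LINT y|L. exp (h * y) * f (y - h))" by (rule integral_mult_right_zero)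
    finally show "integral\<^sup>L (tilt h L') f = (LINT y|L. exp (h * y) * f (y - h)) / M0"
      unfolding integral_tilt(1)[OF rL' iL' that] Z by (simp add: divide_inverse)
  qed
  have i1: "integrable L (\<lambda>y. exp (h * y) * y)" and i2: "integrable L (\<lambda>y. exp (h * y) * y\<^sup>2)" and i3: "integrable L (\<lambda>y. exp (h * y) * \<bar>y\<bar> ^ 3)"
    by (rule int_exp[OF _ int_simple(1)], simp) (rule int_exp[OF _ int_simple(2)], simp, rule int_exp[OF _ int_simple(3)], simp)
  have s1: "exp (h * y) * (y - h) = exp (h * y) * y - h * exp (h * y)" for y by (simp add: algebra_simps)
  have s2: "exp (h * y) * (y - h)\<^sup>2 = exp (h * y) * y\<^sup>2 - 2 * h * (exp (h * y) * y) + h\<^sup>2 * exp (h * y)" for y by (simp add: algebra_simps power2_eq_square)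
  have s3: "\<bar>y - h\<bar> ^ 3 \<le> 4 * \<bar>y\<bar> ^ 3 + 4 * h ^ 3" for y
  proof -
    have "\<bar>y - h\<bar> ^ 3 \<le> (\<bar>y\<bar> + h) ^ 3" using h by (intro power_mono) auto
    also have "\<dots> \<le> 4 * \<bar>y\<bar> ^ 3 + 4 * h ^ 3"
    proof -
      have "0 \<le> 3 * (\<bar>y\<bar> + h) * (\<bar>y\<bar> - h)\<^sup>2" using h by (intro mult_nonneg_nonneg) auto
      then show ?thesis by (simp add: power3_eq_cube power2_eq_square algebra_simps)
    qed
    finally show ?thesis .
  qed
  show "integrable (tilt h L') (\<lambda>y. y)" using i1 int_exp0 by (subst I) (auto simp: s1)
  show "integrable (tilt h L') (\<lambda>y. y\<^sup>2)" using i1 i2 int_exp0 by (subst I) (auto simp: s2)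
  have i33: "integrable L (\<lambda>y. exp (h * y) * \<bar>y - h\<bar> ^ 3)"
  proof (rule Bochner_Integration.integrable_bound[of _ "\<lambda>y. 4 * (exp (h * y) * \<bar>y\<bar> ^ 3) + 4 * h ^ 3 * exp (h * y)"])
    show "AE y in L. norm (exp (h * y) * \<bar>y - h\<bar> ^ 3) \<le> norm (4 * (exp (h * y) * \<bar>y\<bar> ^ 3) + 4 * h ^ 3 * exp (h * y))"
    proof (intro AE_I2)
      fix y
      have "exp (h * y) * \<bar>y - h\<bar> ^ 3 \<le> exp (h * y) * (4 * \<bar>y\<bar> ^ 3 + 4 * h ^ 3)" using s3 by (intro mult_left_mono) auto
      then show "norm (exp (h * y) * \<bar>y - h\<bar> ^ 3) \<le> norm (4 * (exp (h * y) * \<bar>y\<bar> ^ 3) + 4 * h ^ 3 * exp (h * y))"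
        using h by (simp add: algebra_simps)
    qed
  qed (use i3 int_exp0 in auto)
  then show "integrable (tilt h L') (\<lambda>y. \<bar>y\<bar> ^ 3)" by (subst I) auto
  have M0p: "M0 > 0" using M0_ge by linarith
  have "(LINT y|tilt h L'. y) = (LINT y|L. exp (h * y) * y) / M0 - h"
    using i1 int_exp0 M0p by (subst E) (auto simp: s1 diff_divide_distrib)
  then show "\<bar>LINT y|tilt h L'. y\<bar> \<le> 4 * \<kappa>1 + 2 * h * \<kappa>2 + 9 * h\<^sup>2 * \<beta>" using M1_bound by simp
  let ?A = "(LINT y|L. exp (h * y) * y) / M0 - h" and ?B = "(LINT y|L. exp (h * y) * y\<^sup>2) / M0 - 1"
  have "(LINT y|L. exp (h * y) * (y - h)\<^sup>2) = (LINT y|L. exp (h * y) * y\<^sup>2) - 2 * h * (LINT y|L. exp (h * y) * y) + h\<^sup>2 * M0"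
    unfolding s2 using i1 i2 int_exp0 by simp
  then have "(LINT y|tilt h L'. y\<^sup>2) = ((LINT y|L. exp (h * y) * y\<^sup>2) - 2 * h * (LINT y|L. exp (h * y) * y) + h\<^sup>2 * M0) / M0"
    using E[of "\<lambda>y. y\<^sup>2"] by simp
  also have "\<dots> = (LINT y|L. exp (h * y) * y\<^sup>2) / M0 - 2 * h * ((LINT y|L. exp (h * y) * y) / M0) + h\<^sup>2"
    using M0p by (simp add: diff_divide_distrib add_divide_distrib)
  finally have "(LINT y|tilt h L'. y\<^sup>2) - 1 = ?B - 2 * h * ?A - h\<^sup>2"
    by (simp add: right_diff_distrib power2_eq_square)
  moreover have "\<bar>h * ?A\<bar> \<le> h * (4 * \<kappa>1 + 2 * h * \<kappa>2 + 9 * h\<^sup>2 * \<beta>)" unfolding abs_mult using h M1_bound by (intro mult_mono) auto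
  moreover have "h * (4 * \<kappa>1 + 2 * h * \<kappa>2 + 9 * h\<^sup>2 * \<beta>) = 4 * (h * \<kappa>1) + 2 * (h\<^sup>2 * \<kappa>2) + 9 * (h ^ 3 * \<beta>)"
    by (simp add: algebra_simps power2_eq_square power3_eq_cube)
  ultimately show "\<bar>(LINT y|tilt h L'. y\<^sup>2) - 1\<bar> \<le> 6 * \<kappa>2 + 10 * h * \<kappa>1 + 31 * h * \<beta>"
    using abs_le_D1[OF M2_bound] abs_le_D2[OF M2_bound] h_powers(1,2,4,6,7,13) h k1(2) h_powers(8,9) \<beta>(2)
    by (intro abs_leI) (simp only: abs_le_iff, linarith)+
  have "(LINT y|tilt h L'. \<bar>y\<bar> ^ 3) = (LINT y|L. exp (h * y) * \<bar>y - h\<bar> ^ 3) / M0" by (subst E) auto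
  also have "\<dots> \<le> (LINT y|L. 4 * (exp (h * y) * \<bar>y\<bar> ^ 3) + 4 * h ^ 3 * exp (h * y)) / M0"
  proof (intro divide_right_mono integral_mono i33)
    fix y
    have "exp (h * y) * \<bar>y - h\<bar> ^ 3 \<le> exp (h * y) * (4 * \<bar>y\<bar> ^ 3 + 4 * h ^ 3)" using s3 by (intro mult_left_mono) auto
    then show "exp (h * y) * \<bar>y - h\<bar> ^ 3 \<le> 4 * (exp (h * y) * \<bar>y\<bar> ^ 3) + 4 * h ^ 3 * exp (h * y)" by (simp add: algebra_simps)
  qed (use i3 int_exp0 M0p in auto)
  also have "\<dots> = 4 * ((LINT y|L. exp (h * y) * \<bar>y\<bar> ^ 3) / M0) + 4 * h ^ 3"
    using i3 int_exp0 M0p by (simp add: field_simps)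
  also have "\<dots> \<le> 32 * \<beta>" using M3_bound h_powers(11) \<beta>(2) by linarith
  finally show "(LINT y|tilt h L'. \<bar>y\<bar> ^ 3) \<le> 32 * \<beta>" .
qed

end

lemma power_one_plus_diff_le:
  fixes a :: real
  assumes "real n * \<bar>a - 1\<bar> \<le> d" "d \<le> 1"
  shows "\<bar>a ^ n - 1\<bar> \<le> 2 * d"
proof -
  have d0: "0 \<le> d" using assms(1) by (meson abs_ge_zero mult_nonneg_nonneg of_nat_0_le_iff order_trans)
  have "\<bar>a ^ n - 1\<bar> \<le> (1 + \<bar>a - 1\<bar>) ^ n - 1"
  proof (induction n)
    case (Suc n)
    let ?w = "\<bar>a - 1\<bar>"
    have "a ^ Suc n - 1 = a * (a ^ n - 1) + (a - 1)" by (simp add: algebra_simps)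
    then have "\<bar>a ^ Suc n - 1\<bar> \<le> \<bar>a\<bar> * \<bar>a ^ n - 1\<bar> + ?w" by (metis abs_mult abs_triangle_ineq)
    also have "\<dots> \<le> (1 + ?w) * ((1 + ?w) ^ n - 1) + ?w" using Suc by (intro add_mono mult_mono) auto
    also have "\<dots> = (1 + ?w) ^ Suc n - 1" by (simp add: algebra_simps)
    finally show ?case .
  qed simp
  also have "(1 + \<bar>a - 1\<bar>) ^ n \<le> exp \<bar>a - 1\<bar> ^ n" by (intro power_mono exp_ge_add_one_self) auto
  also have "\<dots> = exp (real n * \<bar>a - 1\<bar>)" by (simp add: exp_of_nat_mult)
  also have "\<dots> \<le> exp d" using assms by simp
  also have "exp d \<le> 1 + 2 * d"
  proof -
    have "exp d \<le> 1 + d + d\<^sup>2" using exp_bound d0 assms(2) by blast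
    also have "d\<^sup>2 \<le> d * 1" unfolding power2_eq_square using d0 assms(2) by (intro mult_left_mono)
    finally show ?thesis by simp
  qed
  finally show ?thesis by simp
qed

lemma (in prob_space) moderate_deviation:
  fixes \<xi> :: "'i \<Rightarrow> 'a \<Rightarrow> real" and n :: nat and x b \<kappa>1 \<kappa>2 \<beta> :: real
  assumes I: "finite I" "card I = n" and n: "n \<ge> 3"
    and ind: "indep_vars (\<lambda>_. borel) \<xi> I" and id: "\<And>i. i \<in> I \<Longrightarrow> distr M borel (\<xi> i) = L"
    and L: "real_distribution L" and bnd: "AE y in L. \<bar>y\<bar> \<le> b"
    and x: "0 \<le> x" "x / sqrt n * b \<le> 1"
    and k1: "\<bar>LINT y|L. y\<bar> \<le> \<kappa>1" and k2: "\<bar>(LINT y|L. y\<^sup>2) - 1\<bar> \<le> \<kappa>2"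
    and \<beta>: "(LINT y|L. \<bar>y\<bar> ^ 3) \<le> \<beta>" "1/2 \<le> \<beta>"
    and \<delta>: "\<delta> = (1 + x) * (sqrt n * \<kappa>1) + (1 + x)\<^sup>2 * \<kappa>2 + (1 + x) ^ 3 * (\<beta> / sqrt n) + (1 + x) * ln n * (\<beta> / sqrt n)"
    and small: "\<delta> \<le> 1/1000"
  shows "\<bar>prob {\<omega>\<in>space M. x * sqrt n < (\<Sum>i\<in>I. \<xi> i \<omega>)} - measure std_normal_distribution {x<..}\<bar>
     \<le> 300000000 * \<delta> * measure std_normal_distribution {x<..}"
proof -
  define s where "s = sqrt n"
  have s: "s > 0" "s \<ge> 1" "s * s = n" using n by (auto simp: s_def)
  define \<gamma> where "\<gamma> = \<beta> / s"
  define h where "h = x / s"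
  define l where "l = ln (real n)"
  have "exp 1 \<le> (3::real)" using exp_le by simp
  then have l1: "l \<ge> 1" unfolding l_def using n ln_ge_iff[of "real n" 1] by auto
  have g0: "\<gamma> > 0" using \<beta> s by (simp add: \<gamma>_def)
  have k0: "0 \<le> \<kappa>1" "0 \<le> \<kappa>2" using k1 k2 by linarith+
  define X where "X = 1 + x"
  have X: "X \<ge> 1" "X = 1 + x" using x by (auto simp: X_def)
  have \<delta>': "\<delta> = X * (s * \<kappa>1) + X\<^sup>2 * \<kappa>2 + X ^ 3 * \<gamma> + X * l * \<gamma>" unfolding \<delta> X_def s_def \<gamma>_def l_def ..
  define d1 where "d1 = X * (s * \<kappa>1)"
  define d2 where "d2 = X\<^sup>2 * \<kappa>2"
  define d3 where "d3 = X ^ 3 * \<gamma>"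
  define d4 where "d4 = X * l * \<gamma>"
  have d: "0 \<le> d1" "0 \<le> d2" "0 \<le> d3" "0 \<le> d4" using X s k0 g0 l1 by (auto simp: d1_def d2_def d3_def d4_def)
  have dd: "\<delta> = d1 + d2 + d3 + d4" unfolding \<delta>' d1_def d2_def d3_def d4_def ..
  have X2: "1 \<le> X\<^sup>2" "1 \<le> X ^ 3" "X \<le> X\<^sup>2" "X\<^sup>2 \<le> X ^ 3" "X \<le> X ^ 3"
    using X by (auto intro: one_le_power simp: power2_eq_square power3_eq_cube mult_mono)
       (metis X(1) le_numeral_extra(4) mult.right_neutral mult_left_mono order_trans zero_le_one mult_right_mono mult.assoc one_le_power power2_eq_square)+
  have hs: "h * s = x" "x = h * s" using s by (auto simp: h_def)
  have h0: "0 \<le> h" using x s by (simp add: h_def)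
  have hb: "h * b \<le> 1" using x(2) by (simp add: h_def s_def)
  have hbeta: "h * \<beta> = x * \<gamma>" by (simp add: h_def \<gamma>_def)
  have "h \<le> 2 * (x * \<gamma>)" using mult_left_mono[OF \<beta>(2) h0] by (simp add: hbeta[symmetric])
  also have "x * \<gamma> \<le> X ^ 3 * \<gamma>" using X X2 g0 by (intro mult_right_mono) auto
  finally have h_le: "h \<le> 2 * d3" by (simp add: d3_def)
  have h1: "h \<le> 1" using h_le dd d small by linarith
  have hk1: "h * \<kappa>1 \<le> d1"
  proof -
    have "h * \<kappa>1 \<le> 1 * \<kappa>1" using h1 k0 by (intro mult_right_mono)
    also have "1 * \<kappa>1 \<le> s * \<kappa>1" using s k0 by (intro mult_right_mono)
    also have "s * \<kappa>1 = 1 * (s * \<kappa>1)" by simp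
    also have "\<dots> \<le> d1" unfolding d1_def using X s k0 by (intro mult_right_mono) auto
    finally show ?thesis .
  qed
  have sk1: "s * \<kappa>1 \<le> d1" unfolding d1_def using X s k0 mult_right_mono[of 1 X "s * \<kappa>1"] by simp
  have k2d: "\<kappa>2 \<le> d2" unfolding d2_def using X2 k0 mult_right_mono[of 1 "X\<^sup>2" \<kappa>2] by simp
  have hk1': "h * \<kappa>1 \<le> 1/2" using hk1 dd d small by linarith
  have k2': "\<kappa>2 \<le> 1" using k2d dd d small by linarith
  note ctx = L bnd h0 h1 hb k1 hk1' k2 k2' \<beta>
  define L' where "L' = distr L borel (\<lambda>y. y - h)"
  note mom = shifted_tilt_moments[OF ctx, folded L'_def]
  note M0ge = M0_ge[OF ctx] note M0ap = M0_approx[OF ctx]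
  define M0 where "M0 = (LINT y|L. exp (h * y))"
  define t1 where "t1 = 4 * \<kappa>1 + 2 * h * \<kappa>2 + 9 * h\<^sup>2 * \<beta>"
  define t2 where "t2 = 6 * \<kappa>2 + 10 * h * \<kappa>1 + 31 * h * \<beta>"
  have t1: "s * t1 = 4 * (s * \<kappa>1) + 2 * (x * \<kappa>2) + 9 * (x\<^sup>2 * \<gamma>)"
  proof -
    have "h\<^sup>2 * \<beta> = h * (x * \<gamma>)" unfolding power2_eq_square mult.assoc hbeta ..
    then have "s * t1 = 4 * (s * \<kappa>1) + 2 * ((h * s) * \<kappa>2) + 9 * ((h * s) * (x * \<gamma>))" unfolding t1_def by (simp add: algebra_simps)
    then show ?thesis unfolding hs(1) by (simp add: power2_eq_square)
  qed
  have t2: "t2 = 6 * \<kappa>2 + 10 * (h * \<kappa>1) + 31 * (x * \<gamma>)" unfolding t2_def by (simp add: hbeta mult.assoc)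
  have xk2: "X * (x * \<kappa>2) \<le> d2" "X * \<kappa>2 \<le> d2" "x\<^sup>2 * \<kappa>2 \<le> d2"
  proof -
    have "X * x \<le> X * X" "X \<le> X * X" "x * x \<le> X * X" using X x by (auto intro: mult_mono)
    then have "X * x * \<kappa>2 \<le> X * X * \<kappa>2" "X * \<kappa>2 \<le> X * X * \<kappa>2" "x * x * \<kappa>2 \<le> X * X * \<kappa>2"
      using k0 by (auto intro: mult_right_mono)
    then show "X * (x * \<kappa>2) \<le> d2" "X * \<kappa>2 \<le> d2" "x\<^sup>2 * \<kappa>2 \<le> d2" by (auto simp: d2_def power2_eq_square mult.assoc)
  qed
  have xg: "X * (x\<^sup>2 * \<gamma>) \<le> d3" "X * (x * \<gamma>) \<le> d3" "x ^ 3 * \<gamma> \<le> d3"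
  proof -
    have a: "x\<^sup>2 \<le> X\<^sup>2" "x \<le> X\<^sup>2" "x ^ 3 \<le> X ^ 3" using X x X2 by (auto intro: power_mono)
    have "X * x\<^sup>2 \<le> X ^ 3" "X * x \<le> X ^ 3" using a X mult_left_mono[of "x\<^sup>2" "X\<^sup>2" X] mult_left_mono[of "x" "X\<^sup>2" X] by (auto simp: power3_eq_cube power2_eq_square)
    then have "X * x\<^sup>2 * \<gamma> \<le> X ^ 3 * \<gamma>" "X * x * \<gamma> \<le> X ^ 3 * \<gamma>" "x ^ 3 * \<gamma> \<le> X ^ 3 * \<gamma>" using a g0 by (auto intro: mult_right_mono)
    then show "X * (x\<^sup>2 * \<gamma>) \<le> d3" "X * (x * \<gamma>) \<le> d3" "x ^ 3 * \<gamma> \<le> d3" by (auto simp: d3_def mult.assoc)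
  qed
  have Xhk1: "X * (h * \<kappa>1) \<le> d1"
  proof -
    have "h * \<kappa>1 \<le> s * \<kappa>1" using h1 s k0 by (intro mult_right_mono) auto
    then show ?thesis unfolding d1_def using X by (intro mult_left_mono) auto
  qed
  have t0: "0 \<le> t1" "0 \<le> t2" using k0 h0 \<beta> by (auto simp: t1_def t2_def)
  have XD: "X * (s * t1 + t2 + l * \<gamma>) \<le> 40 * \<delta>"
  proof -
    have "X * (s * t1 + t2 + l * \<gamma>) = 4 * (X * (s * \<kappa>1)) + 2 * (X * (x * \<kappa>2)) + 9 * (X * (x\<^sup>2 * \<gamma>)) + 6 * (X * \<kappa>2) + 10 * (X * (h * \<kappa>1)) + 31 * (X * (x * \<gamma>)) + X * l * \<gamma>"
      unfolding t1 t2 by (simp add: algebra_simps)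
    also have "\<dots> \<le> 4 * d1 + 2 * d2 + 9 * d3 + 6 * d2 + 10 * d1 + 31 * d3 + d4"
      unfolding d1_def[symmetric] d4_def[symmetric] using xk2 xg Xhk1 by (intro add_mono mult_left_mono) auto
    also have "\<dots> \<le> 40 * \<delta>" unfolding dd using d by simp
    finally show ?thesis .
  qed
  have D40: "s * t1 + t2 + l * \<gamma> \<le> 40 * \<delta>"
  proof -
    have "0 \<le> s * t1 + t2 + l * \<gamma>" using t0 s l1 g0 by auto
    then have "1 * (s * t1 + t2 + l * \<gamma>) \<le> X * (s * t1 + t2 + l * \<gamma>)" using X by (intro mult_right_mono) auto
    then show ?thesis using order_trans[OF _ XD] by (simp only: mult_1_left)
  qed
  have lg: "0 \<le> l * \<gamma>" "0 \<le> s * t1" using l1 g0 t0 s by auto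
  have st1: "sqrt (real n) * t1 \<le> 1" and t2': "t2 \<le> 1/10" unfolding s_def[symmetric] using D40 lg t0 small by linarith+
  have rvi: "random_variable borel (\<xi> i)" if "i \<in> I" for i using ind that unfolding indep_vars_def by auto
  define \<zeta> where "\<zeta> = (\<lambda>i \<omega>. \<xi> i \<omega> - h)"
  have ind\<zeta>: "indep_vars (\<lambda>_. borel) \<zeta> I" unfolding \<zeta>_def by (rule indep_vars_compose2[OF ind]) measurable
  have id\<zeta>: "distr M borel (\<zeta> i) = L'" if "i \<in> I" for i
    unfolding L'_def id[OF that, symmetric] \<zeta>_def using rvi[OF that] by (subst distr_distr) (auto simp: comp_def)
  define G where "G = (\<lambda>\<omega>. (\<Sum>i\<in>I. \<zeta> i \<omega>) / sqrt n)"
  have rvG[measurable]: "random_variable borel G" unfolding G_def \<zeta>_def using rvi by (intro borel_measurable_divide borel_measurable_sum borel_measurable_diff) auto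
  have n0: "n > 0" using n by simp
  note ct = char_tilt_sum[OF I n0 ind\<zeta> id\<zeta> mom(2), folded G_def, folded s_def, unfolded hs(1)]
  let ?G = "distr M borel G"
  have rG: "real_distribution ?G" by (rule real_distribution_distr) simp
  interpret G: real_distribution ?G by (rule rG)
  let ?T = "tilt x ?G"
  have rT: "real_distribution ?T" by (rule real_distribution_tilt[OF rG ct(1)])
  have rtL: "real_distribution (tilt h L')" by (rule real_distribution_tilt[OF mom(1,2)])
  have K: "\<bar>cdf ?T z - cdf std_normal_distribution z\<bar> \<le> 63000 * (s * t1 + t2 + l * \<gamma>)" for z
  proof -
    have "\<bar>cdf ?T z - cdf std_normal_distribution z\<bar> \<le> 63000 * (sqrt n * t1 + t2 + ln n * (\<beta> / sqrt n))"
    proof (rule kolmogorov_distance_le[OF rT _ n \<beta>(2) t0(1) st1 t0(2) t2'])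
      show "char ?T s' = char (tilt h L') (s' / sqrt n) ^ n" for s' using ct(3) unfolding s_def .
      show "cmod (char (tilt h L') u - complex_of_real (exp (- u\<^sup>2 / 2))) \<le> \<bar>u\<bar> * t1 + u\<^sup>2 * t2 / 2 + \<bar>u\<bar> ^ 3 * (32 * \<beta>) / 6 + u ^ 4 / 8" for u
        using real_distribution.char_diff_std_normal_le[OF rtL mom(4-6) _ _ mom(9)] mom(7,8) unfolding t1_def t2_def by blast
    qed
    then show ?thesis unfolding s_def l_def \<gamma>_def .
  qed
  define A where "A = (LINT g|?T. exp (- (x * g)) * indicator {0<..} g)"
  define A0 where "A0 = (LINT g|std_normal_distribution. exp (- (x * g)) * indicator {0<..} g)"
  have AA: "\<bar>A - A0\<bar> \<le> 2 * (63000 * (s * t1 + t2 + l * \<gamma>))"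
    unfolding A_def A0_def by (rule laplace_half_line_diff_le[OF rT real_dist_normal_dist x(1) K])
  have A0: "1 / (27 * X) \<le> A0" unfolding A0_def X_def by (rule std_normal_laplace_ge[OF x(1)])
  have A0': "1 \<le> 27 * X * A0" using A0 X by (simp add: field_simps)
  have A0p: "A0 > 0" using A0 X by (smt (verit) divide_pos_pos mult_pos_pos)
  have rel: "\<bar>A - A0\<bar> \<le> 140000000 * \<delta> * A0"
  proof -
    have "\<bar>A - A0\<bar> \<le> 2 * (63000 * (s * t1 + t2 + l * \<gamma>)) * (27 * X * A0)"
      using AA A0' mult_left_mono[OF A0', of "2 * (63000 * (s * t1 + t2 + l * \<gamma>))"] lg t0 by simp
    also have "\<dots> = 3402000 * (X * (s * t1 + t2 + l * \<gamma>)) * A0" by simp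
    also have "\<dots> \<le> 3402000 * (40 * \<delta>) * A0" using XD A0p by (intro mult_right_mono mult_left_mono) auto
    also have "\<dots> \<le> 140000000 * \<delta> * A0"
    proof (intro mult_right_mono)
      have "0 \<le> \<delta>" using dd d by simp
      then show "3402000 * (40 * \<delta>) \<le> 140000000 * \<delta>" by simp
    qed (use A0p in simp)
    finally show ?thesis .
  qed
  have Zn: "(LINT y|?G. exp (x * y)) = (M0 * exp (- h\<^sup>2)) ^ n" using ct(2) mom(3) unfolding M0_def by simp
  have M0p: "M0 > 0" using M0ge unfolding M0_def by linarith
  have PA: "measure ?G {0<..} = (M0 * exp (- h\<^sup>2)) ^ n * A"
  proof -
    have "A = (LINT g|?G. exp (x * g) *\<^sub>R (exp (- (x * g)) * indicator {0<..} g)) /\<^sub>R (LINT y|?G. exp (x * y))"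
      unfolding A_def by (rule integral_tilt(1)[OF rG ct(1)]) measurable
    also have "(LINT g|?G. exp (x * g) *\<^sub>R (exp (- (x * g)) * indicator {0<..} g)) = (LINT g|?G. indicator {0<..} g)"
      by (intro Bochner_Integration.integral_cong) (auto simp: exp_minus)
    also have "\<dots> = measure ?G {0<..}" by simp
    finally show ?thesis unfolding Zn using M0p by (simp add: field_simps)
  qed
  have PG: "measure ?G {0<..} = prob {\<omega>\<in>space M. x * sqrt n < (\<Sum>i\<in>I. \<xi> i \<omega>)}"
  proof -
    have eq: "(\<Sum>i\<in>I. \<zeta> i \<omega>) = (\<Sum>i\<in>I. \<xi> i \<omega>) - x * s" for \<omega>
    proof -
      have "real n * h = x * s" unfolding s(3)[symmetric] hs(2) by simp
      then show ?thesis unfolding \<zeta>_def sum_subtractf using I by simp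
    qed
    have "measure ?G {0<..} = prob (G -` {0<..} \<inter> space M)" by (subst measure_distr) auto
    also have "G -` {0<..} \<inter> space M = {\<omega>\<in>space M. x * sqrt n < (\<Sum>i\<in>I. \<xi> i \<omega>)}"
      unfolding G_def eq using s by (auto simp: s_def[symmetric] zero_less_divide_iff)
    finally show ?thesis .
  qed
  define r where "r = (M0 * exp (- (h\<^sup>2 / 2))) ^ n"
  have nh: "real n * h\<^sup>2 = x\<^sup>2" unfolding s(3)[symmetric] hs(2) by (simp add: power2_eq_square)
  have rr: "(M0 * exp (- h\<^sup>2)) ^ n = r * exp (- x\<^sup>2 / 2)"
  proof -
    have "exp (- x\<^sup>2 / 2) = exp (- (h\<^sup>2 / 2)) ^ n" unfolding exp_of_nat_mult[symmetric] nh[symmetric] by simp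
    then show ?thesis unfolding r_def power_mult_distrib by (simp add: mult.assoc flip: power_mult_distrib exp_add)
  qed
  have rd: "\<bar>r - 1\<bar> \<le> 4 * \<delta>"
  proof -
    have "h\<^sup>2 \<le> 1" using h0 h1 by (simp add: power_le_one)
    then have v: "\<bar>h\<^sup>2 / 2\<bar> \<le> 1" by simp
    have "\<bar>exp (h\<^sup>2 / 2) - 1 - h\<^sup>2 / 2\<bar> \<le> h ^ 4 / 2"
      using exp_taylor_remainders(2)[OF v] by (simp add: power_divide flip: power_mult)
    then have a: "\<bar>M0 - exp (h\<^sup>2 / 2)\<bar> \<le> h * \<kappa>1 + h\<^sup>2 * \<kappa>2 / 2 + h ^ 3 * \<beta> / 2 + h ^ 4 / 2"
      using M0ap unfolding M0_def[symmetric] by linarith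
    have "M0 * exp (- (h\<^sup>2 / 2)) - 1 = exp (- (h\<^sup>2 / 2)) * (M0 - exp (h\<^sup>2 / 2))" by (simp add: algebra_simps flip: exp_add)
    then have "\<bar>M0 * exp (- (h\<^sup>2 / 2)) - 1\<bar> = exp (- (h\<^sup>2 / 2)) * \<bar>M0 - exp (h\<^sup>2 / 2)\<bar>" by (simp add: abs_mult)
    also have "\<dots> \<le> \<bar>M0 - exp (h\<^sup>2 / 2)\<bar>" by (intro mult_left_le_one_le) auto
    also note a
    finally have "\<bar>M0 * exp (- (h\<^sup>2 / 2)) - 1\<bar> \<le> h * \<kappa>1 + h\<^sup>2 * \<kappa>2 / 2 + h ^ 3 * \<beta> / 2 + h ^ 4 / 2" .
    then have "real n * \<bar>M0 * exp (- (h\<^sup>2 / 2)) - 1\<bar> \<le> real n * (h * \<kappa>1 + h\<^sup>2 * \<kappa>2 / 2 + h ^ 3 * \<beta> / 2 + h ^ 4 / 2)"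
      by (intro mult_left_mono) auto
    also have "\<dots> = real n * h * \<kappa>1 + real n * h\<^sup>2 * \<kappa>2 / 2 + real n * h\<^sup>2 * (h * \<beta>) / 2 + real n * h\<^sup>2 * h\<^sup>2 / 2"
      by (simp add: algebra_simps power2_eq_square power3_eq_cube power4_eq_xxxx)
    also have "\<dots> = x * (s * \<kappa>1) + x\<^sup>2 * \<kappa>2 / 2 + x ^ 3 * \<gamma> / 2 + x\<^sup>2 * h\<^sup>2 / 2"
    proof -
      have "real n * h = x * s" unfolding s(3)[symmetric] hs(2) by simp
      then show ?thesis unfolding nh hbeta by (simp add: power2_eq_square power3_eq_cube)
    qed
    also have "\<dots> \<le> 2 * \<delta>"
    proof -
      have "x * (s * \<kappa>1) \<le> d1" unfolding d1_def using X x s k0 by (intro mult_right_mono) auto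
      moreover have "x\<^sup>2 * h\<^sup>2 \<le> 2 * d3"
      proof -
        have "h\<^sup>2 \<le> h * 1" unfolding power2_eq_square using h0 h1 by (intro mult_left_mono)
        also have "h * 1 \<le> 2 * (x * \<gamma>)" using \<open>h \<le> 2 * (x * \<gamma>)\<close> by simp
        finally have "x\<^sup>2 * h\<^sup>2 \<le> x\<^sup>2 * (2 * (x * \<gamma>))" by (intro mult_left_mono) auto
        also have "\<dots> = 2 * (x ^ 3 * \<gamma>)" by (simp add: power2_eq_square power3_eq_cube)
        finally show ?thesis using xg(3) by linarith
      qed
      ultimately show ?thesis using xk2(3) xg(3) d unfolding dd by argo
    qed
    finally have "real n * \<bar>M0 * exp (- (h\<^sup>2 / 2)) - 1\<bar> \<le> 2 * \<delta>" .
    then have "\<bar>(M0 * exp (- (h\<^sup>2 / 2))) ^ n - 1\<bar> \<le> 2 * (2 * \<delta>)" using small by (intro power_one_plus_diff_le) auto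
    then show ?thesis unfolding r_def by simp
  qed
  have Ntail: "measure std_normal_distribution {x<..} = exp (- x\<^sup>2 / 2) * A0" unfolding A0_def by (rule std_normal_tail_tilt)
  have \<delta>0: "0 \<le> \<delta>" using dd d by simp
  have \<delta>A: "0 \<le> \<delta> * A0" using \<delta>0 A0p by simp
  have "\<bar>r * A - A0\<bar> \<le> 300000000 * \<delta> * A0"
  proof -
    have "r * A - A0 = r * (A - A0) + (r - 1) * A0" by (simp add: algebra_simps)
    then have "\<bar>r * A - A0\<bar> \<le> \<bar>r * (A - A0)\<bar> + \<bar>(r - 1) * A0\<bar>" by (simp only: abs_triangle_ineq)
    also have "\<dots> = \<bar>r\<bar> * \<bar>A - A0\<bar> + \<bar>r - 1\<bar> * A0" using A0p by (simp add: abs_mult)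
    also have "\<dots> \<le> 2 * (140000000 * \<delta> * A0) + (4 * \<delta>) * A0"
    proof (intro add_mono mult_mono rel rd)
      show "\<bar>r\<bar> \<le> 2" using rd small by linarith
    qed (use \<delta>0 A0p in auto)
    also have "\<dots> = 280000004 * (\<delta> * A0)" by simp
    also have "\<dots> \<le> 300000000 * (\<delta> * A0)" using \<delta>A by (intro mult_right_mono) auto
    finally show ?thesis by (simp only: mult.assoc)
  qed
  then have "exp (- x\<^sup>2 / 2) * \<bar>r * A - A0\<bar> \<le> exp (- x\<^sup>2 / 2) * (300000000 * \<delta> * A0)" by (intro mult_left_mono) auto
  moreover have "exp (- x\<^sup>2 / 2) * \<bar>r * A - A0\<bar> = \<bar>prob {\<omega>\<in>space M. x * sqrt n < (\<Sum>i\<in>I. \<xi> i \<omega>)} - measure std_normal_distribution {x<..}\<bar>"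
  proof -
    have "exp (- x\<^sup>2 / 2) * \<bar>r * A - A0\<bar> = \<bar>exp (- x\<^sup>2 / 2) * (r * A - A0)\<bar>" by (simp add: abs_mult)
    also have "exp (- x\<^sup>2 / 2) * (r * A - A0) = r * exp (- x\<^sup>2 / 2) * A - exp (- x\<^sup>2 / 2) * A0" by (simp only: right_diff_distrib mult.assoc mult.left_commute[of r])
    finally show ?thesis unfolding PG[symmetric] PA rr Ntail .
  qed
  ultimately show ?thesis unfolding Ntail by (simp only: ac_simps)
qed

section \<open>Chi-square tails\<close>

lemma nn_integral_gamma_scaled:
  assumes a: "a > 0" and c: "(c::real) > 0"
  shows "(\<integral>\<^sup>+x. ennreal (if x > 0 then x powr (a - 1) * exp (- (c * x)) else 0) \<partial>lborel) = ennreal (Gamma a / c powr a)"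
proof -
  let ?f = "\<lambda>x::real. ennreal (if x > 0 then x powr (a - 1) * exp (- (c * x)) else 0)"
  have "(\<integral>\<^sup>+x. ?f x \<partial>lborel) = ennreal (1 / c) * (\<integral>\<^sup>+x. ?f (0 + (1 / c) * x) \<partial>lborel)"
    using c by (subst nn_integral_real_affine[where c="1/c" and t=0]) auto
  also have "(\<integral>\<^sup>+x. ?f (0 + (1 / c) * x) \<partial>lborel) = (\<integral>\<^sup>+x. ennreal ((1 / c) powr (a - 1)) * ennreal (indicator {0..} x * x powr (a - 1) / exp x) \<partial>lborel)"
  proof (intro nn_integral_cong_AE AE_I[where N="{0}"])
    have "?f (0 + (1 / c) * x) = ennreal ((1 / c) powr (a - 1)) * ennreal (indicator {0..} x * x powr (a - 1) / exp x)" if x: "x \<noteq> 0" for x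
    proof (cases "x > 0")
      case True
      have "?f (0 + (1 / c) * x) = ennreal ((1 / c * x) powr (a - 1) * exp (- x))" using True c by simp
      also have "(1 / c * x) powr (a - 1) * exp (- x) = (1 / c) powr (a - 1) * (x powr (a - 1) / exp x)"
        using True c powr_mult[of "1 / c" x "a - 1"] by (simp add: exp_minus divide_inverse)
      also have "ennreal \<dots> = ennreal ((1 / c) powr (a - 1)) * ennreal (x powr (a - 1) / exp x)" by (intro ennreal_mult') simp
      finally show ?thesis using True by simp
    next
      case False
      then have n: "\<not> 0 < 0 + (1 / c) * x" using c by (simp add: field_simps)
      show ?thesis unfolding if_not_P[OF n] using False x by simp
    qed
    then show "{x \<in> space lborel. ?f (0 + (1 / c) * x) \<noteq> ennreal ((1 / c) powr (a - 1)) * ennreal (indicator {0..} x * x powr (a - 1) / exp x)} \<subseteq> {0}" by blast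
  qed auto
  also have "\<dots> = ennreal ((1 / c) powr (a - 1)) * ennreal (Gamma a)"
    by (subst nn_integral_cmult) (auto simp: Gamma_conv_nn_integral_real[OF a])
  also have "ennreal (1 / c) * (ennreal ((1 / c) powr (a - 1)) * ennreal (Gamma a)) = ennreal (Gamma a / c powr a)"
    using c a Gamma_real_pos[OF a] by (simp add: powr_diff powr_divide field_simps flip: ennreal_mult)
  finally show ?thesis .
qed

definition chi2 :: "nat \<Rightarrow> real measure" where
  "chi2 k = density lborel (\<lambda>x. ennreal (chi2_density k x))"

lemma chi2_density_measurable[measurable]: "chi2_density k \<in> borel_measurable borel"
  unfolding chi2_density_def[abs_def] by measurable

lemma sets_chi2[simp, measurable_cong]: "sets (chi2 k) = sets borel" and space_chi2[simp]: "space (chi2 k) = UNIV"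
  by (auto simp: chi2_def)

lemma chi2_density_nonneg: "k \<ge> 1 \<Longrightarrow> 0 \<le> chi2_density k x"
  unfolding chi2_density_def by (auto intro!: mult_nonneg_nonneg divide_nonneg_nonneg less_imp_le[OF Gamma_real_pos])

lemma nn_integral_chi2_exp:
  assumes k: "k \<ge> 1" and \<theta>: "\<theta> < 1/2"
  shows "(\<integral>\<^sup>+x. ennreal (chi2_density k x * exp (\<theta> * x)) \<partial>lborel) = ennreal ((1 - 2 * \<theta>) powr (- (real k / 2)))"
proof -
  let ?K = "2 powr (real k / 2) * Gamma (real k / 2)"
  have K: "?K > 0" using k by (intro mult_pos_pos Gamma_real_pos) auto
  have "chi2_density k x * exp (\<theta> * x) = (1 / ?K) * (if x > 0 then x powr (real k / 2 - 1) * exp (- ((1/2 - \<theta>) * x)) else 0)" for x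
    unfolding chi2_density_def by (simp add: algebra_simps flip: exp_add)
  then have "(\<integral>\<^sup>+x. ennreal (chi2_density k x * exp (\<theta> * x)) \<partial>lborel)
     = (\<integral>\<^sup>+x. ennreal (1 / ?K) * ennreal (if x > 0 then x powr (real k / 2 - 1) * exp (- ((1/2 - \<theta>) * x)) else 0) \<partial>lborel)"
    using K by (simp only: ennreal_mult' less_imp_le zero_le_divide_1_iff)
  also have "\<dots> = ennreal (1 / ?K) * ennreal (Gamma (real k / 2) / (1/2 - \<theta>) powr (real k / 2))"
    using k \<theta> by (subst nn_integral_cmult) (auto simp: nn_integral_gamma_scaled)
  also have "\<dots> = ennreal (1 / ?K * (Gamma (real k / 2) / (1/2 - \<theta>) powr (real k / 2)))"
    using K by (subst ennreal_mult') auto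
  also have "1 / ?K * (Gamma (real k / 2) / (1/2 - \<theta>) powr (real k / 2)) = 1 / ((2 * (1/2 - \<theta>)) powr (real k / 2))"
  proof -
    have "Gamma (real k / 2) > 0" using k by (intro Gamma_real_pos) simp
    moreover have "1 / (P * G) * (G / Q) = 1 / (P * Q)" if "G > 0" for P G Q :: real using that by simp
    moreover have "(2 * (1/2 - \<theta>)) powr (real k / 2) = 2 powr (real k / 2) * (1/2 - \<theta>) powr (real k / 2)"
      using \<theta> by (intro powr_mult)
    ultimately show ?thesis by metis
  qed
  also have "\<dots> = (1 - 2 * \<theta>) powr (- (real k / 2))" by (simp add: powr_minus_divide algebra_simps)
  finally show ?thesis .
qed

lemma prob_space_chi2: "k \<ge> 1 \<Longrightarrow> prob_space (chi2 k)"
  using nn_integral_chi2_exp[of k 0] unfolding chi2_def by (intro prob_spaceI) (simp add: emeasure_density)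

lemma real_distribution_chi2: "k \<ge> 1 \<Longrightarrow> real_distribution (chi2 k)"
  using prob_space_chi2 unfolding real_distribution_def real_distribution_axioms_def by simp

lemma chi2_tail_eq: "chi2_tail k t = measure (chi2 k) {t..}" "chi2_tail k t = measure (chi2 k) {t<..}"
proof -
  show "chi2_tail k t = measure (chi2 k) {t..}" by (simp add: chi2_tail_def chi2_def)
  have "(\<integral>\<^sup>+x. ennreal (chi2_density k x) * indicator {t..} x \<partial>lborel) = (\<integral>\<^sup>+x. ennreal (chi2_density k x) * indicator {t<..} x \<partial>lborel)"
    by (intro nn_integral_cong_AE AE_I[where N="{t}"]) (auto simp: indicator_def)
  then show "chi2_tail k t = measure (chi2 k) {t<..}"
    by (simp add: chi2_tail_def chi2_def measure_def emeasure_density)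
qed

lemma chi2_tail_exp_le:
  assumes k: "k \<ge> 1" and \<theta>: "0 \<le> \<theta>" "\<theta> < 1/2"
  shows "chi2_tail k t \<le> exp (- (\<theta> * t)) * (1 - 2 * \<theta>) powr (- (real k / 2))"
proof -
  have "emeasure (chi2 k) {t..} = (\<integral>\<^sup>+x. ennreal (chi2_density k x) * indicator {t..} x \<partial>lborel)"
    unfolding chi2_def by (simp add: emeasure_density)
  also have "\<dots> \<le> (\<integral>\<^sup>+x. ennreal (exp (- (\<theta> * t))) * ennreal (chi2_density k x * exp (\<theta> * x)) \<partial>lborel)"
  proof (intro nn_integral_mono)
    fix x
    show "ennreal (chi2_density k x) * indicator {t..} x \<le> ennreal (exp (- (\<theta> * t))) * ennreal (chi2_density k x * exp (\<theta> * x))"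
    proof (cases "t \<le> x")
      case True
      have "\<theta> * t \<le> \<theta> * x" using True \<theta> by (intro mult_left_mono)
      then have "1 \<le> exp (- (\<theta> * t)) * exp (\<theta> * x)" by (simp flip: exp_add)
      then have "chi2_density k x * 1 \<le> chi2_density k x * (exp (- (\<theta> * t)) * exp (\<theta> * x))"
        using chi2_density_nonneg[OF k, of x] by (intro mult_left_mono)
      then have "ennreal (chi2_density k x) \<le> ennreal (exp (- (\<theta> * t)) * (chi2_density k x * exp (\<theta> * x)))"
        by (intro ennreal_leI) (simp add: ac_simps)
      then show ?thesis using True by (simp add: ennreal_mult')
    qed (simp add: indicator_def)
  qed
  also have "\<dots> = ennreal (exp (- (\<theta> * t)) * (1 - 2 * \<theta>) powr (- (real k / 2)))"
    using nn_integral_chi2_exp[OF k \<theta>(2)] by (subst nn_integral_cmult) (auto simp: ennreal_mult')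
  finally have "emeasure (chi2 k) {t..} \<le> ennreal (exp (- (\<theta> * t)) * (1 - 2 * \<theta>) powr (- (real k / 2)))" .
  then show ?thesis unfolding chi2_tail_eq(1) measure_def by (intro enn2real_leI) auto
qed

lemma nn_integral_beta_scaled:
  assumes a: "a > 0" and b: "b > 0" and x: "(x::real) > 0"
  shows "(\<integral>\<^sup>+y. ennreal (if 0 < y \<and> y < x then (x - y) powr (a - 1) * y powr (b - 1) else 0) \<partial>lborel) = ennreal (x powr (a + b - 1) * Beta a b)"
proof -
  let ?f = "\<lambda>y::real. ennreal (if 0 < y \<and> y < x then (x - y) powr (a - 1) * y powr (b - 1) else 0)"
  have "(\<integral>\<^sup>+y. ?f y \<partial>lborel) = ennreal x * (\<integral>\<^sup>+u. ?f (0 + x * u) \<partial>lborel)"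
    using x by (subst nn_integral_real_affine[where c=x and t=0]) auto
  also have "(\<integral>\<^sup>+u. ?f (0 + x * u) \<partial>lborel) = (\<integral>\<^sup>+u. ennreal (x powr (a + b - 2)) * ennreal (indicator {0..1} u * (u powr (b - 1) * (1 - u) powr (a - 1))) \<partial>lborel)"
  proof (intro nn_integral_cong_AE AE_I[where N="{0, 1}"])
    have "?f (0 + x * u) = ennreal (x powr (a + b - 2)) * ennreal (indicator {0..1} u * (u powr (b - 1) * (1 - u) powr (a - 1)))" if u: "u \<noteq> 0" "u \<noteq> 1" for u
    proof (cases "0 < u \<and> u < 1")
      case True
      have "(x - x * u) powr (a - 1) * (x * u) powr (b - 1) = x powr (a - 1) * x powr (b - 1) * (u powr (b - 1) * (1 - u) powr (a - 1))"
      proof -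
        have "x - x * u = x * (1 - u)" by (simp add: algebra_simps)
        then show ?thesis using True x by (simp add: powr_mult)
      qed
      also have "x powr (a - 1) * x powr (b - 1) = x powr (a + b - 2)" by (simp flip: powr_add)
      finally show ?thesis using True x by (simp flip: ennreal_mult')
    next
      case False
      then have n: "\<not> (0 < 0 + x * u \<and> 0 + x * u < x)" using x by (auto simp: zero_less_mult_iff)
      have "u \<notin> {0..1}" using False u by auto
      then show ?thesis unfolding if_not_P[OF n] by simp
    qed
    then show "{u \<in> space lborel. ?f (0 + x * u) \<noteq> ennreal (x powr (a + b - 2)) * ennreal (indicator {0..1} u * (u powr (b - 1) * (1 - u) powr (a - 1)))} \<subseteq> {0, 1}" by blast
    show "emeasure lborel {0, 1::real} = 0" by (rule emeasure_lborel_countable) simp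
  qed auto
  also have "\<dots> = ennreal (x powr (a + b - 2)) * ennreal (Beta b a)"
  proof -
    have "(\<integral>\<^sup>+u. ennreal (indicator {0..1} u * (u powr (b - 1) * (1 - u) powr (a - 1))) \<partial>lborel) = ennreal (Beta b a)"
      using nn_integral_has_integral_lebesgue[OF _ has_integral_Beta_real[OF b a]] by simp
    then show ?thesis by (subst nn_integral_cmult) auto
  qed
  also have "ennreal x * (ennreal (x powr (a + b - 2)) * ennreal (Beta b a)) = ennreal (x powr (a + b - 1) * Beta a b)"
  proof -
    have "x * x powr (a + b - 2) = x powr (a + b - 1)" using x powr_add[of x 1 "a + b - 2"] by (simp add: algebra_simps)
    then show ?thesis using x by (simp add: Beta_commute[of b a] mult.assoc[symmetric] flip: ennreal_mult')
  qed
  finally show ?thesis .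
qed

lemma chi2_convolution:
  assumes j: "j \<ge> 1" and k: "k \<ge> 1"
  shows "convolution (chi2 j) (chi2 k) = chi2 (j + k)"
proof -
  let ?a = "real j / 2" and ?b = "real k / 2"
  let ?K = "\<lambda>k::nat. 2 powr (real k / 2) * Gamma (real k / 2)"
  have K: "?K k > 0" if "k \<ge> 1" for k using that by (intro mult_pos_pos Gamma_real_pos) auto
  have fin: "finite_measure (density lborel (\<lambda>x. ennreal (chi2_density k x)))" if "k \<ge> 1" for k
    using prob_space_chi2[OF that] unfolding chi2_def by (simp add: prob_space.finite_measure)
  have "convolution (chi2 j) (chi2 k) = density lborel (\<lambda>x. \<integral>\<^sup>+y. ennreal (chi2_density j (x - y)) * ennreal (chi2_density k y) \<partial>lborel)"
    unfolding chi2_def by (rule convolution_density) (auto intro: fin j k)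
  also have "(\<lambda>x. \<integral>\<^sup>+y. ennreal (chi2_density j (x - y)) * ennreal (chi2_density k y) \<partial>lborel) = (\<lambda>x. ennreal (chi2_density (j + k) x))"
  proof
    fix x :: real
    let ?g = "\<lambda>y. if 0 < y \<and> y < x then (x - y) powr (?a - 1) * y powr (?b - 1) else 0"
    have "ennreal (chi2_density j (x - y)) * ennreal (chi2_density k y) = ennreal (exp (- x / 2) / (?K j * ?K k)) * ennreal (?g y)" for y
    proof -
      have ee: "exp (- (x - y) / 2) * exp (- y / 2) = exp (- x / 2)"
      proof -
        have "- (x - y) / 2 + - y / 2 = - x / 2" by argo
        then show ?thesis unfolding exp_add[symmetric] by simp
      qed
      have alg: "p * e1 / K1 * (q * e2 / K2) = e1 * e2 / (K1 * K2) * (p * q)" for p q e1 e2 K1 K2 :: real by simp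
      have "chi2_density j (x - y) * chi2_density k y = exp (- x / 2) / (?K j * ?K k) * ?g y"
      proof (cases "0 < y \<and> y < x")
        case True
        then show ?thesis unfolding chi2_density_def by (simp only: if_True diff_gt_0_iff_gt simp_thms alg ee)
      next
        case False
        then show ?thesis unfolding chi2_density_def by auto
      qed
      then show ?thesis using chi2_density_nonneg[OF j] K[OF j] K[OF k] by (simp add: less_imp_le flip: ennreal_mult')
    qed
    then have "(\<integral>\<^sup>+y. ennreal (chi2_density j (x - y)) * ennreal (chi2_density k y) \<partial>lborel)
       = ennreal (exp (- x / 2) / (?K j * ?K k)) * (\<integral>\<^sup>+y. ennreal (?g y) \<partial>lborel)"
      by (simp add: nn_integral_cmult)
    also have "\<dots> = ennreal (chi2_density (j + k) x)"
    proof (cases "x > 0")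
      case True
      have "(\<integral>\<^sup>+y. ennreal (?g y) \<partial>lborel) = ennreal (x powr (?a + ?b - 1) * Beta ?a ?b)"
        using j k True by (intro nn_integral_beta_scaled) auto
      then have "ennreal (exp (- x / 2) / (?K j * ?K k)) * (\<integral>\<^sup>+y. ennreal (?g y) \<partial>lborel) = ennreal (exp (- x / 2) / (?K j * ?K k) * (x powr (?a + ?b - 1) * Beta ?a ?b))"
        using K[OF j] K[OF k] by (simp add: less_imp_le flip: ennreal_mult')
      also have "exp (- x / 2) / (?K j * ?K k) * (x powr (?a + ?b - 1) * Beta ?a ?b) = chi2_density (j + k) x"
      proof -
        have "Gamma ?a > 0" "Gamma ?b > 0" "Gamma (?a + ?b) > 0" using j k by (auto intro: Gamma_real_pos)
        moreover have alg: "e / (P * Ga * (Q * Gb)) * (X * (Ga * Gb / Gab)) = X * e / (P * Q * Gab)" if "Ga > 0" "Gb > 0" "Gab > 0" for e P Q X Ga Gb Gab :: real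
          using that by simp
        moreover have "real (j + k) / 2 = ?a + ?b" by simp
        moreover have "2 powr (?a + ?b) = 2 powr ?a * 2 powr ?b" by (rule powr_add)
        ultimately show ?thesis unfolding chi2_density_def Beta_def if_P[OF True] by metis
      qed
      finally show ?thesis .
    next
      case False
      then have g0: "ennreal (?g y) = 0" for y by auto
      show ?thesis unfolding g0 using False by (simp add: chi2_density_def)
    qed
    finally show "(\<integral>\<^sup>+y. ennreal (chi2_density j (x - y)) * ennreal (chi2_density k y) \<partial>lborel) = ennreal (chi2_density (j + k) x)" .
  qed
  finally show ?thesis unfolding chi2_def .
qed

lemma convolution_tail:
  assumes R: "real_distribution R" and V: "real_distribution V"
  shows "measure (convolution R V) {s<..} = (LINT r|R. measure V {s - r<..})"
    and "integrable R (\<lambda>r. measure V {s - r<..})"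
proof -
  interpret R: real_distribution R by fact
  interpret V: real_distribution V by fact
  have meas: "(\<lambda>r. measure V {s - r<..}) \<in> borel_measurable borel"
    by (intro borel_measurable_mono monoI V.finite_measure_mono) auto
  show i: "integrable R (\<lambda>r. measure V {s - r<..})"
    using meas by (intro R.integrable_const_bound[where B=1]) auto
  have "emeasure (convolution R V) {s<..} = (\<integral>\<^sup>+r. emeasure V {a. a + r \<in> {s<..}} \<partial>R)"
    by (rule convolution_emeasure) (auto intro: R.finite_measure_axioms V.finite_measure_axioms)
  also have "\<dots> = (\<integral>\<^sup>+r. ennreal (measure V {s - r<..}) \<partial>R)"
    by (intro nn_integral_cong) (auto simp: V.emeasure_eq_measure intro!: arg_cong[where f="measure V"])
  also have "\<dots> = ennreal (LINT r|R. measure V {s - r<..})" using i by (intro nn_integral_eq_integral) auto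
  finally show "measure (convolution R V) {s<..} = (LINT r|R. measure V {s - r<..})"
    by (simp add: measure_def Bochner_Integration.integral_nonneg)
qed

lemma chi2_AE_nonneg: "AE q in chi2 k. 0 \<le> q"
  unfolding chi2_def by (subst AE_density) (auto simp: chi2_density_def)

lemma integral_tail_diff_le:
  assumes R: "real_distribution R" and "AE r in R. 0 \<le> r" and V: "real_distribution V" and K: "real_distribution K"
    and st: "s \<le> t" and le: "\<And>u. u \<le> t \<Longrightarrow> \<bar>measure V {u<..} - measure K {u<..}\<bar> \<le> \<theta> * measure K {u<..}"
  shows "\<bar>measure (convolution R V) {s<..} - measure (convolution R K) {s<..}\<bar> \<le> \<theta> * measure (convolution R K) {s<..}"
proof -
  note cV = convolution_tail[OF R V, of s] and cK = convolution_tail[OF R K, of s]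
  have "measure (convolution R V) {s<..} - measure (convolution R K) {s<..} = (LINT r|R. measure V {s - r<..} - measure K {s - r<..})"
    unfolding cV(1) cK(1) using cV(2) cK(2) by simp
  also have "\<bar>\<dots>\<bar> \<le> (LINT r|R. \<bar>measure V {s - r<..} - measure K {s - r<..}\<bar>)" by (rule integral_abs_bound)
  also have "\<dots> \<le> (LINT r|R. \<theta> * measure K {s - r<..})"
  proof (intro integral_mono_AE)
    show "AE r in R. \<bar>measure V {s - r<..} - measure K {s - r<..}\<bar> \<le> \<theta> * measure K {s - r<..}"
      using assms(2) by eventually_elim (use st in \<open>auto intro!: le\<close>)
  qed (use cV(2) cK(2) in auto)
  also have "\<dots> = \<theta> * measure (convolution R K) {s<..}" unfolding cK(1) by simp
  finally show ?thesis .
qed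

lemma (in prob_space) sum_tail_chi2:
  fixes V :: "'i \<Rightarrow> 'a \<Rightarrow> real"
  assumes A: "finite A" "A \<noteq> {}" and "indep_vars (\<lambda>_. borel) V A"
    and "\<And>m \<omega>. m \<in> A \<Longrightarrow> \<omega> \<in> space M \<Longrightarrow> 0 \<le> V m \<omega>" and \<theta>: "0 \<le> \<theta>"
    and "\<And>m u. m \<in> A \<Longrightarrow> u \<le> t \<Longrightarrow> \<bar>prob {\<omega>\<in>space M. u < V m \<omega>} - chi2_tail 1 u\<bar> \<le> \<theta> * chi2_tail 1 u"
    and "s \<le> t"
  shows "\<bar>prob {\<omega>\<in>space M. s < (\<Sum>m\<in>A. V m \<omega>)} - chi2_tail (card A) s\<bar> \<le> ((1 + \<theta>) ^ card A - 1) * chi2_tail (card A) s"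
  using assms(1,2,3,4,6,7)
proof (induction A arbitrary: s rule: finite_ne_induct)
  case (singleton m)
  then show ?case using singleton(3)[of m s] by simp
next
  case (insert m A)
  let ?R = "\<lambda>\<omega>. \<Sum>m\<in>A. V m \<omega>" and ?k = "card A"
  have k: "?k \<ge> 1" using insert by (simp add: Suc_leI card_gt_0_iff)
  have rv: "random_variable borel (V m')" if "m' \<in> insert m A" for m'
    using insert.prems(1) that unfolding indep_vars_def by auto
  have rvR: "random_variable borel ?R" using rv by (intro borel_measurable_sum) auto
  have ind: "indep_var borel (V m) borel ?R" using insert by (intro indep_vars_sum) auto
  let ?r = "distr M borel ?R" and ?v = "distr M borel (V m)"
  have rr: "real_distribution ?r" using rvR by (rule real_distribution_distr)
  have rv': "real_distribution ?v" using rv by (intro real_distribution_distr) auto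
  interpret rr: real_distribution ?r by (rule rr)
  interpret c1: real_distribution "chi2 1" by (rule real_distribution_chi2) simp
  have vt: "measure ?v {u<..} = prob {\<omega>\<in>space M. u < V m \<omega>}" for u
    using rv[of m] by (subst measure_distr) (auto intro!: arg_cong[where f=prob])
  have rt: "measure ?r {u<..} = prob {\<omega>\<in>space M. u < ?R \<omega>}" for u
    using rvR by (subst measure_distr) (auto intro!: arg_cong[where f=prob])
  have Rpos: "AE r in ?r. 0 \<le> r"
    using rvR insert.prems(2) by (subst AE_distr_iff) (auto intro!: AE_I2 sum_nonneg)
  have step1: "\<bar>measure (convolution ?r ?v) {s<..} - measure (convolution ?r (chi2 1)) {s<..}\<bar> \<le> \<theta> * measure (convolution ?r (chi2 1)) {s<..}"
    using insert.prems(3)[of m] insert.prems(4)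
    by (intro integral_tail_diff_le[OF rr Rpos rv' c1.real_distribution_axioms]) (auto simp: vt chi2_tail_eq(2)[symmetric])
  have "indep_vars (\<lambda>_. borel) V A" using insert.prems(1) by (rule indep_vars_subset) auto
  then have IH: "\<bar>prob {\<omega>\<in>space M. u < ?R \<omega>} - chi2_tail ?k u\<bar> \<le> ((1 + \<theta>) ^ ?k - 1) * chi2_tail ?k u" if "u \<le> t" for u
    using insert.IH[of u] insert.prems that by auto
  have comm: "convolution ?r (chi2 1) = convolution (chi2 1) ?r"
    by (intro convolution_commutative rr.finite_measure_axioms c1.finite_measure_axioms) auto
  have step2: "\<bar>measure (convolution (chi2 1) ?r) {s<..} - measure (convolution (chi2 1) (chi2 ?k)) {s<..}\<bar> \<le> ((1 + \<theta>) ^ ?k - 1) * measure (convolution (chi2 1) (chi2 ?k)) {s<..}"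
    using IH insert.prems(4)
    by (intro integral_tail_diff_le[OF c1.real_distribution_axioms chi2_AE_nonneg rr real_distribution_chi2[OF k]]) (auto simp: rt chi2_tail_eq(2)[symmetric])
  have cc: "convolution (chi2 1) (chi2 ?k) = chi2 (Suc ?k)" using chi2_convolution[of 1 ?k] k by simp
  have sum: "prob {\<omega>\<in>space M. s < (\<Sum>m\<in>insert m A. V m \<omega>)} = measure (convolution ?r ?v) {s<..}"
  proof -
    interpret rv': real_distribution ?v by (rule rv')
    have "distr M borel (\<lambda>\<omega>. V m \<omega> + ?R \<omega>) = convolution ?v ?r"
      using rv rvR by (intro sum_indep_random_variable ind) auto
    also have "convolution ?v ?r = convolution ?r ?v"
      by (intro convolution_commutative rr.finite_measure_axioms rv'.finite_measure_axioms) auto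
    finally have "distr M borel (\<lambda>\<omega>. V m \<omega> + ?R \<omega>) = convolution ?r ?v" .
    then have "measure (convolution ?r ?v) {s<..} = measure (distr M borel (\<lambda>\<omega>. V m \<omega> + ?R \<omega>)) {s<..}" by simp
    also have "\<dots> = prob {\<omega>\<in>space M. s < (\<Sum>m\<in>insert m A. V m \<omega>)}"
      using rv rvR insert by (subst measure_distr) (auto intro!: arg_cong[where f=prob] simp: add.commute)
    finally show ?thesis by simp
  qed
  let ?p = "prob {\<omega>\<in>space M. s < (\<Sum>m\<in>insert m A. V m \<omega>)}" and ?c = "chi2_tail (Suc ?k) s"
  define q where "q = measure (convolution (chi2 1) ?r) {s<..}"
  define e where "e = (1 + \<theta>) ^ ?k - 1"
  have e0: "0 \<le> e" using \<theta> by (simp add: e_def)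
  have c0: "0 \<le> ?c" by (simp add: chi2_tail_def)
  have s1: "\<bar>?p - q\<bar> \<le> \<theta> * q" using step1 unfolding sum comm q_def .
  have s2: "\<bar>q - ?c\<bar> \<le> e * ?c" using step2 unfolding cc chi2_tail_eq(2)[symmetric] q_def e_def .
  have "\<theta> * q \<le> \<theta> * ((1 + e) * ?c)" using s2 \<theta> by (intro mult_left_mono) (auto simp: algebra_simps abs_le_iff)
  then have "\<bar>?p - ?c\<bar> \<le> \<theta> * ((1 + e) * ?c) + e * ?c" using s1 s2 by argo
  also have "\<dots> = ((1 + \<theta>) ^ Suc ?k - 1) * ?c" by (simp add: e_def algebra_simps)
  finally show ?case using insert by simp
qed

lemma chi2_tail_1:
  assumes s: "0 \<le> s"
  shows "chi2_tail 1 s = 2 * measure std_normal_distribution {sqrt s<..}"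
proof -
  interpret c1: real_distribution "chi2 1" by (rule real_distribution_chi2) simp
  interpret N: real_distribution std_normal_distribution by (rule real_dist_normal_dist)
  define a where "a = sqrt s"
  have a: "0 \<le> a" "a\<^sup>2 = s" using s by (auto simp: a_def)
  have seg: "measure (chi2 1) {a\<^sup>2..b\<^sup>2} = 2 * measure std_normal_distribution {a..b}" if ab: "a \<le> b" for b
  proof -
    have "emeasure (chi2 1) {a\<^sup>2..b\<^sup>2} = (\<integral>\<^sup>+x. ennreal (chi2_density 1 x * indicator {a\<^sup>2..b\<^sup>2} x) \<partial>lborel)"
      unfolding chi2_def by (subst emeasure_density) (auto simp: chi2_density_nonneg ennreal_mult' intro!: nn_integral_cong split: split_indicator)
    also have "\<dots> = (\<integral>\<^sup>+x. ennreal (chi2_density 1 (x\<^sup>2) * (2 * x) * indicator {a..b} x) \<partial>lborel)"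
      using a ab by (intro nn_integral_substitution[where g="\<lambda>x. x\<^sup>2" and g'="\<lambda>x. 2 * x"])
        (auto intro!: derivative_eq_intros continuous_intros simp: set_borel_measurable_def)
    also have "\<dots> = (\<integral>\<^sup>+x. ennreal 2 * (ennreal (std_normal_density x) * indicator {a..b} x) \<partial>lborel)"
    proof (intro nn_integral_cong_AE AE_I[where N="{0}"])
      have "ennreal (chi2_density 1 (x\<^sup>2) * (2 * x) * indicator {a..b} x) = ennreal 2 * (ennreal (std_normal_density x) * indicator {a..b} x)" if "x \<noteq> 0" for x
      proof (cases "x \<in> {a..b}")
        case True
        then have x: "x > 0" using that a by auto
        have "(x\<^sup>2) powr (1/2 - 1) = 1 / x" using x by (simp add: powr_minus_divide powr_half_sqrt)
        moreover have "2 powr (1/2) * Gamma (1/2) = sqrt (2 * pi)" by (simp add: powr_half_sqrt Gamma_one_half_real real_sqrt_mult)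
        ultimately have e: "chi2_density 1 (x\<^sup>2) * (2 * x) = 2 * std_normal_density x"
          unfolding chi2_density_def std_normal_density_def using x by simp
        have "ennreal (chi2_density 1 (x\<^sup>2) * (2 * x)) = ennreal 2 * ennreal (std_normal_density x)"
          unfolding e by (rule ennreal_mult') simp
        then show ?thesis using True by (simp only: indicator_simps mult_1_right)
      qed simp
      then show "{x \<in> space lborel. ennreal (chi2_density 1 (x\<^sup>2) * (2 * x) * indicator {a..b} x) \<noteq> ennreal 2 * (ennreal (std_normal_density x) * indicator {a..b} x)} \<subseteq> {0}" by blast
    qed auto
    also have "\<dots> = ennreal 2 * emeasure std_normal_distribution {a..b}"
      by (subst nn_integral_cmult) (auto simp: emeasure_density)
    finally have "ennreal (measure (chi2 1) {a\<^sup>2..b\<^sup>2}) = ennreal (2 * measure std_normal_distribution {a..b})"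
      unfolding c1.emeasure_eq_measure N.emeasure_eq_measure by (simp only: ennreal_mult' zero_le_numeral)
    then show ?thesis by (subst (asm) ennreal_inj) auto
  qed
  have "(\<lambda>n. measure (chi2 1) {a\<^sup>2..(a + real n)\<^sup>2}) \<longlonglongrightarrow> measure (chi2 1) (\<Union>n. {a\<^sup>2..(a + real n)\<^sup>2})"
  proof (intro c1.finite_Lim_measure_incseq)
    have "(a + real m)\<^sup>2 \<le> (a + real n)\<^sup>2" if "m \<le> n" for m n using that a by (intro power_mono) auto
    then show "incseq (\<lambda>n. {a\<^sup>2..(a + real n)\<^sup>2})" unfolding incseq_def by (meson Icc_subset_Ici_iff atLeastatMost_subset_iff order_refl)
  qed auto
  moreover have "(\<Union>n. {a\<^sup>2..(a + real n)\<^sup>2}) = {s..}"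
  proof -
    have "\<exists>n. x \<le> (a + real n)\<^sup>2" if "s \<le> x" for x
    proof -
      obtain n where n: "sqrt x \<le> real n" using real_arch_simple by blast
      have "x = (sqrt x)\<^sup>2" using that s by simp
      also have "\<dots> \<le> (a + real n)\<^sup>2" using n a that s by (intro power_mono) auto
      finally show ?thesis by blast
    qed
    then show ?thesis using a by auto
  qed
  moreover have "(\<lambda>n. 2 * measure std_normal_distribution {a..a + real n}) \<longlonglongrightarrow> 2 * measure std_normal_distribution (\<Union>n. {a..a + real n})"
    by (intro tendsto_mult tendsto_const N.finite_Lim_measure_incseq) (auto simp: incseq_def)
  moreover have "(\<Union>n. {a..a + real n}) = {a..}"
  proof -
    have "\<exists>n. x \<le> a + real n" for x using real_arch_simple[of "x - a"] by (metis add.commute diff_le_eq)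
    then show ?thesis by auto
  qed
  moreover have "measure (chi2 1) {a\<^sup>2..(a + real n)\<^sup>2} = 2 * measure std_normal_distribution {a..a + real n}" for n using seg by simp
  ultimately have "measure (chi2 1) {s..} = 2 * measure std_normal_distribution {a..}" by (simp add: LIMSEQ_unique)
  moreover have "measure std_normal_distribution {a..} = measure std_normal_distribution {a<..}"
  proof -
    have "(\<integral>\<^sup>+x. ennreal (std_normal_density x) * indicator {a..} x \<partial>lborel) = (\<integral>\<^sup>+x. ennreal (std_normal_density x) * indicator {a<..} x \<partial>lborel)"
      by (intro nn_integral_cong_AE AE_I[where N="{a}"]) (auto simp: indicator_def)
    then show ?thesis by (simp add: measure_def emeasure_density)
  qed
  ultimately show ?thesis unfolding chi2_tail_eq(1) a_def by simp
qed

section \<open>Exponential bounds for truncated arrays\<close>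

definition trunc :: "real set \<Rightarrow> real \<Rightarrow> real" where
  "trunc D y = y * indicator D y"

lemma trunc_measurable[measurable]: "D \<in> sets borel \<Longrightarrow> trunc D \<in> borel_measurable borel"
  unfolding trunc_def[abs_def] by (intro borel_measurable_times borel_measurable_indicator) auto

lemma truncated_exp_pointwise:
  fixes u v l l' \<tau> \<zeta> b b0 :: real
  assumes b0: "b0 > 0" and D: "{-b0..b0} \<subseteq> D" "D \<subseteq> {-b..b}" and l: "\<bar>l\<bar> \<le> \<tau>" "\<bar>l'\<bar> \<le> \<tau>"
    and \<zeta>: "2 * \<tau> * b0 \<le> \<zeta>" "\<zeta> \<le> 1"
  shows "exp (l * trunc D u + l' * trunc D v) \<le>
     1 + (l * u + l' * v) + (1 + \<zeta>) / 2 * (l * u + l' * v)\<^sup>2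
       + (2 * \<tau> / b0 + exp (2 * \<tau> * b) / b0\<^sup>2) * ((if b0 < \<bar>u\<bar> then u\<^sup>2 else 0) + (if b0 < \<bar>v\<bar> then v\<^sup>2 else 0))"
proof -
  define a where "a = (\<lambda>y::real. if b0 < \<bar>y\<bar> then y\<^sup>2 else 0)"
  have \<tau>0: "0 \<le> \<tau>" using l by linarith
  have "b0 \<in> D" using D b0 by auto
  then have bb: "b0 \<le> b" using D b0 by auto
  let ?Z = "l * u + l' * v"
  have a0: "0 \<le> a y" for y by (simp add: a_def)
  have Zle: "\<bar>l * y + l' * z\<bar> \<le> \<tau> * (\<bar>y\<bar> + \<bar>z\<bar>)" for y z
  proof -
    have "\<bar>l * y + l' * z\<bar> \<le> \<bar>l\<bar> * \<bar>y\<bar> + \<bar>l'\<bar> * \<bar>z\<bar>" using abs_triangle_ineq[of "l * y" "l' * z"] by (simp add: abs_mult)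
    also have "\<dots> \<le> \<tau> * \<bar>y\<bar> + \<tau> * \<bar>z\<bar>" using l by (intro add_mono mult_right_mono) auto
    finally show ?thesis by (simp add: distrib_left)
  qed
  have "exp (l * trunc D u + l' * trunc D v) \<le> 1 + ?Z + (1 + \<zeta>) / 2 * ?Z\<^sup>2 + (2 * \<tau> / b0 + exp (2 * \<tau> * b) / b0\<^sup>2) * (a u + a v)"
  proof (cases "\<bar>u\<bar> \<le> b0 \<and> \<bar>v\<bar> \<le> b0")
    case True
    then have "u \<in> {-b0..b0}" "v \<in> {-b0..b0}" by (auto simp: abs_le_iff)
    then have "u \<in> D" "v \<in> D" using D by auto
    then have t: "trunc D u = u" "trunc D v = v" by (auto simp: trunc_def)
    have "\<bar>?Z\<bar> \<le> \<tau> * (b0 + b0)" using True \<tau>0 by (intro order_trans[OF Zle] mult_left_mono) auto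
    then have Z: "\<bar>?Z\<bar> \<le> \<zeta>" using \<zeta> by simp
    then have Z1: "\<bar>?Z\<bar> \<le> 1" using \<zeta> by simp
    have z1: "exp ?Z \<le> 1 + ?Z + ?Z\<^sup>2 / 2 + \<bar>?Z\<bar> ^ 3 / 2" using abs_le_D1[OF exp_taylor_remainders(3)[OF Z1]] by simp
    have z2: "\<bar>?Z\<bar> ^ 3 \<le> \<zeta> * ?Z\<^sup>2"
    proof -
      have "\<bar>?Z\<bar> ^ 3 = \<bar>?Z\<bar> * ?Z\<^sup>2" by (simp add: power3_eq_cube power2_eq_square)
      also have "\<dots> \<le> \<zeta> * ?Z\<^sup>2" using Z by (intro mult_right_mono) auto
      finally show ?thesis .
    qed
    have "(1 + \<zeta>) / 2 * ?Z\<^sup>2 = ?Z\<^sup>2 / 2 + \<zeta> * ?Z\<^sup>2 / 2" by (simp add: add_divide_distrib distrib_right)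
    then have "exp ?Z \<le> 1 + ?Z + (1 + \<zeta>) / 2 * ?Z\<^sup>2" using z1 z2 by linarith
    moreover have "0 \<le> (2 * \<tau> / b0 + exp (2 * \<tau> * b) / b0\<^sup>2) * (a u + a v)" using \<tau>0 b0 a0 by (intro mult_nonneg_nonneg add_nonneg_nonneg) auto
    ultimately show ?thesis unfolding t by linarith
  next
    case False
    have tb: "\<bar>trunc D y\<bar> \<le> b" for y
    proof (cases "y \<in> D")
      case True
      then have "y \<in> {-b..b}" using D by blast
      then show ?thesis using True by (auto simp: trunc_def abs_le_iff)
    qed (use bb b0 in \<open>auto simp: trunc_def\<close>)
    have "\<tau> * (\<bar>trunc D u\<bar> + \<bar>trunc D v\<bar>) \<le> \<tau> * (b + b)" using tb \<tau>0 by (intro mult_left_mono add_mono) auto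
    then have "l * trunc D u + l' * trunc D v \<le> \<tau> * (b + b)"
      using Zle[of "trunc D u" "trunc D v"] by linarith
    then have 1: "exp (l * trunc D u + l' * trunc D v) \<le> exp (2 * \<tau> * b)" by simp
    have aa: "b0\<^sup>2 \<le> a u + a v"
    proof -
      have "b0\<^sup>2 \<le> y\<^sup>2" if "b0 < \<bar>y\<bar>" for y using that b0 abs_le_square_iff[of b0 y] by simp
      then have "b0\<^sup>2 \<le> a y" if "b0 < \<bar>y\<bar>" for y using that by (simp add: a_def)
      then show ?thesis using False a0[of u] a0[of v] by (metis add_increasing add_increasing2 not_le)
    qed
    have 2: "exp (2 * \<tau> * b) \<le> exp (2 * \<tau> * b) / b0\<^sup>2 * (a u + a v)"
    proof -
      have "exp (2 * \<tau> * b) / b0\<^sup>2 * b0\<^sup>2 \<le> exp (2 * \<tau> * b) / b0\<^sup>2 * (a u + a v)" using aa by (intro mult_left_mono) auto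
      then show ?thesis using b0 by simp
    qed
    have "b0 * \<bar>u\<bar> + b0 * \<bar>v\<bar> \<le> 2 * (a u + a v)"
    proof -
      have s: "b0 * \<bar>y\<bar> \<le> a y" if "b0 < \<bar>y\<bar>" for y
      proof -
        have "b0 * \<bar>y\<bar> \<le> \<bar>y\<bar> * \<bar>y\<bar>" using that by (intro mult_right_mono) auto
        then show ?thesis using that by (simp add: a_def power2_eq_square)
      qed
      have s2: "b0 * \<bar>y\<bar> \<le> b0\<^sup>2" if "\<not> b0 < \<bar>y\<bar>" for y using that b0 by (simp add: power2_eq_square mult_left_mono)
      consider "b0 < \<bar>u\<bar>" "b0 < \<bar>v\<bar>" | "b0 < \<bar>u\<bar>" "\<not> b0 < \<bar>v\<bar>" | "\<not> b0 < \<bar>u\<bar>" "b0 < \<bar>v\<bar>" using False by linarith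
      then show ?thesis
      proof cases
        case 1
        have "x + y \<le> 2 * (p + q)" if "x \<le> p" "y \<le> q" "0 \<le> p" "0 \<le> q" for x y p q :: real using that by argo
        from this[OF s[OF 1(1)] s[OF 1(2)] a0 a0] show ?thesis .
      next
        case 2
        have "x + y \<le> 2 * (p + q)" if "x \<le> p" "y \<le> w" "w \<le> p + q" "0 \<le> q" for x y p q w :: real using that by argo
        from this[OF s[OF 2(1)] s2[OF 2(2)] aa a0] show ?thesis .
      next
        case 3
        have "x + y \<le> 2 * (p + q)" if "x \<le> w" "y \<le> q" "w \<le> p + q" "0 \<le> p" for x y p q w :: real using that by argo
        from this[OF s2[OF 3(1)] s[OF 3(2)] aa a0] show ?thesis .
      qed
    qed
    then have "\<bar>u\<bar> + \<bar>v\<bar> \<le> 2 / b0 * (a u + a v)" using b0 by (simp add: field_simps)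
    then have "\<tau> * (\<bar>u\<bar> + \<bar>v\<bar>) \<le> \<tau> * (2 / b0 * (a u + a v))" using \<tau>0 by (intro mult_left_mono) auto
    then have 3: "\<bar>?Z\<bar> \<le> 2 * \<tau> / b0 * (a u + a v)" using Zle[of u v] by (simp add: ac_simps)
    have "0 \<le> 2 * \<tau> * b0" using \<tau>0 b0 by simp
    then have "0 \<le> \<zeta>" using \<zeta> by linarith
    then have 4: "0 \<le> (1 + \<zeta>) / 2 * ?Z\<^sup>2" by simp
    have 5: "(2 * \<tau> / b0 + exp (2 * \<tau> * b) / b0\<^sup>2) * (a u + a v) = 2 * \<tau> / b0 * (a u + a v) + exp (2 * \<tau> * b) / b0\<^sup>2 * (a u + a v)"
      by (rule distrib_right)
    have "0 \<le> 1 + ?Z + 2 * \<tau> / b0 * (a u + a v)" using 3 by linarith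
    then show ?thesis using 1 2 4 unfolding 5 by linarith
  qed
  then show ?thesis unfolding a_def .
qed

lemma (in prob_space) truncated_mgf_le:
  fixes U V :: "'a \<Rightarrow> real"
  assumes [measurable]: "random_variable borel U" "random_variable borel V" "D \<in> sets borel"
    and i: "integrable M (\<lambda>\<omega>. (U \<omega>)\<^sup>2)" "integrable M (\<lambda>\<omega>. (V \<omega>)\<^sup>2)"
    and E: "expectation U = 0" "expectation V = 0" "expectation (\<lambda>\<omega>. (U \<omega>)\<^sup>2) = 1" "expectation (\<lambda>\<omega>. (V \<omega>)\<^sup>2) = 1"
      "expectation (\<lambda>\<omega>. U \<omega> * V \<omega>) = 0"
    and b0: "b0 > 0" and D: "{-b0..b0} \<subseteq> D" "D \<subseteq> {-b..b}" and l: "\<bar>l\<bar> \<le> \<tau>" "\<bar>l'\<bar> \<le> \<tau>"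
    and \<zeta>: "2 * \<tau> * b0 \<le> \<zeta>" "\<zeta> \<le> 1"
    and tU: "expectation (\<lambda>\<omega>. if b0 < \<bar>U \<omega>\<bar> then (U \<omega>)\<^sup>2 else 0) \<le> b0\<^sup>2 * \<rho>"
    and tV: "expectation (\<lambda>\<omega>. if b0 < \<bar>V \<omega>\<bar> then (V \<omega>)\<^sup>2 else 0) \<le> b0\<^sup>2 * \<rho>"
  shows "expectation (\<lambda>\<omega>. exp (l * trunc D (U \<omega>) + l' * trunc D (V \<omega>))) \<le> exp ((l\<^sup>2 + l'\<^sup>2) / 2 * (1 + \<zeta>) + 4 * exp (2 * \<tau> * b) * \<rho>)"
    and "integrable M (\<lambda>\<omega>. exp (l * trunc D (U \<omega>) + l' * trunc D (V \<omega>)))"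
    and "expectation (\<lambda>\<omega>. (if b0 < \<bar>U \<omega>\<bar> then 1 else 0) * exp (l * trunc D (U \<omega>) + l' * trunc D (V \<omega>))) \<le> exp (2 * \<tau> * b) * \<rho>"
    and "0 \<le> \<rho>"
proof -
  have \<tau>0: "0 \<le> \<tau>" using l by linarith
  have "b0 \<in> D" using D b0 by auto
  then have bb: "b0 \<le> b" using D b0 by auto
  let ?a = "\<lambda>y::real. if b0 < \<bar>y\<bar> then y\<^sup>2 else 0"
  let ?c = "2 * \<tau> / b0 + exp (2 * \<tau> * b) / b0\<^sup>2"
  have iU: "integrable M U" "integrable M V" using i by (auto intro: square_integrable_imp_integrable)
  have iUV: "integrable M (\<lambda>\<omega>. U \<omega> * V \<omega>)"
  proof (rule Bochner_Integration.integrable_bound[of _ "\<lambda>\<omega>. (U \<omega>)\<^sup>2 + (V \<omega>)\<^sup>2"])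
    show "AE \<omega> in M. norm (U \<omega> * V \<omega>) \<le> norm ((U \<omega>)\<^sup>2 + (V \<omega>)\<^sup>2)"
    proof (intro AE_I2)
      fix \<omega>
      have "2 * (\<bar>U \<omega>\<bar> * \<bar>V \<omega>\<bar>) \<le> (U \<omega>)\<^sup>2 + (V \<omega>)\<^sup>2" using sum_squares_bound[of "\<bar>U \<omega>\<bar>" "\<bar>V \<omega>\<bar>"] by simp
      moreover have "0 \<le> \<bar>U \<omega>\<bar> * \<bar>V \<omega>\<bar>" by simp
      ultimately have "\<bar>U \<omega>\<bar> * \<bar>V \<omega>\<bar> \<le> (U \<omega>)\<^sup>2 + (V \<omega>)\<^sup>2" by linarith
      then show "norm (U \<omega> * V \<omega>) \<le> norm ((U \<omega>)\<^sup>2 + (V \<omega>)\<^sup>2)" by (simp add: abs_mult)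
    qed
  qed (use i in auto)
  have ia: "integrable M (\<lambda>\<omega>. ?a (U \<omega>))" "integrable M (\<lambda>\<omega>. ?a (V \<omega>))"
    by (rule Bochner_Integration.integrable_bound[OF i(1)], auto) (rule Bochner_Integration.integrable_bound[OF i(2)], auto)
  have "0 \<le> expectation (\<lambda>\<omega>. ?a (U \<omega>))" by (intro Bochner_Integration.integral_nonneg) auto
  then have "0 \<le> b0\<^sup>2 * \<rho>" using tU by linarith
  then show \<rho>0: "0 \<le> \<rho>" using b0 by (simp add: zero_le_mult_iff)
  have tb: "\<bar>trunc D y\<bar> \<le> b" for y
    proof (cases "y \<in> D")
      case True
      then have "y \<in> {-b..b}" using D by blast
      then show ?thesis using True by (auto simp: trunc_def abs_le_iff)
    qed (use bb b0 in \<open>auto simp: trunc_def\<close>)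
  have expb: "exp (l * trunc D u + l' * trunc D v) \<le> exp (2 * \<tau> * b)" for u v
  proof -
    have "l * trunc D u + l' * trunc D v \<le> \<bar>l\<bar> * \<bar>trunc D u\<bar> + \<bar>l'\<bar> * \<bar>trunc D v\<bar>"
      unfolding abs_mult[symmetric] by (intro add_mono abs_ge_self)
    also have "\<dots> \<le> \<tau> * b + \<tau> * b" using l tb \<tau>0 by (intro add_mono mult_mono) auto
    finally show ?thesis by simp
  qed
  have [measurable]: "trunc D \<in> borel_measurable borel" by measurable
  show ie: "integrable M (\<lambda>\<omega>. exp (l * trunc D (U \<omega>) + l' * trunc D (V \<omega>)))"
    using expb by (intro integrable_const_bound[where B="exp (2 * \<tau> * b)"]) auto
  have sqe: "(l * u + l' * v)\<^sup>2 = l\<^sup>2 * u\<^sup>2 + 2 * l * l' * (u * v) + l'\<^sup>2 * v\<^sup>2" for u v :: real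
    by (simp add: power2_eq_square algebra_simps)
  let ?F = "\<lambda>\<omega>. 1 + (l * U \<omega> + l' * V \<omega>) + (1 + \<zeta>) / 2 * (l\<^sup>2 * (U \<omega>)\<^sup>2 + 2 * l * l' * (U \<omega> * V \<omega>) + l'\<^sup>2 * (V \<omega>)\<^sup>2) + ?c * (?a (U \<omega>) + ?a (V \<omega>))"
  have hF: "has_bochner_integral M ?F (1 + (l * 0 + l' * 0) + (1 + \<zeta>) / 2 * (l\<^sup>2 * 1 + 2 * l * l' * 0 + l'\<^sup>2 * 1)
      + ?c * (expectation (\<lambda>\<omega>. ?a (U \<omega>)) + expectation (\<lambda>\<omega>. ?a (V \<omega>))))"
  proof (intro has_bochner_integral_add has_bochner_integral_mult_right has_bochner_integral_integrable ia)
    show "has_bochner_integral M (\<lambda>\<omega>. 1) (1::real)" by (simp add: has_bochner_integral_iff prob_space)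
    show "has_bochner_integral M U 0" "has_bochner_integral M V 0" using iU E by (auto simp: has_bochner_integral_iff)
    show "has_bochner_integral M (\<lambda>\<omega>. (U \<omega>)\<^sup>2) 1" "has_bochner_integral M (\<lambda>\<omega>. (V \<omega>)\<^sup>2) 1" using i E by (auto simp: has_bochner_integral_iff)
    show "has_bochner_integral M (\<lambda>\<omega>. U \<omega> * V \<omega>) 0" using iUV E by (auto simp: has_bochner_integral_iff)
  qed
  have "expectation (\<lambda>\<omega>. exp (l * trunc D (U \<omega>) + l' * trunc D (V \<omega>))) \<le> expectation ?F"
  proof (intro integral_mono ie)
    show "integrable M ?F" using hF by (simp only: has_bochner_integral_iff)
    fix \<omega>
    show "exp (l * trunc D (U \<omega>) + l' * trunc D (V \<omega>)) \<le> ?F \<omega>"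
      using truncated_exp_pointwise[OF b0 D l \<zeta>, of "U \<omega>" "V \<omega>"] unfolding sqe .
  qed
  also have "\<dots> = 1 + (1 + \<zeta>) / 2 * (l\<^sup>2 + l'\<^sup>2) + ?c * (expectation (\<lambda>\<omega>. ?a (U \<omega>)) + expectation (\<lambda>\<omega>. ?a (V \<omega>)))"
    using has_bochner_integral_integral_eq[OF hF] by simp
  also have "\<dots> \<le> 1 + (1 + \<zeta>) / 2 * (l\<^sup>2 + l'\<^sup>2) + ?c * (b0\<^sup>2 * \<rho> + b0\<^sup>2 * \<rho>)"
    using tU tV \<tau>0 b0 by (intro add_left_mono mult_left_mono add_mono) auto
  also have "?c * (b0\<^sup>2 * \<rho> + b0\<^sup>2 * \<rho>) = 2 * ((2 * \<tau> * b0 + exp (2 * \<tau> * b)) * \<rho>)"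
    using b0 by (simp add: field_simps power2_eq_square)
  finally have m1: "expectation (\<lambda>\<omega>. exp (l * trunc D (U \<omega>) + l' * trunc D (V \<omega>))) \<le> 1 + (1 + \<zeta>) / 2 * (l\<^sup>2 + l'\<^sup>2) + 2 * ((2 * \<tau> * b0 + exp (2 * \<tau> * b)) * \<rho>)" .
  have m2: "2 * ((2 * \<tau> * b0 + exp (2 * \<tau> * b)) * \<rho>) \<le> 2 * ((2 * exp (2 * \<tau> * b)) * \<rho>)"
  proof -
    have "0 \<le> 2 * \<tau> * b" using \<tau>0 bb b0 by simp
    then have "1 \<le> exp (2 * \<tau> * b)" by simp
    then have "2 * \<tau> * b0 + exp (2 * \<tau> * b) \<le> 2 * exp (2 * \<tau> * b)" using \<zeta> by linarith
    then show ?thesis using \<rho>0 by (intro mult_left_mono mult_right_mono) auto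
  qed
  note order_trans[OF m1 add_left_mono[OF m2]]
  also have "1 + (1 + \<zeta>) / 2 * (l\<^sup>2 + l'\<^sup>2) + 2 * ((2 * exp (2 * \<tau> * b)) * \<rho>) = 1 + ((l\<^sup>2 + l'\<^sup>2) / 2 * (1 + \<zeta>) + 4 * exp (2 * \<tau> * b) * \<rho>)"
    by algebra
  also have "\<dots> \<le> exp ((l\<^sup>2 + l'\<^sup>2) / 2 * (1 + \<zeta>) + 4 * exp (2 * \<tau> * b) * \<rho>)" by (rule exp_ge_add_one_self)
  finally show "expectation (\<lambda>\<omega>. exp (l * trunc D (U \<omega>) + l' * trunc D (V \<omega>))) \<le> exp ((l\<^sup>2 + l'\<^sup>2) / 2 * (1 + \<zeta>) + 4 * exp (2 * \<tau> * b) * \<rho>)" .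
  have "expectation (\<lambda>\<omega>. (if b0 < \<bar>U \<omega>\<bar> then 1 else 0) * exp (l * trunc D (U \<omega>) + l' * trunc D (V \<omega>))) \<le> expectation (\<lambda>\<omega>. exp (2 * \<tau> * b) / b0\<^sup>2 * ?a (U \<omega>))"
  proof (intro integral_mono integrable_mult_right ia)
    show "integrable M (\<lambda>\<omega>. (if b0 < \<bar>U \<omega>\<bar> then 1 else 0) * exp (l * trunc D (U \<omega>) + l' * trunc D (V \<omega>)))"
      using expb by (intro integrable_const_bound[where B="exp (2 * \<tau> * b)"]) auto
    fix \<omega>
    show "(if b0 < \<bar>U \<omega>\<bar> then 1 else 0) * exp (l * trunc D (U \<omega>) + l' * trunc D (V \<omega>)) \<le> exp (2 * \<tau> * b) / b0\<^sup>2 * ?a (U \<omega>)"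
    proof (cases "b0 < \<bar>U \<omega>\<bar>")
      case True
      then have "b0\<^sup>2 \<le> (U \<omega>)\<^sup>2" using b0 abs_le_square_iff[of b0 "U \<omega>"] by simp
      then have "exp (2 * \<tau> * b) / b0\<^sup>2 * b0\<^sup>2 \<le> exp (2 * \<tau> * b) / b0\<^sup>2 * (U \<omega>)\<^sup>2" by (intro mult_left_mono) auto
      then have "exp (2 * \<tau> * b) \<le> exp (2 * \<tau> * b) / b0\<^sup>2 * (U \<omega>)\<^sup>2" using b0 by simp
      from order_trans[OF expb this] show ?thesis using True by (simp only: if_True mult_1_left)
    qed simp
  qed
  also have "\<dots> \<le> exp (2 * \<tau> * b) / b0\<^sup>2 * (b0\<^sup>2 * \<rho>)" unfolding integral_mult_right_zero using tU by (intro mult_left_mono) auto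
  also have "\<dots> = exp (2 * \<tau> * b) * \<rho>" using b0 by simp
  finally show "expectation (\<lambda>\<omega>. (if b0 < \<bar>U \<omega>\<bar> then 1 else 0) * exp (l * trunc D (U \<omega>) + l' * trunc D (V \<omega>))) \<le> exp (2 * \<tau> * b) * \<rho>" .
qed

text \<open>Rounding \<open>s / T\<close> towards \<open>0\<close> on a grid of mesh \<open>1 / K\<close> loses little of its length, while each inner
  product with \<open>s\<close> is bounded below coordinatewise; the event of a long \<open>s\<close> is thus covered by
  finitely many half-spaces.\<close>

lemma grid_vector:
  fixes s :: "'m \<Rightarrow> real" and K :: nat
  assumes A: "finite A" and T: "T > 0" and K: "K > 0" and big: "T\<^sup>2 < (\<Sum>m\<in>A. (s m)\<^sup>2)"
  shows "\<exists>g\<in>PiE A (\<lambda>_. {-int K..int K}). (\<forall>m\<in>A. (real_of_int (g m) / K)\<^sup>2 * T \<le> real_of_int (g m) / K * s m)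
     \<and> 1 - 2 * real (card A) / K \<le> (\<Sum>m\<in>A. (real_of_int (g m) / K)\<^sup>2)"
proof (cases "\<exists>m\<in>A. T \<le> \<bar>s m\<bar>")
  case True
  then obtain m0 where m0: "m0 \<in> A" "T \<le> \<bar>s m0\<bar>" by blast
  define g where "g = (\<lambda>m\<in>A. if m = m0 then (if 0 \<le> s m0 then int K else - int K) else 0)"
  have sq: "(real_of_int (g m) / K)\<^sup>2 = (if m = m0 then 1 else 0)" if "m \<in> A" for m using that K by (simp add: g_def)
  have "(\<Sum>m\<in>A. (real_of_int (g m) / K)\<^sup>2) = (\<Sum>m\<in>A. if m = m0 then 1 else 0)" using sq by (intro sum.cong) auto
  also have "\<dots> = 1" using A m0 by simp
  finally have "1 - 2 * real (card A) / K \<le> (\<Sum>m\<in>A. (real_of_int (g m) / K)\<^sup>2)" by simp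
  moreover have "(real_of_int (g m) / K)\<^sup>2 * T \<le> real_of_int (g m) / K * s m" if "m \<in> A" for m
    using that m0 K unfolding sq[OF that] by (auto simp: g_def)
  moreover have "g \<in> PiE A (\<lambda>_. {-int K..int K})" by (auto simp: g_def)
  ultimately show ?thesis by blast
next
  case False
  then have lt: "\<bar>s m\<bar> < T" if "m \<in> A" for m using that by force
  define f where "f = (\<lambda>m. \<lfloor>real K * (\<bar>s m\<bar> / T)\<rfloor>)"
  define g where "g = (\<lambda>m\<in>A. if 0 \<le> s m then f m else - f m)"
  have f0: "0 \<le> f m" for m using T by (simp add: f_def)
  have fK: "f m \<le> int K" if "m \<in> A" for m
  proof -
    have "real K * (\<bar>s m\<bar> / T) \<le> real K * 1" using lt[OF that] T by (intro mult_left_mono) auto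
    then have "real_of_int (f m) \<le> real K" unfolding f_def by linarith
    then show ?thesis by linarith
  qed
  have c1: "real_of_int (f m) / K \<le> \<bar>s m\<bar> / T" for m
  proof -
    have "real_of_int (f m) \<le> real K * (\<bar>s m\<bar> / T)" unfolding f_def by (rule of_int_floor_le)
    then show ?thesis using K by (simp add: pos_divide_le_eq mult.commute)
  qed
  have c2: "\<bar>s m\<bar> / T - 1 / K \<le> real_of_int (f m) / K" for m
  proof -
    have "real K * (\<bar>s m\<bar> / T) - 1 \<le> real_of_int (f m)" unfolding f_def by linarith
    then have "(real K * (\<bar>s m\<bar> / T) - 1) / K \<le> real_of_int (f m) / K" by (intro divide_right_mono) auto
    then show ?thesis using K by (simp add: diff_divide_distrib)
  qed
  have "(\<bar>s m\<bar> / T)\<^sup>2 - 2 / K \<le> (real_of_int (g m) / K)\<^sup>2" if m: "m \<in> A" for m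
  proof -
    let ?x = "\<bar>s m\<bar> / T" and ?c = "real_of_int (f m) / K"
    have x: "0 \<le> ?x" "?x \<le> 1" using lt[OF m] T by auto
    have c: "0 \<le> ?c" "?c \<le> ?x" using f0[of m] c1[of m] by auto
    have "?x\<^sup>2 - ?c\<^sup>2 = (?x - ?c) * (?x + ?c)" by (simp add: power2_eq_square algebra_simps)
    also have "\<dots> \<le> (1 / K) * 2" using x c c2[of m] by (intro mult_mono) auto
    finally have "?x\<^sup>2 - 2 / K \<le> ?c\<^sup>2" by simp
    moreover have "(real_of_int (g m) / K)\<^sup>2 = ?c\<^sup>2" using m by (simp add: g_def)
    ultimately show ?thesis by simp
  qed
  then have "(\<Sum>m\<in>A. (\<bar>s m\<bar> / T)\<^sup>2 - 2 / K) \<le> (\<Sum>m\<in>A. (real_of_int (g m) / K)\<^sup>2)" by (rule sum_mono)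
  moreover have "(\<Sum>m\<in>A. (\<bar>s m\<bar> / T)\<^sup>2 - 2 / K) = (\<Sum>m\<in>A. (s m)\<^sup>2) / T\<^sup>2 - 2 * real (card A) / K"
    by (simp add: sum_subtractf power_divide sum_divide_distrib)
  moreover have "1 \<le> (\<Sum>m\<in>A. (s m)\<^sup>2) / T\<^sup>2" using big T by simp
  ultimately have "1 - 2 * real (card A) / K \<le> (\<Sum>m\<in>A. (real_of_int (g m) / K)\<^sup>2)" by linarith
  moreover have "(real_of_int (g m) / K)\<^sup>2 * T \<le> real_of_int (g m) / K * s m" if m: "m \<in> A" for m
  proof -
    let ?c = "real_of_int (f m) / K"
    have "?c * T \<le> \<bar>s m\<bar>" using c1[of m] T by (simp add: pos_le_divide_eq)
    then have "?c * (?c * T) \<le> ?c * \<bar>s m\<bar>" using f0[of m] by (intro mult_left_mono) auto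
    moreover have e1: "real_of_int (g m) / K * s m = ?c * \<bar>s m\<bar>" using m by (simp add: g_def)
    moreover have e2: "(real_of_int (g m) / K)\<^sup>2 = ?c\<^sup>2" using m by (simp add: g_def)
    ultimately show ?thesis unfolding e1 e2 by (simp only: power2_eq_square mult.assoc)
  qed
  moreover have "g \<in> PiE A (\<lambda>_. {-int K..int K})"
  proof (rule PiE_I)
    fix m assume m: "m \<in> A"
    show "g m \<in> {-int K..int K}" using f0[of m] fK[OF m] m by (simp add: g_def)
  qed (simp add: g_def)
  ultimately show ?thesis by blast
qed

locale truncated_array = prob_space M for M :: "'a measure" +
  fixes A :: "'m set" and I :: "'k set" and n :: nat and U V :: "'m \<times> 'k \<Rightarrow> 'a \<Rightarrow> real" and D :: "real set"
    and b0 b \<tau> \<zeta> \<rho> t :: real and K :: nat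
  assumes A: "finite A" and I: "finite I" "card I = n" "n > 0"
    and ind: "indep_vars (\<lambda>_. borel \<Otimes>\<^sub>M borel) (\<lambda>j \<omega>. (U j \<omega>, V j \<omega>)) (A \<times> I)"
    and D_sets: "D \<in> sets borel"
    and sq: "\<And>j. j \<in> A \<times> I \<Longrightarrow> integrable M (\<lambda>\<omega>. (U j \<omega>)\<^sup>2) \<and> integrable M (\<lambda>\<omega>. (V j \<omega>)\<^sup>2)"
    and E: "\<And>j. j \<in> A \<times> I \<Longrightarrow> expectation (U j) = 0 \<and> expectation (V j) = 0 \<and> expectation (\<lambda>\<omega>. (U j \<omega>)\<^sup>2) = 1
        \<and> expectation (\<lambda>\<omega>. (V j \<omega>)\<^sup>2) = 1 \<and> expectation (\<lambda>\<omega>. U j \<omega> * V j \<omega>) = 0"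
    and b0: "b0 > 0" and D: "{-b0..b0} \<subseteq> D" "D \<subseteq> {-b..b}"
    and t: "t > 0" and \<tau>: "\<tau> = sqrt (t / n)"
    and \<zeta>: "2 * \<tau> * b0 \<le> \<zeta>" "\<zeta> \<le> 1"
    and tail: "\<And>j. j \<in> A \<times> I \<Longrightarrow> expectation (\<lambda>\<omega>. if b0 < \<bar>U j \<omega>\<bar> then (U j \<omega>)\<^sup>2 else 0) \<le> b0\<^sup>2 * \<rho>
        \<and> expectation (\<lambda>\<omega>. if b0 < \<bar>V j \<omega>\<bar> then (V j \<omega>)\<^sup>2 else 0) \<le> b0\<^sup>2 * \<rho>"
    and K: "K > 0" "2 * real (card A) \<le> real K"
begin

lemma rv: "j \<in> A \<times> I \<Longrightarrow> random_variable borel (U j)" "j \<in> A \<times> I \<Longrightarrow> random_variable borel (V j)"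
proof -
  assume "j \<in> A \<times> I"
  then have "(\<lambda>\<omega>. (U j \<omega>, V j \<omega>)) \<in> measurable M (borel \<Otimes>\<^sub>M borel)" using ind unfolding indep_vars_def by auto
  from measurable_compose[OF this measurable_fst] measurable_compose[OF this measurable_snd]
  show "random_variable borel (U j)" "random_variable borel (V j)" by simp_all
qed

lemma \<tau>_pos: "\<tau> > 0" using t I \<tau> by simp
lemma \<tau>_sq: "real n * \<tau>\<^sup>2 = t" using t I \<tau> by simp
lemma \<tau>_sqrt: "\<tau> * sqrt (n * t) = t"
proof -
  have "\<tau> * sqrt (n * t) = sqrt (t / n * (n * t))" unfolding \<tau> by (rule real_sqrt_mult[symmetric])
  also have "t / n * (n * t) = t\<^sup>2" using I by (simp add: power2_eq_square)
  finally show ?thesis using t by simp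
qed

text \<open>On the marked set \<open>H\<close> the entries are required to exceed \<open>b0\<close>; \<open>H = {}\<close> gives the plain bound and singletons
  bound the effect of lowering the truncation from \<open>b\<close> to \<open>b0\<close>.\<close>

lemma marked_mgf_le:
  assumes c: "\<forall>m\<in>A. \<bar>c m\<bar> \<le> 1" "\<forall>m\<in>A. \<bar>c' m\<bar> \<le> 1" and H: "H \<subseteq> A \<times> I"
  shows "expectation (\<lambda>\<omega>. \<Prod>j\<in>A \<times> I. (if j \<in> H \<and> \<not> b0 < \<bar>U j \<omega>\<bar> then 0 else 1) * exp (\<tau> * c (fst j) * trunc D (U j \<omega>) + \<tau> * c' (fst j) * trunc D (V j \<omega>)))
     \<le> exp (t / 2 * (1 + \<zeta>) * (\<Sum>m\<in>A. (c m)\<^sup>2 + (c' m)\<^sup>2) + 4 * n * card A * exp (2 * \<tau> * b) * \<rho>) * (exp (2 * \<tau> * b) * \<rho>) ^ card H" (is "expectation (\<lambda>\<omega>. \<Prod>j\<in>_. ?f j \<omega>) \<le> _")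
    and "integrable M (\<lambda>\<omega>. \<Prod>j\<in>A \<times> I. (if j \<in> H \<and> \<not> b0 < \<bar>U j \<omega>\<bar> then 0 else 1) * exp (\<tau> * c (fst j) * trunc D (U j \<omega>) + \<tau> * c' (fst j) * trunc D (V j \<omega>)))"
proof -
  let ?J = "A \<times> I"
  have fJ: "finite ?J" using A I by simp
  have fH: "finite H" using H fJ finite_subset by blast
  have tr[measurable]: "trunc D \<in> borel_measurable borel" using D_sets by simp
  have indf: "indep_vars (\<lambda>_. borel) ?f ?J"
  proof -
    have "indep_vars (\<lambda>_. borel) (\<lambda>j \<omega>. (\<lambda>j p. (if j \<in> H \<and> \<not> b0 < \<bar>fst p\<bar> then 0 else 1) * exp (\<tau> * c (fst j) * trunc D (fst p) + \<tau> * c' (fst j) * trunc D (snd p))) j (U j \<omega>, V j \<omega>)) ?J"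
      by (rule indep_vars_compose2[OF ind]) measurable
    then show ?thesis by simp
  qed
  let ?e = "\<lambda>j. (\<tau>\<^sup>2 * ((c (fst j))\<^sup>2 + (c' (fst j))\<^sup>2)) / 2 * (1 + \<zeta>) + 4 * exp (2 * \<tau> * b) * \<rho>"
  have tc: "\<bar>\<tau> * x\<bar> \<le> \<tau>" if "\<bar>x\<bar> \<le> 1" for x using that \<tau>_pos by (simp add: abs_mult)
  have L: "expectation (\<lambda>\<omega>. exp (\<tau> * c (fst j) * trunc D (U j \<omega>) + \<tau> * c' (fst j) * trunc D (V j \<omega>))) \<le> exp (?e j)"
      "integrable M (\<lambda>\<omega>. exp (\<tau> * c (fst j) * trunc D (U j \<omega>) + \<tau> * c' (fst j) * trunc D (V j \<omega>)))"
      "expectation (\<lambda>\<omega>. (if b0 < \<bar>U j \<omega>\<bar> then 1 else 0) * exp (\<tau> * c (fst j) * trunc D (U j \<omega>) + \<tau> * c' (fst j) * trunc D (V j \<omega>))) \<le> exp (2 * \<tau> * b) * \<rho>" "0 \<le> \<rho>"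
    if j: "j \<in> ?J" for j
  proof -
    have m: "fst j \<in> A" using j by auto
    have s: "integrable M (\<lambda>\<omega>. (U j \<omega>)\<^sup>2)" "integrable M (\<lambda>\<omega>. (V j \<omega>)\<^sup>2)" using sq[OF j] by auto
    have e: "expectation (U j) = 0" "expectation (V j) = 0" "expectation (\<lambda>\<omega>. (U j \<omega>)\<^sup>2) = 1"
      "expectation (\<lambda>\<omega>. (V j \<omega>)\<^sup>2) = 1" "expectation (\<lambda>\<omega>. U j \<omega> * V j \<omega>) = 0" using E[OF j] by auto
    note T = truncated_mgf_le[OF rv(1)[OF j] rv(2)[OF j] D_sets s e b0 D tc[OF bspec[OF c(1) m]] tc[OF bspec[OF c(2) m]] \<zeta> conjunct1[OF tail[OF j]] conjunct2[OF tail[OF j]]]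
    have "(\<tau> * c (fst j))\<^sup>2 + (\<tau> * c' (fst j))\<^sup>2 = \<tau>\<^sup>2 * ((c (fst j))\<^sup>2 + (c' (fst j))\<^sup>2)" by (simp only: power_mult_distrib distrib_left)
    then show "expectation (\<lambda>\<omega>. exp (\<tau> * c (fst j) * trunc D (U j \<omega>) + \<tau> * c' (fst j) * trunc D (V j \<omega>))) \<le> exp (?e j)"
      using T(1) by (simp only:)
    show "integrable M (\<lambda>\<omega>. exp (\<tau> * c (fst j) * trunc D (U j \<omega>) + \<tau> * c' (fst j) * trunc D (V j \<omega>)))" by (rule T(2))
    show "expectation (\<lambda>\<omega>. (if b0 < \<bar>U j \<omega>\<bar> then 1 else 0) * exp (\<tau> * c (fst j) * trunc D (U j \<omega>) + \<tau> * c' (fst j) * trunc D (V j \<omega>))) \<le> exp (2 * \<tau> * b) * \<rho>" by (rule T(3))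
    show "0 \<le> \<rho>" by (rule T(4))
  qed
  have intf: "integrable M (?f j)" if j: "j \<in> ?J" for j
    using rv[OF j] by (intro Bochner_Integration.integrable_bound[OF L(2)[OF j]]) auto
  show "integrable M (\<lambda>\<omega>. \<Prod>j\<in>?J. ?f j \<omega>)" by (rule indep_vars_integrable[OF fJ indf intf])
  have Ef: "expectation (?f j) \<le> (if j \<in> H then exp (2 * \<tau> * b) * \<rho> else 1) * exp (?e j)" if j: "j \<in> ?J" for j
  proof (cases "j \<in> H")
    case True
    have "?f j = (\<lambda>\<omega>. (if b0 < \<bar>U j \<omega>\<bar> then 1 else 0) * exp (\<tau> * c (fst j) * trunc D (U j \<omega>) + \<tau> * c' (fst j) * trunc D (V j \<omega>)))" using True by auto
    then have "expectation (?f j) \<le> exp (2 * \<tau> * b) * \<rho>" using L(3)[OF j] by simp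
    also have "\<dots> \<le> exp (2 * \<tau> * b) * \<rho> * exp (?e j)"
    proof -
      have "0 \<le> 2 * \<tau> * b0" using \<tau>_pos b0 by simp
      then have "0 \<le> \<zeta>" using \<zeta> by linarith
      then have "0 \<le> ?e j" using L(4)[OF j] by simp
      then have "1 \<le> exp (?e j)" by simp
      then have "exp (2 * \<tau> * b) * \<rho> * 1 \<le> exp (2 * \<tau> * b) * \<rho> * exp (?e j)" using L(4)[OF j] by (intro mult_left_mono) auto
      then show ?thesis by simp
    qed
    finally show ?thesis using True by simp
  next
    case False
    then show ?thesis using L(1)[OF j] by simp
  qed
  have E0: "0 \<le> expectation (?f j)" for j by (intro Bochner_Integration.integral_nonneg) auto
  have "expectation (\<lambda>\<omega>. \<Prod>j\<in>?J. ?f j \<omega>) = (\<Prod>j\<in>?J. expectation (?f j))" by (rule indep_vars_lebesgue_integral[OF fJ indf intf])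
  also have "\<dots> \<le> (\<Prod>j\<in>?J. (if j \<in> H then exp (2 * \<tau> * b) * \<rho> else 1) * exp (?e j))"
    using Ef E0 by (intro prod_mono) auto
  also have "\<dots> = (\<Prod>j\<in>?J. if j \<in> H then exp (2 * \<tau> * b) * \<rho> else 1) * exp (\<Sum>j\<in>?J. ?e j)"
    using fJ by (simp add: prod.distrib exp_sum)
  also have "(\<Prod>j\<in>?J. if j \<in> H then exp (2 * \<tau> * b) * \<rho> else 1) = (exp (2 * \<tau> * b) * \<rho>) ^ card H"
  proof -
    have "?J \<inter> H = H" using H by auto
    then show ?thesis using fJ by (simp add: prod.If_cases)
  qed
  also have "(\<Sum>j\<in>?J. ?e j) = t / 2 * (1 + \<zeta>) * (\<Sum>m\<in>A. (c m)\<^sup>2 + (c' m)\<^sup>2) + 4 * n * card A * exp (2 * \<tau> * b) * \<rho>"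
  proof -
    have "(\<Sum>j\<in>?J. ?e j) = (\<Sum>m\<in>A. \<Sum>k\<in>I. (\<tau>\<^sup>2 * ((c m)\<^sup>2 + (c' m)\<^sup>2)) / 2 * (1 + \<zeta>) + 4 * exp (2 * \<tau> * b) * \<rho>)"
      by (subst sum.cartesian_product) (auto intro!: sum.cong)
    also have "\<dots> = (\<Sum>m\<in>A. (real n * \<tau>\<^sup>2) / 2 * (1 + \<zeta>) * ((c m)\<^sup>2 + (c' m)\<^sup>2) + 4 * n * exp (2 * \<tau> * b) * \<rho>)"
      using I by (intro sum.cong) (auto simp: algebra_simps)
    also have "\<dots> = t / 2 * (1 + \<zeta>) * (\<Sum>m\<in>A. (c m)\<^sup>2 + (c' m)\<^sup>2) + 4 * n * card A * exp (2 * \<tau> * b) * \<rho>"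
      unfolding \<tau>_sq by (subst sum.distrib, simp only: sum_distrib_left[symmetric] sum_constant) simp
    finally show ?thesis .
  qed
  finally show "expectation (\<lambda>\<omega>. \<Prod>j\<in>?J. ?f j \<omega>) \<le> exp (t / 2 * (1 + \<zeta>) * (\<Sum>m\<in>A. (c m)\<^sup>2 + (c' m)\<^sup>2) + 4 * n * card A * exp (2 * \<tau> * b) * \<rho>) * (exp (2 * \<tau> * b) * \<rho>) ^ card H"
    by (simp add: mult.commute)
qed

definition "S m \<omega> = (\<Sum>k\<in>I. trunc D (U (m, k) \<omega>))"
definition "S' m \<omega> = (\<Sum>k\<in>I. trunc D (V (m, k) \<omega>))"

lemma S_meas: "m \<in> A \<Longrightarrow> random_variable borel (S m)" "m \<in> A \<Longrightarrow> random_variable borel (S' m)"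
proof -
  assume m: "m \<in> A"
  have tr[measurable]: "trunc D \<in> borel_measurable borel" using D_sets by simp
  have "random_variable borel (\<lambda>\<omega>. trunc D (U (m, k) \<omega>))" "random_variable borel (\<lambda>\<omega>. trunc D (V (m, k) \<omega>))" if "k \<in> I" for k
    using measurable_compose[OF rv(1)[of "(m, k)"] tr] measurable_compose[OF rv(2)[of "(m, k)"] tr] m that by simp_all
  then show "random_variable borel (S m)" "random_variable borel (S' m)"
    unfolding S_def S'_def by (auto intro!: borel_measurable_sum)
qed

lemma chernoff:
  assumes c: "\<forall>m\<in>A. \<bar>c m\<bar> \<le> 1" "\<forall>m\<in>A. \<bar>c' m\<bar> \<le> 1" and H: "H \<subseteq> A \<times> I"
  shows "prob {\<omega>\<in>space M. (\<forall>m\<in>A. (c m)\<^sup>2 * sqrt (n * t) \<le> c m * S m \<omega> \<and> (c' m)\<^sup>2 * sqrt (n * t) \<le> c' m * S' m \<omega>) \<and> (\<forall>j\<in>H. b0 < \<bar>U j \<omega>\<bar>)}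
     \<le> exp (- (t / 2 * (1 - \<zeta>) * (\<Sum>m\<in>A. (c m)\<^sup>2 + (c' m)\<^sup>2)) + 4 * n * card A * exp (2 * \<tau> * b) * \<rho>) * (exp (2 * \<tau> * b) * \<rho>) ^ card H"
    (is "prob ?E \<le> _")
    and "{\<omega>\<in>space M. (\<forall>m\<in>A. (c m)\<^sup>2 * sqrt (n * t) \<le> c m * S m \<omega> \<and> (c' m)\<^sup>2 * sqrt (n * t) \<le> c' m * S' m \<omega>) \<and> (\<forall>j\<in>H. b0 < \<bar>U j \<omega>\<bar>)} \<in> events"
proof -
  let ?f = "\<lambda>\<omega>. \<Prod>j\<in>A \<times> I. (if j \<in> H \<and> \<not> b0 < \<bar>U j \<omega>\<bar> then 0 else 1) * exp (\<tau> * c (fst j) * trunc D (U j \<omega>) + \<tau> * c' (fst j) * trunc D (V j \<omega>))"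
  let ?x = "t * (\<Sum>m\<in>A. (c m)\<^sup>2 + (c' m)\<^sup>2)"
  note mgf = marked_mgf_le[OF c H]
  have fJ: "finite (A \<times> I)" using A I by simp
  have ptw: "exp ?x * indicator ?E \<omega> \<le> ?f \<omega>" for \<omega>
  proof (cases "\<omega> \<in> ?E")
    case True
    have "?f \<omega> = (\<Prod>j\<in>A \<times> I. exp (\<tau> * c (fst j) * trunc D (U j \<omega>) + \<tau> * c' (fst j) * trunc D (V j \<omega>)))"
      using True by (intro prod.cong) auto
    also have "\<dots> = exp (\<Sum>j\<in>A \<times> I. \<tau> * c (fst j) * trunc D (U j \<omega>) + \<tau> * c' (fst j) * trunc D (V j \<omega>))"
      using fJ by (simp add: exp_sum)
    also have "(\<Sum>j\<in>A \<times> I. \<tau> * c (fst j) * trunc D (U j \<omega>) + \<tau> * c' (fst j) * trunc D (V j \<omega>))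
        = (\<Sum>m\<in>A. \<Sum>k\<in>I. \<tau> * c m * trunc D (U (m, k) \<omega>) + \<tau> * c' m * trunc D (V (m, k) \<omega>))"
      by (subst sum.cartesian_product) (auto intro!: sum.cong)
    also have "\<dots> = (\<Sum>m\<in>A. \<tau> * (c m * S m \<omega> + c' m * S' m \<omega>))"
      unfolding S_def S'_def by (simp add: sum.distrib sum_distrib_left mult.assoc distrib_left)
    finally have eqf: "?f \<omega> = exp (\<Sum>m\<in>A. \<tau> * (c m * S m \<omega> + c' m * S' m \<omega>))" .
    have "\<tau> * ((c m)\<^sup>2 * sqrt (n * t) + (c' m)\<^sup>2 * sqrt (n * t)) = (\<tau> * sqrt (n * t)) * ((c m)\<^sup>2 + (c' m)\<^sup>2)" for m by (simp only: algebra_simps)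
    then have "?x = (\<Sum>m\<in>A. \<tau> * ((c m)\<^sup>2 * sqrt (n * t) + (c' m)\<^sup>2 * sqrt (n * t)))" unfolding \<tau>_sqrt by (simp only: sum_distrib_left)
    also have "\<dots> \<le> (\<Sum>m\<in>A. \<tau> * (c m * S m \<omega> + c' m * S' m \<omega>))"
      using True \<tau>_pos by (intro sum_mono mult_left_mono add_mono) auto
    finally have "exp ?x \<le> ?f \<omega>" unfolding eqf by simp
    then show ?thesis using True by (simp only: indicator_simps mult_1_right)
  next
    case False
    have "0 \<le> ?f \<omega>" by (intro prod_nonneg) auto
    then show ?thesis using False by simp
  qed
  show E_sets: "?E \<in> events"
  proof -
    have "{\<omega>\<in>space M. \<forall>m\<in>A. (c m)\<^sup>2 * sqrt (n * t) \<le> c m * S m \<omega> \<and> (c' m)\<^sup>2 * sqrt (n * t) \<le> c' m * S' m \<omega>} \<in> events"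
    proof (rule sets.sets_Collect_finite_All[OF _ A])
      fix m assume "m \<in> A"
      note [measurable] = S_meas[OF this]
      show "{\<omega>\<in>space M. (c m)\<^sup>2 * sqrt (n * t) \<le> c m * S m \<omega> \<and> (c' m)\<^sup>2 * sqrt (n * t) \<le> c' m * S' m \<omega>} \<in> events" by measurable
    qed
    moreover have "{\<omega>\<in>space M. \<forall>j\<in>H. b0 < \<bar>U j \<omega>\<bar>} \<in> events"
    proof (rule sets.sets_Collect_finite_All)
      fix j assume "j \<in> H"
      then have "j \<in> A \<times> I" using H by blast
      note [measurable] = rv(1)[OF this]
      show "{\<omega>\<in>space M. b0 < \<bar>U j \<omega>\<bar>} \<in> events" by measurable
    qed (use H fJ finite_subset in blast)
    ultimately have "{\<omega>\<in>space M. \<forall>m\<in>A. (c m)\<^sup>2 * sqrt (n * t) \<le> c m * S m \<omega> \<and> (c' m)\<^sup>2 * sqrt (n * t) \<le> c' m * S' m \<omega>} \<inter> {\<omega>\<in>space M. \<forall>j\<in>H. b0 < \<bar>U j \<omega>\<bar>} \<in> events"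
      by (rule sets.Int)
    moreover have "{\<omega>\<in>space M. \<forall>m\<in>A. (c m)\<^sup>2 * sqrt (n * t) \<le> c m * S m \<omega> \<and> (c' m)\<^sup>2 * sqrt (n * t) \<le> c' m * S' m \<omega>} \<inter> {\<omega>\<in>space M. \<forall>j\<in>H. b0 < \<bar>U j \<omega>\<bar>} = ?E" by blast
    ultimately show ?thesis by simp
  qed
  have "exp ?x * prob ?E = expectation (\<lambda>\<omega>. exp ?x * indicator ?E \<omega>)" using E_sets by simp
  also have "\<dots> \<le> expectation ?f" using E_sets mgf(2) ptw by (intro integral_mono) (auto simp: less_top[symmetric])
  also note mgf(1)
  finally have "exp (- ?x) * (exp ?x * prob ?E) \<le> exp (- ?x) * (exp (t / 2 * (1 + \<zeta>) * (\<Sum>m\<in>A. (c m)\<^sup>2 + (c' m)\<^sup>2) + 4 * n * card A * exp (2 * \<tau> * b) * \<rho>) * (exp (2 * \<tau> * b) * \<rho>) ^ card H)"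
    by (intro mult_left_mono) auto
  also have "\<dots> = exp (- (t / 2 * (1 - \<zeta>) * (\<Sum>m\<in>A. (c m)\<^sup>2 + (c' m)\<^sup>2)) + 4 * n * card A * exp (2 * \<tau> * b) * \<rho>) * (exp (2 * \<tau> * b) * \<rho>) ^ card H"
  proof -
    have "- (t * X) + (t / 2 * (1 + \<zeta>) * X) = - (t / 2 * (1 - \<zeta>) * X)" for X by argo
    from this[of "\<Sum>m\<in>A. (c m)\<^sup>2 + (c' m)\<^sup>2"] have "exp (- ?x) * exp (t / 2 * (1 + \<zeta>) * (\<Sum>m\<in>A. (c m)\<^sup>2 + (c' m)\<^sup>2) + 4 * n * card A * exp (2 * \<tau> * b) * \<rho>) = exp (- (t / 2 * (1 - \<zeta>) * (\<Sum>m\<in>A. (c m)\<^sup>2 + (c' m)\<^sup>2)) + 4 * n * card A * exp (2 * \<tau> * b) * \<rho>)"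
      unfolding exp_add[symmetric] by (simp only: add.assoc[symmetric])
    then show ?thesis by (simp only: mult.assoc[symmetric])
  qed
  also have "exp (- ?x) * (exp ?x * prob ?E) = prob ?E" by (simp add: exp_minus)
  finally show "prob ?E \<le> exp (- (t / 2 * (1 - \<zeta>) * (\<Sum>m\<in>A. (c m)\<^sup>2 + (c' m)\<^sup>2)) + 4 * n * card A * exp (2 * \<tau> * b) * \<rho>) * (exp (2 * \<tau> * b) * \<rho>) ^ card H" .
qed

abbreviation "grid \<equiv> {g \<in> PiE A (\<lambda>_. {-int K..int K}). 1 - 2 * real (card A) / K \<le> (\<Sum>m\<in>A. (real_of_int (g m) / K)\<^sup>2)}"

lemma finite_grid: "finite grid" and card_grid: "card grid \<le> (2 * K + 1) ^ card A"
proof -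
  have f: "finite (PiE A (\<lambda>_. {-int K..int K}))" using A by (intro finite_PiE) auto
  then show "finite grid" by simp
  have "card grid \<le> card (PiE A (\<lambda>_. {-int K..int K}))" using f by (intro card_mono) auto
  also have "\<dots> = (2 * K + 1) ^ card A"
  proof -
    have "card {-int K..int K} = 2 * K + 1" by simp
    then show ?thesis using A by (simp add: card_PiE)
  qed
  finally show "card grid \<le> (2 * K + 1) ^ card A" .
qed

lemma grid_le_1: "g \<in> grid \<Longrightarrow> m \<in> A \<Longrightarrow> \<bar>real_of_int (g m) / K\<bar> \<le> 1"
proof -
  assume "g \<in> grid" "m \<in> A"
  then have "g m \<in> {-int K..int K}" by (auto simp: PiE_iff)
  then have "\<bar>g m\<bar> \<le> int K" by auto
  then have "\<bar>real_of_int (g m)\<bar> \<le> real K" by linarith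
  then show ?thesis using K by simp
qed

lemma grid_exists:
  assumes "n * t < (\<Sum>m\<in>A. (s m)\<^sup>2)"
  shows "\<exists>g\<in>grid. \<forall>m\<in>A. (real_of_int (g m) / K)\<^sup>2 * sqrt (n * t) \<le> real_of_int (g m) / K * s m"
proof -
  have "0 < sqrt (n * t)" "(sqrt (n * t))\<^sup>2 < (\<Sum>m\<in>A. (s m)\<^sup>2)" using t I assms by auto
  from grid_vector[OF A this(1) K(1) this(2)] show ?thesis by auto
qed

lemma exponent_le:
  assumes "r * (1 - 2 * real (card A) / K) \<le> B"
  shows "exp (- (t / 2 * (1 - \<zeta>) * B) + e) \<le> exp (- (t / 2 * (1 - \<zeta>) * (r * (1 - 2 * real (card A) / K))) + e)"
proof -
  have "t / 2 * (1 - \<zeta>) * (r * (1 - 2 * real (card A) / K)) \<le> t / 2 * (1 - \<zeta>) * B"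
    using assms t \<zeta> by (intro mult_left_mono) auto
  then show ?thesis by simp
qed

lemma rho_nonneg: "A \<noteq> {} \<Longrightarrow> 0 \<le> \<rho>"
proof -
  assume "A \<noteq> {}"
  then obtain j where j: "j \<in> A \<times> I" using I by (metis card.empty ex_in_conv mem_Sigma_iff less_numeral_extra(3))
  have "0 \<le> expectation (\<lambda>\<omega>. if b0 < \<bar>U j \<omega>\<bar> then (U j \<omega>)\<^sup>2 else 0)" by (intro Bochner_Integration.integral_nonneg) auto
  then have "0 \<le> b0\<^sup>2 * \<rho>" using tail[OF j] by linarith
  then show ?thesis using b0 by (simp add: zero_le_mult_iff)
qed

lemma exceed_marked:
  assumes H: "H \<subseteq> A \<times> I" and ne: "A \<noteq> {}"
  shows "prob {\<omega>\<in>space M. n * t < (\<Sum>m\<in>A. (S m \<omega>)\<^sup>2) \<and> (\<forall>j\<in>H. b0 < \<bar>U j \<omega>\<bar>)}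
    \<le> (2 * real K + 1) ^ card A * (exp (- (t / 2 * (1 - \<zeta>) * (1 - 2 * real (card A) / K)) + 4 * n * card A * exp (2 * \<tau> * b) * \<rho>) * (exp (2 * \<tau> * b) * \<rho>) ^ card H)"
proof -
  let ?c = "\<lambda>g m. real_of_int (g m) / K"
  let ?E = "\<lambda>g. {\<omega>\<in>space M. (\<forall>m\<in>A. (?c g m)\<^sup>2 * sqrt (n * t) \<le> ?c g m * S m \<omega> \<and> (0::real)\<^sup>2 * sqrt (n * t) \<le> 0 * S' m \<omega>) \<and> (\<forall>j\<in>H. b0 < \<bar>U j \<omega>\<bar>)}"
  let ?B = "exp (- (t / 2 * (1 - \<zeta>) * (1 - 2 * real (card A) / K)) + 4 * n * card A * exp (2 * \<tau> * b) * \<rho>) * (exp (2 * \<tau> * b) * \<rho>) ^ card H"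
  have ch: "prob (?E g) \<le> ?B" "?E g \<in> events" if g: "g \<in> grid" for g
  proof -
    have 0: "\<forall>m\<in>A. \<bar>?c g m\<bar> \<le> 1" "\<forall>m\<in>A. \<bar>0::real\<bar> \<le> 1" using grid_le_1[OF g] by auto
    note C = chernoff[where c="?c g" and c'="\<lambda>_. 0", OF 0 H]
    have "1 * (1 - 2 * real (card A) / K) \<le> (\<Sum>m\<in>A. (?c g m)\<^sup>2 + 0\<^sup>2)" using g by simp
    from exponent_le[OF this] have "exp (- (t / 2 * (1 - \<zeta>) * (\<Sum>m\<in>A. (?c g m)\<^sup>2 + 0\<^sup>2)) + 4 * n * card A * exp (2 * \<tau> * b) * \<rho>) * (exp (2 * \<tau> * b) * \<rho>) ^ card H \<le> ?B"
      using rho_nonneg[OF ne] by (intro mult_right_mono) (auto simp: mult_1_left)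
    then show "prob (?E g) \<le> ?B" using C(1) by (rule order_trans[rotated])
    show "?E g \<in> events" by (rule C(2))
  qed
  have "prob {\<omega>\<in>space M. n * t < (\<Sum>m\<in>A. (S m \<omega>)\<^sup>2) \<and> (\<forall>j\<in>H. b0 < \<bar>U j \<omega>\<bar>)} \<le> prob (\<Union>g\<in>grid. ?E g)"
  proof (intro finite_measure_mono)
    show "{\<omega>\<in>space M. n * t < (\<Sum>m\<in>A. (S m \<omega>)\<^sup>2) \<and> (\<forall>j\<in>H. b0 < \<bar>U j \<omega>\<bar>)} \<subseteq> (\<Union>g\<in>grid. ?E g)"
    proof
      fix \<omega> assume w: "\<omega> \<in> {\<omega>\<in>space M. n * t < (\<Sum>m\<in>A. (S m \<omega>)\<^sup>2) \<and> (\<forall>j\<in>H. b0 < \<bar>U j \<omega>\<bar>)}"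
      then obtain g where g: "g \<in> grid" "\<forall>m\<in>A. (?c g m)\<^sup>2 * sqrt (n * t) \<le> ?c g m * S m \<omega>" using grid_exists[of "\<lambda>m. S m \<omega>"] by auto
      then have "\<omega> \<in> ?E g" using w by simp
      then show "\<omega> \<in> (\<Union>g\<in>grid. ?E g)" using g(1) by blast
    qed
    show "(\<Union>g\<in>grid. ?E g) \<in> events" using ch(2) finite_grid by (intro sets.finite_UN) auto
  qed
  also have "\<dots> \<le> (\<Sum>g\<in>grid. prob (?E g))" using ch(2) finite_grid by (intro measure_UNION_le) auto
  also have "\<dots> \<le> (\<Sum>g\<in>grid. ?B)" by (intro sum_mono ch)
  also have "\<dots> = real (card grid) * ?B" by simp
  also have "\<dots> \<le> (2 * real K + 1) ^ card A * ?B"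
  proof (intro mult_right_mono)
    have "real (card grid) \<le> real ((2 * K + 1) ^ card A)" using card_grid by (simp only: of_nat_le_iff)
    then show "real (card grid) \<le> (2 * real K + 1) ^ card A" by (simp add: add.commute)
  qed (use rho_nonneg[OF ne] in auto)
  finally show ?thesis .
qed

lemma exceed_pair:
  assumes ne: "A \<noteq> {}"
  shows "prob {\<omega>\<in>space M. n * t < (\<Sum>m\<in>A. (S m \<omega>)\<^sup>2) \<and> n * t < (\<Sum>m\<in>A. (S' m \<omega>)\<^sup>2)}
    \<le> ((2 * real K + 1) ^ card A)\<^sup>2 * exp (- (t * (1 - \<zeta>) * (1 - 2 * real (card A) / K)) + 4 * n * card A * exp (2 * \<tau> * b) * \<rho>)"
proof -
  let ?c = "\<lambda>g m. real_of_int (g m) / K"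
  let ?E = "\<lambda>p. {\<omega>\<in>space M. (\<forall>m\<in>A. (?c (fst p) m)\<^sup>2 * sqrt (n * t) \<le> ?c (fst p) m * S m \<omega> \<and> (?c (snd p) m)\<^sup>2 * sqrt (n * t) \<le> ?c (snd p) m * S' m \<omega>) \<and> (\<forall>j\<in>{}. b0 < \<bar>U j \<omega>\<bar>)}"
  let ?B = "exp (- (t * (1 - \<zeta>) * (1 - 2 * real (card A) / K)) + 4 * n * card A * exp (2 * \<tau> * b) * \<rho>)"
  have ch: "prob (?E p) \<le> ?B" "?E p \<in> events" if p: "p \<in> grid \<times> grid" for p
  proof -
    have g: "fst p \<in> grid" "snd p \<in> grid" using p by auto
    have 0: "\<forall>m\<in>A. \<bar>?c (fst p) m\<bar> \<le> 1" "\<forall>m\<in>A. \<bar>?c (snd p) m\<bar> \<le> 1" using grid_le_1[OF g(1)] grid_le_1[OF g(2)] by auto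
    note C = chernoff[where c="?c (fst p)" and c'="?c (snd p)", OF 0 empty_subsetI]
    have "2 * (1 - 2 * real (card A) / K) \<le> (\<Sum>m\<in>A. (?c (fst p) m)\<^sup>2 + (?c (snd p) m)\<^sup>2)"
      using g unfolding sum.distrib by auto
    note e = exponent_le[OF this]
    have "t / 2 * (1 - \<zeta>) * (2 * (1 - 2 * real (card A) / K)) = t * (1 - \<zeta>) * (1 - 2 * real (card A) / K)" by simp
    note e = e[unfolded this]
    show "prob (?E p) \<le> ?B" using C(1) e by (simp only: card.empty power_0 mult_1_right) (rule order_trans)
    show "?E p \<in> events" by (rule C(2))
  qed
  have "prob {\<omega>\<in>space M. n * t < (\<Sum>m\<in>A. (S m \<omega>)\<^sup>2) \<and> n * t < (\<Sum>m\<in>A. (S' m \<omega>)\<^sup>2)} \<le> prob (\<Union>p\<in>grid \<times> grid. ?E p)"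
  proof (intro finite_measure_mono)
    show "{\<omega>\<in>space M. n * t < (\<Sum>m\<in>A. (S m \<omega>)\<^sup>2) \<and> n * t < (\<Sum>m\<in>A. (S' m \<omega>)\<^sup>2)} \<subseteq> (\<Union>p\<in>grid \<times> grid. ?E p)"
    proof
      fix \<omega> assume w: "\<omega> \<in> {\<omega>\<in>space M. n * t < (\<Sum>m\<in>A. (S m \<omega>)\<^sup>2) \<and> n * t < (\<Sum>m\<in>A. (S' m \<omega>)\<^sup>2)}"
      then obtain g g' where g: "g \<in> grid" "\<forall>m\<in>A. (?c g m)\<^sup>2 * sqrt (n * t) \<le> ?c g m * S m \<omega>"
         "g' \<in> grid" "\<forall>m\<in>A. (?c g' m)\<^sup>2 * sqrt (n * t) \<le> ?c g' m * S' m \<omega>"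
        using grid_exists[of "\<lambda>m. S m \<omega>"] grid_exists[of "\<lambda>m. S' m \<omega>"] by auto
      then have "\<omega> \<in> ?E (g, g')" using w by simp
      then show "\<omega> \<in> (\<Union>p\<in>grid \<times> grid. ?E p)" using g(1,3) by blast
    qed
    show "(\<Union>p\<in>grid \<times> grid. ?E p) \<in> events" using ch(2) finite_grid by (intro sets.finite_UN finite_cartesian_product) auto
  qed
  also have "\<dots> \<le> (\<Sum>p\<in>grid \<times> grid. prob (?E p))" using ch(2) finite_grid by (intro measure_UNION_le finite_cartesian_product) auto
  also have "\<dots> \<le> (\<Sum>p\<in>grid \<times> grid. ?B)" by (intro sum_mono ch)
  also have "\<dots> = (real (card grid))\<^sup>2 * ?B" by (simp add: card_cartesian_product power2_eq_square)
  also have "\<dots> \<le> ((2 * real K + 1) ^ card A)\<^sup>2 * ?B"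
  proof (intro mult_right_mono power_mono)
    have "real (card grid) \<le> real ((2 * K + 1) ^ card A)" using card_grid by (simp only: of_nat_le_iff)
    then show "real (card grid) \<le> (2 * real K + 1) ^ card A" by (simp add: add.commute)
  qed auto
  finally show ?thesis .
qed

end

section \<open>Arrays of products\<close>

lemma (in prob_space) indep_var_cong_space:
  assumes "indep_var S X T Y" "\<And>\<omega>. \<omega> \<in> space M \<Longrightarrow> X \<omega> = X' \<omega>" "\<And>\<omega>. \<omega> \<in> space M \<Longrightarrow> Y \<omega> = Y' \<omega>"
  shows "indep_var S X' T Y'"
proof -
  have "X -` A \<inter> space M = X' -` A \<inter> space M" "Y -` A' \<inter> space M = Y' -` A' \<inter> space M" for A A' using assms(2,3) by auto
  moreover have "random_variable S X \<longleftrightarrow> random_variable S X'" "random_variable T Y \<longleftrightarrow> random_variable T Y'"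
    using assms(2,3) by (auto intro!: measurable_cong)
  ultimately show ?thesis using assms(1) unfolding indep_var_eq by simp
qed

lemma (in prob_space) indep_vars_blocks:
  assumes ind: "indep_vars M' X L" and K: "\<And>j. j \<in> J \<Longrightarrow> K j \<subseteq> L" "disjoint_family_on K J"
    and F: "\<And>j. j \<in> J \<Longrightarrow> F j \<in> measurable (PiM (K j) M') N"
  shows "indep_vars (\<lambda>_. N) (\<lambda>j \<omega>. F j (\<lambda>i\<in>K j. X i \<omega>)) J"
  by (rule indep_vars_compose2[OF indep_vars_restrict[OF ind K] F])

locale iid_products = prob_space M for M :: "'a measure" +
  fixes d :: nat and Xa :: "nat \<Rightarrow> nat \<Rightarrow> nat \<Rightarrow> 'a \<Rightarrow> real" and \<nu> :: "real measure"
  assumes d: "d \<ge> 1"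
    and indep: "indep_vars (\<lambda>_. borel) (\<lambda>(m, k, i). Xa m k i) {(m, k, i). 1 \<le> m \<and> m \<le> d \<and> 1 \<le> k \<and> 1 \<le> i}"
    and law: "\<And>m k i j. 1 \<le> m \<Longrightarrow> m \<le> d \<Longrightarrow> 1 \<le> k \<Longrightarrow> 1 \<le> i \<Longrightarrow> 1 \<le> j \<Longrightarrow> i \<noteq> j \<Longrightarrow>
        distr M borel (\<lambda>\<omega>. Xa m k i \<omega> * Xa m k j \<omega>) = \<nu>"
    and orth: "\<And>m k c i j. 1 \<le> m \<Longrightarrow> m \<le> d \<Longrightarrow> 1 \<le> k \<Longrightarrow> 1 \<le> c \<Longrightarrow> 1 \<le> i \<Longrightarrow> 1 \<le> j \<Longrightarrow> c \<noteq> i \<Longrightarrow> c \<noteq> j \<Longrightarrow> i \<noteq> j \<Longrightarrow>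
        expectation (\<lambda>\<omega>. (Xa m k c \<omega> * Xa m k i \<omega>) * (Xa m k c \<omega> * Xa m k j \<omega>)) = 0"
    and \<nu>_sq: "integrable \<nu> (\<lambda>y. y\<^sup>2)" and \<nu>_mean: "(LINT y|\<nu>. y) = 0" and \<nu>_var: "(LINT y|\<nu>. y\<^sup>2) = 1"
begin

definition Y :: "nat \<Rightarrow> nat \<Rightarrow> nat \<times> nat \<Rightarrow> 'a \<Rightarrow> real" where
  "Y a b j \<omega> = Xa (fst j) (snd j) a \<omega> * Xa (fst j) (snd j) b \<omega>"

lemma Y_commute: "Y a b = Y b a"
  by (auto simp: Y_def fun_eq_iff)

lemma Xa_rv: "1 \<le> m \<Longrightarrow> m \<le> d \<Longrightarrow> 1 \<le> k \<Longrightarrow> 1 \<le> i \<Longrightarrow> random_variable borel (Xa m k i)"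
  using indep unfolding indep_vars_def by fastforce

context
  fixes n :: nat
begin

abbreviation "J \<equiv> {1..d} \<times> {1..n}"

lemma Y_rv: "j \<in> J \<Longrightarrow> 1 \<le> a \<Longrightarrow> 1 \<le> b \<Longrightarrow> random_variable borel (Y a b j)"
  unfolding Y_def[abs_def] by (intro borel_measurable_times Xa_rv) auto

lemma Y_law: "j \<in> J \<Longrightarrow> 1 \<le> a \<Longrightarrow> 1 \<le> b \<Longrightarrow> a \<noteq> b \<Longrightarrow> distr M borel (Y a b j) = \<nu>"
  unfolding Y_def[abs_def] using law by auto

lemma \<nu>_distr: "n \<ge> 1 \<Longrightarrow> real_distribution \<nu>"
proof -
  assume "n \<ge> 1"
  then have j: "(1, 1) \<in> J" using d by auto
  have "1 \<le> (1::nat)" "1 \<le> (2::nat)" "1 \<noteq> (2::nat)" by auto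
  note h = this
  show ?thesis using Y_law[OF j h] real_distribution_distr[OF Y_rv[OF j h(1,2)]] by simp
qed

lemma Y_expectation:
  fixes f :: "real \<Rightarrow> real"
  assumes j: "j \<in> J" "1 \<le> a" "1 \<le> b" "a \<noteq> b" and f: "f \<in> borel_measurable borel"
  shows "expectation (\<lambda>\<omega>. f (Y a b j \<omega>)) = (LINT y|\<nu>. f y)" "integrable M (\<lambda>\<omega>. f (Y a b j \<omega>)) \<longleftrightarrow> integrable \<nu> f"
  unfolding Y_law[OF j, symmetric] using Y_rv[OF j(1-3)] f by (auto simp: integral_distr integrable_distr_eq)

lemma Y_prob:
  assumes j: "j \<in> J" "1 \<le> a" "1 \<le> b" "a \<noteq> b" and B: "B \<in> sets borel"
  shows "prob {\<omega>\<in>space M. Y a b j \<omega> \<in> B} = measure \<nu> B"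
  unfolding Y_law[OF j, symmetric] using Y_rv[OF j(1-3)] B
  by (subst measure_distr) (auto intro!: arg_cong[where f=prob])

lemma indep_Y_pair:
  assumes h: "1 \<le> c" "1 \<le> i" "1 \<le> j"
  shows "indep_vars (\<lambda>_. borel \<Otimes>\<^sub>M borel) (\<lambda>r \<omega>. (Y c i r \<omega>, Y c j r \<omega>)) J"
proof -
  define K where "K = (\<lambda>r::nat \<times> nat. {(fst r, snd r, c), (fst r, snd r, i), (fst r, snd r, j)})"
  define F where "F = (\<lambda>(r::nat \<times> nat) x. (x (fst r, snd r, c) * x (fst r, snd r, i), x (fst r, snd r, c) * x (fst r, snd r, j)) :: real \<times> real)"
  have "indep_vars (\<lambda>_. borel \<Otimes>\<^sub>M borel) (\<lambda>r \<omega>. F r (\<lambda>q\<in>K r. (case q of (m, k, i) \<Rightarrow> Xa m k i) \<omega>)) J"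
  proof (rule indep_vars_blocks[OF indep])
    show "K r \<subseteq> {(m, k, i). 1 \<le> m \<and> m \<le> d \<and> 1 \<le> k \<and> 1 \<le> i}" if "r \<in> J" for r using that h by (auto simp: K_def)
    show "disjoint_family_on K J" by (auto simp: disjoint_family_on_def K_def)
    show "F r \<in> measurable (PiM (K r) (\<lambda>_. borel)) (borel \<Otimes>\<^sub>M borel)" if "r \<in> J" for r
      unfolding F_def by (intro measurable_Pair borel_measurable_times measurable_component_singleton) (auto simp: K_def)
  qed
  moreover have "F r (\<lambda>q\<in>K r. (case q of (m, k, i) \<Rightarrow> Xa m k i) \<omega>) = (Y c i r \<omega>, Y c j r \<omega>)" for r \<omega>
    by (simp add: F_def K_def Y_def)
  ultimately show ?thesis by simp
qed

lemma indep_Y_rows: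
  fixes f :: "real \<Rightarrow> real"
  assumes h: "1 \<le> a" "1 \<le> b" and f: "f \<in> borel_measurable borel"
  shows "indep_vars (\<lambda>_. borel) (\<lambda>m \<omega>. \<Sum>k=1..n. f (Y a b (m, k) \<omega>)) {1..d}"
proof -
  define K where "K = (\<lambda>m::nat. {m} \<times> {1..n} \<times> {a, b})"
  define F where "F = (\<lambda>(m::nat) x. \<Sum>k=1..n. f (x (m, k, a) * x (m, k, b)))"
  have "indep_vars (\<lambda>_. borel) (\<lambda>m \<omega>. F m (\<lambda>q\<in>K m. (case q of (m, k, i) \<Rightarrow> Xa m k i) \<omega>)) {1..d}"
  proof (rule indep_vars_blocks[OF indep])
    show "K r \<subseteq> {(m, k, i). 1 \<le> m \<and> m \<le> d \<and> 1 \<le> k \<and> 1 \<le> i}" if "r \<in> {1..d}" for r using that h by (auto simp: K_def)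
    show "disjoint_family_on K {1..d}" by (auto simp: disjoint_family_on_def K_def)
    show "F r \<in> measurable (PiM (K r) (\<lambda>_. borel)) borel" if "r \<in> {1..d}" for r
      unfolding F_def
      by (intro borel_measurable_sum measurable_compose[OF _ f] borel_measurable_times measurable_component_singleton) (auto simp: K_def)
  qed
  moreover have "F m (\<lambda>q\<in>K m. (case q of (m, k, i) \<Rightarrow> Xa m k i) \<omega>) = (\<Sum>k=1..n. f (Y a b (m, k) \<omega>))" for m \<omega>
    unfolding F_def by (intro sum.cong refl) (simp add: K_def Y_def)
  ultimately show ?thesis by simp
qed

lemma indep_Y_cols:
  fixes f :: "real \<Rightarrow> real"
  assumes h: "1 \<le> a" "1 \<le> b" "m \<in> {1..d}" and f: "f \<in> borel_measurable borel"
  shows "indep_vars (\<lambda>_. borel) (\<lambda>k \<omega>. f (Y a b (m, k) \<omega>)) {1..n}"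
proof -
  define K where "K = (\<lambda>k::nat. {(m, k, a), (m, k, b)})"
  define F where "F = (\<lambda>(k::nat) x. f (x (m, k, a) * x (m, k, b)))"
  have "indep_vars (\<lambda>_. borel) (\<lambda>k \<omega>. F k (\<lambda>q\<in>K k. (case q of (m, k, i) \<Rightarrow> Xa m k i) \<omega>)) {1..n}"
  proof (rule indep_vars_blocks[OF indep])
    show "K r \<subseteq> {(m, k, i). 1 \<le> m \<and> m \<le> d \<and> 1 \<le> k \<and> 1 \<le> i}" if "r \<in> {1..n}" for r using that h by (auto simp: K_def)
    show "disjoint_family_on K {1..n}" by (auto simp: disjoint_family_on_def K_def)
    show "F r \<in> measurable (PiM (K r) (\<lambda>_. borel)) borel" if "r \<in> {1..n}" for r
      unfolding F_def
      by (intro measurable_compose[OF _ f] borel_measurable_times measurable_component_singleton) (auto simp: K_def)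
  qed
  moreover have "F k (\<lambda>q\<in>K k. (case q of (m, k, i) \<Rightarrow> Xa m k i) \<omega>) = f (Y a b (m, k) \<omega>)" for k \<omega>
    by (simp add: F_def K_def Y_def)
  ultimately show ?thesis by simp
qed

lemma truncated_array_Y:
  assumes h: "1 \<le> c" "1 \<le> i" "1 \<le> j" "c \<noteq> i" "c \<noteq> j" "i \<noteq> j" and n: "n > 0"
    and D: "D \<in> sets borel" "{-b0..b0} \<subseteq> D" "D \<subseteq> {-b..b}" and b0: "b0 > 0" and t: "t > 0" "\<tau> = sqrt (t / n)"
    and \<zeta>: "2 * \<tau> * b0 \<le> \<zeta>" "\<zeta> \<le> 1" and \<rho>: "(LINT y|\<nu>. (if b0 < \<bar>y\<bar> then y\<^sup>2 else 0)) \<le> b0\<^sup>2 * \<rho>"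
    and K: "K > 0" "2 * real d \<le> real K"
  shows "truncated_array M {1..d} {1..n} n (Y c i) (Y c j) D b0 b \<tau> \<zeta> \<rho> t K"
proof (unfold_locales, goal_cases)
  case (5)
  show ?case by (rule indep_Y_pair) (use h in auto)
next
  case (7 r)
  then show ?case using Y_expectation(2)[OF 7 h(1,2,4), of "\<lambda>y. y\<^sup>2"] Y_expectation(2)[OF 7 h(1,3,5), of "\<lambda>y. y\<^sup>2"] \<nu>_sq by simp
next
  case (8 r)
  have "expectation (\<lambda>\<omega>. Y c i r \<omega> * Y c j r \<omega>) = 0" unfolding Y_def using 8 h by (intro orth) auto
  then show ?case using Y_expectation(1)[OF 8 h(1,2,4), of "\<lambda>y. y\<^sup>2"] Y_expectation(1)[OF 8 h(1,3,5), of "\<lambda>y. y\<^sup>2"]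
     Y_expectation(1)[OF 8 h(1,2,4), of "\<lambda>y. y"] Y_expectation(1)[OF 8 h(1,3,5), of "\<lambda>y. y"] \<nu>_mean \<nu>_var by simp
next
  case (16 r)
  have m: "(\<lambda>y::real. if b0 < \<bar>y\<bar> then y\<^sup>2 else 0) \<in> borel_measurable borel" by measurable
  show ?case using Y_expectation(1)[OF 16 h(1,2,4) m] Y_expectation(1)[OF 16 h(1,3,5) m] \<rho> by simp
qed (use assms in auto)

end

end

locale products_params = iid_products M d Xa \<nu> for M :: "'a measure" and d Xa \<nu> +
  fixes n p K :: nat and b0 b \<tau> \<zeta> \<rho> t0 :: real
  assumes n: "n \<ge> 3" and p: "p \<ge> 2" and b0: "0 < b0" "b0 < b" and t0: "0 < t0" and \<tau>: "\<tau> = sqrt (t0 / n)"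
    and \<zeta>: "2 * \<tau> * b0 \<le> \<zeta>" "\<zeta> \<le> 1" and \<rho>: "(LINT y|\<nu>. (if b0 < \<bar>y\<bar> then y\<^sup>2 else 0)) \<le> b0\<^sup>2 * \<rho>"
    and K: "K > 0" "2 * real d \<le> real K"
begin

definition Q :: "real set \<Rightarrow> nat \<Rightarrow> nat \<Rightarrow> 'a \<Rightarrow> real" where
  "Q D a c \<omega> = (\<Sum>m=1..d. (\<Sum>k=1..n. trunc D (Y a c (m, k) \<omega>))\<^sup>2)"

definition "err = 4 * real n * real d * exp (2 * \<tau> * b) * \<rho>"
definition "\<pi>0 = (2 * real K + 1) ^ d * exp (- (t0 / 2 * (1 - \<zeta>) * (1 - 2 * real d / K)) + err)"
definition "\<pi>2 = ((2 * real K + 1) ^ d)\<^sup>2 * exp (- (t0 * (1 - \<zeta>) * (1 - 2 * real d / K)) + err)"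
definition "adde = real n * real d * (\<pi>0 * (exp (2 * \<tau> * b) * \<rho>))"

lemma nu: "real_distribution \<nu>" using \<nu>_distr[of n] n by simp

lemma Q_rv:
  assumes D: "D \<in> sets borel" and ac: "1 \<le> a" "1 \<le> c"
  shows "random_variable borel (Q D a c)"
  unfolding Q_def[abs_def]
  by (intro borel_measurable_sum borel_measurable_power measurable_compose[OF Y_rv[where n=n] trunc_measurable[OF D]]) (use ac in auto)

lemma Q_commute: "Q D a c = Q D c a" unfolding Q_def[abs_def] Y_commute[of a c] ..

lemma Q_event:
  fixes t :: real
  assumes "D \<in> sets borel" "1 \<le> a" "1 \<le> c"
  shows "{\<omega>\<in>space M. n * t < Q D a c \<omega>} \<in> events"
proof -
  note [measurable] = Q_rv[OF assms]
  show ?thesis by measurable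
qed

lemma truncation_sets: "{-b<..<b} \<in> sets borel" "{-b0..b0} \<subseteq> {-b<..<b}" "{-b<..<b} \<subseteq> {-b..b}" "{-b0..b0} \<in> sets borel" "{-b0..b0} \<subseteq> {-b..b}"
  using b0 by auto

lemma truncated_array_instance:
  assumes "1 \<le> c" "1 \<le> i" "1 \<le> j" "c \<noteq> i" "c \<noteq> j" "i \<noteq> j" "D \<in> sets borel" "{-b0..b0} \<subseteq> D" "D \<subseteq> {-b..b}"
  shows "truncated_array M {1..d} {1..n} n (Y c i) (Y c j) D b0 b \<tau> \<zeta> \<rho> t0 K"
  using assms n b0 t0 \<tau> \<zeta> \<rho> K by (intro truncated_array_Y) auto

lemma truncated_array_instance_Q:
  assumes "truncated_array M {1..d} {1..n} n (Y c i) (Y c j) D b0 b \<tau> \<zeta> \<rho> t0 K"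
  shows "(\<Sum>m\<in>{1..d}. (truncated_array.S {1..n} (Y c i) D m \<omega>)\<^sup>2) = Q D c i \<omega>"
    "(\<Sum>m\<in>{1..d}. (truncated_array.S' {1..n} (Y c j) D m \<omega>)\<^sup>2) = Q D c j \<omega>"
  unfolding truncated_array.S_def[OF assms] truncated_array.S'_def[OF assms] Q_def by simp_all

lemma marked_le:
  fixes t :: real
  assumes ac: "1 \<le> a" "1 \<le> c" "a \<noteq> c" and D: "D \<in> sets borel" "{-b0..b0} \<subseteq> D" "D \<subseteq> {-b..b}" and t: "t0 \<le> t" and H: "H \<subseteq> {1..d} \<times> {1..n}"
  shows "prob {\<omega>\<in>space M. n * t < Q D a c \<omega> \<and> (\<forall>j\<in>H. b0 < \<bar>Y a c j \<omega>\<bar>)} \<le> \<pi>0 * (exp (2 * \<tau> * b) * \<rho>) ^ card H"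
proof -
  have T: "truncated_array M {1..d} {1..n} n (Y a c) (Y a (a + c)) D b0 b \<tau> \<zeta> \<rho> t0 K" using ac D by (intro truncated_array_instance) auto
  have ne: "{1..d} \<noteq> {}" using d by simp
  note e = truncated_array.exceed_marked[OF T H ne, unfolded truncated_array_instance_Q[OF T]]
  have fH: "finite H" using H finite_subset by blast
  have "{\<omega>\<in>space M. \<forall>j\<in>H. b0 < \<bar>Y a c j \<omega>\<bar>} \<in> events"
  proof (rule sets.sets_Collect_finite_All[OF _ fH])
    fix j assume "j \<in> H"
    then have "j \<in> {1..d} \<times> {1..n}" using H by blast
    note [measurable] = Y_rv[OF this ac(1,2)]
    show "{\<omega>\<in>space M. b0 < \<bar>Y a c j \<omega>\<bar>} \<in> events" by measurable
  qed
  from sets.Int[OF Q_event[OF D(1) ac(1,2), of t0] this]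
  have ev: "{\<omega>\<in>space M. n * t0 < Q D a c \<omega>} \<inter> {\<omega>\<in>space M. \<forall>j\<in>H. b0 < \<bar>Y a c j \<omega>\<bar>} \<in> events" .
  have eq: "{\<omega>\<in>space M. n * t0 < Q D a c \<omega>} \<inter> {\<omega>\<in>space M. \<forall>j\<in>H. b0 < \<bar>Y a c j \<omega>\<bar>} = {\<omega>\<in>space M. n * t0 < Q D a c \<omega> \<and> (\<forall>j\<in>H. b0 < \<bar>Y a c j \<omega>\<bar>)}" by blast
  have "real n * t0 \<le> real n * t" using t by (intro mult_left_mono) auto
  then have "prob {\<omega>\<in>space M. n * t < Q D a c \<omega> \<and> (\<forall>j\<in>H. b0 < \<bar>Y a c j \<omega>\<bar>)} \<le> prob {\<omega>\<in>space M. n * t0 < Q D a c \<omega> \<and> (\<forall>j\<in>H. b0 < \<bar>Y a c j \<omega>\<bar>)}"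
    using ev unfolding eq by (intro finite_measure_mono) auto
  also have "\<dots> \<le> \<pi>0 * (exp (2 * \<tau> * b) * \<rho>) ^ card H" using e unfolding \<pi>0_def err_def by (simp add: mult.assoc)
  finally show ?thesis .
qed

lemma exceed_le:
  fixes t :: real
  assumes "1 \<le> a" "1 \<le> c" "a \<noteq> c" "t0 \<le> t"
  shows "prob {\<omega>\<in>space M. n * t < Q {-b<..<b} a c \<omega>} \<le> \<pi>0"
  using marked_le[OF assms(1-3) truncation_sets(1-3) assms(4), of "{}"] by simp

lemma exceed_both_le:
  fixes t :: real
  assumes h: "1 \<le> c" "1 \<le> i" "1 \<le> j" "c \<noteq> i" "c \<noteq> j" "i \<noteq> j" and t: "t0 \<le> t"
  shows "prob {\<omega>\<in>space M. n * t < Q {-b<..<b} c i \<omega> \<and> n * t < Q {-b<..<b} c j \<omega>} \<le> \<pi>2"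
proof -
  note T = truncated_array_instance[OF h truncation_sets(1-3)]
  have ne: "{1..d} \<noteq> {}" using d by simp
  note e = truncated_array.exceed_pair[OF T ne, unfolded truncated_array_instance_Q[OF T]]
  have ev: "{\<omega>\<in>space M. n * t0 < Q {-b<..<b} c i \<omega>} \<inter> {\<omega>\<in>space M. n * t0 < Q {-b<..<b} c j \<omega>} \<in> events"
    by (intro sets.Int Q_event truncation_sets h)
  have eq: "{\<omega>\<in>space M. n * t0 < Q {-b<..<b} c i \<omega>} \<inter> {\<omega>\<in>space M. n * t0 < Q {-b<..<b} c j \<omega>} = {\<omega>\<in>space M. n * t0 < Q {-b<..<b} c i \<omega> \<and> n * t0 < Q {-b<..<b} c j \<omega>}" by blast
  have "real n * t0 \<le> real n * t" using t by (intro mult_left_mono) auto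
  then have "prob {\<omega>\<in>space M. n * t < Q {-b<..<b} c i \<omega> \<and> n * t < Q {-b<..<b} c j \<omega>} \<le> prob {\<omega>\<in>space M. n * t0 < Q {-b<..<b} c i \<omega> \<and> n * t0 < Q {-b<..<b} c j \<omega>}"
    using ev unfolding eq by (intro finite_measure_mono) auto
  also have "\<dots> \<le> \<pi>2" using e unfolding \<pi>2_def err_def by (simp add: mult.assoc)
  finally show ?thesis .
qed

lemma rho_nonneg: "0 \<le> \<rho>"
proof -
  have "0 \<le> (LINT y|\<nu>. (if b0 < \<bar>y\<bar> then y\<^sup>2 else 0))" by (intro Bochner_Integration.integral_nonneg) auto
  then have "0 \<le> b0\<^sup>2 * \<rho>" using \<rho> by linarith
  then show ?thesis using b0 by (simp add: zero_le_mult_iff)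
qed

lemma truncation_change_le:
  fixes t :: real
  assumes ac: "1 \<le> a" "1 \<le> c" "a \<noteq> c" and t: "t0 \<le> t"
  shows "\<bar>prob {\<omega>\<in>space M. n * t < Q {-b<..<b} a c \<omega>} - prob {\<omega>\<in>space M. n * t < Q {-b0..b0} a c \<omega>}\<bar> \<le> adde"
proof -
  let ?J = "{1..d} \<times> {1..n}"
  let ?E = "\<lambda>D. {\<omega>\<in>space M. n * t < Q D a c \<omega>}"
  have ev: "?E {-b<..<b} \<in> events" "?E {-b0..b0} \<in> events" by (intro Q_event truncation_sets ac)+
  have one: "prob (?E D) \<le> prob (?E D') + adde" if D: "D \<in> sets borel" "{-b0..b0} \<subseteq> D" "D \<subseteq> {-b..b}" and D': "D' \<in> sets borel" "{-b0..b0} \<subseteq> D'" for D D'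
  proof -
    let ?F = "\<lambda>j. {\<omega>\<in>space M. n * t < Q D a c \<omega> \<and> (\<forall>r\<in>{j}. b0 < \<bar>Y a c r \<omega>\<bar>)}"
    have F: "?F j \<in> events" if "j \<in> ?J" for j
    proof -
      note [measurable] = Y_rv[OF that ac(1,2)]
      have "{\<omega>\<in>space M. b0 < \<bar>Y a c j \<omega>\<bar>} \<in> events" by measurable
      from sets.Int[OF Q_event[OF D(1) ac(1,2), of t] this]
      have "{\<omega>\<in>space M. n * t < Q D a c \<omega>} \<inter> {\<omega>\<in>space M. b0 < \<bar>Y a c j \<omega>\<bar>} \<in> events" .
      moreover have "?F j = {\<omega>\<in>space M. n * t < Q D a c \<omega>} \<inter> {\<omega>\<in>space M. b0 < \<bar>Y a c j \<omega>\<bar>}" by auto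
      ultimately show ?thesis by simp
    qed
    have same: "Q D a c \<omega> = Q D' a c \<omega>" if "\<forall>j\<in>?J. \<bar>Y a c j \<omega>\<bar> \<le> b0" for \<omega>
    proof -
      have "trunc D (Y a c (m, k) \<omega>) = trunc D' (Y a c (m, k) \<omega>)" if "m \<in> {1..d}" "k \<in> {1..n}" for m k
      proof -
        have "\<bar>Y a c (m, k) \<omega>\<bar> \<le> b0" using \<open>\<forall>j\<in>?J. \<bar>Y a c j \<omega>\<bar> \<le> b0\<close> that by auto
        then have "Y a c (m, k) \<omega> \<in> {-b0..b0}" by (auto simp: abs_le_iff)
        then show ?thesis using D(2) D'(2) by (auto simp: trunc_def indicator_def)
      qed
      then show ?thesis unfolding Q_def by (intro sum.cong arg_cong[where f="\<lambda>x. x\<^sup>2"]) auto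
    qed
    have "?E D \<subseteq> ?E D' \<union> (\<Union>j\<in>?J. ?F j)"
    proof
      fix \<omega> assume w: "\<omega> \<in> ?E D"
      show "\<omega> \<in> ?E D' \<union> (\<Union>j\<in>?J. ?F j)"
      proof (cases "\<forall>j\<in>?J. \<bar>Y a c j \<omega>\<bar> \<le> b0")
        case True
        then show ?thesis using w same[OF True] by simp
      next
        case False
        then obtain j where "j \<in> ?J" "b0 < \<bar>Y a c j \<omega>\<bar>" by force
        then have "\<omega> \<in> ?F j" using w by simp
        then show ?thesis using \<open>j \<in> ?J\<close> by blast
      qed
    qed
    then have "prob (?E D) \<le> prob (?E D' \<union> (\<Union>j\<in>?J. ?F j))"
      using F Q_event[OF D'(1) ac(1,2), of t] by (intro finite_measure_mono sets.Un sets.finite_UN) auto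
    also have "\<dots> \<le> prob (?E D') + prob (\<Union>j\<in>?J. ?F j)"
      using F Q_event[OF D'(1) ac(1,2), of t] by (intro measure_Un_le sets.finite_UN) auto
    also have "prob (\<Union>j\<in>?J. ?F j) \<le> (\<Sum>j\<in>?J. prob (?F j))" using F by (intro measure_UNION_le) auto
    also have "\<dots> \<le> (\<Sum>j\<in>?J. \<pi>0 * (exp (2 * \<tau> * b) * \<rho>))"
    proof (intro sum_mono)
      fix j assume "j \<in> ?J"
      then have "{j} \<subseteq> ?J" by simp
      from marked_le[OF ac D t this] show "prob (?F j) \<le> \<pi>0 * (exp (2 * \<tau> * b) * \<rho>)" by simp
    qed
    also have "\<dots> = adde" unfolding adde_def by (simp add: card_cartesian_product)
    finally show ?thesis by simp
  qed
  show ?thesis using one[OF truncation_sets(1-3) truncation_sets(4) order_refl] one[OF truncation_sets(4) order_refl truncation_sets(5) truncation_sets(1,2)] by linarith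
qed

lemma \<nu>_trunc_moments:
  "\<bar>LINT y|\<nu>. trunc {-b0..b0} y\<bar> \<le> b0 * \<rho>" "\<bar>(LINT y|\<nu>. (trunc {-b0..b0} y)\<^sup>2) - 1\<bar> \<le> b0\<^sup>2 * \<rho>"
proof -
  interpret nu: real_distribution \<nu> by (rule nu)
  let ?t = "\<lambda>y::real. if b0 < \<bar>y\<bar> then y\<^sup>2 else 0"
  have it: "integrable \<nu> ?t" by (rule Bochner_Integration.integrable_bound[OF \<nu>_sq]) auto
  have i1: "integrable \<nu> (\<lambda>y. y)" by (rule nu.square_integrable_imp_integrable[OF _ \<nu>_sq]) simp
  have tm: "trunc {-b0..b0} \<in> borel_measurable borel" by measurable
  have tr: "trunc {-b0..b0} y = (if b0 < \<bar>y\<bar> then 0 else y)" for y by (auto simp: trunc_def indicator_def abs_le_iff not_less)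
  have itr: "integrable \<nu> (trunc {-b0..b0})"
  proof (rule Bochner_Integration.integrable_bound[OF i1])
    show "AE y in \<nu>. norm (trunc {-b0..b0} y) \<le> norm y" by (simp add: tr)
  qed (use tm in simp)
  have "(LINT y|\<nu>. trunc {-b0..b0} y) - (LINT y|\<nu>. y) = (LINT y|\<nu>. trunc {-b0..b0} y - y)" using itr i1 by (intro Bochner_Integration.integral_diff[symmetric])
  also have "\<bar>\<dots>\<bar> \<le> (LINT y|\<nu>. \<bar>trunc {-b0..b0} y - y\<bar>)" by (rule integral_abs_bound)
  also have "\<dots> \<le> (LINT y|\<nu>. (1 / b0) * ?t y)"
  proof (rule integral_mono)
    show "integrable \<nu> (\<lambda>y. \<bar>trunc {-b0..b0} y - y\<bar>)" by (rule integrable_abs[OF Bochner_Integration.integrable_diff[OF itr i1]])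
    show "integrable \<nu> (\<lambda>y. (1 / b0) * ?t y)" by (rule integrable_mult_right[OF it])
    fix y
    show "\<bar>trunc {-b0..b0} y - y\<bar> \<le> (1 / b0) * ?t y"
    proof (cases "b0 < \<bar>y\<bar>")
      case True
      then have "b0 * \<bar>y\<bar> \<le> \<bar>y\<bar> * \<bar>y\<bar>" by (intro mult_right_mono) auto
      then have "\<bar>y\<bar> \<le> y\<^sup>2 / b0" using b0 by (simp add: pos_le_divide_eq mult.commute power2_eq_square)
      then show ?thesis using True by (simp add: tr)
    qed (simp add: tr)
  qed
  also have "\<dots> \<le> (1 / b0) * (b0\<^sup>2 * \<rho>)" unfolding integral_mult_right_zero using \<rho> b0 by (intro mult_left_mono) auto
  also have "\<dots> = b0 * \<rho>" using b0 by (simp add: power2_eq_square)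
  finally show "\<bar>LINT y|\<nu>. trunc {-b0..b0} y\<bar> \<le> b0 * \<rho>" using \<nu>_mean by simp
  have "(trunc {-b0..b0} y)\<^sup>2 = y\<^sup>2 - ?t y" for y unfolding tr by simp
  then have "(LINT y|\<nu>. (trunc {-b0..b0} y)\<^sup>2) = (LINT y|\<nu>. y\<^sup>2 - ?t y)" by (intro Bochner_Integration.integral_cong) auto
  also have "\<dots> = 1 - (LINT y|\<nu>. ?t y)" unfolding Bochner_Integration.integral_diff[OF \<nu>_sq it] \<nu>_var ..
  finally have "(LINT y|\<nu>. (trunc {-b0..b0} y)\<^sup>2) = 1 - (LINT y|\<nu>. ?t y)" .
  moreover have "0 \<le> (LINT y|\<nu>. ?t y)" by (intro Bochner_Integration.integral_nonneg) auto
  ultimately show "\<bar>(LINT y|\<nu>. (trunc {-b0..b0} y)\<^sup>2) - 1\<bar> \<le> b0\<^sup>2 * \<rho>" using \<rho> by linarith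
qed

definition "\<beta> = (LINT y|\<nu>. \<bar>trunc {-b0..b0} y\<bar> ^ 3)"

definition "\<delta> x = (1 + x) * (sqrt n * (b0 * \<rho>)) + (1 + x)\<^sup>2 * (b0\<^sup>2 * \<rho>) + (1 + x) ^ 3 * (\<beta> / sqrt n) + (1 + x) * ln n * (\<beta> / sqrt n)"

lemma trunc_b0_measurable: "trunc {-b0..b0} \<in> borel_measurable borel" by measurable

lemma trunc_bound: "\<bar>trunc {-b0..b0} y\<bar> \<le> b0"
  using b0 by (auto simp: trunc_def indicator_def abs_le_iff)

lemma beta_ge: assumes "b0\<^sup>2 * \<rho> \<le> 1/4" shows "1/2 \<le> \<beta>"
proof -
  interpret nu: real_distribution \<nu> by (rule nu)
  let ?t = "trunc {-b0..b0}"
  have p: "\<bar>?t y\<bar> ^ k \<le> b0 ^ k" for y k using trunc_bound by (intro power_mono) auto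
  have i2: "integrable \<nu> (\<lambda>y. (?t y)\<^sup>2)" using trunc_b0_measurable p[of _ 2] by (intro nu.integrable_const_bound[where B="b0\<^sup>2"]) auto
  have i3: "integrable \<nu> (\<lambda>y. \<bar>?t y\<bar> ^ 3)" using trunc_b0_measurable p[of _ 3] by (intro nu.integrable_const_bound[where B="b0^3"]) auto
  have "3 * v\<^sup>2 \<le> 2 * v ^ 3 + 1" if "0 \<le> v" for v :: real
  proof -
    have "0 \<le> (2 * v + 1) * (v - 1)\<^sup>2" using that by (intro mult_nonneg_nonneg) auto
    also have "\<dots> = 2 * v ^ 3 + 1 - 3 * v\<^sup>2" by (simp add: power2_eq_square power3_eq_cube algebra_simps)
    finally show ?thesis by simp
  qed
  from this[OF abs_ge_zero] have "3 * u\<^sup>2 \<le> 2 * \<bar>u\<bar> ^ 3 + 1" for u :: real by (simp only: power2_abs)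
  then have "(LINT y|\<nu>. 3 * (?t y)\<^sup>2) \<le> (LINT y|\<nu>. 2 * \<bar>?t y\<bar> ^ 3 + 1)"
    using i2 i3 by (intro integral_mono) auto
  also have "\<dots> = 2 * \<beta> + 1" unfolding \<beta>_def using i3 nu.prob_space by simp
  finally have "3 * (LINT y|\<nu>. (?t y)\<^sup>2) \<le> 2 * \<beta> + 1" by simp
  then show ?thesis using \<nu>_trunc_moments(2) assms by linarith
qed

lemma delta_mono: "0 \<le> x \<Longrightarrow> x \<le> y \<Longrightarrow> \<delta> x \<le> \<delta> y" and delta_nonneg: "0 \<le> x \<Longrightarrow> 0 \<le> \<delta> x"
proof -
  have b: "0 \<le> \<beta>" unfolding \<beta>_def by (intro Bochner_Integration.integral_nonneg) auto
  note r = rho_nonneg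
  have l: "0 \<le> ln (real n)" using n by simp
  have nn: "0 \<le> sqrt n * (b0 * \<rho>)" "0 \<le> b0\<^sup>2 * \<rho>" "0 \<le> \<beta> / sqrt n" using b r b0 by auto
  show "\<delta> x \<le> \<delta> y" if "0 \<le> x" "x \<le> y"
  proof -
    have p: "(1 + x)\<^sup>2 \<le> (1 + y)\<^sup>2" "(1 + x) ^ 3 \<le> (1 + y) ^ 3" "1 + x \<le> 1 + y" using that by (auto intro: power_mono)
    have q: "(1 + x) * ln n \<le> (1 + y) * ln n" using that l by (intro mult_right_mono) auto
    show ?thesis unfolding \<delta>_def
      by (rule add_mono[OF add_mono[OF add_mono[OF mult_right_mono[OF p(3) nn(1)] mult_right_mono[OF p(1) nn(2)]] mult_right_mono[OF p(2) nn(3)]] mult_right_mono[OF q nn(3)]])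
  qed
  show "0 \<le> \<delta> x" if "0 \<le> x"
  proof -
    have p: "0 \<le> (1 + x) * ln n" "0 \<le> 1 + x" "0 \<le> (1 + x)\<^sup>2" "0 \<le> (1 + x) ^ 3" using l that by auto
    show ?thesis unfolding \<delta>_def
      by (rule add_nonneg_nonneg[OF add_nonneg_nonneg[OF add_nonneg_nonneg[OF mult_nonneg_nonneg[OF p(2) nn(1)] mult_nonneg_nonneg[OF p(3) nn(2)]] mult_nonneg_nonneg[OF p(4) nn(3)]] mult_nonneg_nonneg[OF p(1) nn(3)]])
  qed
qed

lemma one_coordinate:
  fixes u x1 :: real
  assumes ac: "1 \<le> a" "1 \<le> c" "a \<noteq> c" and m: "m \<in> {1..d}" and x1: "0 \<le> x1" "x1 / sqrt n * b0 \<le> 1" and sm: "b0\<^sup>2 * \<rho> \<le> 1/4"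
    and \<delta>: "\<delta> x1 \<le> 1/1000" and u: "u \<le> x1\<^sup>2"
  shows "\<bar>prob {\<omega>\<in>space M. u < (\<Sum>k=1..n. trunc {-b0..b0} (Y a c (m, k) \<omega>))\<^sup>2 / n} - chi2_tail 1 u\<bar> \<le> 300000000 * \<delta> x1 * chi2_tail 1 u"
proof (cases "u < 0")
  case True
  interpret c1: prob_space "chi2 1" by (rule prob_space_chi2) simp
  interpret N: real_distribution std_normal_distribution by (rule real_dist_normal_dist)
  have "{\<omega>\<in>space M. u < (\<Sum>k=1..n. trunc {-b0..b0} (Y a c (m, k) \<omega>))\<^sup>2 / n} = space M"
    using True by (auto intro: less_le_trans)
  moreover have "chi2_tail 1 u = 1"
  proof -
    have "AE q in chi2 1. q \<in> {u..}" using chi2_AE_nonneg[of 1] by eventually_elim (use True in auto)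
    then show ?thesis unfolding chi2_tail_eq(1) by (intro c1.prob_eq_1[THEN iffD2]) auto
  qed
  ultimately show ?thesis using prob_space delta_nonneg[OF x1(1)] by simp
next
  case False
  define x where "x = sqrt u"
  have x: "0 \<le> x" "x \<le> x1" "x\<^sup>2 = u" using False u x1 by (auto simp: x_def real_le_lsqrt)
  have n0: "real n > 0" using n by simp
  let ?t = "trunc {-b0..b0}"
  let ?T = "\<lambda>\<omega>. \<Sum>k=1..n. ?t (Y a c (m, k) \<omega>)"
  interpret nu: real_distribution \<nu> by (rule nu)
  have xb: "x / sqrt n * b0 \<le> 1"
  proof -
    have "x / sqrt n * b0 \<le> x1 / sqrt n * b0" using x b0 n0 by (intro mult_right_mono divide_right_mono) auto
    then show ?thesis using x1 by linarith
  qed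
  have \<delta>x: "\<delta> x \<le> 1/1000" using delta_mono[OF x(1,2)] \<delta> by linarith
  have md: "\<bar>prob {\<omega>\<in>space M. x * sqrt n < (\<Sum>k=1..n. \<sigma> * ?t (Y a c (m, k) \<omega>))} - measure std_normal_distribution {x<..}\<bar> \<le> 300000000 * \<delta> x * measure std_normal_distribution {x<..}"
    if \<sigma>: "\<sigma> = 1 \<or> \<sigma> = -1" for \<sigma> :: real
  proof (rule moderate_deviation)
    let ?L = "distr \<nu> borel (\<lambda>y. \<sigma> * ?t y)"
    have fm: "(\<lambda>y. \<sigma> * ?t y) \<in> borel_measurable borel" using trunc_b0_measurable by measurable
    show "finite {1..n}" "card {1..n} = n" "3 \<le> n" using n by auto
    show "indep_vars (\<lambda>_. borel) (\<lambda>k \<omega>. \<sigma> * ?t (Y a c (m, k) \<omega>)) {1..n}" by (rule indep_Y_cols[OF ac(1,2) m fm])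
    show "distr M borel (\<lambda>\<omega>. \<sigma> * ?t (Y a c (m, k) \<omega>)) = ?L" if k: "k \<in> {1..n}" for k
    proof -
      have j: "(m, k) \<in> {1..d} \<times> {1..n}" using m k by auto
      show ?thesis unfolding Y_law[OF j ac, symmetric] using Y_rv[OF j ac(1,2)] fm by (subst distr_distr) (auto simp: comp_def)
    qed
    show "real_distribution ?L" using fm by (intro nu.real_distribution_distr) auto
    show "AE y in ?L. \<bar>y\<bar> \<le> b0" using fm trunc_bound \<sigma> by (subst AE_distr_iff) (auto simp: abs_mult)
    show "0 \<le> x" "x / sqrt n * b0 \<le> 1" by fact+
    have s2: "\<sigma>\<^sup>2 = 1" "\<bar>\<sigma>\<bar> = 1" using \<sigma> by auto
    show "\<bar>LINT y|?L. y\<bar> \<le> b0 * \<rho>" using fm \<nu>_trunc_moments(1) s2 by (subst integral_distr) (auto simp: abs_mult)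
    show "\<bar>(LINT y|?L. y\<^sup>2) - 1\<bar> \<le> b0\<^sup>2 * \<rho>" using fm \<nu>_trunc_moments(2) s2 by (subst integral_distr) (auto simp: power_mult_distrib)
    show "(LINT y|?L. \<bar>y\<bar> ^ 3) \<le> \<beta>" unfolding \<beta>_def using fm s2 by (subst integral_distr) (auto simp: abs_mult)
    show "1/2 \<le> \<beta>" by (rule beta_ge[OF sm])
    show "\<delta> x = (1 + x) * (sqrt n * (b0 * \<rho>)) + (1 + x)\<^sup>2 * (b0\<^sup>2 * \<rho>) + (1 + x) ^ 3 * (\<beta> / sqrt n) + (1 + x) * ln n * (\<beta> / sqrt n)" by (rule \<delta>_def)
    show "\<delta> x \<le> 1/1000" by fact
  qed
  have Trv: "random_variable borel ?T"
    by (intro borel_measurable_sum measurable_compose[OF Y_rv[where n=n] trunc_b0_measurable]) (use ac m in auto)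
  let ?A = "{\<omega>\<in>space M. x * sqrt n < ?T \<omega>}" and ?B = "{\<omega>\<in>space M. x * sqrt n < - ?T \<omega>}"
  have ev: "?A \<in> events" "?B \<in> events" using Trv by measurable
  have xs: "0 \<le> x * sqrt n" using x by simp
  have sq: "u < z\<^sup>2 / n \<longleftrightarrow> x * sqrt n < z \<or> x * sqrt n < - z" for z
  proof -
    have "u < z\<^sup>2 / n \<longleftrightarrow> (x * sqrt n)\<^sup>2 < z\<^sup>2" using n0 x(3) by (simp add: pos_less_divide_eq power_mult_distrib)
    also have "\<dots> \<longleftrightarrow> \<bar>x * sqrt n\<bar> < \<bar>z\<bar>" by (metis abs_le_square_iff not_le)
    also have "\<dots> \<longleftrightarrow> x * sqrt n < z \<or> x * sqrt n < - z" using xs by (simp only: abs_of_nonneg) linarith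
    finally show ?thesis .
  qed
  have "{\<omega>\<in>space M. u < (?T \<omega>)\<^sup>2 / n} = ?A \<union> ?B" unfolding sq by auto
  moreover have "?A \<inter> ?B = {}" using xs by auto
  ultimately have P: "prob {\<omega>\<in>space M. u < (?T \<omega>)\<^sup>2 / n} = prob ?A + prob ?B" using finite_measure_Union[OF ev] by simp
  have A: "\<bar>prob ?A - measure std_normal_distribution {x<..}\<bar> \<le> 300000000 * \<delta> x * measure std_normal_distribution {x<..}"
    using md[of 1] by simp
  have B: "\<bar>prob ?B - measure std_normal_distribution {x<..}\<bar> \<le> 300000000 * \<delta> x * measure std_normal_distribution {x<..}"
    using md[of "-1"] by (simp add: sum_negf)
  have c: "chi2_tail 1 u = 2 * measure std_normal_distribution {x<..}" using chi2_tail_1[of u] False unfolding x_def by simp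
  have "300000000 * \<delta> x * measure std_normal_distribution {x<..} \<le> 300000000 * \<delta> x1 * measure std_normal_distribution {x<..}"
    using delta_mono[OF x(1,2)] by (intro mult_right_mono) auto
  then show ?thesis unfolding P c using A B by argo
qed

lemma chi2_compare:
  fixes t x1 :: real
  assumes ac: "1 \<le> a" "1 \<le> c" "a \<noteq> c" and x1: "0 \<le> x1" "x1 / sqrt n * b0 \<le> 1" and sm: "b0\<^sup>2 * \<rho> \<le> 1/4"
    and \<delta>: "\<delta> x1 \<le> 1/1000" and t: "t \<le> x1\<^sup>2"
  shows "\<bar>prob {\<omega>\<in>space M. n * t < Q {-b0..b0} a c \<omega>} - chi2_tail d t\<bar> \<le> ((1 + 300000000 * \<delta> x1) ^ d - 1) * chi2_tail d t"
proof -
  define V where "V = (\<lambda>m \<omega>. (\<Sum>k=1..n. trunc {-b0..b0} (Y a c (m, k) \<omega>))\<^sup>2 / n)"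
  have sqm: "(\<lambda>x::real. x\<^sup>2 / n) \<in> borel_measurable borel" by measurable
  have ind: "indep_vars (\<lambda>_. borel) V {1..d}"
    unfolding V_def by (rule indep_vars_compose2[OF indep_Y_rows[OF ac(1,2) trunc_b0_measurable] sqm])
  have "\<bar>prob {\<omega>\<in>space M. t < (\<Sum>m\<in>{1..d}. V m \<omega>)} - chi2_tail (card {1..d}) t\<bar> \<le> ((1 + 300000000 * \<delta> x1) ^ card {1..d} - 1) * chi2_tail (card {1..d}) t"
  proof (rule sum_tail_chi2[OF _ _ ind])
    show "{1..d} \<noteq> {}" using d by simp
    show "0 \<le> V m \<omega>" for m \<omega> by (simp add: V_def)
    show "0 \<le> 300000000 * \<delta> x1" using delta_nonneg[OF x1(1)] by simp
    show "\<bar>prob {\<omega>\<in>space M. u < V m \<omega>} - chi2_tail 1 u\<bar> \<le> 300000000 * \<delta> x1 * chi2_tail 1 u" if "m \<in> {1..d}" "u \<le> x1\<^sup>2" for m u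
      unfolding V_def by (rule one_coordinate[OF ac that(1) x1 sm \<delta> that(2)])
    show "t \<le> x1\<^sup>2" by fact
  qed simp
  moreover have "n * t < Q {-b0..b0} a c \<omega> \<longleftrightarrow> t < (\<Sum>m\<in>{1..d}. V m \<omega>)" for \<omega>
  proof -
    have "(\<Sum>m\<in>{1..d}. V m \<omega>) = Q {-b0..b0} a c \<omega> / n" unfolding V_def Q_def by (simp add: sum_divide_distrib)
    then show ?thesis using n by (simp add: pos_less_divide_eq mult.commute)
  qed
  ultimately show ?thesis by simp
qed

end

section \<open>The maximum over all pairs\<close>

lemma exp_minus_diff_le:
  fixes a L \<theta> r :: real
  assumes "0 \<le> a" "0 \<le> L" "0 \<le> \<theta>" "0 \<le> r" and le: "\<bar>a - L\<bar> \<le> \<theta> * L + r"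
  shows "\<bar>exp (- a) - exp (- L)\<bar> \<le> r + 2 * \<theta>"
proof (cases "\<theta> \<le> 1/2")
  case False
  have "exp (- a) \<le> 1" "exp (- L) \<le> 1" "0 \<le> exp (- a)" "0 \<le> exp (- L)" using assms by auto
  then show ?thesis using False assms by linarith
next
  case True
  have lip: "\<bar>exp (- u) - exp (- v)\<bar> \<le> \<bar>u - v\<bar> * exp (- min u v)" for u v :: real
  proof -
    have one: "exp (- u) - exp (- v) \<le> (v - u) * exp (- u)" for u v :: real
    proof -
      have "1 + (u - v) \<le> exp (u - v)" by (rule exp_ge_add_one_self)
      then have "(1 + (u - v)) * exp (- u) \<le> exp (u - v) * exp (- u)" by (intro mult_right_mono) auto
      also have "exp (u - v) * exp (- u) = exp (- v)" by (simp flip: exp_add)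
      finally show ?thesis by (simp add: algebra_simps)
    qed
    show ?thesis
    proof (cases "u \<le> v")
      case True
      then have "exp (- v) \<le> exp (- u)" by simp
      then show ?thesis using True one[of u v] by (simp add: min_def)
    next
      case False
      then have "exp (- u) \<le> exp (- v)" by simp
      then show ?thesis using False one[of v u] by (simp add: min_def)
    qed
  qed
  define a' where "a' = max ((1 - \<theta>) * L) (min ((1 + \<theta>) * L) a)"
  have tL: "0 \<le> \<theta> * L" using assms by simp
  have e1: "(1 - \<theta>) * L = L - \<theta> * L" "(1 + \<theta>) * L = L + \<theta> * L" by (simp_all add: algebra_simps)
  have d1: "\<bar>a - a'\<bar> \<le> r" unfolding a'_def e1 using le tL assms by (simp add: max_def min_def abs_le_iff)
  have d2: "\<bar>a' - L\<bar> \<le> \<theta> * L" "L - \<theta> * L \<le> a'" unfolding a'_def e1 using tL by (auto simp: max_def min_def abs_le_iff)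
  have La: "L / 2 \<le> min a' L"
  proof -
    have "\<theta> * L \<le> 1/2 * L" using True assms by (intro mult_right_mono) auto
    then show ?thesis using d2(2) assms by auto
  qed
  have "\<bar>exp (- a) - exp (- a')\<bar> \<le> \<bar>a - a'\<bar> * exp (- min a a')" by (rule lip)
  also have "\<dots> \<le> \<bar>a - a'\<bar> * 1" using La assms by (intro mult_left_mono) auto
  finally have 1: "\<bar>exp (- a) - exp (- a')\<bar> \<le> r" using d1 by simp
  have "\<bar>exp (- a') - exp (- L)\<bar> \<le> \<bar>a' - L\<bar> * exp (- min a' L)" by (rule lip)
  also have "\<dots> \<le> (\<theta> * L) * exp (- (L / 2))" using La d2 tL by (intro mult_mono) auto
  also have "\<dots> = \<theta> * (L * exp (- (L / 2)))" by simp
  also have "\<dots> \<le> \<theta> * 2"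
  proof (intro mult_left_mono)
    have "1 + L / 2 \<le> exp (L / 2)" by (rule exp_ge_add_one_self)
    then have "L \<le> 2 * exp (L / 2)" using assms by linarith
    then have "L * exp (- (L / 2)) \<le> 2 * exp (L / 2) * exp (- (L / 2))" by (intro mult_right_mono) auto
    also have "2 * exp (L / 2) * exp (- (L / 2)) = 2" by (simp add: mult.assoc flip: exp_add)
    finally show "L * exp (- (L / 2)) \<le> 2" .
  qed fact
  finally show ?thesis using 1 by linarith
qed

lemma power_one_plus_le:
  fixes \<theta> B :: real
  assumes "0 \<le> \<theta>" "\<theta> \<le> B"
  shows "(1 + \<theta>) ^ d - 1 \<le> \<theta> * (real d * (1 + B) ^ d)"
proof (induction d)
  case (Suc d)
  have B: "0 \<le> B" using assms by linarith
  have "(1 + \<theta>) ^ Suc d - 1 = (1 + \<theta>) * ((1 + \<theta>) ^ d - 1) + \<theta>" by (simp add: algebra_simps)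
  also have "\<dots> \<le> (1 + B) * (\<theta> * (real d * (1 + B) ^ d)) + \<theta> * (1 + B) ^ Suc d"
  proof (intro add_mono mult_mono Suc)
    have "1 \<le> (1 + B) ^ Suc d" using B by (intro one_le_power) simp
    then show "\<theta> \<le> \<theta> * (1 + B) ^ Suc d" using assms mult_left_mono[of 1 "(1 + B) ^ Suc d" \<theta>] by simp
  qed (use assms B in auto)
  also have "\<dots> = \<theta> * (real (Suc d) * (1 + B) ^ Suc d)"
  proof -
    have "(1 + B) * (\<theta> * (D * P)) + \<theta> * ((1 + B) * P) = \<theta> * ((1 + D) * ((1 + B) * P))" for D P by algebra
    then show ?thesis unfolding power_Suc of_nat_Suc .
  qed
  finally show ?case .
qed simp

definition pairs :: "nat \<Rightarrow> (nat \<times> nat) set" where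
  "pairs p = {(i, j). 1 \<le> i \<and> i < j \<and> j \<le> p}"

lemma finite_pairs: "finite (pairs p)"
  by (rule finite_subset[of _ "{1..p} \<times> {1..p}"]) (auto simp: pairs_def)

lemma card_pairs: "real (card (pairs p)) = ((real p)\<^sup>2 - real p) / 2"
proof (induction p)
  case (Suc p)
  have "pairs (Suc p) = pairs p \<union> (\<lambda>i. (i, Suc p)) ` {1..p}" by (auto simp: pairs_def)
  moreover have "pairs p \<inter> (\<lambda>i. (i, Suc p)) ` {1..p} = {}" by (auto simp: pairs_def)
  ultimately have "card (pairs (Suc p)) = card (pairs p) + card ((\<lambda>i. (i, Suc p)) ` {1..p})"
    using finite_pairs by (simp add: card_Un_disjoint)
  also have "card ((\<lambda>i. (i, Suc p)) ` {1..p}) = p" by (subst card_image) (auto simp: inj_on_def)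
  finally show ?case using Suc by (simp add: power2_eq_square field_simps)
next
  case 0
  have "pairs 0 = {}" by (auto simp: pairs_def)
  then show ?case by simp
qed

definition neighbours :: "nat \<Rightarrow> nat \<times> nat \<Rightarrow> (nat \<times> nat) set" where
  "neighbours p e = {f \<in> pairs p. {fst f, snd f} \<inter> {fst e, snd e} \<noteq> {}}"

lemma card_neighbours: "card (neighbours p e) \<le> 2 * p"
proof -
  have "neighbours p e \<subseteq> (\<lambda>(a, b). (min a b, max a b)) ` ({fst e, snd e} \<times> {1..p})"
  proof
    fix f assume "f \<in> neighbours p e"
    then obtain i j where f: "f = (i, j)" "1 \<le> i" "i < j" "j \<le> p" "i \<in> {fst e, snd e} \<or> j \<in> {fst e, snd e}"
      by (auto simp: neighbours_def pairs_def)
    have "f = (\<lambda>(a, b). (min a b, max a b)) (i, j)" "f = (\<lambda>(a, b). (min a b, max a b)) (j, i)" using f by auto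
    moreover have "(i, j) \<in> {fst e, snd e} \<times> {1..p} \<or> (j, i) \<in> {fst e, snd e} \<times> {1..p}" using f by auto
    ultimately show "f \<in> (\<lambda>(a, b). (min a b, max a b)) ` ({fst e, snd e} \<times> {1..p})" by blast
  qed
  then have "card (neighbours p e) \<le> card ({fst e, snd e} \<times> {1..p})"
    by (rule surj_card_le[rotated]) simp
  also have "\<dots> \<le> 2 * p" by (simp add: card_cartesian_product card_insert_if)
  finally show ?thesis .
qed

context products_params
begin

definition exceed :: "real \<Rightarrow> nat \<times> nat \<Rightarrow> 'a set" where
  "exceed t e = {\<omega>\<in>space M. real n * t < Q {-b<..<b} (fst e) (snd e) \<omega>}"

lemma exceed_event: "e \<in> pairs p \<Longrightarrow> exceed t e \<in> events"
  unfolding exceed_def by (intro Q_event truncation_sets) (auto simp: pairs_def)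

lemma exceed_indep:
  fixes t :: real
  assumes e: "e \<in> pairs p"
  shows "indep_var borel (indicator (exceed t e) :: 'a \<Rightarrow> real) borel (\<lambda>\<omega>. \<Sum>f\<in>pairs p - neighbours p e. indicator (exceed t f) \<omega> :: real)"
proof -
  define L1 where "L1 = {1..d} \<times> {1..n} \<times> {fst e, snd e}"
  define L2 where "L2 = {1..d} \<times> {1..n} \<times> ({1..p} - {fst e, snd e})"
  define F where "F = (\<lambda>(f::nat \<times> nat) x. if real n * t < (\<Sum>m=1..d. (\<Sum>k=1..n. trunc {-b<..<b} (x (m, k, fst f) * x (m, k, snd f)))\<^sup>2) then 1 else 0 :: real)"
  let ?X = "\<lambda>q \<omega>. (case q of (m, k, i) \<Rightarrow> Xa m k i) \<omega>"
  have Fm: "F f \<in> measurable (PiM L (\<lambda>_. borel)) borel" if L: "{1..d} \<times> {1..n} \<times> {fst f, snd f} \<subseteq> L" for f L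
  proof -
    have "(\<lambda>x. \<Sum>m=1..d. (\<Sum>k=1..n. trunc {-b<..<b} (x (m, k, fst f) * x (m, k, snd f)))\<^sup>2) \<in> borel_measurable (PiM L (\<lambda>_. borel))"
      by (intro borel_measurable_sum borel_measurable_power measurable_compose[OF _ trunc_measurable[OF truncation_sets(1)]] borel_measurable_times measurable_component_singleton)
         (use L in auto)
    note [measurable] = this
    show ?thesis unfolding F_def by measurable
  qed
  have sub: "L1 \<inter> L2 = {}" "L1 \<subseteq> {(m, k, i). 1 \<le> m \<and> m \<le> d \<and> 1 \<le> k \<and> 1 \<le> i}" "L2 \<subseteq> {(m, k, i). 1 \<le> m \<and> m \<le> d \<and> 1 \<le> k \<and> 1 \<le> i}"
    using e by (auto simp: L1_def L2_def pairs_def)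
  have f2: "{1..d} \<times> {1..n} \<times> {fst f, snd f} \<subseteq> L2" if "f \<in> pairs p - neighbours p e" for f
    using that by (auto simp: L2_def pairs_def neighbours_def)
  have Gm: "(\<lambda>x. \<Sum>f\<in>pairs p - neighbours p e. F f x) \<in> measurable (PiM L2 (\<lambda>_. borel)) borel"
    by (intro borel_measurable_sum Fm f2)
  have iv: "indep_var borel (F e \<circ> (\<lambda>\<omega>. \<lambda>q\<in>L1. ?X q \<omega>)) borel ((\<lambda>x. \<Sum>f\<in>pairs p - neighbours p e. F f x) \<circ> (\<lambda>\<omega>. \<lambda>q\<in>L2. ?X q \<omega>))"
    by (rule indep_var_compose[OF indep_var_restrict[OF indep sub] Fm Gm]) (simp add: L1_def)
  have eq: "F f (\<lambda>q\<in>L. ?X q \<omega>) = indicator (exceed t f) \<omega>" if L: "{1..d} \<times> {1..n} \<times> {fst f, snd f} \<subseteq> L" and w: "\<omega> \<in> space M" for f L \<omega>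
  proof -
    have "(\<Sum>m=1..d. (\<Sum>k=1..n. trunc {-b<..<b} ((\<lambda>q\<in>L. ?X q \<omega>) (m, k, fst f) * (\<lambda>q\<in>L. ?X q \<omega>) (m, k, snd f)))\<^sup>2) = Q {-b<..<b} (fst f) (snd f) \<omega>"
      unfolding Q_def
    proof (intro sum.cong refl arg_cong[where f="\<lambda>x. x\<^sup>2"])
      fix m k assume "m \<in> {1..d}" "k \<in> {1..n}"
      then have "(m, k, fst f) \<in> L" "(m, k, snd f) \<in> L" using L by auto
      then show "trunc {-b<..<b} ((\<lambda>q\<in>L. ?X q \<omega>) (m, k, fst f) * (\<lambda>q\<in>L. ?X q \<omega>) (m, k, snd f)) = trunc {-b<..<b} (Y (fst f) (snd f) (m, k) \<omega>)"
        by (simp add: Y_def)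
    qed
    then show ?thesis unfolding F_def exceed_def using w by (simp add: indicator_def)
  qed
  show ?thesis
  proof (rule indep_var_cong_space[OF iv])
    fix \<omega> assume w: "\<omega> \<in> space M"
    show "(F e \<circ> (\<lambda>\<omega>. \<lambda>q\<in>L1. ?X q \<omega>)) \<omega> = indicator (exceed t e) \<omega>" using eq[OF _ w, of e L1] by (simp add: L1_def)
    show "((\<lambda>x. \<Sum>f\<in>pairs p - neighbours p e. F f x) \<circ> (\<lambda>\<omega>. \<lambda>q\<in>L2. ?X q \<omega>)) \<omega> = (\<Sum>f\<in>pairs p - neighbours p e. indicator (exceed t f) \<omega>)"
      unfolding comp_def by (intro sum.cong refl eq f2 w)
  qed
qed

lemma \<pi>_nonneg: "0 \<le> \<pi>0" "0 \<le> \<pi>2" "0 \<le> adde"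
  unfolding adde_def using rho_nonneg by (auto simp: \<pi>0_def \<pi>2_def)

lemma prob_exceed_both:
  fixes t :: real
  assumes e: "e \<in> pairs p" and f: "f \<in> neighbours p e - {e}" and t: "t0 \<le> t"
  shows "prob (exceed t e \<inter> exceed t f) \<le> \<pi>2"
proof -
  obtain i j where ij: "e = (i, j)" "1 \<le> i" "i < j" using e by (auto simp: pairs_def)
  obtain k l where kl: "f = (k, l)" "1 \<le> k" "k < l" using f by (auto simp: neighbours_def pairs_def)
  have ne: "(i, j) \<noteq> (k, l)" "{k, l} \<inter> {i, j} \<noteq> {}" using f ij kl by (auto simp: neighbours_def)
  have both: "prob {\<omega>\<in>space M. real n * t < Q {-b<..<b} c u \<omega> \<and> real n * t < Q {-b<..<b} c v \<omega>} \<le> \<pi>2"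
    if "1 \<le> c" "1 \<le> u" "1 \<le> v" "c \<noteq> u" "c \<noteq> v" "u \<noteq> v" for c u v using exceed_both_le[OF that t] .
  have I: "exceed t e \<inter> exceed t f = {\<omega>\<in>space M. real n * t < Q {-b<..<b} i j \<omega> \<and> real n * t < Q {-b<..<b} k l \<omega>}"
    unfolding exceed_def ij kl by auto
  from ne(2) consider "k = i" | "k = j" | "l = i" | "l = j" by auto
  then show ?thesis
  proof cases
    case 1
    then have "prob {\<omega>\<in>space M. real n * t < Q {-b<..<b} i j \<omega> \<and> real n * t < Q {-b<..<b} i l \<omega>} \<le> \<pi>2" using ij kl ne by (intro both) auto
    then show ?thesis unfolding I 1 .
  next
    case 2
    then have "prob {\<omega>\<in>space M. real n * t < Q {-b<..<b} j i \<omega> \<and> real n * t < Q {-b<..<b} j l \<omega>} \<le> \<pi>2" using ij kl ne by (intro both) auto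
    then show ?thesis unfolding I 2 Q_commute[of _ j i] .
  next
    case 3
    then have "prob {\<omega>\<in>space M. real n * t < Q {-b<..<b} i j \<omega> \<and> real n * t < Q {-b<..<b} i k \<omega>} \<le> \<pi>2" using ij kl ne by (intro both) auto
    then show ?thesis unfolding I 3 Q_commute[of _ i k] .
  next
    case 4
    then have "prob {\<omega>\<in>space M. real n * t < Q {-b<..<b} j i \<omega> \<and> real n * t < Q {-b<..<b} j k \<omega>} \<le> \<pi>2" using ij kl ne by (intro both) auto
    then show ?thesis unfolding I 4 Q_commute[of _ j i] Q_commute[of _ j k] .
  qed
qed

lemma pairs_le: "real (card (pairs p)) \<le> (real p)\<^sup>2"
  unfolding card_pairs using zero_le_power2[of "real p"] by (simp add: field_simps)

lemma poisson_approx: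
  fixes t :: real
  assumes t: "t0 \<le> t"
  shows "\<bar>prob (space M - (\<Union>e\<in>pairs p. exceed t e)) - exp (- (\<Sum>e\<in>pairs p. prob (exceed t e)))\<bar> \<le> 2 * real p ^ 3 * (\<pi>0\<^sup>2 + \<pi>2)"
proof -
  have P: "prob (exceed t e) \<le> \<pi>0" if "e \<in> pairs p" for e
    unfolding exceed_def using that t by (intro exceed_le) (auto simp: pairs_def)
  have nb: "e \<in> neighbours p e \<and> neighbours p e \<subseteq> pairs p" if "e \<in> pairs p" for e using that by (auto simp: neighbours_def)
  have fn: "finite (neighbours p e)" for e using finite_pairs by (rule finite_subset[rotated]) (auto simp: neighbours_def)
  have "\<bar>prob (space M - (\<Union>e\<in>pairs p. exceed t e)) - exp (- (\<Sum>e\<in>pairs p. prob (exceed t e)))\<bar>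
    \<le> (\<Sum>e\<in>pairs p. \<Sum>f\<in>neighbours p e. prob (exceed t e) * prob (exceed t f)) + (\<Sum>e\<in>pairs p. \<Sum>f\<in>neighbours p e - {e}. prob (exceed t e \<inter> exceed t f))"
    by (rule chen_stein_void[OF finite_pairs exceed_event nb exceed_indep])
  also have "\<dots> \<le> (\<Sum>e\<in>pairs p. \<Sum>f\<in>neighbours p e. \<pi>0 * \<pi>0) + (\<Sum>e\<in>pairs p. \<Sum>f\<in>neighbours p e - {e}. \<pi>2)"
  proof (intro add_mono sum_mono)
    fix e f assume e: "e \<in> pairs p" and f: "f \<in> neighbours p e"
    then have "f \<in> pairs p" using nb[OF e] by blast
    then show "prob (exceed t e) * prob (exceed t f) \<le> \<pi>0 * \<pi>0" using P[OF e] P[of f] \<pi>_nonneg by (intro mult_mono) auto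
  next
    fix e f assume "e \<in> pairs p" "f \<in> neighbours p e - {e}"
    then show "prob (exceed t e \<inter> exceed t f) \<le> \<pi>2" using t by (rule prob_exceed_both)
  qed
  also have "\<dots> \<le> (\<Sum>e\<in>pairs p. 2 * real p * \<pi>0\<^sup>2) + (\<Sum>e\<in>pairs p. 2 * real p * \<pi>2)"
  proof (intro add_mono sum_mono)
    fix e
    have c: "real (card (neighbours p e)) \<le> 2 * real p" using card_neighbours[of p e] by linarith
    then show "(\<Sum>f\<in>neighbours p e. \<pi>0 * \<pi>0) \<le> 2 * real p * \<pi>0\<^sup>2" by (simp add: power2_eq_square mult_right_mono)
    have "card (neighbours p e - {e}) \<le> card (neighbours p e)" using fn by (intro card_mono) auto
    then have "real (card (neighbours p e - {e})) \<le> 2 * real p" using c by linarith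
    then show "(\<Sum>f\<in>neighbours p e - {e}. \<pi>2) \<le> 2 * real p * \<pi>2" using \<pi>_nonneg by (simp add: mult_right_mono)
  qed
  also have "\<dots> = real (card (pairs p)) * (2 * real p * (\<pi>0\<^sup>2 + \<pi>2))" by (simp add: algebra_simps)
  also have "\<dots> \<le> (real p)\<^sup>2 * (2 * real p * (\<pi>0\<^sup>2 + \<pi>2))" using pairs_le \<pi>_nonneg by (intro mult_right_mono) auto
  also have "\<dots> = 2 * real p ^ 3 * (\<pi>0\<^sup>2 + \<pi>2)" by (simp add: power2_eq_square power3_eq_cube)
  finally show ?thesis .
qed

definition "Cd = 1000 + 2 * (300000000 * (real d * 300001 ^ d))"

lemma truncated_max_approx:
  fixes t x1 :: real
  assumes t: "t0 \<le> t" "t \<le> x1\<^sup>2" and x1: "0 \<le> x1" "x1 / sqrt n * b0 \<le> 1" and sm: "b0\<^sup>2 * \<rho> \<le> 1/4"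
  shows "\<bar>prob (space M - (\<Union>e\<in>pairs p. exceed t e)) - exp (- (((real p)\<^sup>2 - real p) / 2 * chi2_tail d t))\<bar>
     \<le> 2 * real p ^ 3 * (\<pi>0\<^sup>2 + \<pi>2) + (real p)\<^sup>2 * adde + Cd * \<delta> x1"
proof (cases "\<delta> x1 \<le> 1/1000")
  case False
  have c0: "0 \<le> chi2_tail d t" by (simp add: chi2_tail_def)
  have "0 \<le> ((real p)\<^sup>2 - real p) / 2" using card_pairs[of p, symmetric] by simp
  then have "0 \<le> ((real p)\<^sup>2 - real p) / 2 * chi2_tail d t" using c0 by simp
  then have e: "exp (- (((real p)\<^sup>2 - real p) / 2 * chi2_tail d t)) \<le> 1" by simp
  have "0 \<le> 2 * (300000000 * (real d * 300001 ^ d)) * \<delta> x1" using delta_nonneg[OF x1(1)] by simp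
  then have "1 \<le> Cd * \<delta> x1" unfolding Cd_def distrib_right using False by linarith
  moreover have "0 \<le> 2 * real p ^ 3 * (\<pi>0\<^sup>2 + \<pi>2)" "0 \<le> (real p)\<^sup>2 * adde" using \<pi>_nonneg by auto
  moreover have "prob (space M - (\<Union>e\<in>pairs p. exceed t e)) \<le> 1" "0 \<le> prob (space M - (\<Union>e\<in>pairs p. exceed t e))" by auto
  moreover have "0 \<le> exp (- (((real p)\<^sup>2 - real p) / 2 * chi2_tail d t))" by simp
  ultimately show ?thesis using e by linarith
next
  case True
  let ?N = "((real p)\<^sup>2 - real p) / 2" and ?c = "chi2_tail d t"
  define \<theta> where "\<theta> = 300000000 * \<delta> x1"
  define \<theta>d where "\<theta>d = (1 + \<theta>) ^ d - 1"
  have \<delta>0: "0 \<le> \<delta> x1" by (rule delta_nonneg[OF x1(1)])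
  have \<theta>: "0 \<le> \<theta>" "\<theta> \<le> 300000" using \<delta>0 True by (auto simp: \<theta>_def)
  have \<theta>d: "0 \<le> \<theta>d" using \<theta> by (simp add: \<theta>d_def)
  have c0: "0 \<le> ?c" by (simp add: chi2_tail_def)
  have one: "\<bar>prob (exceed t e) - ?c\<bar> \<le> \<theta>d * ?c + adde" if e: "e \<in> pairs p" for e
  proof -
    have h: "1 \<le> fst e" "1 \<le> snd e" "fst e \<noteq> snd e" using e by (auto simp: pairs_def)
    show ?thesis using truncation_change_le[OF h t(1)] chi2_compare[OF h x1 sm True t(2)]
      unfolding exceed_def \<theta>d_def \<theta>_def by linarith
  qed
  have "\<bar>(\<Sum>e\<in>pairs p. prob (exceed t e)) - ?N * ?c\<bar> = \<bar>\<Sum>e\<in>pairs p. prob (exceed t e) - ?c\<bar>"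
    unfolding card_pairs[symmetric] by (simp add: sum_subtractf)
  also have "\<dots> \<le> (\<Sum>e\<in>pairs p. \<theta>d * ?c + adde)" by (intro order_trans[OF sum_abs] sum_mono one)
  also have "\<dots> = \<theta>d * (?N * ?c) + ?N * adde" unfolding card_pairs[symmetric] by (simp add: algebra_simps)
  finally have lam: "\<bar>(\<Sum>e\<in>pairs p. prob (exceed t e)) - ?N * ?c\<bar> \<le> \<theta>d * (?N * ?c) + ?N * adde" .
  have N0: "0 \<le> ?N" using card_pairs[of p, symmetric] by simp
  have "\<bar>exp (- (\<Sum>e\<in>pairs p. prob (exceed t e))) - exp (- (?N * ?c))\<bar> \<le> ?N * adde + 2 * \<theta>d"
    by (rule exp_minus_diff_le[OF _ _ \<theta>d _ lam]) (use N0 c0 \<pi>_nonneg in \<open>auto intro: sum_nonneg\<close>)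
  moreover have "?N * adde \<le> (real p)\<^sup>2 * adde" using pairs_le \<pi>_nonneg unfolding card_pairs by (intro mult_right_mono) auto
  moreover have "2 * \<theta>d \<le> Cd * \<delta> x1"
  proof -
    have "\<theta>d \<le> \<theta> * (real d * (1 + 300000) ^ d)" unfolding \<theta>d_def by (rule power_one_plus_le[OF \<theta>])
    then have "2 * \<theta>d \<le> 2 * (300000000 * (real d * 300001 ^ d)) * \<delta> x1" unfolding \<theta>_def by (simp add: ac_simps)
    moreover have "Cd * \<delta> x1 = 1000 * \<delta> x1 + 2 * (300000000 * (real d * 300001 ^ d)) * \<delta> x1" unfolding Cd_def by (rule distrib_right)
    ultimately show ?thesis using \<delta>0 by linarith
  qed
  ultimately show ?thesis using poisson_approx[OF t(1)] by linarith
qed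

lemma W_le_iff:
  fixes t :: real
  shows "(W d Xa p n \<omega>)\<^sup>2 / n \<le> t \<longleftrightarrow> (\<forall>e\<in>pairs p. Q UNIV (fst e) (snd e) \<omega> \<le> real n * t)"
proof -
  let ?f = "\<lambda>i j. L2_set (\<lambda>m. \<Sum>k=1..n. Xa m k i \<omega> * Xa m k j \<omega>) {1..d}"
  let ?S = "{?f i j | i j. 1 \<le> i \<and> i < j \<and> j \<le> p}"
  have S: "?S = (\<lambda>e. ?f (fst e) (snd e)) ` pairs p"
  proof (intro set_eqI iffI)
    fix z assume "z \<in> ?S"
    then obtain i j where "z = ?f i j" "(i, j) \<in> pairs p" by (auto simp: pairs_def)
    then have "z = ?f (fst (i, j)) (snd (i, j))" by simp
    with \<open>(i, j) \<in> pairs p\<close> show "z \<in> (\<lambda>e. ?f (fst e) (snd e)) ` pairs p" by (rule rev_image_eqI)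
  next
    fix z assume "z \<in> (\<lambda>e. ?f (fst e) (snd e)) ` pairs p"
    then obtain e where e: "e \<in> pairs p" "z = ?f (fst e) (snd e)" by blast
    then have "1 \<le> fst e \<and> fst e < snd e \<and> snd e \<le> p" by (auto simp: pairs_def)
    then show "z \<in> ?S" using e(2) by blast
  qed
  have fin: "finite ?S" unfolding S using finite_pairs by simp
  have "(1, 2) \<in> pairs p" using p by (auto simp: pairs_def)
  then have ne: "?S \<noteq> {}" unfolding S by blast
  have sq: "(?f i j)\<^sup>2 = Q UNIV i j \<omega>" for i j
    unfolding L2_set_def Q_def Y_def trunc_def by (simp add: sum_nonneg)
  have W: "W d Xa p n \<omega> = Max ?S" unfolding W_def ..
  have n0: "real n > 0" using n by simp
  have "(W d Xa p n \<omega>)\<^sup>2 \<le> real n * t \<longleftrightarrow> (\<forall>e\<in>pairs p. Q UNIV (fst e) (snd e) \<omega> \<le> real n * t)"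
  proof
    assume le: "(W d Xa p n \<omega>)\<^sup>2 \<le> real n * t"
    show "\<forall>e\<in>pairs p. Q UNIV (fst e) (snd e) \<omega> \<le> real n * t"
    proof
      fix e assume "e \<in> pairs p"
      then have "?f (fst e) (snd e) \<le> Max ?S" using fin unfolding S by (intro Max_ge) auto
      then have "(?f (fst e) (snd e))\<^sup>2 \<le> (Max ?S)\<^sup>2" by (intro power_mono L2_set_nonneg)
      then show "Q UNIV (fst e) (snd e) \<omega> \<le> real n * t" using le unfolding W sq by linarith
    qed
  next
    assume le: "\<forall>e\<in>pairs p. Q UNIV (fst e) (snd e) \<omega> \<le> real n * t"
    have "Max ?S \<in> ?S" using fin ne by (rule Max_in)
    then obtain e where e: "e \<in> pairs p" "Max ?S = ?f (fst e) (snd e)" unfolding S by blast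
    show "(W d Xa p n \<omega>)\<^sup>2 \<le> real n * t" unfolding W e(2) sq using le e(1) by blast
  qed
  then show ?thesis using n0 by (simp add: pos_divide_le_eq mult.commute)
qed

lemma max_truncation_le:
  fixes t :: real
  shows "\<bar>prob {\<omega>\<in>space M. (W d Xa p n \<omega>)\<^sup>2 / n \<le> t} - prob (space M - (\<Union>e\<in>pairs p. exceed t e))\<bar>
    \<le> (real p)\<^sup>2 * (real n * real d * measure \<nu> {y. b \<le> \<bar>y\<bar>})"
proof -
  let ?J = "{1..d} \<times> {1..n}"
  let ?A = "{\<omega>\<in>space M. (W d Xa p n \<omega>)\<^sup>2 / n \<le> t}" and ?B = "space M - (\<Union>e\<in>pairs p. exceed t e)"
  let ?F = "\<lambda>e j. {\<omega>\<in>space M. Y (fst e) (snd e) j \<omega> \<in> {y. b \<le> \<bar>y\<bar>}}"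
  let ?U = "\<Union>e\<in>pairs p. \<Union>j\<in>?J. ?F e j"
  have bm: "{y::real. b \<le> \<bar>y\<bar>} \<in> sets borel" by measurable
  have h: "1 \<le> fst e" "1 \<le> snd e" "fst e \<noteq> snd e" if "e \<in> pairs p" for e using that by (auto simp: pairs_def)
  have F: "?F e j \<in> events" if "e \<in> pairs p" "j \<in> ?J" for e j
    using measurable_sets[OF Y_rv[OF that(2) h(1,2)[OF that(1)]] bm] by (simp add: vimage_def Int_def conj_commute)
  have U: "?U \<in> events" using F finite_pairs by (intro sets.finite_UN) auto
  have A: "?A \<in> events"
  proof -
    have "{\<omega>\<in>space M. \<forall>e\<in>pairs p. Q UNIV (fst e) (snd e) \<omega> \<le> real n * t} \<in> events"
    proof (rule sets.sets_Collect_finite_All[OF _ finite_pairs])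
      fix e assume "e \<in> pairs p"
      note [measurable] = Q_rv[OF _ h(1,2)[OF this], of UNIV]
      show "{\<omega>\<in>space M. Q UNIV (fst e) (snd e) \<omega> \<le> real n * t} \<in> events" by measurable
    qed
    then show ?thesis unfolding W_le_iff .
  qed
  have B: "?B \<in> events" using exceed_event finite_pairs by (intro sets.Diff sets.finite_UN) auto
  have same: "\<omega> \<in> ?A \<longleftrightarrow> \<omega> \<in> ?B" if w: "\<omega> \<in> space M" "\<omega> \<notin> ?U" for \<omega>
  proof -
    have "Q UNIV (fst e) (snd e) \<omega> = Q {-b<..<b} (fst e) (snd e) \<omega>" if e: "e \<in> pairs p" for e
      unfolding Q_def
    proof (intro sum.cong refl arg_cong[where f="\<lambda>x. x\<^sup>2"])
      fix m k assume "m \<in> {1..d}" "k \<in> {1..n}"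
      then have "\<bar>Y (fst e) (snd e) (m, k) \<omega>\<bar> < b" using w e by force
      then have "Y (fst e) (snd e) (m, k) \<omega> \<in> {-b<..<b}" by (auto simp: abs_less_iff)
      then show "trunc UNIV (Y (fst e) (snd e) (m, k) \<omega>) = trunc {-b<..<b} (Y (fst e) (snd e) (m, k) \<omega>)" by (simp add: trunc_def)
    qed
    then show ?thesis using w(1) by (auto simp: W_le_iff exceed_def not_less)
  qed
  have PU: "prob ?U \<le> (real p)\<^sup>2 * (real n * real d * measure \<nu> {y. b \<le> \<bar>y\<bar>})"
  proof -
    have "prob ?U \<le> (\<Sum>e\<in>pairs p. prob (\<Union>j\<in>?J. ?F e j))" using F finite_pairs by (intro measure_UNION_le sets.finite_UN) auto
    also have "\<dots> \<le> (\<Sum>e\<in>pairs p. \<Sum>j\<in>?J. prob (?F e j))" using F by (intro sum_mono measure_UNION_le) auto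
    also have "\<dots> = (\<Sum>e\<in>pairs p. \<Sum>j\<in>?J. measure \<nu> {y. b \<le> \<bar>y\<bar>})"
      by (intro sum.cong refl Y_prob h bm) auto
    also have "\<dots> = real (card (pairs p)) * (real n * real d * measure \<nu> {y. b \<le> \<bar>y\<bar>})" by (simp add: card_cartesian_product)
    also have "\<dots> \<le> (real p)\<^sup>2 * (real n * real d * measure \<nu> {y. b \<le> \<bar>y\<bar>})" using pairs_le by (intro mult_right_mono) auto
    finally show ?thesis .
  qed
  have "prob ?A \<le> prob (?B \<union> ?U)" using same A B U by (intro finite_measure_mono) auto
  also have "\<dots> \<le> prob ?B + prob ?U" using B U by (rule measure_Un_le)
  finally have 1: "prob ?A \<le> prob ?B + prob ?U" .
  have "prob ?B \<le> prob (?A \<union> ?U)" using same A B U by (intro finite_measure_mono) auto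
  also have "\<dots> \<le> prob ?A + prob ?U" using A U by (rule measure_Un_le)
  finally show ?thesis using 1 PU by linarith
qed

lemma max_approx:
  fixes t x1 :: real
  assumes t: "t0 \<le> t" "t \<le> x1\<^sup>2" and x1: "0 \<le> x1" "x1 / sqrt n * b0 \<le> 1" and sm: "b0\<^sup>2 * \<rho> \<le> 1/4"
  shows "\<bar>prob {\<omega>\<in>space M. (W d Xa p n \<omega>)\<^sup>2 / n \<le> t} - exp (- (((real p)\<^sup>2 - real p) / 2 * chi2_tail d t))\<bar>
     \<le> (real p)\<^sup>2 * (real n * real d * measure \<nu> {y. b \<le> \<bar>y\<bar>}) + 2 * real p ^ 3 * (\<pi>0\<^sup>2 + \<pi>2) + (real p)\<^sup>2 * adde + Cd * \<delta> x1"
  using truncated_max_approx[OF assms] max_truncation_le[of t] by linarith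

end

section \<open>Asymptotics of the parameters\<close>

lemma chi2_tail_mono_dof:
  assumes "d \<ge> 1"
  shows "chi2_tail 1 t \<le> chi2_tail d t"
proof (cases "d = 1")
  case False
  then have k: "d - 1 \<ge> 1" "1 + (d - 1) = d" using assms by auto
  note c1 = real_distribution_chi2[of 1] and ck = real_distribution_chi2[OF k(1)]
  have one: "1 \<le> (1::nat)" by simp
  interpret c1: real_distribution "chi2 1" by (rule c1) simp
  interpret ck: real_distribution "chi2 (d - 1)" by (rule ck)
  have conv: "convolution (chi2 (d - 1)) (chi2 1) = chi2 d" using chi2_convolution[OF k(1) one] k(2) by simp
  note ct = convolution_tail[OF ck c1[OF one], of t]
  have "chi2_tail 1 t = (LINT r|chi2 (d - 1). measure (chi2 1) {t<..})"
    unfolding chi2_tail_eq(2) using ck.prob_space by simp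
  also have "\<dots> \<le> (LINT r|chi2 (d - 1). measure (chi2 1) {t - r<..})"
  proof (rule integral_mono_AE)
    show "AE r in chi2 (d - 1). measure (chi2 1) {t<..} \<le> measure (chi2 1) {t - r<..}"
      using chi2_AE_nonneg[of "d - 1"]
    proof eventually_elim
      case (elim r)
      then show ?case by (intro c1.finite_measure_mono) auto
    qed
  qed (rule ck.integrable_const, rule ct(2))
  also have "\<dots> = chi2_tail d t" unfolding ct(1)[symmetric] conv chi2_tail_eq(2) ..
  finally show ?thesis .
qed simp

lemma chi2_tail_ge:
  assumes "d \<ge> 1" "0 \<le> t"
  shows "2 * (exp (- t / 2) * (1 / (27 * (1 + sqrt t)))) \<le> chi2_tail d t"
proof -
  have "exp (- (sqrt t)\<^sup>2 / 2) * (1 / (27 * (1 + sqrt t))) \<le> measure std_normal_distribution {sqrt t<..}"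
    unfolding std_normal_tail_tilt using assms std_normal_laplace_ge[of "sqrt t"] by (intro mult_left_mono) auto
  then have "exp (- t / 2) * (1 / (27 * (1 + sqrt t))) \<le> measure std_normal_distribution {sqrt t<..}" using assms by simp
  then show ?thesis using chi2_tail_mono_dof[OF assms(1), of t] chi2_tail_1[OF assms(2)] by linarith
qed

lemma moment_from_tail:
  assumes \<nu>: "real_distribution \<nu>" and \<alpha>: "\<alpha> > 0"
    and tail: "\<And>x::real. x > 0 \<Longrightarrow> x powr (1 + 2 * \<alpha>) * measure \<nu> {y. sqrt (x * logc x) \<le> \<bar>y\<bar>} \<le> B0"
  shows "integrable \<nu> (\<lambda>y. \<bar>y\<bar> powr (2 + 3 * \<alpha>))"
proof -
  interpret nu: real_distribution \<nu> by (rule \<nu>)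
  define s where "s = 2 + 3 * \<alpha>"
  define e where "e = 2 - \<alpha> / (2 * (1 + 2 * \<alpha>))"
  have e: "e * (1 + 2 * \<alpha>) = s + \<alpha> / 2" unfolding e_def s_def using \<alpha> by (simp add: field_simps)
  have e0: "e > 0" unfolding e_def using \<alpha> by (simp add: field_simps)
  have ev: "eventually (\<lambda>u::real. u powr e * max (e * ln u) 1 \<le> u\<^sup>2) at_top"
  proof -
    define a where "a = \<alpha> / (2 * (1 + 2 * \<alpha>))"
    have a: "a > 0" unfolding a_def using \<alpha> by simp
    have "eventually (\<lambda>u::real. max (e * ln u) 1 \<le> u powr a) at_top"
    proof -
      have "eventually (\<lambda>u::real. e * ln u \<le> u powr a) at_top" using a e0 by real_asymp
      moreover have "eventually (\<lambda>u::real. 1 \<le> u powr a) at_top" using a by real_asymp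
      ultimately show ?thesis by eventually_elim simp
    qed
    with eventually_gt_at_top[of 0] show ?thesis
    proof eventually_elim
      case (elim u)
      have "u powr e * max (e * ln u) 1 \<le> u powr e * u powr a" using elim by (intro mult_left_mono) auto
      also have "\<dots> = u powr 2" unfolding powr_add[symmetric] by (simp add: e_def a_def)
      also have "\<dots> = u\<^sup>2" using elim by (simp add: powr_numeral)
      finally show ?case .
    qed
  qed
  then obtain u0 where u0: "\<And>u. u \<ge> u0 \<Longrightarrow> u powr e * max (e * ln u) 1 \<le> u\<^sup>2" by (auto simp: eventually_at_top_linorder)
  define u1 where "u1 = max u0 1"
  have tl: "measure \<nu> {y. u \<le> \<bar>y\<bar>} \<le> B0 * u powr (- (s + \<alpha> / 2))" if u: "u \<ge> u1" for u
  proof -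
    have u1: "u \<ge> u0" "u \<ge> 1" using u by (auto simp: u1_def)
    define x where "x = u powr e"
    have x: "x > 0" using u1 by (simp add: x_def)
    have "logc x = max (e * ln u) 1"
    proof -
      have "ln (max x (exp 1)) = max (ln x) 1"
      proof (cases "x \<le> exp 1")
        case True
        then have "ln x \<le> ln (exp 1)" using x by (subst ln_le_cancel_iff) auto
        then show ?thesis using True by (simp add: max_def)
      next
        case False
        then have "ln (exp 1) \<le> ln x" using x by (subst ln_le_cancel_iff) auto
        then show ?thesis using False by (simp add: max_def)
      qed
      then show ?thesis unfolding logc_def x_def using u1 by (simp add: ln_powr)
    qed
    then have "x * logc x \<le> u\<^sup>2" using u0[OF u1(1)] by (simp add: x_def)
    then have "sqrt (x * logc x) \<le> u" using u1 by (intro real_le_lsqrt) auto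
    then have "measure \<nu> {y. u \<le> \<bar>y\<bar>} \<le> measure \<nu> {y. sqrt (x * logc x) \<le> \<bar>y\<bar>}"
      by (intro nu.finite_measure_mono) auto
    also have "\<dots> \<le> B0 * x powr (- (1 + 2 * \<alpha>))"
    proof -
      have "x powr (1 + 2 * \<alpha>) * measure \<nu> {y. sqrt (x * logc x) \<le> \<bar>y\<bar>} * x powr (- (1 + 2 * \<alpha>)) \<le> B0 * x powr (- (1 + 2 * \<alpha>))"
        by (intro mult_right_mono tail x) auto
      moreover have "x powr (1 + 2 * \<alpha>) * x powr (- (1 + 2 * \<alpha>)) = 1" using x unfolding powr_add[symmetric] by simp
      moreover have "X * m * X' = m * (X * X')" for X m X' :: real by simp
      ultimately show ?thesis by (metis mult_1_right)
    qed
    also have "x powr (- (1 + 2 * \<alpha>)) = u powr (- (s + \<alpha> / 2))" unfolding x_def powr_powr e[symmetric] mult_minus_right ..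
    finally show ?thesis .
  qed
  obtain k0 :: nat where k0: "u1 \<le> 2 ^ k0" using real_arch_pow[of 2 u1] by (auto intro: less_imp_le)
  define P where "P k = 2 powr (real (Suc k) * s) * measure \<nu> {y. 2 ^ k \<le> \<bar>y\<bar>}" for k
  have P0: "0 \<le> P k" for k by (simp add: P_def)
  have "summable P"
  proof (rule summable_comparison_test_ev)
    show "summable (\<lambda>k. (B0 * 2 powr s) * (2 powr (- (\<alpha> / 2))) ^ k)"
    proof (intro summable_mult summable_geometric)
      have "2 powr (- (\<alpha> / 2)) < 2 powr 0" using \<alpha> by (intro powr_less_mono) auto
      then show "norm (2 powr (- (\<alpha> / 2))) < 1" by simp
    qed
    show "eventually (\<lambda>k. norm (P k) \<le> (B0 * 2 powr s) * (2 powr (- (\<alpha> / 2))) ^ k) sequentially"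
      using eventually_ge_at_top[of k0]
    proof eventually_elim
      case (elim k)
      have "(2::real) ^ k0 \<le> 2 ^ k" using elim by (intro power_increasing) auto
      then have "u1 \<le> 2 ^ k" using k0 by linarith
      then have "measure \<nu> {y. 2 ^ k \<le> \<bar>y\<bar>} \<le> B0 * (2 ^ k) powr (- (s + \<alpha> / 2))" by (rule tl)
      then have "P k \<le> 2 powr (real (Suc k) * s) * (B0 * (2 ^ k) powr (- (s + \<alpha> / 2)))" unfolding P_def by (intro mult_left_mono) auto
      also have "\<dots> = B0 * (2 powr (real (Suc k) * s) * 2 powr (real k * (- (s + \<alpha> / 2))))"
        by (simp add: powr_powr flip: powr_realpow)
      also have "\<dots> = B0 * (2 powr s * 2 powr (real k * (- (\<alpha> / 2))))" unfolding powr_add[symmetric] by (simp add: algebra_simps)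
      also have "2 powr (real k * (- (\<alpha> / 2))) = (2 powr (- (\<alpha> / 2))) ^ k" by (simp add: powr_power mult.commute)
      finally show ?case using P0[of k] by simp
    qed
  qed
  have m: "(\<lambda>y::real. \<bar>y\<bar> powr s) \<in> borel_measurable borel" by measurable
  have pt: "ennreal (\<bar>y\<bar> powr s) \<le> 1 + (\<Sum>k. ennreal (2 powr (real (Suc k) * s)) * indicator {y. 2 ^ k \<le> \<bar>y\<bar>} y)" for y :: real
  proof (cases "\<bar>y\<bar> < 1")
    case True
    then have "\<bar>y\<bar> powr s \<le> 1" using \<alpha> by (intro powr_le1) (auto simp: s_def)
    then have "ennreal (\<bar>y\<bar> powr s) \<le> 1" by simp
    then show ?thesis by (rule order_trans) simp
  next
    case False
    then have y1: "1 \<le> \<bar>y\<bar>" by simp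
    define k where "k = nat \<lfloor>log 2 \<bar>y\<bar>\<rfloor>"
    have l0: "0 \<le> log 2 \<bar>y\<bar>" using y1 by simp
    have kl: "real k \<le> log 2 \<bar>y\<bar>" "log 2 \<bar>y\<bar> \<le> real (Suc k)" unfolding k_def using l0 by linarith+
    have yy: "\<bar>y\<bar> = 2 powr (log 2 \<bar>y\<bar>)" using y1 by simp
    have lo: "2 ^ k \<le> \<bar>y\<bar>"
    proof -
      have "2 powr (real k) \<le> 2 powr (log 2 \<bar>y\<bar>)" using kl by (intro powr_mono) auto
      then show ?thesis using yy by (simp add: powr_realpow)
    qed
    have "\<bar>y\<bar> powr s \<le> 2 powr (real (Suc k) * s)"
    proof -
      have "\<bar>y\<bar> powr s = 2 powr (log 2 \<bar>y\<bar> * s)" using yy powr_powr[of 2 "log 2 \<bar>y\<bar>" s] by simp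
      also have "\<dots> \<le> 2 powr (real (Suc k) * s)" using kl \<alpha> by (intro powr_mono mult_right_mono) (auto simp: s_def)
      finally show ?thesis .
    qed
    then have "ennreal (\<bar>y\<bar> powr s) \<le> ennreal (2 powr (real (Suc k) * s)) * indicator {y. 2 ^ k \<le> \<bar>y\<bar>} y" using lo by (simp add: ennreal_leI)
    also have "\<dots> \<le> (\<Sum>k. ennreal (2 powr (real (Suc k) * s)) * indicator {y. 2 ^ k \<le> \<bar>y\<bar>} y)"
    proof -
      define g where "g = (\<lambda>k. ennreal (2 powr (real (Suc k) * s)) * indicator {y. 2 ^ k \<le> \<bar>y\<bar>} y)"
      have "sum g {k} \<le> suminf g" by (rule sum_le_suminf) (auto intro: summableI)
      then have "g k \<le> suminf g" by simp
      then show ?thesis unfolding g_def .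
    qed
    finally show ?thesis by (rule order_trans) simp
  qed
  have "(\<integral>\<^sup>+y. ennreal (\<bar>y\<bar> powr s) \<partial>\<nu>) \<le> (\<integral>\<^sup>+y. 1 + (\<Sum>k. ennreal (2 powr (real (Suc k) * s)) * indicator {y. 2 ^ k \<le> \<bar>y\<bar>} y) \<partial>\<nu>)"
    by (intro nn_integral_mono pt)
  also have "\<dots> = 1 + (\<Sum>k. \<integral>\<^sup>+y. ennreal (2 powr (real (Suc k) * s)) * indicator {y. 2 ^ k \<le> \<bar>y\<bar>} y \<partial>\<nu>)"
    using nu.emeasure_space_1 by (subst nn_integral_add) (auto simp: nn_integral_suminf)
  also have "\<dots> = 1 + (\<Sum>k. ennreal (P k))"
  proof -
    have "(\<integral>\<^sup>+y. ennreal (2 powr (real (Suc k) * s)) * indicator {y. 2 ^ k \<le> \<bar>y\<bar>} y \<partial>\<nu>) = ennreal (P k)" for k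
      by (subst nn_integral_cmult_indicator) (auto simp: P_def nu.emeasure_eq_measure ennreal_mult)
    then show ?thesis by simp
  qed
  also have "\<dots> = 1 + ennreal (suminf P)" using suminf_ennreal2[OF P0 \<open>summable P\<close>] by simp
  also have "\<dots> < \<infinity>" by (simp add: ennreal_add_eq_top less_top)
  finally have "(\<integral>\<^sup>+y. ennreal (\<bar>y\<bar> powr s) \<partial>\<nu>) < \<infinity>" .
  then have "integrable \<nu> (\<lambda>y. \<bar>y\<bar> powr s)" using m by (intro integrableI_bounded) auto
  then show ?thesis unfolding s_def .
qed

lemma eventually_parameter_bounds:
  fixes \<alpha> c1 c2 \<epsilon> \<eta> B D q0 :: real
  assumes "\<alpha> > 0" "c1 > 0" "c2 > 0" "\<epsilon> > 0" "\<eta> > 0" "D > 0" "B > 0" "q0 > 0"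
  shows "eventually (\<lambda>n::nat. n \<ge> 3 \<and> real n powr (\<alpha> / 2) \<le> c1 * real n powr \<alpha> \<and> 3 \<le> c1 * real n powr \<alpha> \<and> c2 * real n powr \<alpha> \<le> real n powr (2 * \<alpha>)
      \<and> 1 / ln n ^ 4 < \<epsilon> * sqrt (\<alpha> / 2 * ln n) / D \<and> 4 * sqrt (2 * \<alpha> * ln n) / ln n ^ 4 \<le> \<eta> \<and> sqrt (16 * \<alpha> * ln n) / ln n ^ 4 \<le> 1) sequentially"
    "eventually (\<lambda>n::nat. B * (sqrt n / ln n ^ 4) powr (- (3 * \<alpha>)) \<le> 1/4) sequentially"
    "eventually (\<lambda>n::nat. ln n * (B * n * (sqrt n / ln n ^ 4) powr (- (2 + 3 * \<alpha>))) \<le> n powr (- (5 * \<alpha> / 4))) sequentially"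
    "eventually (\<lambda>n::nat. D / (c1 * n powr \<alpha>) \<le> 1 \<and> q0 \<le> \<alpha> / 2 * ln n) sequentially"
    "eventually (\<lambda>q::real. 54 * (q * (1 + 2 * sqrt q)) \<le> exp (2 * \<eta> * q)) at_top"
proof -
  note a = assms
  show "eventually (\<lambda>n::nat. n \<ge> 3 \<and> real n powr (\<alpha> / 2) \<le> c1 * real n powr \<alpha> \<and> 3 \<le> c1 * real n powr \<alpha> \<and> c2 * real n powr \<alpha> \<le> real n powr (2 * \<alpha>)
      \<and> 1 / ln n ^ 4 < \<epsilon> * sqrt (\<alpha> / 2 * ln n) / D \<and> 4 * sqrt (2 * \<alpha> * ln n) / ln n ^ 4 \<le> \<eta> \<and> sqrt (16 * \<alpha> * ln n) / ln n ^ 4 \<le> 1) sequentially"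
  proof (intro eventually_conj)
    show "eventually (\<lambda>n::nat. n \<ge> 3) sequentially" by (rule eventually_ge_at_top)
    show "eventually (\<lambda>n::nat. real n powr (\<alpha> / 2) \<le> c1 * real n powr \<alpha>) sequentially" using a by real_asymp
    show "eventually (\<lambda>n::nat. 3 \<le> c1 * real n powr \<alpha>) sequentially" using a by real_asymp
    show "eventually (\<lambda>n::nat. c2 * real n powr \<alpha> \<le> real n powr (2 * \<alpha>)) sequentially" using a by real_asymp
    show "eventually (\<lambda>n::nat. 1 / ln n ^ 4 < \<epsilon> * sqrt (\<alpha> / 2 * ln n) / D) sequentially" using a by real_asymp
    show "eventually (\<lambda>n::nat. 4 * sqrt (2 * \<alpha> * ln n) / ln n ^ 4 \<le> \<eta>) sequentially" using a by real_asymp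
    show "eventually (\<lambda>n::nat. sqrt (16 * \<alpha> * ln n) / ln n ^ 4 \<le> 1) sequentially" using a by real_asymp
  qed
  show "eventually (\<lambda>n::nat. B * (sqrt n / ln n ^ 4) powr (- (3 * \<alpha>)) \<le> 1/4) sequentially" using a by real_asymp
  have "eventually (\<lambda>n::nat. ln n * (B * ln n powr (4 * (2 + 3 * \<alpha>))) \<le> n powr (\<alpha> / 4)) sequentially" using a by real_asymp
  with eventually_ge_at_top[of 3]
  show "eventually (\<lambda>n::nat. ln n * (B * n * (sqrt n / ln n ^ 4) powr (- (2 + 3 * \<alpha>))) \<le> n powr (- (5 * \<alpha> / 4))) sequentially"
  proof eventually_elim
    case (elim n)
    have n0: "real n > 0" using elim by simp
    have l0: "ln (real n) > 0" using elim by simp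
    have "(sqrt n / ln n ^ 4) powr (- (2 + 3 * \<alpha>)) = sqrt n powr (- (2 + 3 * \<alpha>)) / (ln n ^ 4) powr (- (2 + 3 * \<alpha>))"
      by (rule powr_divide)
    also have "sqrt n powr (- (2 + 3 * \<alpha>)) = n powr (- 1 - 3 * \<alpha> / 2)" unfolding powr_half_sqrt[OF less_imp_le[OF n0], symmetric] powr_powr by (simp add: algebra_simps)
    also have "(ln n ^ 4) powr (- (2 + 3 * \<alpha>)) = 1 / ln n powr (4 * (2 + 3 * \<alpha>))"
    proof -
      have "ln n ^ 4 = ln n powr 4" using l0 by (simp add: powr_numeral)
      then have "(ln n ^ 4) powr (- (2 + 3 * \<alpha>)) = ln n powr (- (4 * (2 + 3 * \<alpha>)))" by (simp add: powr_powr)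
      also have "\<dots> = 1 / ln n powr (4 * (2 + 3 * \<alpha>))" by (rule powr_minus_divide)
      finally show ?thesis .
    qed
    finally have e: "(sqrt n / ln n ^ 4) powr (- (2 + 3 * \<alpha>)) = n powr (- 1 - 3 * \<alpha> / 2) * ln n powr (4 * (2 + 3 * \<alpha>))" by simp
    have f: "n * n powr (- 1 - 3 * \<alpha> / 2) = n powr (- (3 * \<alpha> / 2))"
      using n0 powr_add[of n 1 "- 1 - 3 * \<alpha> / 2"] by simp
    have "ln n * (B * n * (sqrt n / ln n ^ 4) powr (- (2 + 3 * \<alpha>))) = (ln n * (B * ln n powr (4 * (2 + 3 * \<alpha>)))) * n powr (- (3 * \<alpha> / 2))"
      unfolding e f[symmetric] by (simp only: ac_simps)
    also have "\<dots> \<le> n powr (\<alpha> / 4) * n powr (- (3 * \<alpha> / 2))" using elim by (intro mult_right_mono) auto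
    also have "\<dots> = n powr (- (5 * \<alpha> / 4))" unfolding powr_add[symmetric] by simp
    finally show ?case .
  qed
  show "eventually (\<lambda>n::nat. D / (c1 * n powr \<alpha>) \<le> 1 \<and> q0 \<le> \<alpha> / 2 * ln n) sequentially"
  proof (intro eventually_conj)
    show "eventually (\<lambda>n::nat. D / (c1 * n powr \<alpha>) \<le> 1) sequentially" using a by real_asymp
    show "eventually (\<lambda>n::nat. q0 \<le> \<alpha> / 2 * ln n) sequentially" using a by real_asymp
  qed
  show "eventually (\<lambda>q::real. 54 * (q * (1 + 2 * sqrt q)) \<le> exp (2 * \<eta> * q)) at_top" using a by real_asymp
qed

lemma monotone_sandwich:
  fixes F G :: "real \<Rightarrow> real"
  assumes F: "mono F" "\<And>t. 0 \<le> F t" "\<And>t. F t \<le> 1" and G: "mono G" "\<And>t. 0 \<le> G t" "\<And>t. G t \<le> 1"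
    and E: "\<And>t. a \<le> t \<Longrightarrow> t \<le> b \<Longrightarrow> \<bar>F t - G t\<bar> \<le> E" and ab: "a \<le> b" and r: "G a \<le> r" "1 - G b \<le> r"
  shows "\<bar>F t - G t\<bar> \<le> E + r"
proof -
  have r0: "0 \<le> r" using r(1) G(2)[of a] by linarith
  have E0: "0 \<le> E" using E[of a] ab by linarith
  consider "t < a" | "a \<le> t" "t \<le> b" | "b < t" by linarith
  then show ?thesis
  proof cases
    case 1
    then have "F t \<le> F a" "G t \<le> G a" using monoD[OF F(1)] monoD[OF G(1)] by auto
    then show ?thesis using E[of a] ab r F(2)[of t] G(2)[of t] E0 by linarith
  next
    case 2
    then show ?thesis using E[of t] r0 by linarith
  next
    case 3
    then have "F b \<le> F t" "G b \<le> G t" using monoD[OF F(1)] monoD[OF G(1)] by auto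
    then show ?thesis using E[of b] ab r F(3)[of t] G(3)[of t] E0 by linarith
  qed
qed

lemma truncated_second_moment_le:
  assumes \<nu>: "real_distribution \<nu>" and s: "2 < s" and i: "integrable \<nu> (\<lambda>y. \<bar>y\<bar> powr s)" and b0: "0 < b0" and B: "(LINT y|\<nu>. \<bar>y\<bar> powr s) \<le> B"
  shows "(LINT y|\<nu>. (if b0 < \<bar>y\<bar> then y\<^sup>2 else 0)) \<le> b0\<^sup>2 * (B * b0 powr (- s))"
proof -
  interpret nu: real_distribution \<nu> by (rule \<nu>)
  have "(LINT y|\<nu>. (if b0 < \<bar>y\<bar> then y\<^sup>2 else 0)) \<le> (LINT y|\<nu>. b0 powr (2 - s) * \<bar>y\<bar> powr s)"
  proof (rule integral_mono_AE')
    show "integrable \<nu> (\<lambda>y. b0 powr (2 - s) * \<bar>y\<bar> powr s)" using i by simp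
    show "AE y in \<nu>. (if b0 < \<bar>y\<bar> then y\<^sup>2 else 0) \<le> b0 powr (2 - s) * \<bar>y\<bar> powr s"
    proof (intro AE_I2)
      fix y :: real
      show "(if b0 < \<bar>y\<bar> then y\<^sup>2 else 0) \<le> b0 powr (2 - s) * \<bar>y\<bar> powr s"
      proof (cases "b0 < \<bar>y\<bar>")
        case True
        then have y0: "0 < \<bar>y\<bar>" using b0 by linarith
        have "\<bar>y\<bar> powr (2 - s) \<le> b0 powr (2 - s)" using True b0 s by (intro powr_mono2') auto
        then have "\<bar>y\<bar> powr (2 - s) * \<bar>y\<bar> powr s \<le> b0 powr (2 - s) * \<bar>y\<bar> powr s" by (intro mult_right_mono) auto
        also have "\<bar>y\<bar> powr (2 - s) * \<bar>y\<bar> powr s = y\<^sup>2" using y0 unfolding powr_add[symmetric] by (simp add: powr_numeral)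
        finally show ?thesis using True by simp
      qed simp
    qed
    show "AE y in \<nu>. 0 \<le> b0 powr (2 - s) * \<bar>y\<bar> powr s" by auto
  qed
  also have "\<dots> \<le> b0 powr (2 - s) * B" using B by (simp add: mult_left_mono)
  also have "b0 powr (2 - s) = b0\<^sup>2 * b0 powr (- s)" using b0 powr_add[of b0 2 "- s"] by (simp add: powr_numeral)
  finally show ?thesis by (simp add: ac_simps)
qed

context iid_products
begin

lemma W_cdf_mono:
  assumes "n \<ge> 1" "p \<ge> 2"
  shows "mono (\<lambda>t::real. prob {\<omega>\<in>space M. (W d Xa p n \<omega>)\<^sup>2 / real n \<le> t})"
proof (rule monoI)
  fix s t :: real assume st: "s \<le> t"
  let ?Q = "\<lambda>e \<omega>. \<Sum>m=1..d. (\<Sum>k=1..n. Xa m k (fst e) \<omega> * Xa m k (snd e) \<omega>)\<^sup>2"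
  show "prob {\<omega>\<in>space M. (W d Xa p n \<omega>)\<^sup>2 / real n \<le> s} \<le> prob {\<omega>\<in>space M. (W d Xa p n \<omega>)\<^sup>2 / real n \<le> t}"
  proof (rule finite_measure_mono)
    have "random_variable borel (W d Xa p n)"
    proof -
      have eq: "W d Xa p n = (\<lambda>\<omega>. Max ((\<lambda>e. L2_set (\<lambda>m. \<Sum>k=1..n. Xa m k (fst e) \<omega> * Xa m k (snd e) \<omega>) {1..d}) ` pairs p))"
      proof
        fix \<omega>
        let ?f = "\<lambda>i j. L2_set (\<lambda>m. \<Sum>k=1..n. Xa m k i \<omega> * Xa m k j \<omega>) {1..d}"
        have "{?f i j | i j. 1 \<le> i \<and> i < j \<and> j \<le> p} = (\<lambda>e. ?f (fst e) (snd e)) ` pairs p"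
        proof (intro set_eqI iffI)
          fix z assume "z \<in> {?f i j | i j. 1 \<le> i \<and> i < j \<and> j \<le> p}"
          then obtain i j where "z = ?f i j" "(i, j) \<in> pairs p" by (auto simp: pairs_def)
          then have "z = ?f (fst (i, j)) (snd (i, j))" by simp
          with \<open>(i, j) \<in> pairs p\<close> show "z \<in> (\<lambda>e. ?f (fst e) (snd e)) ` pairs p" by (rule rev_image_eqI)
        next
          fix z assume "z \<in> (\<lambda>e. ?f (fst e) (snd e)) ` pairs p"
          then obtain e where e: "e \<in> pairs p" "z = ?f (fst e) (snd e)" by blast
          then have "1 \<le> fst e \<and> fst e < snd e \<and> snd e \<le> p" by (auto simp: pairs_def)
          then show "z \<in> {?f i j | i j. 1 \<le> i \<and> i < j \<and> j \<le> p}" using e(2) by blast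
        qed
        then show "W d Xa p n \<omega> = Max ((\<lambda>e. ?f (fst e) (snd e)) ` pairs p)" unfolding W_def by simp
      qed
      show ?thesis unfolding eq
      proof (rule borel_measurable_Max)
        show "finite (pairs p)" by (rule finite_pairs)
        fix e assume e: "e \<in> pairs p"
        have "random_variable borel (\<lambda>\<omega>. Xa m k (fst e) \<omega> * Xa m k (snd e) \<omega>)" if "m \<in> {1..d}" "k \<in> {1..n}" for m k
          using e that by (intro borel_measurable_times Xa_rv) (auto simp: pairs_def)
        then show "random_variable borel (\<lambda>\<omega>. L2_set (\<lambda>m. \<Sum>k=1..n. Xa m k (fst e) \<omega> * Xa m k (snd e) \<omega>) {1..d})"
          unfolding L2_set_def by (intro measurable_compose[OF _ borel_measurable_sqrt] borel_measurable_sum borel_measurable_power) auto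
      qed
    qed
    note [measurable] = this
    show "{\<omega>\<in>space M. (W d Xa p n \<omega>)\<^sup>2 / real n \<le> t} \<in> events" by measurable
  qed (use st in auto)
qed

lemma large_n_bound:
  assumes \<alpha>: "\<alpha> > 0" and c: "c1 > 0" "c2 > 0" and \<epsilon>: "0 < \<epsilon>" "\<epsilon> \<le> 1/10000" and mom: "integrable \<nu> (\<lambda>y. \<bar>y\<bar> powr (2 + 3 * \<alpha>))"
  shows "\<exists>C n0. 0 \<le> C \<and> (\<forall>n p. n \<ge> n0 \<longrightarrow> c1 * real n powr \<alpha> \<le> real p \<longrightarrow> real p \<le> c2 * real n powr \<alpha> \<longrightarrow> n \<ge> 3 \<and> p \<ge> 3 \<and> (\<forall>t.
      \<bar>prob {\<omega>\<in>space M. (W d Xa p n \<omega>)\<^sup>2 / real n \<le> t} - exp (- (((real p)\<^sup>2 - real p) / 2 * chi2_tail d t))\<bar>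
       \<le> C * real p powr (-1 + 20 * sqrt \<epsilon>) + C * (ln n powr (5/2) / sqrt n * (LINT y|\<nu>. (if \<bar>y\<bar> \<le> sqrt n / ln n ^ 4 then \<bar>y\<bar> ^ 3 else 0)))
        + C * (real n powr (1 + 2 * \<alpha>) * measure \<nu> {y. \<epsilon> * sqrt (n * ln p) / sqrt d \<le> \<bar>y\<bar>})))"
proof -
  define s where "s = 2 + 3 * \<alpha>"
  define \<eta> where "\<eta> = sqrt \<epsilon>"
  have \<eta>: "0 < \<eta>" "\<eta> \<le> 1/100" "\<eta>\<^sup>2 = \<epsilon>"
  proof -
    have "sqrt \<epsilon> \<le> 1/100" using \<epsilon> by (intro real_le_lsqrt) (auto simp: power2_eq_square)
    then show "0 < \<eta>" "\<eta> \<le> 1/100" "\<eta>\<^sup>2 = \<epsilon>" using \<epsilon> by (auto simp: \<eta>_def)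
  qed
  have d0: "real d \<ge> 1" using d by simp
  define K where "K = nat \<lceil>2 * real d / \<eta>\<rceil>"
  have K: "2 * real d / \<eta> \<le> real K" unfolding K_def by (rule real_nat_ceiling_ge)
  have dK: "2 * real d \<le> real K * \<eta>" using K \<eta> by (simp add: pos_divide_le_eq)
  have "real K * \<eta> \<le> real K * 1" using \<eta> by (intro mult_left_mono) auto
  then have K2: "2 * real d \<le> real K" using dK by linarith
  then have K0: "K > 0" using d0 by (cases "K = 0") auto
  have K3: "2 * real d / K \<le> \<eta>" using dK K0 by (simp add: pos_divide_le_eq mult.commute)
  define B where "B = 1 + (LINT y|\<nu>. \<bar>y\<bar> powr s)"
  have B: "B > 0" "(LINT y|\<nu>. \<bar>y\<bar> powr s) \<le> B"
  proof -
    have "0 \<le> (LINT y|\<nu>. \<bar>y\<bar> powr s)" by (intro Bochner_Integration.integral_nonneg) auto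
    then show "B > 0" "(LINT y|\<nu>. \<bar>y\<bar> powr s) \<le> B" unfolding B_def by linarith+
  qed
  define c where "c = c2 powr (5/4)"
  have c0: "c > 0" using assms(3) by (simp add: c_def)
  define A where "A = 1 + 4 * sqrt \<alpha>"
  have A1: "A \<ge> 1" using \<alpha> by (simp add: A_def)
  define G where "G = (2 * real K + 1) ^ d * exp 1"
  have G0: "G > 0" by (simp add: G_def)
  define Cd where "Cd = 1000 + 2 * (300000000 * (real d * 300001 ^ d))"
  have Cd0: "Cd \<ge> 0" by (simp add: Cd_def)
  have "4 * real d * c > 0" using c0 d0 by simp
  note as5 = eventually_parameter_bounds(5)[OF \<alpha> assms(2,3) \<epsilon>(1) \<eta>(1) this B(1) zero_less_one]
  then obtain q1 where q1: "\<And>q. q \<ge> q1 \<Longrightarrow> 54 * (q * (1 + 2 * sqrt q)) \<le> exp (2 * \<eta> * q)" by (auto simp: eventually_at_top_linorder)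
  define q0 where "q0 = max q1 1"
  have q0: "q0 > 0" "q0 \<ge> q1" "q0 \<ge> 1" by (auto simp: q0_def)
  have Dp: "sqrt (real d) > 0" "4 * real d * c > 0" using d0 c0 by auto
  have "eventually (\<lambda>n::nat. (n \<ge> 3 \<and> real n powr (\<alpha> / 2) \<le> c1 * real n powr \<alpha> \<and> 3 \<le> c1 * real n powr \<alpha> \<and> c2 * real n powr \<alpha> \<le> real n powr (2 * \<alpha>)
      \<and> 1 / ln n ^ 4 < \<epsilon> * sqrt (\<alpha> / 2 * ln n) / sqrt d \<and> 4 * sqrt (2 * \<alpha> * ln n) / ln n ^ 4 \<le> \<eta> \<and> sqrt (16 * \<alpha> * ln n) / ln n ^ 4 \<le> 1)
      \<and> B * (sqrt n / ln n ^ 4) powr (- (3 * \<alpha>)) \<le> 1/4 \<and> ln n * (B * n * (sqrt n / ln n ^ 4) powr (- (2 + 3 * \<alpha>))) \<le> n powr (- (5 * \<alpha> / 4))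
      \<and> (4 * real d * c) / (c1 * n powr \<alpha>) \<le> 1 \<and> q0 \<le> \<alpha> / 2 * ln n) sequentially"
    by (intro eventually_conj[OF eventually_parameter_bounds(1)[OF \<alpha> assms(2,3) \<epsilon>(1) \<eta>(1) Dp(1) B(1) q0(1)]] eventually_conj[OF eventually_parameter_bounds(2)[OF \<alpha> assms(2,3) \<epsilon>(1) \<eta>(1) Dp(1) B(1) q0(1)]]
       eventually_conj[OF eventually_parameter_bounds(3)[OF \<alpha> assms(2,3) \<epsilon>(1) \<eta>(1) Dp(1) B(1) q0(1)]] eventually_parameter_bounds(4)[OF \<alpha> assms(2,3) \<epsilon>(1) \<eta>(1) Dp(2) B(1) q0(1)])
  then obtain n0 where n0: "\<And>n. n \<ge> n0 \<Longrightarrow> (n \<ge> 3 \<and> real n powr (\<alpha> / 2) \<le> c1 * real n powr \<alpha> \<and> 3 \<le> c1 * real n powr \<alpha> \<and> c2 * real n powr \<alpha> \<le> real n powr (2 * \<alpha>)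
      \<and> 1 / ln n ^ 4 < \<epsilon> * sqrt (\<alpha> / 2 * ln n) / sqrt d \<and> 4 * sqrt (2 * \<alpha> * ln n) / ln n ^ 4 \<le> \<eta> \<and> sqrt (16 * \<alpha> * ln n) / ln n ^ 4 \<le> 1)
      \<and> B * (sqrt n / ln n ^ 4) powr (- (3 * \<alpha>)) \<le> 1/4 \<and> ln n * (B * n * (sqrt n / ln n ^ 4) powr (- (2 + 3 * \<alpha>))) \<le> n powr (- (5 * \<alpha> / 4))
      \<and> (4 * real d * c) / (c1 * n powr \<alpha>) \<le> 1 \<and> q0 \<le> \<alpha> / 2 * ln n" by (auto simp: eventually_sequentially)
  define C where "C = max (max (4 * G\<^sup>2 + real d * G * c + Cd * (2 * A\<^sup>2 * c) + (1 + 2 ^ d)) (Cd * (2 * A ^ 3))) (c2\<^sup>2 * real d)"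
  have C: "4 * G\<^sup>2 + real d * G * c + Cd * (2 * A\<^sup>2 * c) + (1 + 2 ^ d) \<le> C" "Cd * (2 * A ^ 3) \<le> C" "c2\<^sup>2 * real d \<le> C" by (auto simp: C_def)
  have C0: "0 \<le> C" using C(3) d0 by (meson mult_nonneg_nonneg of_nat_0_le_iff order_trans zero_le_power2)
  show ?thesis
  proof (intro exI[of _ C] exI[of _ n0] conjI allI impI C0)
    fix n p :: nat
    assume nn: "n \<ge> n0" and p1: "c1 * real n powr \<alpha> \<le> real p" and p2: "real p \<le> c2 * real n powr \<alpha>"
    note F = n0[OF nn]
    show n3: "n \<ge> 3" using F by blast
    have "3 \<le> real p" using F p1 by linarith
    then show p3: "p \<ge> 3" by linarith
    define l where "l = ln (real n)"
    define q where "q = ln (real p)"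
    define b0 where "b0 = sqrt n / l ^ 4"
    define b where "b = \<epsilon> * sqrt (n * q) / sqrt d"
    define t0 where "t0 = 4 * (1 - \<eta>) * q"
    define \<tau> where "\<tau> = sqrt (t0 / n)"
    define \<rho> where "\<rho> = B * b0 powr (- s)"
    define R where "R = real n * \<rho>"
    define x1 where "x1 = sqrt (8 * q)"
    have n0': "real n > 0" "real n \<ge> 1" using n3 by auto
    have "exp 1 \<le> (3::real)" using exp_le by simp
    then have l1: "l \<ge> 1" unfolding l_def using n3 ln_ge_iff[of "real n" 1] by auto
    have lp: "ln (real n powr x) = x * l" for x using n0' by (simp add: l_def ln_powr)
    have ql: "\<alpha> / 2 * l \<le> q"
    proof -
      have "real n powr (\<alpha> / 2) \<le> real p" using F p1 by linarith
      then have "ln (real n powr (\<alpha> / 2)) \<le> ln (real p)" using n0' p3 by (subst ln_le_cancel_iff) auto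
      then show ?thesis unfolding lp q_def .
    qed
    have qu: "q \<le> 2 * \<alpha> * l"
    proof -
      have "real p \<le> real n powr (2 * \<alpha>)" using F p2 by linarith
      then have "ln (real p) \<le> ln (real n powr (2 * \<alpha>))" using n0' p3 by (subst ln_le_cancel_iff) auto
      then show ?thesis unfolding lp q_def .
    qed
    have qq0: "q0 \<le> q" using F ql unfolding l_def by linarith
    have q: "q > 0" "q \<ge> q1" "q \<ge> 1" using qq0 q0 by auto
    have pw: "real p powr x = exp (x * q)" for x using p3 by (simp add: powr_def q_def)
    have b0p: "0 < b0" using n0' l1 by (simp add: b0_def)
    have l41: "1 \<le> l ^ 4" using l1 by (rule one_le_power)
    have b0n: "b0 \<le> sqrt n"
    proof -
      have "sqrt n / l ^ 4 \<le> sqrt n / 1" using l41 by (intro divide_left_mono) auto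
      then show ?thesis by (simp add: b0_def)
    qed
    have b0b: "b0 < b"
    proof -
      have "sqrt (\<alpha> / 2 * l) \<le> sqrt q" using ql by simp
      then have "\<epsilon> * sqrt (\<alpha> / 2 * l) / sqrt d \<le> \<epsilon> * sqrt q / sqrt d" using \<epsilon> by (intro divide_right_mono mult_left_mono) auto
      then have "1 / l ^ 4 < \<epsilon> * sqrt q / sqrt d" using F unfolding l_def by linarith
      then have "sqrt n * (1 / l ^ 4) < sqrt n * (\<epsilon> * sqrt q / sqrt d)" using n0' by (intro mult_strict_left_mono) auto
      then show ?thesis by (simp add: b0_def b_def real_sqrt_mult ac_simps)
    qed
    have t0p: "0 < t0" using q \<eta> by (simp add: t0_def)
    have t0q: "t0 \<le> 4 * q" unfolding t0_def using q \<eta> by (simp add: algebra_simps)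
    have st0: "sqrt t0 \<le> 2 * sqrt q"
    proof -
      have "sqrt t0 \<le> sqrt (4 * q)" using t0q by simp
      then show ?thesis by (simp add: real_sqrt_mult)
    qed
    have \<tau>': "\<tau> = sqrt t0 / sqrt n" by (simp add: \<tau>_def real_sqrt_divide)
    have \<zeta>: "2 * \<tau> * b0 \<le> \<eta>"
    proof -
      have "2 * \<tau> * b0 = 2 * sqrt t0 / l ^ 4" unfolding \<tau>' b0_def using n0' by simp
      also have "\<dots> \<le> 4 * sqrt q / l ^ 4" using st0 l41 by (intro divide_right_mono) auto
      also have "\<dots> \<le> 4 * sqrt (2 * \<alpha> * l) / l ^ 4" using qu l41 by (intro divide_right_mono mult_left_mono) auto
      also have "\<dots> \<le> \<eta>" using F unfolding l_def by blast
      finally show ?thesis .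
    qed
    have nu: "real_distribution \<nu>" using \<nu>_distr[of n] n3 by simp
    have s2: "2 < s" using \<alpha> by (simp add: s_def)
    have tail: "(LINT y|\<nu>. (if b0 < \<bar>y\<bar> then y\<^sup>2 else 0)) \<le> b0\<^sup>2 * \<rho>"
      unfolding \<rho>_def by (rule truncated_second_moment_le[OF nu s2 _ b0p B(2)]) (use mom in \<open>simp add: s_def\<close>)
    have \<rho>0: "0 \<le> \<rho>" using B by (simp add: \<rho>_def)
    have "\<eta> \<le> 1" using \<eta> by simp
    interpret pp: products_params M d Xa \<nu> n p K b0 b \<tau> \<eta> \<rho> t0
      by unfold_locales (use n3 p3 b0p b0b t0p \<tau>_def \<zeta> \<open>\<eta> \<le> 1\<close> tail K0 K2 in auto)
    let ?P = "real p powr (-1 + 20 * \<eta>)"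
    have P: "real p powr x \<le> ?P" if "x \<le> -1 + 20 * \<eta>" for x using that p3 by (intro powr_mono) auto
    have Rc: "l * R \<le> c * real p powr (- (5/4))"
    proof -
      have "l * R \<le> real n powr (- (5 * \<alpha> / 4))" using F unfolding R_def \<rho>_def b0_def l_def s_def by (simp add: ac_simps)
      also have "\<dots> = (real n powr \<alpha>) powr (- (5/4))" unfolding powr_powr by (rule arg_cong[where f="\<lambda>x. real n powr x"]) simp
      also have "\<dots> \<le> (real p / c2) powr (- (5/4))" using p2 p3 assms(3) by (intro powr_mono2') (auto simp: pos_divide_le_eq mult.commute)
      also have "\<dots> = c * real p powr (- (5/4))" unfolding c_def powr_divide by (simp add: powr_minus_divide)
      finally show ?thesis .
    qed
    have R0: "0 \<le> R" using \<rho>0 by (simp add: R_def)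
    have RlR: "R \<le> l * R" using l1 R0 mult_right_mono[of 1 l R] by simp
    have eb: "exp (2 * \<tau> * b) \<le> real p powr (1/4)"
    proof -
      have "2 * \<tau> * b = 2 * \<epsilon> * sqrt t0 * sqrt q / sqrt d" unfolding \<tau>' b_def using n0' by (simp add: real_sqrt_mult)
      also have "\<dots> \<le> 2 * \<epsilon> * sqrt t0 * sqrt q / 1" using d0 \<epsilon> q t0p by (intro divide_left_mono) auto
      also have "\<dots> = 2 * \<epsilon> * (sqrt t0 * sqrt q)" by simp
      also have "\<dots> \<le> 2 * \<epsilon> * (2 * sqrt q * sqrt q)" using st0 \<epsilon> q by (intro mult_left_mono mult_right_mono) auto
      also have "\<dots> = 4 * \<epsilon> * q" using q by simp
      also have "\<dots> \<le> 1/4 * q" using \<epsilon> q by (intro mult_right_mono) auto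
      finally show ?thesis unfolding pw by simp
    qed
    have eR: "exp (2 * \<tau> * b) * R \<le> c * real p powr (- 1)"
    proof -
      have "exp (2 * \<tau> * b) * R \<le> real p powr (1/4) * (c * real p powr (- (5/4)))" using eb R0 RlR Rc by (intro mult_mono) auto
      also have "\<dots> = c * (real p powr (1/4) * real p powr (- (5/4)))" by simp
      also have "real p powr (1/4) * real p powr (- (5/4)) = real p powr (- 1)" unfolding powr_add[symmetric] by simp
      finally show ?thesis .
    qed
    have err1: "pp.err \<le> 1"
    proof -
      have "pp.err = 4 * real d * (exp (2 * \<tau> * b) * R)" unfolding pp.err_def R_def by simp
      also have "\<dots> \<le> 4 * real d * (c * real p powr (- 1))" using eR by (intro mult_left_mono) auto
      also have "\<dots> = (4 * real d * c) / real p" using p3 by (simp add: powr_minus_divide)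
      also have "\<dots> \<le> (4 * real d * c) / (c1 * real n powr \<alpha>)" using p1 p3 Dp assms(2) n0' by (intro divide_left_mono mult_pos_pos) auto
      also have "\<dots> \<le> 1" using F by blast
      finally show ?thesis .
    qed
    have cube: "1 - 3 * \<eta> \<le> (1 - \<eta>) * ((1 - \<eta>) * (1 - 2 * real d / K))"
    proof -
      have "(1 - \<eta>) * ((1 - \<eta>) * (1 - \<eta>)) \<le> (1 - \<eta>) * ((1 - \<eta>) * (1 - 2 * real d / K))" using K3 \<eta> by (intro mult_left_mono) auto
      moreover have "1 - 3 * \<eta> \<le> (1 - \<eta>) * ((1 - \<eta>) * (1 - \<eta>))"
      proof -
        have "(1 - \<eta>) * ((1 - \<eta>) * (1 - \<eta>)) - (1 - 3 * \<eta>) = \<eta>\<^sup>2 * (3 - \<eta>)" by (simp add: power2_eq_square algebra_simps)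
        moreover have "0 \<le> \<eta>\<^sup>2 * (3 - \<eta>)" using \<eta>(2) by (intro mult_nonneg_nonneg) auto
        ultimately show ?thesis by linarith
      qed
      ultimately show ?thesis by linarith
    qed
    have e2: "exp (- (t0 / 2 * (1 - \<eta>) * (1 - 2 * real d / K)) + pp.err) \<le> exp 1 * real p powr (- 2 + 6 * \<eta>)"
    proof -
      have "2 * q * (1 - 3 * \<eta>) \<le> 2 * q * ((1 - \<eta>) * ((1 - \<eta>) * (1 - 2 * real d / K)))" using cube q by (intro mult_left_mono) auto
      also have "\<dots> = t0 / 2 * (1 - \<eta>) * (1 - 2 * real d / K)" unfolding t0_def by simp
      finally have "- (t0 / 2 * (1 - \<eta>) * (1 - 2 * real d / K)) + pp.err \<le> 1 + (- 2 + 6 * \<eta>) * q" using err1 by argo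
      then show ?thesis unfolding pw exp_add[symmetric] by simp
    qed
    have e4: "exp (- (t0 * (1 - \<eta>) * (1 - 2 * real d / K)) + pp.err) \<le> exp 1 * real p powr (- 4 + 12 * \<eta>)"
    proof -
      have "4 * q * (1 - 3 * \<eta>) \<le> 4 * q * ((1 - \<eta>) * ((1 - \<eta>) * (1 - 2 * real d / K)))" using cube q by (intro mult_left_mono) auto
      also have "\<dots> = t0 * (1 - \<eta>) * (1 - 2 * real d / K)" unfolding t0_def by simp
      finally have "- (t0 * (1 - \<eta>) * (1 - 2 * real d / K)) + pp.err \<le> 1 + (- 4 + 12 * \<eta>) * q" using err1 by argo
      then show ?thesis unfolding pw exp_add[symmetric] by simp
    qed
    have pi0: "pp.\<pi>0 \<le> G * real p powr (- 2 + 6 * \<eta>)" 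
    proof -
      have "pp.\<pi>0 \<le> (2 * real K + 1) ^ d * (exp 1 * real p powr (- 2 + 6 * \<eta>))" unfolding pp.\<pi>0_def using e2 by (intro mult_left_mono) auto
      then show ?thesis by (simp add: G_def)
    qed
    have pi2: "pp.\<pi>2 \<le> G\<^sup>2 * real p powr (- 4 + 12 * \<eta>)"
    proof -
      have "pp.\<pi>2 \<le> ((2 * real K + 1) ^ d)\<^sup>2 * (exp 1 * real p powr (- 4 + 12 * \<eta>))" unfolding pp.\<pi>2_def using e4 by (intro mult_left_mono) auto
      also have "\<dots> \<le> ((2 * real K + 1) ^ d)\<^sup>2 * ((exp 1)\<^sup>2 * real p powr (- 4 + 12 * \<eta>))"
      proof (intro mult_left_mono mult_right_mono)
        have "(1::real) \<le> exp 1" by simp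
        then show "exp 1 \<le> (exp 1 :: real)\<^sup>2" unfolding power2_eq_square using mult_left_mono[of 1 "exp 1 :: real" "exp 1"] by simp
      qed auto
      also have "\<dots> = G\<^sup>2 * real p powr (- 4 + 12 * \<eta>)" unfolding G_def by (simp add: power_mult_distrib)
      finally show ?thesis .
    qed
    have p0: "real p > 0" using p3 by simp
    have pc: "real p ^ 3 = real p powr 3" "(real p)\<^sup>2 = real p powr 2" using p0 by (simp_all add: powr_numeral)
    have T1: "2 * real p ^ 3 * (pp.\<pi>0\<^sup>2 + pp.\<pi>2) \<le> 4 * G\<^sup>2 * ?P"
    proof -
      have "pp.\<pi>0\<^sup>2 \<le> (G * real p powr (- 2 + 6 * \<eta>))\<^sup>2" using pi0 pp.\<pi>_nonneg by (intro power_mono) auto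
      also have "\<dots> = G\<^sup>2 * real p powr (- 4 + 12 * \<eta>)" unfolding power_mult_distrib power2_eq_square[of "real p powr _"] powr_add[symmetric] by simp
      finally have "pp.\<pi>0\<^sup>2 + pp.\<pi>2 \<le> 2 * G\<^sup>2 * real p powr (- 4 + 12 * \<eta>)" using pi2 by linarith
      then have "2 * real p ^ 3 * (pp.\<pi>0\<^sup>2 + pp.\<pi>2) \<le> 2 * real p ^ 3 * (2 * G\<^sup>2 * real p powr (- 4 + 12 * \<eta>))" by (intro mult_left_mono) auto
      also have "\<dots> = 4 * G\<^sup>2 * (real p powr 3 * real p powr (- 4 + 12 * \<eta>))" unfolding pc by simp
      also have "real p powr 3 * real p powr (- 4 + 12 * \<eta>) = real p powr (- 1 + 12 * \<eta>)" unfolding powr_add[symmetric] by simp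
      also have "4 * G\<^sup>2 * real p powr (- 1 + 12 * \<eta>) \<le> 4 * G\<^sup>2 * ?P" using \<eta> by (intro mult_left_mono P) auto
      finally show ?thesis .
    qed
    have T2: "(real p)\<^sup>2 * pp.adde \<le> real d * G * c * ?P"
    proof -
      have "pp.adde = real d * (pp.\<pi>0 * (exp (2 * \<tau> * b) * R))" unfolding pp.adde_def R_def by simp
      also have "\<dots> \<le> real d * (G * real p powr (- 2 + 6 * \<eta>) * (c * real p powr (- 1)))"
        using mult_mono[OF pi0 eR] pp.\<pi>_nonneg R0 G0 by (intro mult_left_mono) auto
      finally have "(real p)\<^sup>2 * pp.adde \<le> (real p)\<^sup>2 * (real d * (G * real p powr (- 2 + 6 * \<eta>) * (c * real p powr (- 1))))" by (intro mult_left_mono) auto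
      also have "\<dots> = real d * G * c * (real p powr 2 * (real p powr (- 2 + 6 * \<eta>) * real p powr (- 1)))" unfolding pc by simp
      also have "real p powr 2 * (real p powr (- 2 + 6 * \<eta>) * real p powr (- 1)) = real p powr (- 1 + 6 * \<eta>)" unfolding powr_add[symmetric] by simp
      also have "real d * G * c * real p powr (- 1 + 6 * \<eta>) \<le> real d * G * c * ?P" using \<eta> G0 c0 by (intro mult_left_mono P) auto
      finally show ?thesis .
    qed
    define \<beta> where "\<beta> = (LINT y|\<nu>. (if \<bar>y\<bar> \<le> sqrt n / ln n ^ 4 then \<bar>y\<bar> ^ 3 else 0))"
    have \<beta>: "pp.\<beta> = \<beta>" "0 \<le> \<beta>"
    proof -
      have "\<bar>trunc {-b0..b0} y\<bar> ^ 3 = (if \<bar>y\<bar> \<le> sqrt n / ln n ^ 4 then \<bar>y\<bar> ^ 3 else 0)" for y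
        by (auto simp: trunc_def indicator_def b0_def l_def abs_le_iff)
      then show "pp.\<beta> = \<beta>" unfolding pp.\<beta>_def \<beta>_def by simp
      show "0 \<le> \<beta>" unfolding \<beta>_def by (intro Bochner_Integration.integral_nonneg) auto
    qed
    have x1: "0 \<le> x1" "x1\<^sup>2 = 8 * q" "1 + x1 \<le> A * sqrt l"
    proof -
      show "0 \<le> x1" "x1\<^sup>2 = 8 * q" using q by (auto simp: x1_def)
      have "x1 \<le> sqrt (16 * (\<alpha> * l))" unfolding x1_def using qu by simp
      also have "\<dots> = 4 * sqrt \<alpha> * sqrt l" by (simp add: real_sqrt_mult)
      finally have "x1 \<le> 4 * sqrt \<alpha> * sqrt l" .
      moreover have "1 \<le> sqrt l" using l1 by simp
      ultimately show "1 + x1 \<le> A * sqrt l" unfolding A_def distrib_right by linarith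
    qed
    have T3: "Cd * pp.\<delta> x1 \<le> Cd * (2 * A\<^sup>2 * c) * ?P + Cd * (2 * A ^ 3) * (l powr (5/2) / sqrt n * \<beta>)"
    proof -
      have four: "u \<le> w \<Longrightarrow> v \<le> w \<Longrightarrow> w \<le> x \<Longrightarrow> y \<le> z \<Longrightarrow> y' \<le> z \<Longrightarrow> u + v + y + y' \<le> 2 * x + 2 * z" for u v w x y y' z :: real by linarith
      let ?X = "1 + x1"
      have X1: "1 \<le> ?X" using x1 by simp
      have X2: "?X\<^sup>2 \<le> A\<^sup>2 * l"
      proof -
        have "?X\<^sup>2 \<le> (A * sqrt l)\<^sup>2" using x1 X1 by (intro power_mono) auto
        then show ?thesis using l1 by (simp add: power_mult_distrib)
      qed
      have XX: "?X \<le> ?X\<^sup>2" using X1 by (simp add: power2_eq_square)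
      have l52: "l powr (3/2) \<le> l powr (5/2)" using l1 by (intro powr_mono) auto
      have sl3: "sqrt l ^ 3 = l powr (3/2)"
      proof -
        have "sqrt l ^ 3 = (l powr (1/2)) powr 3" using l1 by (simp add: powr_half_sqrt powr_numeral)
        then show ?thesis by (simp add: powr_powr)
      qed
      have X3: "?X ^ 3 \<le> A ^ 3 * l powr (5/2)"
      proof -
        have "?X ^ 3 \<le> (A * sqrt l) ^ 3" using x1 X1 by (intro power_mono) auto
        also have "\<dots> = A ^ 3 * l powr (3/2)" by (simp add: power_mult_distrib sl3)
        also have "\<dots> \<le> A ^ 3 * l powr (5/2)" using l52 A1 by (intro mult_left_mono) auto
        finally show ?thesis .
      qed
      have X4: "?X * l \<le> A ^ 3 * l powr (5/2)"
      proof -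
        have "?X * l \<le> A * sqrt l * l" using x1 l1 by (intro mult_right_mono) auto
        also have "\<dots> = A * l powr (3/2)" using l1 powr_add[of l "1/2" 1] by (simp add: powr_half_sqrt)
        also have "\<dots> \<le> A ^ 3 * l powr (5/2)" using l52 A1 self_le_power[of A 3] by (intro mult_mono) auto
        finally show ?thesis .
      qed
      have r1: "sqrt n * (b0 * \<rho>) \<le> R"
      proof -
        have "sqrt n * (b0 * \<rho>) \<le> sqrt n * (sqrt n * \<rho>)" using b0n \<rho>0 by (intro mult_left_mono mult_right_mono) auto
        then show ?thesis unfolding R_def using n0' by (simp flip: mult.assoc)
      qed
      have r2: "b0\<^sup>2 * \<rho> \<le> R"
      proof -
        have "b0\<^sup>2 \<le> (sqrt n)\<^sup>2" using b0n b0p by (intro power_mono) auto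
        then have "b0\<^sup>2 \<le> real n" by simp
        then show ?thesis unfolding R_def using \<rho>0 by (intro mult_right_mono) auto
      qed
      have "?X * (sqrt n * (b0 * \<rho>)) \<le> ?X\<^sup>2 * R" using XX r1 R0 X1 b0p \<rho>0 by (intro mult_mono) auto
      moreover have "?X\<^sup>2 * (b0\<^sup>2 * \<rho>) \<le> ?X\<^sup>2 * R" using r2 by (intro mult_left_mono) auto
      moreover have "?X\<^sup>2 * R \<le> A\<^sup>2 * c * ?P"
      proof -
        have "?X\<^sup>2 * R \<le> (A\<^sup>2 * l) * R" using X2 R0 by (intro mult_right_mono)
        also have "\<dots> = A\<^sup>2 * (l * R)" by simp
        also have "\<dots> \<le> A\<^sup>2 * (c * real p powr (- (5/4)))" using Rc by (intro mult_left_mono) auto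
        also have "\<dots> \<le> A\<^sup>2 * (c * ?P)" using \<eta> c0 by (intro mult_left_mono P) auto
        finally show ?thesis by simp
      qed
      moreover have "?X ^ 3 * (\<beta> / sqrt n) \<le> A ^ 3 * l powr (5/2) * (\<beta> / sqrt n)" using X3 \<beta> by (intro mult_right_mono) auto
      moreover have "?X * ln n * (\<beta> / sqrt n) \<le> A ^ 3 * l powr (5/2) * (\<beta> / sqrt n)" using X4 \<beta> unfolding l_def by (intro mult_right_mono) auto
      ultimately have "pp.\<delta> x1 \<le> 2 * (A\<^sup>2 * c * ?P) + 2 * (A ^ 3 * l powr (5/2) * (\<beta> / sqrt n))" unfolding pp.\<delta>_def \<beta>(1) by (rule four)
      then have "Cd * pp.\<delta> x1 \<le> Cd * (2 * (A\<^sup>2 * c * ?P) + 2 * (A ^ 3 * l powr (5/2) * (\<beta> / sqrt n)))" using Cd0 by (intro mult_left_mono)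
      also have "\<dots> = Cd * (2 * A\<^sup>2 * c) * ?P + Cd * (2 * A ^ 3) * (l powr (5/2) / sqrt n * \<beta>)" by (simp add: algebra_simps)
      finally show ?thesis .
    qed
    have T4: "(real p)\<^sup>2 * (real n * real d * measure \<nu> {y. b \<le> \<bar>y\<bar>}) \<le> c2\<^sup>2 * real d * (real n powr (1 + 2 * \<alpha>) * measure \<nu> {y. b \<le> \<bar>y\<bar>})"
    proof -
      have "(real p)\<^sup>2 \<le> (c2 * real n powr \<alpha>)\<^sup>2" using p2 by (intro power_mono) auto
      also have "\<dots> = c2\<^sup>2 * real n powr (2 * \<alpha>)" unfolding power_mult_distrib power2_eq_square[of "real n powr \<alpha>"] powr_add[symmetric] by simp
      finally have "(real p)\<^sup>2 * (real n * real d * measure \<nu> {y. b \<le> \<bar>y\<bar>}) \<le> c2\<^sup>2 * real n powr (2 * \<alpha>) * (real n * real d * measure \<nu> {y. b \<le> \<bar>y\<bar>})"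
        by (intro mult_right_mono) auto
      also have "\<dots> = c2\<^sup>2 * real d * ((real n * real n powr (2 * \<alpha>)) * measure \<nu> {y. b \<le> \<bar>y\<bar>})" by simp
      also have "real n * real n powr (2 * \<alpha>) = real n powr (1 + 2 * \<alpha>)" using n0' by (simp add: powr_add)
      finally show ?thesis .
    qed
    let ?F = "\<lambda>t::real. prob {\<omega>\<in>space M. (W d Xa p n \<omega>)\<^sup>2 / real n \<le> t}"
    let ?N = "((real p)\<^sup>2 - real p) / 2"
    let ?G = "\<lambda>t. exp (- (?N * chi2_tail d t))"
    define E where "E = (4 * G\<^sup>2 + real d * G * c + Cd * (2 * A\<^sup>2 * c)) * ?P + Cd * (2 * A ^ 3) * (l powr (5/2) / sqrt n * \<beta>) + c2\<^sup>2 * real d * (real n powr (1 + 2 * \<alpha>) * measure \<nu> {y. b \<le> \<bar>y\<bar>})"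
    have x1b: "x1 / sqrt n * b0 \<le> 1"
    proof -
      have "x1 / sqrt n * b0 = x1 / l ^ 4" unfolding b0_def using n0' by simp
      also have "\<dots> \<le> sqrt (16 * \<alpha> * l) / l ^ 4" unfolding x1_def using qu l41 by (intro divide_right_mono) auto
      also have "\<dots> \<le> 1" using F unfolding l_def by blast
      finally show ?thesis .
    qed
    have sm: "b0\<^sup>2 * \<rho> \<le> 1/4"
    proof -
      have "b0\<^sup>2 * \<rho> = B * (b0 powr 2 * b0 powr (- s))" unfolding \<rho>_def using b0p by (simp add: powr_numeral)
      also have "b0 powr 2 * b0 powr (- s) = b0 powr (- (3 * \<alpha>))" unfolding powr_add[symmetric] s_def by simp
      also have "B * b0 powr (- (3 * \<alpha>)) \<le> 1/4" using F unfolding b0_def l_def by blast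
      finally show ?thesis .
    qed
    have mid: "\<bar>?F t - ?G t\<bar> \<le> E" if "t0 \<le> t" "t \<le> 8 * q" for t
    proof -
      have "t \<le> x1\<^sup>2" using that x1 by simp
      have cd: "pp.Cd = Cd" unfolding pp.Cd_def Cd_def ..
      note m = pp.max_approx[OF that(1) \<open>t \<le> x1\<^sup>2\<close> x1(1) x1b sm, unfolded cd]
      have "(4 * G\<^sup>2 + real d * G * c + Cd * (2 * A\<^sup>2 * c)) * ?P = 4 * G\<^sup>2 * ?P + real d * G * c * ?P + Cd * (2 * A\<^sup>2 * c) * ?P" by (simp only: distrib_right)
      then show ?thesis using m T1 T2 T3 T4 unfolding E_def by linarith
    qed
    have pp2: "real p * real p \<ge> 2 * real p" using p3 by (intro mult_right_mono) auto
    have N0: "0 \<le> ?N" "(real p)\<^sup>2 / 4 \<le> ?N" "?N \<le> (real p)\<^sup>2" using pp2 p0 by (auto simp: power2_eq_square field_simps)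
    have pinv: "exp (- q) = real p powr (- 1)" unfolding pw by simp
    have low: "?G t0 \<le> (1 + 2 ^ d) * ?P"
    proof -
      have g: "2 * (exp (- t0 / 2) * (1 / (27 * (1 + sqrt t0)))) \<le> chi2_tail d t0" using t0p by (intro chi2_tail_ge d) auto
      have "exp (2 * \<eta> * q) / (54 * (1 + 2 * sqrt q)) = (real p)\<^sup>2 / 4 * (2 * (exp (- t0 / 2) * (1 / (27 * (1 + 2 * sqrt q)))))"
      proof -
        have "2 * \<eta> * q = 2 * q + - (4 * (1 - \<eta>) * q) / 2" by (simp add: field_simps)
        then have "exp (2 * \<eta> * q) = (real p)\<^sup>2 * exp (- t0 / 2)" unfolding pc pw exp_add[symmetric] t0_def by (rule arg_cong)
        then show ?thesis by (simp add: field_simps)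
      qed
      also have "\<dots> \<le> (real p)\<^sup>2 / 4 * (2 * (exp (- t0 / 2) * (1 / (27 * (1 + sqrt t0)))))"
        using st0 t0p q by (intro mult_left_mono divide_left_mono mult_pos_pos) (auto intro: add_pos_nonneg)
      also have "\<dots> \<le> (real p)\<^sup>2 / 4 * chi2_tail d t0" using g by (intro mult_left_mono) auto
      also have "\<dots> \<le> ?N * chi2_tail d t0" using N0 by (intro mult_right_mono) (auto simp: chi2_tail_def)
      finally have "exp (2 * \<eta> * q) / (54 * (1 + 2 * sqrt q)) \<le> ?N * chi2_tail d t0" .
      moreover have "q \<le> exp (2 * \<eta> * q) / (54 * (1 + 2 * sqrt q))"
      proof -
        have "0 < 54 * (1 + 2 * sqrt q)" using q by (simp add: add_pos_nonneg)
        moreover have "q * (54 * (1 + 2 * sqrt q)) \<le> exp (2 * \<eta> * q)" using q1[OF q(2)] by (simp add: ac_simps)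
        ultimately show ?thesis by (simp add: pos_le_divide_eq)
      qed
      ultimately have "q \<le> ?N * chi2_tail d t0" by (rule order_trans[rotated])
      then have "?G t0 \<le> exp (- q)" unfolding exp_le_cancel_iff neg_le_iff_le .
      also have "\<dots> \<le> ?P" unfolding pinv using \<eta> by (intro P) auto
      also have "\<dots> = 1 * ?P" by simp
      also have "\<dots> \<le> (1 + 2 ^ d) * ?P" by (intro mult_right_mono) auto
      finally show ?thesis .
    qed
    have high: "1 - ?G (8 * q) \<le> (1 + 2 ^ d) * ?P"
    proof -
      have "chi2_tail d (8 * q) \<le> exp (- (3/8 * (8 * q))) * (1 - 2 * (3/8)) powr (- (real d / 2))" using d by (intro chi2_tail_exp_le) auto
      also have "(1 - 2 * (3/8)) powr (- (real d / 2)) = (2::real) ^ d"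
      proof -
        have "(1 - 2 * (3/8) :: real) = 2 powr (- 2)" by (simp add: powr_minus_divide powr_numeral)
        then have "(1 - 2 * (3/8)) powr (- (real d / 2)) = (2 powr (- 2)) powr (- (real d / 2))" by (simp only:)
        also have "\<dots> = 2 powr (real d)" unfolding powr_powr by simp
        finally show ?thesis by (simp add: powr_realpow)
      qed
      finally have "?N * chi2_tail d (8 * q) \<le> (real p)\<^sup>2 * (exp (- (3/8 * (8 * q))) * 2 ^ d)" using N0 by (intro mult_mono) (auto simp: chi2_tail_def)
      also have "\<dots> = 2 ^ d * real p powr (- 1)" unfolding pc pw by (simp flip: exp_add)
      also have "\<dots> \<le> 2 ^ d * ?P" using \<eta> by (intro mult_left_mono P) auto
      also have "\<dots> \<le> (1 + 2 ^ d) * ?P" by (intro mult_right_mono) auto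
      finally have "?N * chi2_tail d (8 * q) \<le> (1 + 2 ^ d) * ?P" .
      moreover have "1 - ?G (8 * q) \<le> ?N * chi2_tail d (8 * q)" using exp_ge_add_one_self[of "- (?N * chi2_tail d (8 * q))"] by simp
      ultimately show ?thesis by linarith
    qed
    fix t :: real
    have "\<bar>?F t - ?G t\<bar> \<le> E + (1 + 2 ^ d) * ?P"
    proof (rule monotone_sandwich[where F="?F" and G="?G" and t=t and E=E and a=t0 and b="8 * q"])
      show "mono ?F" by (rule W_cdf_mono) (use n3 p3 in auto)
      show "mono ?G"
      proof (rule monoI)
        fix x y :: real assume xy: "x \<le> y"
        interpret cd: prob_space "chi2 d" by (rule prob_space_chi2[OF d])
        have "chi2_tail d y \<le> chi2_tail d x" unfolding chi2_tail_eq(1) using xy by (intro cd.finite_measure_mono) auto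
        then have "?N * chi2_tail d y \<le> ?N * chi2_tail d x" using N0 by (intro mult_left_mono) auto
        then show "?G x \<le> ?G y" by simp
      qed
      show "?G u \<le> 1" for u
      proof -
        have "0 \<le> ?N * chi2_tail d u" using N0 by (intro mult_nonneg_nonneg) (auto simp: chi2_tail_def)
        then show ?thesis by simp
      qed
      show "t0 \<le> 8 * q" using t0q q by linarith
    qed (use mid low high in auto)
    also have "\<dots> \<le> C * ?P + C * (l powr (5/2) / sqrt n * \<beta>) + C * (real n powr (1 + 2 * \<alpha>) * measure \<nu> {y. b \<le> \<bar>y\<bar>})"
    proof -
      have "(4 * G\<^sup>2 + real d * G * c + Cd * (2 * A\<^sup>2 * c) + (1 + 2 ^ d)) * ?P \<le> C * ?P" using C(1) by (intro mult_right_mono) auto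
      moreover have "Cd * (2 * A ^ 3) * (l powr (5/2) / sqrt n * \<beta>) \<le> C * (l powr (5/2) / sqrt n * \<beta>)" using C(2) \<beta> by (intro mult_right_mono) auto
      moreover have "c2\<^sup>2 * real d * (real n powr (1 + 2 * \<alpha>) * measure \<nu> {y. b \<le> \<bar>y\<bar>}) \<le> C * (real n powr (1 + 2 * \<alpha>) * measure \<nu> {y. b \<le> \<bar>y\<bar>})" using C(3) by (intro mult_right_mono) auto
      moreover have "E + (1 + 2 ^ d) * ?P = (4 * G\<^sup>2 + real d * G * c + Cd * (2 * A\<^sup>2 * c) + (1 + 2 ^ d)) * ?P + Cd * (2 * A ^ 3) * (l powr (5/2) / sqrt n * \<beta>) + c2\<^sup>2 * real d * (real n powr (1 + 2 * \<alpha>) * measure \<nu> {y. b \<le> \<bar>y\<bar>})"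
        unfolding E_def by (simp only: distrib_right)
      ultimately show ?thesis by linarith
    qed
    finally show "\<bar>?F t - ?G t\<bar> \<le> C * real p powr (-1 + 20 * sqrt \<epsilon>) + C * (ln n powr (5/2) / sqrt n * (LINT y|\<nu>. (if \<bar>y\<bar> \<le> sqrt n / ln n ^ 4 then \<bar>y\<bar> ^ 3 else 0)))
        + C * (real n powr (1 + 2 * \<alpha>) * measure \<nu> {y. \<epsilon> * sqrt (n * ln p) / sqrt d \<le> \<bar>y\<bar>})"
      unfolding \<eta>_def l_def b_def q_def \<beta>_def .
  qed
qed

end

lemma (in prob_space) distr_mult_indep:
  fixes A B :: "'a \<Rightarrow> real"
  assumes "indep_var borel A borel B"
  shows "distr M borel (\<lambda>\<omega>. A \<omega> * B \<omega>) = distr (distr M borel A \<Otimes>\<^sub>M distr M borel B) borel (\<lambda>z. fst z * snd z)"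
proof -
  have r: "random_variable borel A" "random_variable borel B"
    and eq: "distr M borel A \<Otimes>\<^sub>M distr M borel B = distr M (borel \<Otimes>\<^sub>M borel) (\<lambda>\<omega>. (A \<omega>, B \<omega>))"
    using assms by (simp_all add: indep_var_distribution_eq)
  have m: "(\<lambda>z::real \<times> real. fst z * snd z) \<in> borel_measurable (borel \<Otimes>\<^sub>M borel)" by measurable
  show ?thesis unfolding eq using distr_distr[OF m measurable_Pair[OF r]] by (simp add: comp_def)
qed

lemma (in prob_space) indep_vars_pair:
  fixes X :: "'i \<Rightarrow> 'a \<Rightarrow> real"
  assumes ind: "indep_vars (\<lambda>_. borel) X I" and ab: "a \<in> I" "b \<in> I" "a \<noteq> b"
  shows "indep_var borel (X a) borel (X b)"
  using indep_vars_sum[of "{b}" a X] indep_vars_subset[OF ind, of "{a, b}"] ab by simp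

lemma (in prob_space) moments_cong_distr:
  fixes X Z :: "'a \<Rightarrow> real"
  assumes r: "random_variable borel X" "random_variable borel Z" and eq: "distr M borel Z = distr M borel X"
    and f: "f \<in> borel_measurable borel"
  shows "integrable M (\<lambda>\<omega>. f (Z \<omega>) :: real) \<longleftrightarrow> integrable M (\<lambda>\<omega>. f (X \<omega>))" "expectation (\<lambda>\<omega>. f (Z \<omega>)) = expectation (\<lambda>\<omega>. f (X \<omega>))"
  using integrable_distr_eq[OF r(1) f] integrable_distr_eq[OF r(2) f] integral_distr[OF r(1) f] integral_distr[OF r(2) f] eq by simp_all

lemma iid_products_of_array:
  fixes M :: "'a measure" and X X' :: "'a \<Rightarrow> real" and Xa :: "nat \<Rightarrow> nat \<Rightarrow> nat \<Rightarrow> 'a \<Rightarrow> real"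
  assumes M: "prob_space M" and d: "d \<ge> 1"
    and indep: "prob_space.indep_vars M (\<lambda>_. borel) (\<lambda>idx. case idx of None \<Rightarrow> X | Some (m, k, i) \<Rightarrow> Xa m k i)
                 (insert None (Some ` {(m, k, i). 1 \<le> m \<and> m \<le> d \<and> 1 \<le> k \<and> 1 \<le> i}))"
    and ident: "\<And>m k i. 1 \<le> m \<Longrightarrow> m \<le> d \<Longrightarrow> 1 \<le> k \<Longrightarrow> 1 \<le> i \<Longrightarrow>
                 distr M borel (Xa m k i) = distr M borel X"
    and copy_indep: "prob_space.indep_var M borel X borel X'"
    and copy_distr: "distr M borel X' = distr M borel X"
    and mean0: "integrable M X" "integral\<^sup>L M X = 0"
    and var1: "integrable M (\<lambda>\<omega>. (X \<omega>)\<^sup>2)" "integral\<^sup>L M (\<lambda>\<omega>. (X \<omega>)\<^sup>2) = 1"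
  shows "iid_products M d Xa (distr M borel (\<lambda>\<omega>. X \<omega> * X' \<omega>))"
proof -
  interpret prob_space M by (rule M)
  let ?I = "{(m, k, i). 1 \<le> m \<and> m \<le> d \<and> 1 \<le> k \<and> 1 \<le> i} :: (nat \<times> nat \<times> nat) set"
  let ?Z = "\<lambda>(m, k, i). Xa m k i"
  let ?O = "\<lambda>idx. case idx of None \<Rightarrow> X | Some (m, k, i) \<Rightarrow> Xa m k i"
  have ind: "indep_vars (\<lambda>_. borel) ?Z ?I"
  proof -
    have "indep_vars (\<lambda>_. borel) (\<lambda>j \<omega>. (\<lambda>x. x (Some j)) (\<lambda>q\<in>{Some j}. ?O q \<omega>)) ?I"
      by (rule indep_vars_blocks[OF indep]) (auto simp: disjoint_family_on_def intro: measurable_component_singleton)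
    then show ?thesis by simp
  qed
  have X: "random_variable borel X" and X': "random_variable borel X'"
    using mean0 indep_var_rv2[OF copy_indep] by auto
  have rv: "random_variable borel (Xa m k i)" if "1 \<le> m" "m \<le> d" "1 \<le> k" "1 \<le> i" for m k i
    using ind that unfolding indep_vars_def by fastforce
  have m: "(\<lambda>x::real. x) \<in> borel_measurable borel" "(\<lambda>x::real. x\<^sup>2) \<in> borel_measurable borel" by auto
  note tr = moments_cong_distr[OF X _ _ m(1)] moments_cong_distr[OF X _ _ m(2)]
  have XX: "random_variable borel (\<lambda>\<omega>. X \<omega> * X' \<omega>)" using X X' by simp
  have indsq: "indep_var borel (\<lambda>\<omega>. (X \<omega>)\<^sup>2) borel (\<lambda>\<omega>. (X' \<omega>)\<^sup>2)"
    using indep_var_compose[OF copy_indep m(2) m(2)] by (simp add: comp_def)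
  note mom' = tr(1)[OF X' copy_distr] tr(2)[OF X' copy_distr] tr(3)[OF X' copy_distr] tr(4)[OF X' copy_distr]
  show ?thesis
  proof (unfold_locales, goal_cases)
    case 1
    show ?case by (rule d)
  next
    case 2
    show ?case by (rule ind)
  next
    case (3 m k i j)
    then have "indep_var borel (Xa m k i) borel (Xa m k j)"
      using indep_vars_pair[OF ind, of "(m, k, i)" "(m, k, j)"] by simp
    then have "distr M borel (\<lambda>\<omega>. Xa m k i \<omega> * Xa m k j \<omega>) = distr (distr M borel (Xa m k i) \<Otimes>\<^sub>M distr M borel (Xa m k j)) borel (\<lambda>z. fst z * snd z)"
      by (rule distr_mult_indep)
    also have "\<dots> = distr (distr M borel X \<Otimes>\<^sub>M distr M borel X') borel (\<lambda>z. fst z * snd z)"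
      using ident[of m k i] ident[of m k j] copy_distr 3 by simp
    also have "\<dots> = distr M borel (\<lambda>\<omega>. X \<omega> * X' \<omega>)" by (rule distr_mult_indep[OF copy_indep, symmetric])
    finally show ?case .
  next
    case (4 m k c i j)
    let ?S = "{(m, k, c), (m, k, i), (m, k, j)}"
    define g :: "nat \<times> nat \<times> nat \<Rightarrow> real \<Rightarrow> real" where "g = (\<lambda>q x. if q = (m, k, c) then x\<^sup>2 else x)"
    have gm: "g q \<in> borel_measurable borel" for q by (cases "q = (m, k, c)") (auto simp: g_def[abs_def])
    have ix: "integrable M (Xa m k i)" "integrable M (Xa m k j)" "integrable M (\<lambda>\<omega>. (Xa m k c \<omega>)\<^sup>2)"
      "expectation (Xa m k i) = 0"
      using tr[OF rv ident, of m k i] tr[OF rv ident, of m k j] tr[OF rv ident, of m k c] 4 mean0 var1 by auto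
    have "indep_vars (\<lambda>_. borel) (\<lambda>q \<omega>. g q (?Z q \<omega>)) ?S"
      by (rule indep_vars_compose2[OF indep_vars_subset[OF ind]]) (use 4 gm in auto)
    then have "expectation (\<lambda>\<omega>. \<Prod>q\<in>?S. g q (?Z q \<omega>)) = (\<Prod>q\<in>?S. expectation (\<lambda>\<omega>. g q (?Z q \<omega>)))"
    proof (rule indep_vars_lebesgue_integral[rotated])
      fix q assume "q \<in> ?S"
      then show "integrable M (\<lambda>\<omega>. g q (?Z q \<omega>))" using ix 4 by (auto simp: g_def)
    qed simp
    also have "\<dots> = 0" using ix 4 by (simp add: g_def)
    also have "(\<lambda>\<omega>. \<Prod>q\<in>?S. g q (?Z q \<omega>)) = (\<lambda>\<omega>. (Xa m k c \<omega> * Xa m k i \<omega>) * (Xa m k c \<omega> * Xa m k j \<omega>))"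
      using 4 by (simp add: g_def power2_eq_square ac_simps)
    finally show ?case .
  next
    case 5
    show ?case using indep_var_integrable[OF indsq var1(1)] mom'(3) var1 XX
      by (simp add: integrable_distr_eq power_mult_distrib)
  next
    case 6
    show ?case using indep_var_lebesgue_integral[OF copy_indep mean0(1)] mom'(1,2) mean0 XX by (simp add: integral_distr)
  next
    case 7
    show ?case using indep_var_lebesgue_integral[OF indsq var1(1)] mom'(3,4) var1 XX
      by (simp add: integral_distr power_mult_distrib)
  qed
qed

theorem theorem3p1:
  fixes M :: "'a measure"
    and d :: nat
    and X X' :: "'a \<Rightarrow> real"
    and Xa :: "nat \<Rightarrow> nat \<Rightarrow> nat \<Rightarrow> 'a \<Rightarrow> real"
    and \<alpha> c1 c2 :: real
  assumes "prob_space M"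
    and "d \<ge> 1"
    and indep: "prob_space.indep_vars M (\<lambda>_. borel) (\<lambda>idx. case idx of None \<Rightarrow> X | Some (m, k, i) \<Rightarrow> Xa m k i)
                 (insert None (Some ` {(m, k, i). 1 \<le> m \<and> m \<le> d \<and> 1 \<le> k \<and> 1 \<le> i}))"
    and ident: "\<And>m k i. 1 \<le> m \<Longrightarrow> m \<le> d \<Longrightarrow> 1 \<le> k \<Longrightarrow> 1 \<le> i \<Longrightarrow>
                 distr M borel (Xa m k i) = distr M borel X"
    and copy_indep: "prob_space.indep_var M borel X borel X'"
    and copy_distr: "distr M borel X' = distr M borel X"
    and mean0: "integrable M X" "integral\<^sup>L M X = 0"
    and var1: "integrable M (\<lambda>\<omega>. (X \<omega>)\<^sup>2)" "integral\<^sup>L M (\<lambda>\<omega>. (X \<omega>)\<^sup>2) = 1"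
    and "\<alpha> > 0" "c1 > 0" "c2 > 0"
    and tail: "\<exists>B. \<forall>x::real. x > 0 \<longrightarrow>
                 x powr (1 + 2 * \<alpha>) * measure M {\<omega> \<in> space M. \<bar>X \<omega> * X' \<omega>\<bar> \<ge> sqrt (x * logc x)} \<le> B"
  shows "\<forall>\<epsilon>::real. 0 < \<epsilon> \<and> \<epsilon> \<le> 10 powr (-4) \<longrightarrow>
           (\<exists>C::real. \<forall>(n::nat) (p::nat).
              c1 * real n powr \<alpha> \<le> real p \<and> real p \<le> c2 * real n powr \<alpha> \<and> 2 \<le> p \<longrightarrow>
              (\<forall>y::real.
                 \<bar>measure M {\<omega> \<in> space M. (W d Xa p n \<omega>)\<^sup>2 / real n - alpha_p d p \<le> y}
                  - exp (- ((real p ^ 2 - real p) / 2) * chi2_tail d (alpha_p d p + y))\<bar>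
                 \<le> C * real p powr (-1 + 20 * sqrt \<epsilon>)
                   + C * (logc (real n)) powr (5/2) / sqrt (real n)
                       * integral\<^sup>L M (\<lambda>\<omega>. if \<bar>X \<omega> * X' \<omega>\<bar> \<le> sqrt (real n) / (logc (real n)) ^ 4
                                          then \<bar>X \<omega> * X' \<omega>\<bar> ^ 3 else 0)
                   + C * real n powr (1 + 2 * \<alpha>)
                       * measure M {\<omega> \<in> space M. \<bar>X \<omega> * X' \<omega>\<bar> \<ge> \<epsilon> * sqrt (real n * logc (real p)) / sqrt (real d)}))"
proof (intro allI impI)
  fix \<epsilon> :: real assume "0 < \<epsilon> \<and> \<epsilon> \<le> 10 powr (-4)"
  then have \<epsilon>: "0 < \<epsilon>" "\<epsilon> \<le> 1/10000" by (auto simp: powr_minus_divide powr_numeral)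
  define \<nu> where "\<nu> = distr M borel (\<lambda>\<omega>. X \<omega> * X' \<omega>)"
  interpret prob_space M by fact
  interpret iid_products M d Xa \<nu>
    unfolding \<nu>_def by (rule iid_products_of_array) (fact assms)+
  have X: "random_variable borel X" and X': "random_variable borel X'"
    using mean0 indep_var_rv2[OF copy_indep] by auto
  have XX: "random_variable borel (\<lambda>\<omega>. X \<omega> * X' \<omega>)" using X X' by simp
  have \<nu>_tail: "measure \<nu> {y. a \<le> \<bar>y\<bar>} = prob {\<omega>\<in>space M. \<bar>X \<omega> * X' \<omega>\<bar> \<ge> a}" for a
    unfolding \<nu>_def using XX by (subst measure_distr) (auto intro!: arg_cong[where f=prob])
  have \<nu>_cube: "(LINT y|\<nu>. (if \<bar>y\<bar> \<le> a then \<bar>y\<bar> ^ 3 else 0)) = (LINT \<omega>|M. (if \<bar>X \<omega> * X' \<omega>\<bar> \<le> a then \<bar>X \<omega> * X' \<omega>\<bar> ^ 3 else 0))" for a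
    unfolding \<nu>_def by (rule integral_distr[OF XX]) measurable
  obtain B where B: "\<And>x::real. x > 0 \<Longrightarrow> x powr (1 + 2 * \<alpha>) * measure \<nu> {y. sqrt (x * logc x) \<le> \<bar>y\<bar>} \<le> B"
    using tail unfolding \<nu>_tail by blast
  have "real_distribution \<nu>" unfolding \<nu>_def by (rule real_distribution_distr[OF XX])
  from large_n_bound[OF \<open>\<alpha> > 0\<close> \<open>c1 > 0\<close> \<open>c2 > 0\<close> \<epsilon> moment_from_tail[OF this \<open>\<alpha> > 0\<close> B]]
  obtain C0 n0 where C0: "0 \<le> C0" and bound: "\<And>n p t. n \<ge> n0 \<Longrightarrow> c1 * real n powr \<alpha> \<le> real p \<Longrightarrow> real p \<le> c2 * real n powr \<alpha> \<Longrightarrow> n \<ge> 3 \<and> p \<ge> 3 \<and>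
      \<bar>prob {\<omega>\<in>space M. (W d Xa p n \<omega>)\<^sup>2 / real n \<le> t} - exp (- (((real p)\<^sup>2 - real p) / 2 * chi2_tail d t))\<bar>
       \<le> C0 * real p powr (-1 + 20 * sqrt \<epsilon>) + C0 * (ln n powr (5/2) / sqrt n * (LINT y|\<nu>. (if \<bar>y\<bar> \<le> sqrt n / ln n ^ 4 then \<bar>y\<bar> ^ 3 else 0)))
        + C0 * (real n powr (1 + 2 * \<alpha>) * measure \<nu> {y. \<epsilon> * sqrt (n * ln p) / sqrt d \<le> \<bar>y\<bar>})"
    by blast
  have logc: "logc (real k) = ln (real k)" if "k \<ge> 3" for k :: nat
  proof -
    have "exp 1 \<le> real k" using that exp_le by linarith
    then show ?thesis by (simp add: logc_def max_absorb1)
  qed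
  define C where "C = max C0 (c2 * real n0 powr \<alpha>)"
  have C: "C0 \<le> C" "c2 * real n0 powr \<alpha> \<le> C" "0 \<le> C" using C0 by (auto simp: C_def)
  show "\<exists>C::real. \<forall>(n::nat) (p::nat).
              c1 * real n powr \<alpha> \<le> real p \<and> real p \<le> c2 * real n powr \<alpha> \<and> 2 \<le> p \<longrightarrow>
              (\<forall>y::real.
                 \<bar>measure M {\<omega> \<in> space M. (W d Xa p n \<omega>)\<^sup>2 / real n - alpha_p d p \<le> y}
                  - exp (- ((real p ^ 2 - real p) / 2) * chi2_tail d (alpha_p d p + y))\<bar>
                 \<le> C * real p powr (-1 + 20 * sqrt \<epsilon>)
                   + C * (logc (real n)) powr (5/2) / sqrt (real n)
                       * integral\<^sup>L M (\<lambda>\<omega>. if \<bar>X \<omega> * X' \<omega>\<bar> \<le> sqrt (real n) / (logc (real n)) ^ 4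
                                          then \<bar>X \<omega> * X' \<omega>\<bar> ^ 3 else 0)
                   + C * real n powr (1 + 2 * \<alpha>)
                       * measure M {\<omega> \<in> space M. \<bar>X \<omega> * X' \<omega>\<bar> \<ge> \<epsilon> * sqrt (real n * logc (real p)) / sqrt (real d)})"
  proof (intro exI[of _ C] allI impI, elim conjE)
    fix n p :: nat and y :: real
    assume p: "c1 * real n powr \<alpha> \<le> real p" "real p \<le> c2 * real n powr \<alpha>" "2 \<le> p"
    let ?I = "integral\<^sup>L M (\<lambda>\<omega>. if \<bar>X \<omega> * X' \<omega>\<bar> \<le> sqrt (real n) / (logc (real n)) ^ 4 then \<bar>X \<omega> * X' \<omega>\<bar> ^ 3 else 0)"
    let ?T = "measure M {\<omega> \<in> space M. \<bar>X \<omega> * X' \<omega>\<bar> \<ge> \<epsilon> * sqrt (real n * logc (real p)) / sqrt (real d)}"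
    have eq: "{\<omega> \<in> space M. (W d Xa p n \<omega>)\<^sup>2 / real n - alpha_p d p \<le> y} = {\<omega> \<in> space M. (W d Xa p n \<omega>)\<^sup>2 / real n \<le> alpha_p d p + y}"
      by (auto simp: algebra_simps)
    have I0: "0 \<le> ?I" by (intro Bochner_Integration.integral_nonneg) auto
    have nonneg: "0 \<le> logc (real n) powr (5/2) / sqrt (real n) * ?I" "0 \<le> real n powr (1 + 2 * \<alpha>) * ?T"
      by (intro mult_nonneg_nonneg I0; simp)+
    have "\<bar>measure M {\<omega> \<in> space M. (W d Xa p n \<omega>)\<^sup>2 / real n \<le> alpha_p d p + y} - exp (- (((real p)\<^sup>2 - real p) / 2 * chi2_tail d (alpha_p d p + y)))\<bar>
      \<le> C * real p powr (-1 + 20 * sqrt \<epsilon>) + C * (logc (real n) powr (5/2) / sqrt (real n) * ?I) + C * (real n powr (1 + 2 * \<alpha>) * ?T)"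
      (is "?L \<le> _")
    proof (cases "n \<ge> n0")
      case True
      note b = bound[OF True p(1,2), of "alpha_p d p + y"]
      then have "n \<ge> 3" "p \<ge> 3" by auto
      from b have "?L \<le> C0 * real p powr (-1 + 20 * sqrt \<epsilon>) + C0 * (logc (real n) powr (5/2) / sqrt (real n) * ?I) + C0 * (real n powr (1 + 2 * \<alpha>) * ?T)"
        unfolding \<nu>_cube \<nu>_tail logc[OF \<open>n \<ge> 3\<close>] logc[OF \<open>p \<ge> 3\<close>] by blast
      also have "\<dots> \<le> C * real p powr (-1 + 20 * sqrt \<epsilon>) + C * (logc (real n) powr (5/2) / sqrt (real n) * ?I) + C * (real n powr (1 + 2 * \<alpha>) * ?T)"
        using C(1) nonneg by (intro add_mono mult_right_mono) auto
      finally show ?thesis .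
    next
      case False
      have "(real p)\<^sup>2 - real p \<ge> 0" using p(3) by (simp add: power2_eq_square)
      then have "0 \<le> ((real p)\<^sup>2 - real p) / 2 * chi2_tail d (alpha_p d p + y)"
        by (intro mult_nonneg_nonneg) (auto simp: chi2_tail_def)
      then have "exp (- (((real p)\<^sup>2 - real p) / 2 * chi2_tail d (alpha_p d p + y))) \<le> 1" by simp
      moreover have "0 \<le> exp (- (((real p)\<^sup>2 - real p) / 2 * chi2_tail d (alpha_p d p + y)))" by simp
      ultimately have "?L \<le> 1"
        using prob_le_1[of "{\<omega> \<in> space M. (W d Xa p n \<omega>)\<^sup>2 / real n \<le> alpha_p d p + y}"]
          measure_nonneg[of M "{\<omega> \<in> space M. (W d Xa p n \<omega>)\<^sup>2 / real n \<le> alpha_p d p + y}"] by linarith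
      also have "1 = real p * real p powr (- 1)" using p(3) by (simp add: powr_minus_divide)
      also have "\<dots> \<le> C * real p powr (-1 + 20 * sqrt \<epsilon>)"
      proof (intro mult_mono C powr_mono)
        have "c2 * real n powr \<alpha> \<le> c2 * real n0 powr \<alpha>"
          using False \<open>c2 > 0\<close> \<open>\<alpha> > 0\<close> by (intro mult_left_mono powr_mono2) auto
        then show "real p \<le> C" using p(2) C(2) by linarith
      qed (use p(3) \<epsilon> in auto)
      finally show ?thesis using mult_nonneg_nonneg[OF C(3) nonneg(1)] mult_nonneg_nonneg[OF C(3) nonneg(2)] by linarith
    qed
    then show "\<bar>measure M {\<omega> \<in> space M. (W d Xa p n \<omega>)\<^sup>2 / real n - alpha_p d p \<le> y}
                  - exp (- ((real p ^ 2 - real p) / 2) * chi2_tail d (alpha_p d p + y))\<bar>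
                 \<le> C * real p powr (-1 + 20 * sqrt \<epsilon>)
                   + C * (logc (real n)) powr (5/2) / sqrt (real n) * ?I + C * real n powr (1 + 2 * \<alpha>) * ?T"
      unfolding eq mult.assoc times_divide_eq_right[symmetric] minus_mult_left[symmetric] .
  qed
qed

end
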